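(* Let $n,m\ge 1$, $\lambda_1,\lambda_2>2$, $0<\alpha\le n(\lambda_1-2)/2$ and $0<\beta\le m(\lambda_2-2)/2$. Suppose the kernel $K_{t_1,t_2}$ satisfies Assumptions 1, 2 and 3 (stated in the context). Then for every $f\in L^2(\mathbb{R}^{n+m})$, $$\|g^*_{\lambda_1,\lambda_2}(f)\|_{L^2(\mathbb{R}^{n+m})}\lesssim \|f\|_{L^2(\mathbb{R}^{n+m})},$$ where the implied constant depends only on $n,m,\alpha,\beta,\lambda_1,\lambda_2$ and the constants in the assumptions.
   Context: Norms on $\mathbb{R}^n$ and $\mathbb{R}^m$ are the $\ell^\infty$ norms. Points are written $x=(x_1,x_2)\in\mathbb{R}^{n}\times\mathbb{R}^m$, and $t_1,t_2>0$. For a kernel $K_{t_1,t_2}:\mathbb{R}^{n+m}\times\mathbb{R}^{n+m}\to\mathbb{C}$ set $\theta_{t_1,t_2}f(y_1,y_2)=\iint_{\mathbb{R}^{n+m}}K_{t_1,t_2}((y_1,y_2),(z_1,z_2))f(z_1,z_2)\,dz_1\,dz_2$, and $$g^*_{\lambda_1,\lambda_2}(f)(x)=\Big(\iint_{\mathbb{R}^{m+1}_+}\Big(\tfrac{t_2}{t_2+|x_2-y_2|}\Big)^{m\lambda_2}\iint_{\mathbb{R}^{n+1}_+}\Big(\tfrac{t_1}{t_1+|x_1-y_1|}\Big)^{n\lambda_1}|\theta_{t_1,t_2}f(y_1,y_2)|^2\frac{dy_1dt_1}{t_1^{n+1}}\frac{dy_2dt_2}{t_2^{m+1}}\Big)^{1/2}.$$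 We write $K_{t_1,t_2}(x-y,z_1,z_2)$ for $K_{t_1,t_2}((x_1-y_1,x_2-y_2),(z_1,z_2))$. For a cube $I\subset\mathbb{R}^n$ with side length $\ell(I)$, $\widehat I=I\times(0,\ell(I))$ and $W_I=I\times(\ell(I)/2,\ell(I))$. Assumption 1 (standard estimates), for all $x,y,y'\in\mathbb{R}^{n+m}$, $t_1,t_2>0$: (1) $|K_{t_1,t_2}(x,y)|\lesssim \frac{t_1^\alpha}{(t_1+|x_1-y_1|)^{n+\alpha}}\frac{t_2^\beta}{(t_2+|x_2-y_2|)^{m+\beta}}$; (2) $|K_{t_1,t_2}(x,y)-K_{t_1,t_2}(x,(y_1,y_2'))-K_{t_1,t_2}(x,(y_1',y_2))+K_{t_1,t_2}(x,y')|\lesssim \frac{|y_1-y_1'|^\alpha}{(t_1+|x_1-y_1|)^{n+\alpha}}\frac{|y_2-y_2'|^\beta}{(t_2+|x_2-y_2|)^{m+\beta}}$ whenever $|y_1-y_1'|<t_1/2$, $|y_2-y_2'|<t_2/2$; (3) $|K_{t_1,t_2}(x,y)-K_{t_1,t_2}(x,(y_1,y_2'))|\lesssim \frac{t_1^\alpha}{(t_1+|x_1-y_1|)^{n+\alpha}}\frac{|y_2-y_2'|^\beta}{(t_2+|x_2-y_2|)^{m+\beta}}$ whenever $|y_2-y_2'|<t_2/2$, and $|K_{t_1,t_2}(x,y)-K_{t_1,t_2}(x,(y_1',y_2))|\lesssim \frac{|y_1-y_1'|^\alpha}{(t_1+|x_1-y_1|)^{n+\alpha}}\frac{t_2^\beta}{(t_2+|x_2-y_2|)^{m+\beta}}$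 whenever $|y_1-y_1'|<t_1/2$. Assumption 2, for every cube $I\subset\mathbb{R}^n$, $J\subset\mathbb{R}^m$, all $x_2,y_2,z_2,z_2'\in\mathbb{R}^m$, $x_1,y_1,z_1,z_1'\in\mathbb{R}^n$, $t_1,t_2>0$: (1) $\Big(\iint_{\widehat I}\int_{\mathbb{R}^n}\big|\int_I K_{t_1,t_2}(x-y,z_1,z_2)dz_1\big|^2\big(\tfrac{t_1}{t_1+|y_1|}\big)^{n\lambda_1}\frac{dy_1dx_1dt_1}{t_1^{n+1}}\Big)^{1/2}\lesssim |I|^{1/2}\frac{t_2^\beta}{(t_2+|x_2-y_2-z_2|)^{m+\beta}}$, and symmetrically $\Big(\iint_{\widehat J}\int_{\mathbb{R}^m}\big|\int_J K_{t_1,t_2}(x-y,z_1,z_2)dz_2\big|^2\big(\tfrac{t_2}{t_2+|y_2|}\big)^{m\lambda_2}\frac{dy_2dx_2dt_2}{t_2^{m+1}}\Big)^{1/2}\lesssim |J|^{1/2}\frac{t_1^\alpha}{(t_1+|x_1-y_1-z_1|)^{n+\alpha}}$; (2) $\Big(\iint_{\widehat I}\int_{\mathbb{R}^n}\big|\int_I [K_{t_1,t_2}(x-y,z_1,z_2)-K_{t_1,t_2}(x-y,z_1,z_2')]dz_1\big|^2\big(\tfrac{t_1}{t_1+|y_1|}\big)^{n\lambda_1}\frac{dy_1dx_1dt_1}{t_1^{n+1}}\Big)^{1/2}\lesssim |I|^{1/2}\frac{|z_2-z_2'|^\beta}{(t_2+|x_2-y_2-z_2|)^{m+\beta}}$ whenever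 $|z_2-z_2'|<t_2/2$, and symmetrically $\Big(\iint_{\widehat J}\int_{\mathbb{R}^m}\big|\int_J [K_{t_1,t_2}(x-y,z_1,z_2)-K_{t_1,t_2}(x-y,z_1',z_2)]dz_2\big|^2\big(\tfrac{t_2}{t_2+|y_2|}\big)^{m\lambda_2}\frac{dy_2dx_2dt_2}{t_2^{m+1}}\Big)^{1/2}\lesssim |J|^{1/2}\frac{|z_1-z_1'|^\alpha}{(t_1+|x_1-y_1-z_1|)^{n+\alpha}}$ whenever $|z_1-z_1'|<t_1/2$. Assumption 3 (bi-parameter Carleson condition): For dyadic grids $\mathcal D_n$ in $\mathbb{R}^n$ and $\mathcal D_m$ in $\mathbb{R}^m$ (translates of the standard dyadic grids), $\mathcal D=\mathcal D_n\times\mathcal D_m$, and $I\in\mathcal D_n$, $J\in\mathcal D_m$, let $$C^{\mathcal D}_{IJ}=\iint_{W_J}\iint_{W_I}\iint_{\mathbb{R}^{n+m}}|\theta_{t_1,t_2}\mathbf 1(y_1,y_2)|^2\Big(\tfrac{t_1}{t_1+|x_1-y_1|}\Big)^{n\lambda_1}\Big(\tfrac{t_2}{t_2+|x_2-y_2|}\Big)^{m\lambda_2}\frac{dy_1dy_2}{t_1^nt_2^m}\frac{dx_1dt_1}{t_1}\frac{dx_2dt_2}{t_2}.$$ It is assumed that for every such $\mathcal D$, $\sum_{I\times J\in\mathcal D,\ I\times J\subset\Omega}C^{\mathcal D}_{IJ}\lesssim|\Omega|$ for all sets $\Omega\subset\mathbb{R}^{n+m}$ with $|\Omega|<\infty$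 such that every $x\in\Omega$ lies in some $I\times J\in\mathcal D$ with $I\times J\subset\Omega$. *)

theory Defs
  imports "HOL-Analysis.Analysis"
begin

text \<open>Points of R^n are vectors (real^'n) (dimension n = CARD('n)); the norm is the
  sup norm infnorm. Points of R^(n+m) are pairs (x1,x2).\<close>

definition hcube :: "(real^'n::finite) \<Rightarrow> real \<Rightarrow> (real^'n) set" where
  "hcube a l = {x. \<forall>i. a$i \<le> x$i \<and> x$i < a$i + l}"

text \<open>Standard dyadic grid, cubes indexed by (lower corner, side length).\<close>
definition std_dyadic :: "((real^'n::finite) \<times> real) set" where
  "std_dyadic = {(2 powr (real_of_int k) *\<^sub>R (\<chi> i. real_of_int (j i)), 2 powr (real_of_int k)) |
                 (k::int) (j::'n \<Rightarrow> int). True}"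

definition dyadic_grid :: "(real^'n::finite) \<Rightarrow> ((real^'n) \<times> real) set" where
  "dyadic_grid w = {(a + w, l) | a l. (a, l) \<in> std_dyadic}"

definition ensqrt :: "ennreal \<Rightarrow> ennreal" where
  "ensqrt x = (if x = \<infinity> then \<infinity> else ennreal (sqrt (enn2real x)))"

type_synonym ('n,'m) kernel =
  "real \<Rightarrow> real \<Rightarrow> ((real^'n) \<times> (real^'m)) \<Rightarrow> ((real^'n) \<times> (real^'m)) \<Rightarrow> complex"

definition theta :: "('n::finite,'m::finite) kernel \<Rightarrow> real \<Rightarrow> real \<Rightarrow>
    ((real^'n) \<times> (real^'m) \<Rightarrow> complex) \<Rightarrow> (real^'n) \<times> (real^'m) \<Rightarrow> complex" where
  "theta K t1 t2 f y = (\<integral>z. K t1 t2 y z * f z \<partial>lborel)"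

definition gstar_sq :: "('n::finite,'m::finite) kernel \<Rightarrow> real \<Rightarrow> real \<Rightarrow>
    ((real^'n) \<times> (real^'m) \<Rightarrow> complex) \<Rightarrow> (real^'n) \<times> (real^'m) \<Rightarrow> ennreal" where
  "gstar_sq K l1 l2 f x =
    (\<integral>\<^sup>+ (y2::(real^'m)). \<integral>\<^sup>+ t2. indicator {0<..} t2 *
       ennreal ((t2 / (t2 + infnorm (snd x - y2))) powr (real CARD('m) * l2) / t2 ^ (CARD('m) + 1)) *
       (\<integral>\<^sup>+ (y1::(real^'n)). \<integral>\<^sup>+ t1. indicator {0<..} t1 *
          ennreal ((t1 / (t1 + infnorm (fst x - y1))) powr (real CARD('n) * l1) *
                   (cmod (theta K t1 t2 f (y1, y2)))\<^sup>2 / t1 ^ (CARD('n) + 1))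
        \<partial>lborel \<partial>lborel) \<partial>lborel \<partial>lborel)"

definition gstar :: "('n::finite,'m::finite) kernel \<Rightarrow> real \<Rightarrow> real \<Rightarrow>
    ((real^'n) \<times> (real^'m) \<Rightarrow> complex) \<Rightarrow> (real^'n) \<times> (real^'m) \<Rightarrow> ennreal" where
  "gstar K l1 l2 f x = ensqrt (gstar_sq K l1 l2 f x)"

definition L2 :: "('a::euclidean_space \<Rightarrow> complex) \<Rightarrow> bool" where
  "L2 f \<longleftrightarrow> f \<in> borel_measurable lborel \<and> integrable lborel (\<lambda>x. (cmod (f x))\<^sup>2)"

definition L2norm :: "('a::euclidean_space \<Rightarrow> complex) \<Rightarrow> real" where
  "L2norm f = sqrt (\<integral>x. (cmod (f x))\<^sup>2 \<partial>lborel)"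

definition L2norm_nn :: "('a::euclidean_space \<Rightarrow> ennreal) \<Rightarrow> ennreal" where
  "L2norm_nn g = ensqrt (\<integral>\<^sup>+x. (g x)\<^sup>2 \<partial>lborel)"

definition kernel_measurable :: "('n::finite,'m::finite) kernel \<Rightarrow> bool" where
  "kernel_measurable K \<longleftrightarrow>
    (\<lambda>(t1, t2, x, y). if 0 < t1 \<and> 0 < t2 then K t1 t2 x y else 0)
      \<in> borel_measurable (borel :: (real \<times> real \<times> ((real^'n) \<times> (real^'m)) \<times> ((real^'n) \<times> (real^'m))) measure)"

definition assumption1 :: "real \<Rightarrow> real \<Rightarrow> real \<Rightarrow> ('n::finite,'m::finite) kernel \<Rightarrow> bool" where
  "assumption1 A \<alpha> \<beta> K \<longleftrightarrow>
   (\<forall>t1 t2 (x1::(real^'n)) (x2::(real^'m)) y1 y2 y1' y2'. 0 < t1 \<longrightarrow> 0 < t2 \<longrightarrow>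
     cmod (K t1 t2 (x1, x2) (y1, y2)) \<le>
        A * (t1 powr \<alpha> / (t1 + infnorm (x1 - y1)) powr (real CARD('n) + \<alpha>))
          * (t2 powr \<beta> / (t2 + infnorm (x2 - y2)) powr (real CARD('m) + \<beta>))
   \<and> (infnorm (y1 - y1') < t1 / 2 \<longrightarrow> infnorm (y2 - y2') < t2 / 2 \<longrightarrow>
       cmod (K t1 t2 (x1, x2) (y1, y2) - K t1 t2 (x1, x2) (y1, y2')
             - K t1 t2 (x1, x2) (y1', y2) + K t1 t2 (x1, x2) (y1', y2')) \<le>
        A * (infnorm (y1 - y1') powr \<alpha> / (t1 + infnorm (x1 - y1)) powr (real CARD('n) + \<alpha>))
          * (infnorm (y2 - y2') powr \<beta> / (t2 + infnorm (x2 - y2)) powr (real CARD('m) + \<beta>)))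
   \<and> (infnorm (y2 - y2') < t2 / 2 \<longrightarrow>
       cmod (K t1 t2 (x1, x2) (y1, y2) - K t1 t2 (x1, x2) (y1, y2')) \<le>
        A * (t1 powr \<alpha> / (t1 + infnorm (x1 - y1)) powr (real CARD('n) + \<alpha>))
          * (infnorm (y2 - y2') powr \<beta> / (t2 + infnorm (x2 - y2)) powr (real CARD('m) + \<beta>)))
   \<and> (infnorm (y1 - y1') < t1 / 2 \<longrightarrow>
       cmod (K t1 t2 (x1, x2) (y1, y2) - K t1 t2 (x1, x2) (y1', y2)) \<le>
        A * (infnorm (y1 - y1') powr \<alpha> / (t1 + infnorm (x1 - y1)) powr (real CARD('n) + \<alpha>))
          * (t2 powr \<beta> / (t2 + infnorm (x2 - y2)) powr (real CARD('m) + \<beta>))))"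

definition assumption2 :: "real \<Rightarrow> real \<Rightarrow> real \<Rightarrow> real \<Rightarrow> real \<Rightarrow> ('n::finite,'m::finite) kernel \<Rightarrow> bool" where
  "assumption2 A \<alpha> \<beta> l1 l2 K \<longleftrightarrow>
   (\<forall>(a::(real^'n)) l (x2::(real^'m)) y2 z2 z2' t2. 0 < l \<longrightarrow> 0 < t2 \<longrightarrow>
      ensqrt (\<integral>\<^sup>+ x1. \<integral>\<^sup>+ t1. \<integral>\<^sup>+ y1.
          indicator (hcube a l) x1 * indicator {0<..<l} t1 *
          ennreal ((cmod (\<integral>z1\<in>hcube a l. K t1 t2 (x1 - y1, x2 - y2) (z1, z2) \<partial>lborel))\<^sup>2
                   * (t1 / (t1 + infnorm y1)) powr (real CARD('n) * l1) / t1 ^ (CARD('n) + 1))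
        \<partial>lborel \<partial>lborel \<partial>lborel)
      \<le> ennreal (A * sqrt (measure lborel (hcube a l))
                  * (t2 powr \<beta> / (t2 + infnorm (x2 - y2 - z2)) powr (real CARD('m) + \<beta>)))
    \<and> (infnorm (z2 - z2') < t2 / 2 \<longrightarrow>
      ensqrt (\<integral>\<^sup>+ x1. \<integral>\<^sup>+ t1. \<integral>\<^sup>+ y1.
          indicator (hcube a l) x1 * indicator {0<..<l} t1 *
          ennreal ((cmod (\<integral>z1\<in>hcube a l. (K t1 t2 (x1 - y1, x2 - y2) (z1, z2)
                                            - K t1 t2 (x1 - y1, x2 - y2) (z1, z2')) \<partial>lborel))\<^sup>2
                   * (t1 / (t1 + infnorm y1)) powr (real CARD('n) * l1) / t1 ^ (CARD('n) + 1))
        \<partial>lborel \<partial>lborel \<partial>lborel)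
      \<le> ennreal (A * sqrt (measure lborel (hcube a l))
                  * (infnorm (z2 - z2') powr \<beta> / (t2 + infnorm (x2 - y2 - z2)) powr (real CARD('m) + \<beta>)))))
   \<and>
   (\<forall>(b::(real^'m)) r (x1::(real^'n)) y1 z1 z1' t1. 0 < r \<longrightarrow> 0 < t1 \<longrightarrow>
      ensqrt (\<integral>\<^sup>+ x2. \<integral>\<^sup>+ t2. \<integral>\<^sup>+ y2.
          indicator (hcube b r) x2 * indicator {0<..<r} t2 *
          ennreal ((cmod (\<integral>z2\<in>hcube b r. K t1 t2 (x1 - y1, x2 - y2) (z1, z2) \<partial>lborel))\<^sup>2
                   * (t2 / (t2 + infnorm y2)) powr (real CARD('m) * l2) / t2 ^ (CARD('m) + 1))
        \<partial>lborel \<partial>lborel \<partial>lborel)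
      \<le> ennreal (A * sqrt (measure lborel (hcube b r))
                  * (t1 powr \<alpha> / (t1 + infnorm (x1 - y1 - z1)) powr (real CARD('n) + \<alpha>)))
    \<and> (infnorm (z1 - z1') < t1 / 2 \<longrightarrow>
      ensqrt (\<integral>\<^sup>+ x2. \<integral>\<^sup>+ t2. \<integral>\<^sup>+ y2.
          indicator (hcube b r) x2 * indicator {0<..<r} t2 *
          ennreal ((cmod (\<integral>z2\<in>hcube b r. (K t1 t2 (x1 - y1, x2 - y2) (z1, z2)
                                            - K t1 t2 (x1 - y1, x2 - y2) (z1', z2)) \<partial>lborel))\<^sup>2
                   * (t2 / (t2 + infnorm y2)) powr (real CARD('m) * l2) / t2 ^ (CARD('m) + 1))
        \<partial>lborel \<partial>lborel \<partial>lborel)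
      \<le> ennreal (A * sqrt (measure lborel (hcube b r))
                  * (infnorm (z1 - z1') powr \<alpha> / (t1 + infnorm (x1 - y1 - z1)) powr (real CARD('n) + \<alpha>)))))"

definition carleson_coeff :: "('n::finite,'m::finite) kernel \<Rightarrow> real \<Rightarrow> real \<Rightarrow>
    (real^'n) \<times> real \<Rightarrow> (real^'m) \<times> real \<Rightarrow> ennreal" where
  "carleson_coeff K l1 l2 I J =
    (\<integral>\<^sup>+ x2. \<integral>\<^sup>+ t2. \<integral>\<^sup>+ x1. \<integral>\<^sup>+ t1. \<integral>\<^sup>+ y.
       indicator (hcube (fst J) (snd J)) x2 * indicator {snd J / 2<..<snd J} t2 *
       indicator (hcube (fst I) (snd I)) x1 * indicator {snd I / 2<..<snd I} t1 *
       ennreal ((cmod (theta K t1 t2 (\<lambda>_. 1) y))\<^sup>2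
         * (t1 / (t1 + infnorm (x1 - fst y))) powr (real CARD('n) * l1)
         * (t2 / (t2 + infnorm (x2 - snd y))) powr (real CARD('m) * l2)
         / (t1 ^ CARD('n) * t2 ^ CARD('m)) / t1 / t2)
     \<partial>lborel \<partial>lborel \<partial>lborel \<partial>lborel \<partial>lborel)"

definition assumption3 :: "real \<Rightarrow> real \<Rightarrow> real \<Rightarrow> ('n::finite,'m::finite) kernel \<Rightarrow> bool" where
  "assumption3 A l1 l2 K \<longleftrightarrow>
   (\<forall>(w1::(real^'n)) (w2::(real^'m)) (\<Omega>::((real^'n) \<times> (real^'m)) set).
      \<Omega> \<in> sets lborel \<longrightarrow> emeasure lborel \<Omega> < \<infinity> \<longrightarrow>
      (\<forall>x\<in>\<Omega>. \<exists>I\<in>dyadic_grid w1. \<exists>J\<in>dyadic_grid w2.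
          x \<in> hcube (fst I) (snd I) \<times> hcube (fst J) (snd J)
          \<and> hcube (fst I) (snd I) \<times> hcube (fst J) (snd J) \<subseteq> \<Omega>) \<longrightarrow>
      (\<Sum>\<^sub>\<infinity>IJ\<in>{(I, J). I \<in> dyadic_grid w1 \<and> J \<in> dyadic_grid w2
                    \<and> hcube (fst I) (snd I) \<times> hcube (fst J) (snd J) \<subseteq> \<Omega>}.
          carleson_coeff K l1 l2 (fst IJ) (snd IJ))
        \<le> ennreal A * emeasure lborel \<Omega>)"

end

theory Submission
  imports Defs
begin

text \<open>
  Integrating the weights \<open>(t\<^sub>i / (t\<^sub>i + |x\<^sub>i - y\<^sub>i|))\<close> in \<open>x\<close> first, the squared \<open>L\<^sup>2\<close> norm of \<open>g\<^sup>*\<close> becomes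
  comparable to the vertical square function \<open>\<integral>\<integral>\<integral> |\<theta> f(y)|\<^sup>2 dy dt\<^sub>1/t\<^sub>1 dt\<^sub>2/t\<^sub>2\<close>. In each variable \<open>f\<close> is split
  into its dyadic average \<open>E f\<close> at the scale of \<open>t\<^sub>i\<close>, evaluated at the point \<open>y\<^sub>i\<close>, and the remainder
  \<open>f - E f(y\<^sub>i)\<close>. On the remainder the kernel is almost orthogonal to the martingale differences of \<open>f\<close>,
  with geometric decay in the distance of the scales. This holds for operator-valued kernels, so the
  other variable enters only through the \<open>L\<^sup>2\<close> bound of a one-parameter operator, which is a T1 theorem
  whose Carleson condition comes from Assumption 2 (the part of \<open>1\<close> outside a cube is
  controlled by applying almost orthogonality to the indicator of the cube).

  What is left is the paraproduct \<open>\<theta> 1 \<cdot> E\<^sub>1 E\<^sub>2 f\<close>. It is bounded by a Carleson embedding: the level set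
  \<open>{M f > s}\<close> of the iterated dyadic maximal function contains every dyadic rectangle on which the average of \<open>f\<close>
  exceeds \<open>s\<close>, so Assumption 3 and the layer cake formula reduce the bound to the \<open>L\<^sup>2\<close> boundedness
  of \<open>M\<close>, i.e. to Doob's inequality in each variable.
\<close>

text \<open>Dyadic averages jump across cube boundaries, while the kernel at scale \<open>t\<close>
  sees every point within distance about \<open>t\<close>. The remedy is an L^2 one: a step function
  of scale 2^j differs from its translate by u only on a fraction of order |u| / 2^j of each cube,
  so a coarse average costs a positive power of |u| / 2^j. The power is kept below the decay
  exponent \<open>a\<close> of the kernel and is paid from its tail; the geometric factors for
  scales above \<open>t\<close> arise here, those below \<open>t\<close> from the Hoelder estimates.

  Taking the average at the point y leaves an image of 1 times an average, with no sum over cubes.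
  In two variables f = (f - E1 f) + E1 (f - E2 f) + E1 E2 f. The first piece pairs orthogonality in
  variable 1 with the full one-parameter bound in variable 2; the middle piece pairs orthogonality
  in variable 2 with the one-parameter paraproduct in variable 1. For this reason orthogonality is
  proved between arbitrary sigma-finite spaces, the target being the other point variable together
  with its scale.\<close>

section \<open>Sup norm, boxes and half-open cubes\<close>

lemma infnorm_le_iff_cart: "infnorm (u::real^'n) \<le> r \<longleftrightarrow> (\<forall>i. \<bar>u$i\<bar> \<le> r)"
proof
  assume "infnorm u \<le> r"
  then show "\<forall>i. \<bar>u$i\<bar> \<le> r" using component_le_infnorm_cart order_trans by blast
next
  assume *: "\<forall>i. \<bar>u$i\<bar> \<le> r"
  have "infnorm u \<in> (\<lambda>i. \<bar>u \<bullet> i\<bar>) ` Basis" unfolding infnorm_Max by (intro Max_in) auto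
  then show "infnorm u \<le> r" using * by (auto simp: Basis_vec_def inner_axis)
qed

lemma infnorm_less_iff_cart: "infnorm (u::real^'n) < r \<longleftrightarrow> (\<forall>i. \<bar>u$i\<bar> < r)"
proof
  assume "infnorm u < r"
  then show "\<forall>i. \<bar>u$i\<bar> < r" using component_le_infnorm_cart le_less_trans by blast
next
  assume *: "\<forall>i. \<bar>u$i\<bar> < r"
  have "infnorm u \<in> (\<lambda>i. \<bar>u \<bullet> i\<bar>) ` Basis" unfolding infnorm_Max by (intro Max_in) auto
  then show "infnorm u < r" using * by (auto simp: Basis_vec_def inner_axis)
qed

lemma borel_measurable_infnorm [measurable]: "infnorm \<in> borel_measurable (borel :: (real^'n) measure)"
  by (intro borel_measurable_continuous_onI continuous_on_infnorm continuous_on_id)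

lemma emeasure_cbox_cart:
  fixes a b :: "real^'n"
  assumes "\<And>i. a$i \<le> b$i"
  shows "emeasure lborel (cbox a b) = ennreal (\<Prod>i\<in>UNIV. b$i - a$i)"
proof -
  have "cbox a b \<noteq> {}" using assms by (simp add: interval_ne_empty_cart)
  then show ?thesis
    by (simp add: emeasure_eq_measure2 content_cbox_cart emeasure_lborel_cbox_finite less_top)
qed

lemma inner_const_Basis: "b \<in> Basis \<Longrightarrow> (\<chi> i. (l :: real)) \<bullet> (b::real^'n) = l"
  by (auto simp: Basis_vec_def inner_axis)

lemma vec_nth_measurable [measurable]: "(\<lambda>x::real^'n. x $ i) \<in> borel_measurable borel"
  by (intro borel_measurable_continuous_onI continuous_intros)

lemma sets_hcube [measurable]: "hcube a l \<in> sets borel"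
proof -
  have "hcube a l = (\<Inter>i. {x. a$i \<le> x$i \<and> x$i < a$i + l})" by (auto simp: hcube_def)
  also have "\<dots> \<in> sets borel" by (intro sets.finite_INT) (auto, measurable)
  finally show ?thesis .
qed

lemma emeasure_hcube:
  fixes a :: "real^'n"
  assumes "0 \<le> l" shows "emeasure lborel (hcube a l) = ennreal (l ^ CARD('n))"
proof -
  let ?b = "a + (\<chi> i. l)"
  have c: "emeasure lborel (cbox a ?b) = ennreal (l ^ CARD('n))"
    using assms by (subst emeasure_cbox_cart) auto
  have b: "emeasure lborel (box a ?b) = ennreal (l ^ CARD('n))"
    using assms by (subst emeasure_lborel_box)
      (auto simp: inner_add_left inner_const_Basis)
  have "emeasure lborel (hcube a l) \<le> emeasure lborel (cbox a ?b)"
    by (intro emeasure_mono) (auto simp: hcube_def mem_box_cart less_imp_le)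
  moreover have "emeasure lborel (box a ?b) \<le> emeasure lborel (hcube a l)"
    by (intro emeasure_mono) (auto simp: hcube_def mem_box_cart less_imp_le)
  ultimately show ?thesis using b c by simp
qed

lemma emeasure_infnorm_ball:
  assumes "0 \<le> r"
  shows "emeasure lborel {u::real^'n. infnorm u < r} \<le> ennreal ((2 * r) ^ CARD('n))"
proof -
  have "emeasure lborel {u::real^'n. infnorm u < r} \<le> emeasure lborel (cbox (\<chi> i. - r) (\<chi> i. r) :: (real^'n) set)"
    by (intro emeasure_mono) (auto simp: infnorm_less_iff_cart mem_box_cart abs_less_iff less_imp_le
        minus_less_iff[of _ r])
  also have "\<dots> = ennreal ((2 * r) ^ CARD('n))"
    using assms by (subst emeasure_cbox_cart) auto
  finally show ?thesis .
qed

subsection \<open>The Poisson-type majorant\<close>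

text \<open>The size factor of Assumption 1 in one variable, an approximate identity at scale
  \<open>t\<close> up to constants. By \<open>weight_eq_kap\<close> the weight of the square
  function has the same form, so one integral bound serves both.\<close>

definition kap :: "real \<Rightarrow> real \<Rightarrow> real^'n \<Rightarrow> real" where
  "kap a t u = t powr a / (t + infnorm u) powr (real CARD('n) + a)"

text \<open>Value of a geometric series over the shells \<open>infnorm u < 2 ^ i * t\<close>. The
  factor \<open>2 ^ n\<close> is the volume of the sup-norm unit ball; \<open>2 powr (n + a)\<close>
  is lost because a point of shell \<open>i\<close> only satisfies
  \<open>t + infnorm u \<ge> 2 ^ (i - 1) * t\<close>.\<close>

definition ckap :: "nat \<Rightarrow> real \<Rightarrow> real" where
  "ckap n a = 2 ^ n * 2 powr (real n + a) * (1 / (1 - 2 powr (- a)))"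

lemma ckap_pos: "0 < a \<Longrightarrow> 0 < ckap n a"
  by (simp add: ckap_def powr_less_one)

lemma borel_measurable_kap [measurable]: "kap a t \<in> borel_measurable borel"
  unfolding kap_def[abs_def] by measurable

lemma kap_pos: "0 < t \<Longrightarrow> 0 < kap a t u"
  unfolding kap_def using infnorm_pos_le[of u]
  by (intro divide_pos_pos) (auto intro!: powr_gt_zero[THEN iffD2] simp del: infnorm_pos_le)

lemma kap_nonneg: "0 \<le> kap a t u"
  unfolding kap_def by simp

lemma kap_minus: "kap a t (- u) = kap a t u"
  by (simp add: kap_def infnorm_neg)

lemma kap_le: 
  assumes "0 < t" "0 \<le> a" shows "kap a t (u::real^'n) \<le> 1 / t ^ CARD('n)"
proof -
  have "t powr (real CARD('n) + a) \<le> (t + infnorm u) powr (real CARD('n) + a)"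
    using assms infnorm_pos_le[of u] by (intro powr_mono2) auto
  then have "kap a t u \<le> t powr a / t powr (real CARD('n) + a)"
    unfolding kap_def using assms by (intro divide_left_mono) (auto intro!: mult_pos_pos)
  also have "\<dots> = 1 / t ^ CARD('n)" using assms by (simp add: powr_add powr_realpow)
  finally show ?thesis .
qed

text \<open>\<open>i\<close> is the least index whose ball contains \<open>u\<close>. For
  \<open>i > 0\<close> the preceding ball misses \<open>u\<close>, which bounds the denominator from
  below; for \<open>i = 0\<close> the trivial bound \<open>kap_le\<close> is enough.\<close>

lemma kap_shell:
  assumes "0 < t" "0 < a"
  shows "\<exists>i::nat. infnorm (u::real^'n) < 2 ^ i * t \<and> kap a t u \<le> (2 powr (real CARD('n) + a) / t ^ CARD('n)) * (2 powr (real CARD('n) + a)) powr (- real i)"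
proof -
  let ?s = "real CARD('n) + a"
  define i where "i = (LEAST i::nat. infnorm u < 2 ^ i * t)"
  have ex: "\<exists>i::nat. infnorm u < 2 ^ i * t"
    using real_arch_pow[of 2 "infnorm u / t"] assms by (auto simp: field_simps)
  have i: "infnorm u < 2 ^ i * t" unfolding i_def by (rule LeastI_ex[OF ex])
  have "kap a t u \<le> (2 powr ?s / t ^ CARD('n)) * (2 powr ?s) powr (- real i)"
  proof (cases i)
    case 0
    have "1 \<le> 2 powr ?s" using assms by (intro ge_one_powr_ge_zero) auto
    then have "1 / t ^ CARD('n) \<le> 2 powr ?s / t ^ CARD('n)" using assms by (intro divide_right_mono) auto
    then show ?thesis using 0 kap_le[of t a u] assms by simp
  next
    case (Suc j)
    have "\<not> infnorm u < 2 ^ j * t" using not_less_Least[of j "\<lambda>i. infnorm u < 2 ^ i * t"] Suc by (simp add: i_def)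
    then have le: "2 ^ j * t \<le> t + infnorm u" using assms by simp
    have "(2 ^ j * t) powr ?s \<le> (t + infnorm u) powr ?s"
      using assms le by (intro powr_mono2) auto
    then have "kap a t u \<le> t powr a / (2 ^ j * t) powr ?s"
      unfolding kap_def using assms by (intro divide_left_mono) (auto intro!: mult_pos_pos)
    also have "\<dots> = (1 / t ^ CARD('n)) * (1 / (2 ^ j) powr ?s)"
      using assms by (simp add: powr_mult powr_add powr_realpow)
    also have "1 / (2 ^ j) powr ?s = 2 powr ?s * (2 powr ?s) powr (- real i)"
      unfolding Suc by (simp add: powr_powr powr_realpow[symmetric] powr_minus[symmetric] powr_add[symmetric] inverse_eq_divide[symmetric] algebra_simps)
    finally show ?thesis by simp
  qed
  with i show ?thesis by blast
qed

text \<open>The bound is uniform in \<open>t\<close>: shell \<open>i\<close> has volume of order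
  (2^i t)^n and height of order t^(-n) 2^(-i (n + a)), so it contributes 2^(-a i) up to a
  constant.\<close>

lemma nn_integral_kap:
  assumes "0 < t" "0 < a"
  shows "(\<integral>\<^sup>+u. ennreal (kap a t (u::real^'n)) \<partial>lborel) \<le> ennreal (ckap CARD('n) a)"
proof -
  let ?s = "real CARD('n) + a"
  let ?c = "\<lambda>i::nat. (2 powr ?s / t ^ CARD('n)) * (2 powr ?s) powr (- real i)"
  let ?B = "\<lambda>i::nat. {u::real^'n. infnorm u < 2 ^ i * t}"
  have c0: "0 \<le> ?c i" for i using assms by simp
  have "ennreal (kap a t u) \<le> (\<Sum>i. ennreal (?c i) * indicator (?B i) u)" for u :: "real^'n"
  proof -
    obtain i where i: "infnorm u < 2 ^ i * t" "kap a t u \<le> ?c i" using kap_shell[OF assms] by blast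
    have "ennreal (kap a t u) \<le> ennreal (?c i) * indicator (?B i) u"
      using i by (simp add: ennreal_leI)
    also have "\<dots> \<le> (\<Sum>i. ennreal (?c i) * indicator (?B i) u)"
      using sum_le_suminf[of "\<lambda>i. ennreal (?c i) * indicator (?B i) u" "{i}"] by (simp del: sum_mult_indicator)
    finally show ?thesis .
  qed
  then have "(\<integral>\<^sup>+u. ennreal (kap a t (u::real^'n)) \<partial>lborel) \<le> (\<integral>\<^sup>+u. (\<Sum>i. ennreal (?c i) * indicator (?B i) u) \<partial>lborel)"
    by (intro nn_integral_mono)
  also have "\<dots> = (\<Sum>i. ennreal (?c i) * emeasure lborel (?B i))"
    by (subst nn_integral_suminf) (auto simp: nn_integral_cmult_indicator)
  also have "\<dots> \<le> (\<Sum>i. ennreal (2 ^ CARD('n) * 2 powr ?s * (2 powr (- a)) ^ i))"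
  proof (intro suminf_le allI)
    fix i :: nat
    have "ennreal (?c i) * emeasure lborel (?B i) \<le> ennreal (?c i) * ennreal ((2 * (2 ^ i * t)) ^ CARD('n))"
      using assms by (intro mult_left_mono emeasure_infnorm_ball) auto
    also have "\<dots> = ennreal (?c i * (2 * (2 ^ i * t)) ^ CARD('n))"
      using c0[of i] assms by (subst ennreal_mult) auto
    also have "?c i * (2 * (2 ^ i * t)) ^ CARD('n) = 2 ^ CARD('n) * 2 powr ?s * ((2 powr ?s) powr (- real i) * (2 ^ i) ^ CARD('n))"
      using assms by (simp add: power_mult_distrib field_simps)
    also have "(2 powr ?s) powr (- real i) * (2 ^ i) ^ CARD('n) = (2 powr (- a)) ^ i"
      by (simp add: powr_powr powr_realpow[symmetric] powr_add[symmetric] algebra_simps)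
    finally show "ennreal (?c i) * emeasure lborel (?B i) \<le> ennreal (2 ^ CARD('n) * 2 powr ?s * (2 powr (- a)) ^ i)" .
  qed auto
  also have "\<dots> = ennreal (ckap CARD('n) a)"
    using assms unfolding ckap_def
    by (intro suminf_ennreal_eq sums_mult geometric_sums) (auto simp: powr_less_one)
  finally show ?thesis .
qed

subsection \<open>Dyadic averages\<close>

text \<open>Dyadic cubes of side \<open>2 powr k\<close> are represented by their lower corner: \<open>dcor k x\<close> is the corner of the cube containing \<open>x\<close>.\<close>

definition dcor :: "int \<Rightarrow> real^'n \<Rightarrow> real^'n" where
  "dcor k x = (\<chi> i. 2 powr real_of_int k * real_of_int \<lfloor>x$i / 2 powr real_of_int k\<rfloor>)"

text \<open>Kernel of the conditional expectation on the dyadic cubes of side 2^k. An explicit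
  symmetric kernel lets Fubini replace the abstract theory of conditional expectation.\<close>

definition dker :: "int \<Rightarrow> real^'n \<Rightarrow> real^'n \<Rightarrow> real" where
  "dker k x z = (if dcor k x = dcor k z then (1 / 2 powr real_of_int k) ^ CARD('n) else 0)"

definition dexp :: "int \<Rightarrow> (real^'n \<Rightarrow> real) \<Rightarrow> real^'n \<Rightarrow> real" where
  "dexp k h x = (\<integral>z. dker k x z * h z \<partial>lborel)"

text \<open>The pointwise counterpart of measurability with respect to the dyadic sigma-algebra of
  scale 2^k.\<close>

definition dconst :: "int \<Rightarrow> (real^'n \<Rightarrow> 'b) \<Rightarrow> bool" where
  "dconst k g \<longleftrightarrow> (\<forall>x z. dcor k x = dcor k z \<longrightarrow> g x = g z)"

text \<open>Square integrability of a function that is given everywhere, not of a class modulo null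
  sets: functions on a product are sliced at every value of the other variable.\<close>

definition sqi :: "(real^'n \<Rightarrow> real) \<Rightarrow> bool" where
  "sqi h \<longleftrightarrow> h \<in> borel_measurable borel \<and> (\<integral>\<^sup>+x. ennreal ((h x)\<^sup>2) \<partial>lborel) < \<infinity>"

lemma dcor_eq_iff: "dcor k x = dcor k z \<longleftrightarrow> (\<forall>i. \<lfloor>x$i / 2 powr real_of_int k\<rfloor> = \<lfloor>z$i / 2 powr real_of_int k\<rfloor>)"
  by (simp add: dcor_def vec_eq_iff)

text \<open>Nesting of dyadic cubes: the integer index of a point at the coarser scale
  \<open>j\<close> is the integer quotient by 2^(j - k) of its index at scale
  \<open>k\<close>.\<close>

lemma dcor_eq_mono:
  assumes "k \<le> j" "dcor k x = dcor k z" shows "dcor j x = dcor j z"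
proof -
  define b :: int where "b = 2 ^ nat (j - k)"
  have b: "2 powr real_of_int j = 2 powr real_of_int k * real_of_int b"
    using assms by (simp add: b_def powr_realpow[symmetric] powr_add[symmetric])
  have "\<lfloor>y / 2 powr real_of_int j\<rfloor> = \<lfloor>y / 2 powr real_of_int k\<rfloor> div b" for y
    using floor_divide_real_eq_div[of b "y / 2 powr real_of_int k"] unfolding b by (simp add: b_def field_simps)
  then show ?thesis using assms by (simp add: dcor_eq_iff)
qed

lemma dconstD: "dconst k g \<Longrightarrow> dcor k x = dcor k z \<Longrightarrow> g x = g z"
  unfolding dconst_def by blast

lemma dconst_mono: "dconst j g \<Longrightarrow> k \<le> j \<Longrightarrow> dconst k g"
  unfolding dconst_def using dcor_eq_mono by blast

lemma dcor_cube: "{z. dcor k z = dcor k x} = hcube (dcor k x) (2 powr real_of_int k)"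
proof -
  have "\<lfloor>z / p\<rfloor> = \<lfloor>x / p\<rfloor> \<longleftrightarrow> p * real_of_int \<lfloor>x / p\<rfloor> \<le> z \<and> z < p * real_of_int \<lfloor>x / p\<rfloor> + p"
    if "p > 0" for x z p :: real
    using that by (simp add: floor_eq_iff field_simps)
  then show ?thesis
    by (auto simp: hcube_def dcor_eq_iff set_eq_iff) (auto simp: dcor_def)
qed

lemma dcor_eq_cube: "dcor k z = dcor k x \<longleftrightarrow> z \<in> hcube (dcor k x) (2 powr real_of_int k)"
  using dcor_cube by blast

lemma dcor_dcor [simp]: "dcor k (dcor k x) = dcor k x"
  by (simp add: dcor_eq_cube) (simp add: hcube_def)

lemma dcor_dist: "dcor k x = dcor k z \<Longrightarrow> infnorm (x - z) < 2 powr real_of_int k"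
proof -
  assume a: "dcor k x = dcor k z"
  have "x \<in> hcube (dcor k z) (2 powr real_of_int k)" "z \<in> hcube (dcor k z) (2 powr real_of_int k)"
    using a by (simp_all add: dcor_eq_cube[symmetric])
  then show ?thesis
    by (auto simp: infnorm_less_iff_cart hcube_def abs_less_iff) (smt (verit))+
qed

lemma borel_measurable_vec_lambda:
  assumes "\<And>i. (\<lambda>x. f x i) \<in> borel_measurable M"
  shows "(\<lambda>x. (\<chi> i. f x i) :: real^'n) \<in> borel_measurable M"
  using assms by (subst borel_measurable_euclidean_space) (auto simp: Basis_vec_def inner_axis)

lemma borel_measurable_dcor [measurable]: "dcor k \<in> borel_measurable borel"
  unfolding dcor_def[abs_def] by (intro borel_measurable_vec_lambda) measurable

lemma pred_dcor_eq [measurable (raw)]: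
  assumes [measurable]: "f \<in> borel_measurable M" "g \<in> borel_measurable M"
  shows "Measurable.pred M (\<lambda>x. dcor k (f x) = dcor k (g x :: real^'n))"
proof -
  have "Measurable.pred M (\<lambda>x. \<forall>i\<in>UNIV. \<lfloor>f x$i / 2 powr real_of_int k\<rfloor> = \<lfloor>g x$i / 2 powr real_of_int k\<rfloor>)"
    by (intro pred_intros_finite) (auto, measurable)
  then show ?thesis by (simp add: dcor_eq_iff)
qed

lemma borel_measurable_dker [measurable (raw)]:
  assumes [measurable]: "f \<in> borel_measurable M" "g \<in> borel_measurable M"
  shows "(\<lambda>x. dker k (f x) (g x)) \<in> borel_measurable M"
  unfolding dker_def by measurable

lemma dker_nonneg [simp]: "0 \<le> dker k x z"
  by (simp add: dker_def)

lemma dker_sym: "dker k x z = dker k z x"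
  by (auto simp: dker_def)

lemma dker_le: "dker k x (z::real^'n) \<le> (1 / 2 powr real_of_int k) ^ CARD('n)"
  by (auto simp: dker_def)

lemma nn_integral_dker: "(\<integral>\<^sup>+z. ennreal (dker k (x::real^'n) z) \<partial>lborel) = 1"
proof -
  have "(\<integral>\<^sup>+z. ennreal (dker k x z) \<partial>lborel) = (\<integral>\<^sup>+z. ennreal ((1 / 2 powr real_of_int k) ^ CARD('n)) * indicator {z. dcor k z = dcor k x} z \<partial>lborel)"
    by (intro nn_integral_cong) (auto simp: dker_def indicator_def)
  also have "\<dots> = ennreal ((1 / 2 powr real_of_int k) ^ CARD('n)) * emeasure lborel (hcube (dcor k x) (2 powr real_of_int k))"
    unfolding dcor_cube by (subst nn_integral_cmult_indicator) auto
  also have "\<dots> = 1"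
    by (subst emeasure_hcube) (auto simp: ennreal_mult[symmetric] power_mult_distrib[symmetric])
  finally show ?thesis .
qed

text \<open>Averaging over cubes does not change an integral against a step function. The factor 1,
  written as the integral of \<open>dker k x\<close>, is inserted and the integrals are exchanged;
  on the support of the kernel \<open>\<psi>\<close> takes the same value at both points.\<close>

lemma nn_integral_dconst:
  assumes [measurable]: "\<psi> \<in> borel_measurable borel" "\<phi> \<in> borel_measurable borel" and c: "dconst k \<psi>"
  shows "(\<integral>\<^sup>+x. \<psi> x * \<phi> x \<partial>lborel) = (\<integral>\<^sup>+z. \<psi> z * (\<integral>\<^sup>+x. ennreal (dker k z x) * \<phi> x \<partial>lborel) \<partial>lborel)"
proof -
  have "(\<integral>\<^sup>+x. \<psi> x * \<phi> x \<partial>lborel) = (\<integral>\<^sup>+x. (\<integral>\<^sup>+z. \<psi> x * \<phi> x * ennreal (dker k x z) \<partial>lborel) \<partial>lborel)"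
    by (subst nn_integral_cmult) (auto simp: nn_integral_dker)
  also have "\<dots> = (\<integral>\<^sup>+z. (\<integral>\<^sup>+x. \<psi> x * \<phi> x * ennreal (dker k x z) \<partial>lborel) \<partial>lborel)"
    by (rule lborel_pair.Fubini') measurable
  also have "\<dots> = (\<integral>\<^sup>+z. (\<integral>\<^sup>+x. \<psi> z * (ennreal (dker k z x) * \<phi> x) \<partial>lborel) \<partial>lborel)"
  proof (intro nn_integral_cong)
    fix x z :: "real^'a"
    show "\<psi> x * \<phi> x * ennreal (dker k x z) = \<psi> z * (ennreal (dker k z x) * \<phi> x)"
      using dconstD[OF c, of x z] by (cases "dcor k x = dcor k z") (simp_all add: dker_def mult_ac)
  qed
  also have "\<dots> = (\<integral>\<^sup>+z. \<psi> z * (\<integral>\<^sup>+x. ennreal (dker k z x) * \<phi> x \<partial>lborel) \<partial>lborel)"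
    by (intro nn_integral_cong nn_integral_cmult) measurable
  finally show ?thesis .
qed

lemma nn_integral_dker_dker:
  assumes [measurable]: "\<phi> \<in> borel_measurable borel"
  shows "(\<integral>\<^sup>+z. (\<integral>\<^sup>+x. ennreal (dker k z x) * \<phi> x \<partial>lborel) \<partial>lborel) = (\<integral>\<^sup>+x. \<phi> x \<partial>lborel)"
  using nn_integral_dconst[of "\<lambda>_. 1" \<phi> k] by (simp add: dconst_def)

lemma sqi_prod_integrable:
  assumes "sqi f" "sqi g" shows "integrable lborel (\<lambda>x. f x * g x)"
proof (rule integrableI_bounded)
  have [measurable]: "f \<in> borel_measurable borel" "g \<in> borel_measurable borel"
    using assms by (auto simp: sqi_def)
  show "(\<lambda>x. f x * g x) \<in> borel_measurable lborel" by measurable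
  have "(\<integral>\<^sup>+x. ennreal (norm (f x * g x)) \<partial>lborel) \<le> (\<integral>\<^sup>+x. ennreal ((f x)\<^sup>2) + ennreal ((g x)\<^sup>2) \<partial>lborel)"
  proof (intro nn_integral_mono)
    fix x
    have "norm (f x * g x) \<le> (f x)\<^sup>2 + (g x)\<^sup>2"
      using sum_squares_bound[of "\<bar>f x\<bar>" "\<bar>g x\<bar>"] mult_nonneg_nonneg[of "\<bar>f x\<bar>" "\<bar>g x\<bar>"]
      unfolding real_norm_def abs_mult power2_abs by linarith
    then show "ennreal (norm (f x * g x)) \<le> ennreal ((f x)\<^sup>2) + ennreal ((g x)\<^sup>2)"
      by (simp add: ennreal_plus[symmetric] del: ennreal_plus)
  qed
  also have "\<dots> < \<infinity>" using assms by (subst nn_integral_add) (auto simp: sqi_def)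
  finally show "(\<integral>\<^sup>+x. ennreal (norm (f x * g x)) \<partial>lborel) < \<infinity>" .
qed

lemma sqi_integrable: "sqi f \<Longrightarrow> integrable lborel (\<lambda>x. (f x)\<^sup>2)"
  using sqi_prod_integrable[of f f] by (simp add: power2_eq_square)

lemma sqi_nn: "sqi f \<Longrightarrow> (\<integral>\<^sup>+x. ennreal ((f x)\<^sup>2) \<partial>lborel) = ennreal (\<integral>x. (f x)\<^sup>2 \<partial>lborel)"
  by (intro nn_integral_eq_integral sqi_integrable) auto

lemma square_add_le: "((a::real) + b)\<^sup>2 \<le> 2 * a\<^sup>2 + 2 * b\<^sup>2"
  using sum_squares_bound[of a b] by (simp add: power2_sum)

lemma square_diff_le: "((a::real) - b)\<^sup>2 \<le> 2 * a\<^sup>2 + 2 * b\<^sup>2"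
  using square_add_le[of a "- b"] by simp

lemma sqi_add: assumes "sqi f" "sqi g" shows "sqi (\<lambda>x. f x + g x)"
proof -
  have [measurable]: "f \<in> borel_measurable borel" "g \<in> borel_measurable borel"
    using assms by (auto simp: sqi_def)
  have "(\<integral>\<^sup>+x. ennreal ((f x + g x)\<^sup>2) \<partial>lborel) \<le> (\<integral>\<^sup>+x. 2 * ennreal ((f x)\<^sup>2) + 2 * ennreal ((g x)\<^sup>2) \<partial>lborel)"
  proof (intro nn_integral_mono)
    fix x show "ennreal ((f x + g x)\<^sup>2) \<le> 2 * ennreal ((f x)\<^sup>2) + 2 * ennreal ((g x)\<^sup>2)"
      using ennreal_leI[OF square_add_le[of "f x" "g x"]] by (simp add: ennreal_mult)
  qed
  also have "\<dots> < \<infinity>" using assms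
    by (subst nn_integral_add) (auto simp: sqi_def nn_integral_cmult ennreal_mult_less_top)
  finally show ?thesis unfolding sqi_def by simp
qed

lemma sqi_uminus: "sqi f \<Longrightarrow> sqi (\<lambda>x. - f x)"
  by (simp add: sqi_def)

lemma sqi_diff: "sqi f \<Longrightarrow> sqi g \<Longrightarrow> sqi (\<lambda>x. f x - g x)"
  using sqi_add[of f "\<lambda>x. - g x"] sqi_uminus[of g] by simp

lemma sqi_dker: "sqi (dker k x)"
proof -
  have "(\<integral>\<^sup>+z. ennreal ((dker k x z)\<^sup>2) \<partial>lborel) \<le> (\<integral>\<^sup>+z. ennreal ((1 / 2 powr real_of_int k) ^ CARD('a)) * ennreal (dker k x z) \<partial>lborel)"
  proof (intro nn_integral_mono)
    fix z show "ennreal ((dker k x z)\<^sup>2) \<le> ennreal ((1 / 2 powr real_of_int k) ^ CARD('a)) * ennreal (dker k x z)"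
      unfolding power2_eq_square using dker_le[of k x z]
      by (subst ennreal_mult[symmetric]) (auto intro!: ennreal_leI mult_right_mono)
  qed
  also have "\<dots> < \<infinity>" by (subst nn_integral_cmult) (auto simp: nn_integral_dker)
  finally show ?thesis unfolding sqi_def by simp
qed

lemma dexp_measurable [measurable (raw)]:
  assumes [measurable]: "f \<in> borel_measurable M" "case_prod g \<in> borel_measurable (M \<Otimes>\<^sub>M lborel)"
  shows "(\<lambda>x. dexp k (g x) (f x)) \<in> borel_measurable M"
  unfolding dexp_def by measurable

lemma dexp_dconst: "dconst k (dexp k h)"
  unfolding dconst_def dexp_def dker_def by simp

text \<open>Cauchy-Schwarz with the weight \<open>w\<close>. A non-integrable \<open>f\<close> has
  Bochner integral 0, which keeps the first step true in that case.\<close>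

lemma nn_integral_abs_sq_bound:
  assumes [measurable]: "f \<in> borel_measurable M" "w \<in> borel_measurable M"
    and w: "\<And>z. 0 < w z"
  shows "ennreal ((\<integral>z. f z \<partial>M)\<^sup>2) \<le> (\<integral>\<^sup>+z. ennreal (w z) \<partial>M) * (\<integral>\<^sup>+z. ennreal ((f z)\<^sup>2 / w z) \<partial>M)"
proof -
  have "ennreal \<bar>\<integral>z. f z \<partial>M\<bar> \<le> (\<integral>\<^sup>+z. ennreal \<bar>f z\<bar> \<partial>M)"
    using integral_norm_bound_ennreal[of M f] not_integrable_integral_eq[of M f]
    by (cases "integrable M f") auto
  also have "\<dots> = (\<integral>\<^sup>+z. ennreal (sqrt (w z)) * ennreal (\<bar>f z\<bar> / sqrt (w z)) \<partial>M)"
    using w by (intro nn_integral_cong) (auto simp: ennreal_mult[symmetric] less_imp_le less_imp_neq[symmetric] order.strict_implies_not_eq)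
  finally have "(ennreal \<bar>\<integral>z. f z \<partial>M\<bar>)\<^sup>2 \<le> (\<integral>\<^sup>+z. ennreal (sqrt (w z)) * ennreal (\<bar>f z\<bar> / sqrt (w z)) \<partial>M)\<^sup>2"
    by (rule power_mono) auto
  also have "\<dots> \<le> (\<integral>\<^sup>+z. ennreal (sqrt (w z)) ^ 2 \<partial>M) * (\<integral>\<^sup>+z. ennreal (\<bar>f z\<bar> / sqrt (w z)) ^ 2 \<partial>M)"
    by (rule Cauchy_Schwarz_nn_integral) measurable
  also have "\<dots> = (\<integral>\<^sup>+z. ennreal (w z) \<partial>M) * (\<integral>\<^sup>+z. ennreal ((f z)\<^sup>2 / w z) \<partial>M)"
    using w by (intro arg_cong2[where f="(*)"] nn_integral_cong) (auto simp: ennreal_power less_imp_le power_divide)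
  finally show ?thesis by (simp add: ennreal_power)
qed

text \<open>Jensen's inequality for the probability density \<open>dker k x\<close>, obtained by
  splitting the kernel into two square roots in Cauchy-Schwarz.\<close>

lemma dexp_sq_le:
  assumes [measurable]: "h \<in> borel_measurable borel"
  shows "ennreal ((dexp k h x)\<^sup>2) \<le> (\<integral>\<^sup>+z. ennreal (dker k x z) * ennreal ((h z)\<^sup>2) \<partial>lborel)"
proof -
  have "ennreal \<bar>dexp k h x\<bar> \<le> (\<integral>\<^sup>+z. ennreal \<bar>dker k x z * h z\<bar> \<partial>lborel)"
    unfolding dexp_def
    using integral_norm_bound_ennreal[of lborel "\<lambda>z. dker k x z * h z"] not_integrable_integral_eq[of lborel "\<lambda>z. dker k x z * h z"]
    by (cases "integrable lborel (\<lambda>z. dker k x z * h z)") auto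
  also have "\<dots> = (\<integral>\<^sup>+z. ennreal (sqrt (dker k x z)) * ennreal (sqrt (dker k x z) * \<bar>h z\<bar>) \<partial>lborel)"
    by (intro nn_integral_cong) (auto simp: ennreal_mult[symmetric] abs_mult mult.assoc[symmetric])
  finally have "(ennreal \<bar>dexp k h x\<bar>)\<^sup>2 \<le> (\<integral>\<^sup>+z. ennreal (sqrt (dker k x z)) * ennreal (sqrt (dker k x z) * \<bar>h z\<bar>) \<partial>lborel)\<^sup>2"
    by (rule power_mono) auto
  also have "\<dots> \<le> (\<integral>\<^sup>+z. ennreal (sqrt (dker k x z)) ^ 2 \<partial>lborel) * (\<integral>\<^sup>+z. ennreal (sqrt (dker k x z) * \<bar>h z\<bar>) ^ 2 \<partial>lborel)"
    by (rule Cauchy_Schwarz_nn_integral) measurable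
  also have "\<dots> = (\<integral>\<^sup>+z. ennreal (dker k x z) \<partial>lborel) * (\<integral>\<^sup>+z. ennreal (dker k x z) * ennreal ((h z)\<^sup>2) \<partial>lborel)"
    by (intro arg_cong2[where f="(*)"] nn_integral_cong) (auto simp: ennreal_power power_mult_distrib ennreal_mult)
  finally show ?thesis by (simp add: ennreal_power nn_integral_dker)
qed

lemma dexp_sq_le_const:
  assumes [measurable]: "h \<in> borel_measurable borel"
  shows "ennreal ((dexp k h (x::real^'n))\<^sup>2) \<le> ennreal ((1 / 2 powr real_of_int k) ^ CARD('n)) * (\<integral>\<^sup>+z. ennreal ((h z)\<^sup>2) \<partial>lborel)"
proof -
  have "(\<integral>\<^sup>+z. ennreal (dker k x z) * ennreal ((h z)\<^sup>2) \<partial>lborel) \<le> (\<integral>\<^sup>+z. ennreal ((1 / 2 powr real_of_int k) ^ CARD('n)) * ennreal ((h z)\<^sup>2) \<partial>lborel)"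
    by (intro nn_integral_mono mult_right_mono ennreal_leI dker_le) auto
  also have "\<dots> = ennreal ((1 / 2 powr real_of_int k) ^ CARD('n)) * (\<integral>\<^sup>+z. ennreal ((h z)\<^sup>2) \<partial>lborel)"
    by (intro nn_integral_cmult) measurable
  finally show ?thesis using dexp_sq_le[of h k x] by simp
qed

lemma nn_integral_dexp_sq:
  assumes [measurable]: "h \<in> borel_measurable borel"
  shows "(\<integral>\<^sup>+x. ennreal ((dexp k h x)\<^sup>2) \<partial>lborel) \<le> (\<integral>\<^sup>+z. ennreal ((h z)\<^sup>2) \<partial>lborel)"
proof -
  have "(\<integral>\<^sup>+x. ennreal ((dexp k h x)\<^sup>2) \<partial>lborel) \<le> (\<integral>\<^sup>+x. (\<integral>\<^sup>+z. ennreal (dker k x z) * ennreal ((h z)\<^sup>2) \<partial>lborel) \<partial>lborel)"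
    by (intro nn_integral_mono dexp_sq_le) measurable
  also have "\<dots> = (\<integral>\<^sup>+z. ennreal ((h z)\<^sup>2) \<partial>lborel)"
    by (rule nn_integral_dker_dker) measurable
  finally show ?thesis .
qed

lemma sqi_dexp: "sqi h \<Longrightarrow> sqi (dexp k h)"
  using nn_integral_dexp_sq[of h k] unfolding sqi_def by (auto intro: le_less_trans)

text \<open>\<open>dexp k\<close> acts as the orthogonal projection onto step functions of scale
  2^k: Fubini moves the symmetric kernel to \<open>\<phi>\<close>, which it reproduces.\<close>

lemma integral_dconst_dexp:
  assumes "sqi \<phi>" "sqi h" "dconst k \<phi>"
  shows "(\<integral>x. \<phi> x * dexp k h x \<partial>lborel) = (\<integral>x. \<phi> x * h x \<partial>lborel)"
proof -
  have [measurable]: "\<phi> \<in> borel_measurable borel" "h \<in> borel_measurable borel"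
    using assms by (auto simp: sqi_def)
  \<comment> \<open>Absolute integrability for Fubini: the product of \<open>\<phi> x\<close> and
    \<open>h z\<close> is split into two squares, and in each of them the kernel integrates to 1 in
    the variable that does not occur.\<close>
  have "(\<integral>\<^sup>+x. \<integral>\<^sup>+z. ennreal (norm (\<phi> x * (dker k x z * h z))) \<partial>lborel \<partial>lborel)
      \<le> (\<integral>\<^sup>+x. \<integral>\<^sup>+z. ennreal ((\<phi> x)\<^sup>2) * ennreal (dker k x z) + ennreal (dker k x z) * ennreal ((h z)\<^sup>2) \<partial>lborel \<partial>lborel)"
  proof (intro nn_integral_mono)
    fix x z
    have "\<bar>\<phi> x\<bar> * \<bar>h z\<bar> \<le> (\<phi> x)\<^sup>2 + (h z)\<^sup>2"
      using sum_squares_bound[of "\<bar>\<phi> x\<bar>" "\<bar>h z\<bar>"] mult_nonneg_nonneg[of "\<bar>\<phi> x\<bar>" "\<bar>h z\<bar>"] unfolding power2_abs by linarith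
    then have "norm (\<phi> x * (dker k x z * h z)) \<le> (\<phi> x)\<^sup>2 * dker k x z + dker k x z * (h z)\<^sup>2"
      using mult_left_mono[of "\<bar>\<phi> x\<bar> * \<bar>h z\<bar>" "(\<phi> x)\<^sup>2 + (h z)\<^sup>2" "dker k x z"] by (simp add: abs_mult algebra_simps)
    then show "ennreal (norm (\<phi> x * (dker k x z * h z))) \<le> ennreal ((\<phi> x)\<^sup>2) * ennreal (dker k x z) + ennreal (dker k x z) * ennreal ((h z)\<^sup>2)"
      by (simp add: ennreal_plus[symmetric] ennreal_mult[symmetric] del: ennreal_plus)
  qed
  also have "\<dots> = (\<integral>\<^sup>+x. ennreal ((\<phi> x)\<^sup>2) \<partial>lborel) + (\<integral>\<^sup>+x. \<integral>\<^sup>+z. ennreal (dker k x z) * ennreal ((h z)\<^sup>2) \<partial>lborel \<partial>lborel)"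
    by (simp add: nn_integral_add nn_integral_cmult nn_integral_dker)
  also have "\<dots> < \<infinity>"
    using assms by (subst nn_integral_dker_dker) (auto simp: sqi_def)
  finally have fin: "(\<integral>\<^sup>+x. \<integral>\<^sup>+z. ennreal (norm (\<phi> x * (dker k x z * h z))) \<partial>lborel \<partial>lborel) < \<infinity>" .
  have int: "integrable (lborel \<Otimes>\<^sub>M lborel) (\<lambda>(x, z). \<phi> x * (dker k x z * h z))"
    by (rule integrableI_bounded, measurable)
      (subst lborel.nn_integral_fst[symmetric], measurable, use fin in \<open>simp add: split_beta'\<close>)
  have "(\<integral>x. \<phi> x * dexp k h x \<partial>lborel) = (\<integral>x. (\<integral>z. \<phi> x * (dker k x z * h z) \<partial>lborel) \<partial>lborel)"
    by (simp add: dexp_def)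
  also have "\<dots> = (\<integral>z. (\<integral>x. \<phi> x * (dker k x z * h z) \<partial>lborel) \<partial>lborel)"
    using lborel_pair.Fubini_integral[OF int] by simp
  also have "\<dots> = (\<integral>z. (\<integral>x. (\<phi> z * h z) * dker k z x \<partial>lborel) \<partial>lborel)"
  proof (intro Bochner_Integration.integral_cong refl)
    fix x z :: "real^'a"
    show "\<phi> x * (dker k x z * h z) = \<phi> z * h z * dker k z x"
      using dconstD[OF assms(3), of x z] by (cases "dcor k x = dcor k z") (simp_all add: dker_def)
  qed
  also have "\<dots> = (\<integral>z. \<phi> z * h z \<partial>lborel)"
  proof -
    have "(\<integral>x. dker k z x \<partial>lborel) = 1" for z :: "real^'a"
      using nn_integral_dker[of k z] by (subst integral_eq_nn_integral) auto
    then show ?thesis by simp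
  qed
  finally show ?thesis .
qed

section \<open>Martingale differences and their energy\<close>

text \<open>Larger indices are coarser scales. \<open>dd k h\<close> is constant on cubes of scale
  \<open>k\<close> and has mean zero on cubes of scale \<open>k + 1\<close>; the second scale is the
  one that counts when cancellation is used.\<close>

definition dd :: "int \<Rightarrow> (real^'n \<Rightarrow> real) \<Rightarrow> real^'n \<Rightarrow> real" where
  "dd k h x = dexp k h x - dexp (k + 1) h x"

lemma dd_measurable [measurable (raw)]:
  assumes [measurable]: "f \<in> borel_measurable M" "case_prod g \<in> borel_measurable (M \<Otimes>\<^sub>M lborel)"
  shows "(\<lambda>x. dd k (g x) (f x)) \<in> borel_measurable M"
  unfolding dd_def by measurable

lemma sqi_dd: "sqi h \<Longrightarrow> sqi (dd k h)"
  unfolding dd_def[abs_def] by (intro sqi_diff sqi_dexp)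

lemma dd_dconst: "dconst k (dd k h)"
proof -
  have "dconst k (dexp (k + 1) h)" by (rule dconst_mono[OF dexp_dconst]) simp
  then show ?thesis
    unfolding dd_def[abs_def] dconst_def using dconstD[OF dexp_dconst[of k h]] by metis
qed

text \<open>Pythagoras: the inner products of the coarser average with the finer one and with itself
  both equal its inner product with \<open>h\<close>, so \<open>dd k h\<close> is orthogonal to
  it.\<close>

lemma dd_energy:
  assumes h: "sqi h"
  shows "(\<integral>x. (dd k h x)\<^sup>2 \<partial>lborel) + (\<integral>x. (dexp (k + 1) h x)\<^sup>2 \<partial>lborel) = (\<integral>x. (dexp k h x)\<^sup>2 \<partial>lborel)"
proof -
  let ?E = "dexp k h" and ?E' = "dexp (k + 1) h"
  have s: "sqi ?E" "sqi ?E'" using h by (auto intro: sqi_dexp)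
  have "(\<integral>x. ?E' x * ?E x \<partial>lborel) = (\<integral>x. ?E' x * h x \<partial>lborel)"
    using s h by (intro integral_dconst_dexp dconst_mono[OF dexp_dconst]) auto
  also have "\<dots> = (\<integral>x. ?E' x * ?E' x \<partial>lborel)"
    using s h by (intro integral_dconst_dexp[symmetric] dexp_dconst) auto
  finally have eq: "(\<integral>x. ?E' x * ?E x \<partial>lborel) = (\<integral>x. (?E' x)\<^sup>2 \<partial>lborel)" by (simp add: power2_eq_square)
  have "(\<integral>x. (dd k h x)\<^sup>2 \<partial>lborel) = (\<integral>x. (?E x)\<^sup>2 + (?E' x)\<^sup>2 - 2 * (?E' x * ?E x) \<partial>lborel)"
    by (intro Bochner_Integration.integral_cong refl) (simp add: dd_def power2_diff)
  also have "\<dots> = (\<integral>x. (?E x)\<^sup>2 \<partial>lborel) + (\<integral>x. (?E' x)\<^sup>2 \<partial>lborel) - 2 * (\<integral>x. ?E' x * ?E x \<partial>lborel)"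
    using sqi_integrable[OF s(1)] sqi_integrable[OF s(2)] sqi_prod_integrable[OF s(2,1)] by simp
  finally show ?thesis using eq by simp
qed

text \<open>Bessel's inequality. The energies telescope, and what is left is at most the energy of
  the finest average in the range.\<close>

lemma dd_bessel:
  assumes h: "sqi h"
  shows "(\<Sum>i<N. \<integral>\<^sup>+x. ennreal ((dd (k + int i) h x)\<^sup>2) \<partial>lborel) \<le> (\<integral>\<^sup>+x. ennreal ((h x)\<^sup>2) \<partial>lborel)"
proof -
  let ?e = "\<lambda>k. \<integral>x. (dexp k h x)\<^sup>2 \<partial>lborel"
  have eq: "(\<integral>x. (dd (k + int i) h x)\<^sup>2 \<partial>lborel) = ?e (k + int i) - ?e (k + int (Suc i))" for i
    using dd_energy[OF h, of "k + int i"] by (simp add: algebra_simps)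
  have "(\<Sum>i<N. \<integral>\<^sup>+x. ennreal ((dd (k + int i) h x)\<^sup>2) \<partial>lborel) = ennreal (\<Sum>i<N. \<integral>x. (dd (k + int i) h x)\<^sup>2 \<partial>lborel)"
    using h by (subst sum_ennreal[symmetric]) (auto simp: sqi_nn sqi_dd)
  also have "(\<Sum>i<N. \<integral>x. (dd (k + int i) h x)\<^sup>2 \<partial>lborel) = ?e k - ?e (k + int N)"
    unfolding eq by (subst sum_lessThan_telescope') simp
  also have "ennreal \<dots> \<le> ennreal (?e k)" by (intro ennreal_leI) simp
  also have "\<dots> = (\<integral>\<^sup>+x. ennreal ((dexp k h x)\<^sup>2) \<partial>lborel)" using h by (simp add: sqi_nn sqi_dexp)
  also have "\<dots> \<le> (\<integral>\<^sup>+x. ennreal ((h x)\<^sup>2) \<partial>lborel)" using h by (intro nn_integral_dexp_sq) (simp add: sqi_def)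
  finally show ?thesis .
qed

section \<open>Translates of step functions and the oscillation of averages\<close>

lemma nn_integral_lborel_shift:
  fixes u :: "'a::euclidean_space"
  assumes [measurable]: "f \<in> borel_measurable borel"
  shows "(\<integral>\<^sup>+x. f (u + x) \<partial>lborel) = (\<integral>\<^sup>+x. f x \<partial>lborel)"
proof -
  have "(\<integral>\<^sup>+x. f x \<partial>lborel) = (\<integral>\<^sup>+x. f x \<partial>(distr lborel borel ((+) u)))" by (simp add: lborel_distr_plus)
  also have "\<dots> = (\<integral>\<^sup>+x. f (u + x) \<partial>lborel)" by (subst nn_integral_distr) auto
  finally show ?thesis by simp
qed

text \<open>A point of the cube whose \<open>i\<close>-th coordinate leaves the cube under
  translation by \<open>u\<close> lies within \<open>\<bar>u$i\<bar>\<close> of the face it crosses,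
  the upper one for \<open>u$i \<ge> 0\<close> and the lower one otherwise. This slab is the box
  between \<open>?A\<close> and \<open>?B\<close>.\<close>

lemma emeasure_hcube_slab:
  fixes a u :: "real^'n"
  assumes l: "0 < l"
  shows "emeasure lborel {x \<in> hcube a l. \<not> (a$i \<le> x$i + u$i \<and> x$i + u$i < a$i + l)} \<le> ennreal (\<bar>u$i\<bar> / l * l ^ CARD('n))"
    (is "emeasure _ ?S \<le> _")
proof -
  have P: "(\<Prod>j\<in>UNIV. if j = i then c else l) = c / l * l ^ CARD('n)" for c
  proof -
    have "(\<Prod>j\<in>UNIV. if j = i then c else l) = c * (\<Prod>j\<in>UNIV-{i}. if j = i then c else l)"
      by (subst prod.remove[of UNIV i]) auto
    also have "(\<Prod>j\<in>UNIV-{i}. if j = i then c else l) = (\<Prod>j\<in>UNIV-{i}. l)" by (rule prod.cong) auto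
    also have "\<dots> = l ^ CARD('n) / l"
      using l by (simp add: card_Diff_singleton power_diff)
    finally show ?thesis by simp
  qed
  let ?A = "\<chi> j. if j = i \<and> 0 \<le> u$i then a$i + l - \<bar>u$i\<bar> else a$j"
  let ?B = "\<chi> j. if j = i \<and> u$i < 0 then a$i + \<bar>u$i\<bar> else a$j + l"
  have "?S \<subseteq> cbox ?A ?B"
    by (auto simp: hcube_def mem_box_cart less_imp_le) (smt (verit))+
  then have "emeasure lborel ?S \<le> emeasure lborel (cbox ?A ?B)"
    by (intro emeasure_mono) auto
  also have "\<dots> = ennreal (\<Prod>j\<in>UNIV. ?B$j - ?A$j)"
    using l by (intro emeasure_cbox_cart) auto
  also have "(\<Prod>j\<in>UNIV. ?B$j - ?A$j) = (\<Prod>j\<in>UNIV. if j = i then \<bar>u$i\<bar> else l)"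
    by (rule prod.cong) auto
  finally show ?thesis by (simp add: P)
qed

text \<open>The integral is the fraction of the cube whose points change cubes under the shift. The
  slabs give n |u| / 2^j, and the fraction never exceeds 1; a power \<open>s \<le> 1\<close> of the
  ratio dominates both bounds, so no restriction on \<open>u\<close> remains when \<open>u\<close>
  is integrated later.\<close>

lemma dexp_boundary:
  fixes u z :: "real^'n"
  assumes s: "0 < s" "s \<le> 1"
  shows "(\<integral>\<^sup>+x. ennreal (dker j z x) * indicator {x. dcor j (x + u) \<noteq> dcor j x} x \<partial>lborel)
     \<le> ennreal (real CARD('n) * (infnorm u / 2 powr real_of_int j) powr s)"
proof -
  let ?l = "2 powr real_of_int j" and ?I = "\<integral>\<^sup>+x. ennreal (dker j z x) * indicator {x. dcor j (x + u) \<noteq> dcor j x} x \<partial>lborel"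
  let ?r = "infnorm u / ?l"
  let ?S = "\<lambda>i. {x \<in> hcube (dcor j z) ?l. \<not> (dcor j z$i \<le> x$i + u$i \<and> x$i + u$i < dcor j z$i + ?l)}"
  have S[measurable]: "?S i \<in> sets borel" for i by measurable
  have r0: "0 \<le> ?r" by (simp add: infnorm_pos_le)
  have card: "1 \<le> real CARD('n)" using one_le_card_finite by (simp add: Suc_le_eq)
  show ?thesis
  proof (cases "1 \<le> ?r")
    case True
    have "?I \<le> (\<integral>\<^sup>+x. ennreal (dker j z x) \<partial>lborel)"
      by (intro nn_integral_mono) (auto split: split_indicator)
    also have "\<dots> = ennreal 1" by (simp add: nn_integral_dker)
    also have "\<dots> \<le> ennreal (real CARD('n) * ?r powr s)"
    proof (intro ennreal_leI)
      have "1 \<le> ?r powr s" using True s by (intro ge_one_powr_ge_zero) auto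
      then show "1 \<le> real CARD('n) * ?r powr s" using card mult_mono[of 1 "real CARD('n)" 1 "?r powr s"] by simp
    qed
    finally show ?thesis .
  next
    case False
    have "?I \<le> (\<integral>\<^sup>+x. ennreal ((1 / ?l) ^ CARD('n)) * indicator (\<Union>i. ?S i) x \<partial>lborel)"
    proof (intro nn_integral_mono)
      fix x
      show "ennreal (dker j z x) * indicator {x. dcor j (x + u) \<noteq> dcor j x} x \<le> ennreal ((1 / ?l) ^ CARD('n)) * indicator (\<Union>i. ?S i) x"
      proof (cases "dcor j x = dcor j z \<and> dcor j (x + u) \<noteq> dcor j x")
        case True
        then have "x \<in> hcube (dcor j z) ?l" "x + u \<notin> hcube (dcor j z) ?l"
          using dcor_eq_cube[of j] by metis+
        then have "x \<in> (\<Union>i. ?S i)" by (auto simp: hcube_def)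
        then show ?thesis using True by (simp add: dker_def split: split_indicator)
      next
        case False
        then show ?thesis by (auto simp: dker_def)
      qed
    qed
    also have "\<dots> = ennreal ((1 / ?l) ^ CARD('n)) * emeasure lborel (\<Union>i. ?S i)"
      by (rule nn_integral_cmult_indicator) auto
    also have "emeasure lborel (\<Union>i. ?S i) \<le> (\<Sum>i\<in>UNIV. emeasure lborel (?S i))"
      by (intro emeasure_subadditive_finite) auto
    also have "\<dots> \<le> (\<Sum>i\<in>(UNIV::'n set). ennreal (?r * ?l ^ CARD('n)))"
    proof (intro sum_mono)
      fix i :: 'n
      have "emeasure lborel (?S i) \<le> ennreal (\<bar>u$i\<bar> / ?l * ?l ^ CARD('n))"
        by (rule emeasure_hcube_slab) simp
      also have "\<dots> \<le> ennreal (?r * ?l ^ CARD('n))"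
        by (intro ennreal_leI mult_right_mono divide_right_mono component_le_infnorm_cart) auto
      finally show "emeasure lborel (?S i) \<le> ennreal (?r * ?l ^ CARD('n))" .
    qed
    also have "\<dots> = ennreal (real CARD('n) * (?r * ?l ^ CARD('n)))"
      using r0 by (simp only: sum_constant ennreal_of_nat_eq_real_of_nat) (rule ennreal_mult[symmetric], auto simp: infnorm_pos_le)
    also have "ennreal ((1 / ?l) ^ CARD('n)) * \<dots> = ennreal (real CARD('n) * ?r)"
      using r0 by (subst ennreal_mult[symmetric]) (auto simp: power_divide infnorm_pos_le)
    also have "\<dots> \<le> ennreal (real CARD('n) * ?r powr s)"
    proof (intro ennreal_leI mult_left_mono)
      show "?r \<le> ?r powr s"
        using False s r0 powr_mono'[of s 1 ?r] by (cases "?r = 0") (auto simp: infnorm_pos_le)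
    qed simp
    finally show ?thesis by (simp add: mult_left_mono)
  qed
qed

text \<open>\<open>h (y + u)\<close> and \<open>h y\<close> agree unless \<open>y\<close> and
  \<open>y + u\<close> lie in different cubes. The term \<open>h y\<close> sees this exceptional set
  with shift \<open>u\<close>, the term \<open>h (y + u)\<close> sees it from its own point with
  shift \<open>-u\<close>; since h^2 is constant on cubes, each is charged only the boundary
  fraction of every cube.\<close>

lemma shift_dconst_bound:
  fixes u :: "real^'n"
  assumes [measurable]: "h \<in> borel_measurable borel" and c: "dconst j (h :: _ \<Rightarrow> real)" and s: "0 < s" "s \<le> 1"
  shows "(\<integral>\<^sup>+y. ennreal ((h (y + u) - h y)\<^sup>2) \<partial>lborel)
     \<le> ennreal (4 * real CARD('n) * (infnorm u / 2 powr real_of_int j) powr s) * (\<integral>\<^sup>+y. ennreal ((h y)\<^sup>2) \<partial>lborel)"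
proof -
  let ?c = "ennreal (real CARD('n) * (infnorm u / 2 powr real_of_int j) powr s)"
  let ?H = "\<integral>\<^sup>+y. ennreal ((h y)\<^sup>2) \<partial>lborel"
  let ?X = "\<lambda>u y. indicator {x. dcor j (x + u) \<noteq> dcor j x} y :: ennreal"
  have c2: "dconst j (\<lambda>y. ennreal ((h y)\<^sup>2))" using c unfolding dconst_def by metis
  have X[measurable]: "?X v \<in> borel_measurable borel" for v :: "real^'n"
    by measurable
  have B: "(\<integral>\<^sup>+y. ennreal ((h y)\<^sup>2) * ?X v y \<partial>lborel) \<le> ?c * ?H" if "infnorm v = infnorm u" for v
  proof -
    have "(\<integral>\<^sup>+y. ennreal ((h y)\<^sup>2) * ?X v y \<partial>lborel) = (\<integral>\<^sup>+z. ennreal ((h z)\<^sup>2) * (\<integral>\<^sup>+x. ennreal (dker j z x) * ?X v x \<partial>lborel) \<partial>lborel)"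
      using c2 by (intro nn_integral_dconst) auto
    also have "\<dots> \<le> (\<integral>\<^sup>+z. ennreal ((h z)\<^sup>2) * ?c \<partial>lborel)"
      unfolding that[symmetric] by (intro nn_integral_mono mult_left_mono dexp_boundary s) auto
    also have "\<dots> = ?c * ?H" by (subst nn_integral_multc) (auto simp: mult.commute)
    finally show ?thesis .
  qed
  have "(\<integral>\<^sup>+y. ennreal ((h (y + u) - h y)\<^sup>2) \<partial>lborel) \<le> (\<integral>\<^sup>+y. 2 * (ennreal ((h (u + y))\<^sup>2) * ?X (-u) (u + y)) + 2 * (ennreal ((h y)\<^sup>2) * ?X u y) \<partial>lborel)"
  proof (intro nn_integral_mono)
    fix y
    show "ennreal ((h (y + u) - h y)\<^sup>2) \<le> 2 * (ennreal ((h (u + y))\<^sup>2) * ?X (-u) (u + y)) + 2 * (ennreal ((h y)\<^sup>2) * ?X u y)"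
    proof (cases "dcor j (y + u) = dcor j y")
      case True
      then have "h (y + u) = h y" using c unfolding dconst_def by blast
      then show ?thesis by simp
    next
      case False
      have "ennreal ((h (y + u) - h y)\<^sup>2) \<le> ennreal (2 * (h (y + u))\<^sup>2 + 2 * (h y)\<^sup>2)"
        by (intro ennreal_leI square_diff_le)
      also have "\<dots> = 2 * ennreal ((h (y + u))\<^sup>2) + 2 * ennreal ((h y)\<^sup>2)" by (simp add: ennreal_mult)
      finally show ?thesis using False by (simp add: add.commute[of u y] eq_commute[of "dcor j y"])
    qed
  qed
  also have "\<dots> = 2 * (\<integral>\<^sup>+y. ennreal ((h (u + y))\<^sup>2) * ?X (-u) (u + y) \<partial>lborel) + 2 * (\<integral>\<^sup>+y. ennreal ((h y)\<^sup>2) * ?X u y \<partial>lborel)"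
    by (simp add: nn_integral_add nn_integral_cmult)
  also have "(\<integral>\<^sup>+y. ennreal ((h (u + y))\<^sup>2) * ?X (-u) (u + y) \<partial>lborel) = (\<integral>\<^sup>+y. ennreal ((h y)\<^sup>2) * ?X (-u) y \<partial>lborel)"
    by (rule nn_integral_lborel_shift) auto
  also have "2 * (\<integral>\<^sup>+y. ennreal ((h y)\<^sup>2) * ?X (-u) y \<partial>lborel) + 2 * (\<integral>\<^sup>+y. ennreal ((h y)\<^sup>2) * ?X u y \<partial>lborel) \<le> 2 * (?c * ?H) + 2 * (?c * ?H)"
    by (intro add_mono mult_left_mono B) (auto simp: infnorm_neg)
  also have "\<dots> = 4 * ?c * ?H" by (simp add: mult.assoc flip: distrib_right)
  also have "4 * ?c = ennreal (4 * real CARD('n) * (infnorm u / 2 powr real_of_int j) powr s)"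
    by (simp add: ennreal_mult mult.assoc)
  finally show ?thesis .
qed

text \<open>Cauchy-Schwarz with geometric weights. Each term pays 1 / q^i, which is affordable
  because the estimates for the separate scales decay like q^(2 i).\<close>

lemma weighted_sum_square:
  fixes x :: "nat \<Rightarrow> real"
  assumes q: "0 < q" "q < 1"
  shows "(\<Sum>i<N. x i)\<^sup>2 \<le> 1 / (1 - q) * (\<Sum>i<N. (x i)\<^sup>2 / q ^ i)"
proof -
  have "(\<Sum>i<N. x i) = (\<Sum>i<N. sqrt (q ^ i) * (x i / sqrt (q ^ i)))" using q by simp
  then have "(\<Sum>i<N. x i)\<^sup>2 \<le> (\<Sum>i<N. (sqrt (q ^ i))\<^sup>2) * (\<Sum>i<N. (x i / sqrt (q ^ i))\<^sup>2)"
    by (simp only: Cauchy_Schwarz_ineq_sum)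
  also have "\<dots> = (\<Sum>i<N. q ^ i) * (\<Sum>i<N. (x i)\<^sup>2 / q ^ i)" using q by (simp add: power_divide)
  also have "\<dots> \<le> 1 / (1 - q) * (\<Sum>i<N. (x i)\<^sup>2 / q ^ i)"
  proof (intro mult_right_mono sum_nonneg)
    show "(\<Sum>i<N. q ^ i) \<le> 1 / (1 - q)"
      using q by (subst sum_gp_strict) (auto simp: divide_right_mono)
  qed (use q in auto)
  finally show ?thesis .
qed

lemma ennreal_weighted_sum:
  fixes w x :: "nat \<Rightarrow> real"
  assumes "0 \<le> c" "\<And>i. 0 \<le> w i" "\<And>i. 0 \<le> x i" "0 \<le> b"
  shows "ennreal (c * (\<Sum>i<N. w i * x i) + 2 * b) = ennreal c * (\<Sum>i<N. ennreal (w i) * ennreal (x i)) + 2 * ennreal b"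
proof -
  have "ennreal (\<Sum>i<N. w i * x i) = (\<Sum>i<N. ennreal (w i) * ennreal (x i))"
    using assms by (subst sum_ennreal[symmetric]) (auto simp: ennreal_mult)
  moreover have "0 \<le> (\<Sum>i<N. w i * x i)" using assms by (auto intro: sum_nonneg)
  ultimately show ?thesis using assms by (simp add: ennreal_mult)
qed

lemma dd_telescope: "dexp k h x = (\<Sum>i<N. dd (k + int i) h x) + dexp (k + int N) h x"
  by (induction N) (auto simp: dd_def algebra_simps)

text \<open>Any exponent \<open>dl a\<close> with \<open>0 < 2 * dl a < min a 1\<close> would do; \<open>qq a\<close> is the resulting decay per dyadic scale.\<close>

definition dl :: "real \<Rightarrow> real" where "dl a = min a 1 / 4"
definition qq :: "real \<Rightarrow> real" where "qq a = 2 powr (- dl a)"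

lemma dl_bounds: "0 < a \<Longrightarrow> 0 < dl a" "2 * dl a \<le> 1" "0 < a \<Longrightarrow> 2 * dl a < a"
  by (auto simp: dl_def min_def)

lemma qq_bounds: "0 < qq a" "0 < a \<Longrightarrow> qq a < 1"
  using dl_bounds[of a] by (auto simp: qq_def powr_less_one)

lemma qq_power: "qq a ^ i = 2 powr (- dl a * real i)"
  by (simp add: qq_def powr_powr powr_realpow[symmetric])

text \<open>Removes the error of a truncated telescoping sum by letting the truncation index tend to
  infinity.\<close>

lemma ennreal_le_of_tendsto:
  assumes "\<And>N::nat. (X::ennreal) \<le> S + ennreal (c * r ^ N)" "0 < r" "r < 1"
  shows "X \<le> S"
proof (rule tendsto_lowerbound[OF _ always_eventually])
  have "(\<lambda>N. c * r ^ N) \<longlonglongrightarrow> c * 0" using assms by (intro tendsto_intros LIMSEQ_power_zero) auto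
  then have "(\<lambda>N. ennreal (c * r ^ N)) \<longlonglongrightarrow> ennreal 0" by (intro tendsto_ennrealI) simp
  then show "(\<lambda>N. S + ennreal (c * r ^ N)) \<longlonglongrightarrow> S" using tendsto_add[OF tendsto_const[of S]] by fastforce
qed (use assms in auto)

text \<open>8 n = 2 * 4 n: the 2 comes from splitting off the remainder, 4 n from
  \<open>shift_dconst_bound\<close>, and \<open>1 / (1 - qq a)\<close> from
  \<open>weighted_sum_square\<close>.\<close>

definition csh :: "nat \<Rightarrow> real \<Rightarrow> real" where "csh n a = 8 * real n / (1 - qq a)"

lemma csh_nonneg: "0 < a \<Longrightarrow> 0 \<le> csh n a"
  using qq_bounds(2)[of a] by (simp add: csh_def)

text \<open>Telescoping to coarser scales writes \<open>dexp k h\<close> as a sum of step functions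
  of scales \<open>k + i\<close>. By \<open>U\<close>, level \<open>i\<close> costs
  \<open>?U * (qq a ^ i)^2\<close>: one factor \<open>qq a ^ i\<close> pays for squaring the sum,
  the other one is kept on the right-hand side.\<close>

lemma shift_dexp_bound:
  fixes u :: "real^'n"
  assumes h: "sqi h" and a: "0 < a"
  shows "(\<integral>\<^sup>+y. ennreal ((dexp k h (y + u) - dexp k h y)\<^sup>2) \<partial>lborel)
     \<le> ennreal (csh CARD('n) a * (infnorm u / 2 powr real_of_int k) powr (2 * dl a)) *
        (\<Sum>i. ennreal (qq a ^ i) * (\<integral>\<^sup>+y. ennreal ((dd (k + int i) h y)\<^sup>2) \<partial>lborel))"
    (is "?X \<le> ennreal (_ * ?U) * (\<Sum>i. _ * ?d i)")
proof -
  let ?H = "\<integral>y. (h y)\<^sup>2 \<partial>lborel"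
  let ?q = "qq a"
  have hm[measurable]: "h \<in> borel_measurable borel" using h by (simp add: sqi_def)
  have q: "0 < ?q" "?q < 1" using qq_bounds a by auto
  have r0: "0 \<le> infnorm u" by (simp add: infnorm_pos_le)
  have U: "(infnorm u / 2 powr real_of_int (k + int i)) powr (2 * dl a) = ?U * (?q ^ i)\<^sup>2" for i
  proof -
    have "infnorm u / 2 powr real_of_int (k + int i) = (infnorm u / 2 powr real_of_int k) * 2 powr (- real i)"
      by (simp add: powr_add powr_minus field_simps)
    then have "(infnorm u / 2 powr real_of_int (k + int i)) powr (2 * dl a) = ?U * (2 powr (- real i)) powr (2 * dl a)"
      using r0 by (simp only:) (subst powr_mult, auto)
    also have "(2 powr (- real i)) powr (2 * dl a) = (?q ^ i)\<^sup>2"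
      by (simp add: qq_power powr_powr power2_eq_square powr_add[symmetric] algebra_simps)
    finally show ?thesis .
  qed
  have bb: "(\<integral>\<^sup>+y. ennreal ((g (y + u) - g y)\<^sup>2) \<partial>lborel)
     \<le> ennreal (4 * real CARD('n) * (?U * (?q ^ i)\<^sup>2)) * (\<integral>\<^sup>+y. ennreal ((g y)\<^sup>2) \<partial>lborel)"
    if "sqi g" "dconst (k + int i) g" for g i
    using shift_dconst_bound[of g "k + int i" "2 * dl a" u] that dl_bounds[of a] a
    unfolding U by (simp add: sqi_def)
  \<comment> \<open>\<open>N\<close> is only a truncation. The average at scale \<open>k + N\<close>
    that is left over is a step function of that scale, so its own shift estimate carries
    \<open>(qq a ^ 2) ^ N\<close>.\<close>
  have "?X \<le> ennreal (csh CARD('n) a * ?U) * (\<Sum>i. ennreal (?q ^ i) * ?d i) + ennreal ((8 * real CARD('n) * ?U * ?H) * (?q ^ 2) ^ N)" for N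
  proof -
    let ?x = "\<lambda>i y. dd (k + int i) h (y + u) - dd (k + int i) h y"
    let ?b = "\<lambda>y. dexp (k + int N) h (y + u) - dexp (k + int N) h y"
    have "?X \<le> (\<integral>\<^sup>+y. ennreal (2 / (1 - ?q)) * (\<Sum>i<N. ennreal (1 / ?q ^ i) * ennreal ((?x i y)\<^sup>2)) + 2 * ennreal ((?b y)\<^sup>2) \<partial>lborel)"
    proof (intro nn_integral_mono)
      fix y
      have "dexp k h (y + u) - dexp k h y = (\<Sum>i<N. ?x i y) + ?b y"
        using dd_telescope[of k h "y + u" N] dd_telescope[of k h y N] by (simp add: sum_subtractf)
      then have "(dexp k h (y + u) - dexp k h y)\<^sup>2 \<le> 2 * (\<Sum>i<N. ?x i y)\<^sup>2 + 2 * (?b y)\<^sup>2"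
        by (simp only: square_add_le)
      also have "\<dots> \<le> 2 * (1 / (1 - ?q) * (\<Sum>i<N. (?x i y)\<^sup>2 / ?q ^ i)) + 2 * (?b y)\<^sup>2"
        by (intro add_right_mono mult_left_mono weighted_sum_square q) auto
      also have "\<dots> = 2 / (1 - ?q) * (\<Sum>i<N. 1 / ?q ^ i * (?x i y)\<^sup>2) + 2 * (?b y)\<^sup>2" by simp
      finally have "ennreal ((dexp k h (y + u) - dexp k h y)\<^sup>2) \<le> ennreal (2 / (1 - ?q) * (\<Sum>i<N. 1 / ?q ^ i * (?x i y)\<^sup>2) + 2 * (?b y)\<^sup>2)"
        by (rule ennreal_leI)
      also have "\<dots> = ennreal (2 / (1 - ?q)) * (\<Sum>i<N. ennreal (1 / ?q ^ i) * ennreal ((?x i y)\<^sup>2)) + 2 * ennreal ((?b y)\<^sup>2)"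
        using q by (intro ennreal_weighted_sum) auto
      finally show "ennreal ((dexp k h (y + u) - dexp k h y)\<^sup>2) \<le> \<dots>" .
    qed
    also have "\<dots> = ennreal (2 / (1 - ?q)) * (\<Sum>i<N. ennreal (1 / ?q ^ i) * (\<integral>\<^sup>+y. ennreal ((?x i y)\<^sup>2) \<partial>lborel)) + 2 * (\<integral>\<^sup>+y. ennreal ((?b y)\<^sup>2) \<partial>lborel)"
      by (simp add: nn_integral_add nn_integral_cmult nn_integral_sum)
    also have "\<dots> \<le> ennreal (2 / (1 - ?q)) * (\<Sum>i<N. ennreal (4 * real CARD('n) * ?U) * (ennreal (?q ^ i) * ?d i)) + 2 * (ennreal (4 * real CARD('n) * (?U * (?q ^ N)\<^sup>2)) * ennreal ?H)"
    proof (intro add_mono mult_left_mono sum_mono)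
      fix i
      have "ennreal (1 / ?q ^ i) * (\<integral>\<^sup>+y. ennreal ((?x i y)\<^sup>2) \<partial>lborel) \<le> ennreal (1 / ?q ^ i) * (ennreal (4 * real CARD('n) * (?U * (?q ^ i)\<^sup>2)) * ?d i)"
        by (intro mult_left_mono bb sqi_dd dd_dconst h) auto
      also have "\<dots> = ennreal (1 / ?q ^ i * (4 * real CARD('n) * (?U * (?q ^ i)\<^sup>2))) * ?d i"
        using q by (subst ennreal_mult) (auto simp: mult.assoc)
      also have "1 / ?q ^ i * (4 * real CARD('n) * (?U * (?q ^ i)\<^sup>2)) = (4 * real CARD('n) * ?U) * ?q ^ i"
        using q by (simp add: power2_eq_square)
      also have "ennreal \<dots> = ennreal (4 * real CARD('n) * ?U) * ennreal (?q ^ i)"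
        using q by (subst ennreal_mult) auto
      finally show "ennreal (1 / ?q ^ i) * (\<integral>\<^sup>+y. ennreal ((?x i y)\<^sup>2) \<partial>lborel) \<le> ennreal (4 * real CARD('n) * ?U) * (ennreal (?q ^ i) * ?d i)"
        by (simp add: mult.assoc)
    next
      have "(\<integral>\<^sup>+y. ennreal ((?b y)\<^sup>2) \<partial>lborel) \<le> ennreal (4 * real CARD('n) * (?U * (?q ^ N)\<^sup>2)) * (\<integral>\<^sup>+y. ennreal ((dexp (k + int N) h y)\<^sup>2) \<partial>lborel)"
        by (intro bb sqi_dexp dexp_dconst h)
      also have "\<dots> \<le> ennreal (4 * real CARD('n) * (?U * (?q ^ N)\<^sup>2)) * (\<integral>\<^sup>+y. ennreal ((h y)\<^sup>2) \<partial>lborel)"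
        by (intro mult_left_mono nn_integral_dexp_sq) auto
      also have "(\<integral>\<^sup>+y. ennreal ((h y)\<^sup>2) \<partial>lborel) = ennreal ?H" by (rule sqi_nn[OF h])
      finally show "(\<integral>\<^sup>+y. ennreal ((?b y)\<^sup>2) \<partial>lborel) \<le> ennreal (4 * real CARD('n) * (?U * (?q ^ N)\<^sup>2)) * ennreal ?H" .
    qed auto
    also have "\<dots> = ennreal (csh CARD('n) a * ?U) * (\<Sum>i<N. ennreal (?q ^ i) * ?d i) + ennreal ((8 * real CARD('n) * ?U * ?H) * (?q ^ 2) ^ N)"
    proof (intro arg_cong2[where f="(+)"])
      have "ennreal (2 / (1 - ?q)) * ennreal (4 * real CARD('n) * ?U) = ennreal (csh CARD('n) a * ?U)"
        using q by (subst ennreal_mult[symmetric]) (auto simp: csh_def)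
      then show "ennreal (2 / (1 - ?q)) * (\<Sum>i<N. ennreal (4 * real CARD('n) * ?U) * (ennreal (?q ^ i) * ?d i)) = ennreal (csh CARD('n) a * ?U) * (\<Sum>i<N. ennreal (?q ^ i) * ?d i)"
        unfolding sum_distrib_left[symmetric] mult.assoc[symmetric, where b="ennreal (4 * real CARD('n) * ?U)"] by simp
      have "2 * (ennreal (4 * real CARD('n) * (?U * (?q ^ N)\<^sup>2)) * ennreal ?H) = ennreal 2 * ennreal (4 * real CARD('n) * (?U * (?q ^ N)\<^sup>2) * ?H)"
        by (subst ennreal_mult) auto
      also have "\<dots> = ennreal (2 * (4 * real CARD('n) * (?U * (?q ^ N)\<^sup>2) * ?H))"
        by (rule ennreal_mult[symmetric]) auto
      also have "2 * (4 * real CARD('n) * (?U * (?q ^ N)\<^sup>2) * ?H) = (8 * real CARD('n) * ?U * ?H) * (?q ^ 2) ^ N"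
        by (simp add: power_mult[symmetric] mult.commute[of 2 N])
      finally show "2 * (ennreal (4 * real CARD('n) * (?U * (?q ^ N)\<^sup>2)) * ennreal ?H) = ennreal ((8 * real CARD('n) * ?U * ?H) * (?q ^ 2) ^ N)" .
    qed
    also have "\<dots> \<le> ennreal (csh CARD('n) a * ?U) * (\<Sum>i. ennreal (?q ^ i) * ?d i) + ennreal ((8 * real CARD('n) * ?U * ?H) * (?q ^ 2) ^ N)"
      by (intro add_right_mono mult_left_mono sum_le_suminf) auto
    finally show ?thesis .
  qed
  then show ?thesis
    by (rule ennreal_le_of_tendsto) (use q in \<open>auto simp: power_less_one_iff abs_square_less_1\<close>)
qed

text \<open>Since |u| / r is at most (t + |u|) / t, growth in \<open>u\<close> is traded for decay:
  the exponent drops from \<open>a\<close> to \<open>a - 2 * dl a\<close>, which the choice of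
  \<open>dl\<close> keeps positive.\<close>

lemma kap_times_powr:
  assumes "0 < t" "t \<le> r" "0 < a"
  shows "kap a t (u::real^'n) * (infnorm u / r) powr (2 * dl a) \<le> kap (a - 2 * dl a) t u"
proof -
  let ?s = "2 * dl a" and ?n = "real CARD('n)"
  have s: "0 < ?s" using dl_bounds(1)[of a] assms by simp
  have u: "0 \<le> infnorm u" by (simp add: infnorm_pos_le)
  have "(infnorm u / r) powr ?s \<le> ((t + infnorm u) / t) powr ?s"
    using assms s u by (intro powr_mono2 frac_le) auto
  then have "kap a t u * (infnorm u / r) powr ?s \<le> kap a t u * ((t + infnorm u) / t) powr ?s"
    by (intro mult_left_mono kap_nonneg)
  also have "\<dots> = (t powr a / t powr ?s) / ((t + infnorm u) powr (?n + a) / (t + infnorm u) powr ?s)"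
    using assms u by (simp add: kap_def powr_divide)
  also have "\<dots> = kap (a - ?s) t u"
    unfolding kap_def powr_diff[symmetric] by (simp add: algebra_simps)
  finally show ?thesis .
qed

definition cosc :: "nat \<Rightarrow> real \<Rightarrow> real" where "cosc n a = csh n a * ckap n (a - 2 * dl a)"

lemma cosc_nonneg: "0 < a \<Longrightarrow> 0 \<le> cosc n a"
  unfolding cosc_def using dl_bounds(3)[of a] by (auto intro!: mult_nonneg_nonneg csh_nonneg less_imp_le[OF ckap_pos])

text \<open>With \<open>z = y + u\<close> and \<open>u\<close> fixed, the integral in
  \<open>y\<close> is the shift estimate. Its growth in \<open>u\<close> is absorbed into
  \<open>kap\<close> with the smaller exponent, whose integral does not depend on
  \<open>t\<close>.\<close>

lemma dexp_oscillation:
  fixes h :: "real^'n \<Rightarrow> real"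
  assumes h: "sqi h" and a: "0 < a" and t: "0 < t" "t \<le> 2 powr real_of_int k"
  shows "(\<integral>\<^sup>+y. \<integral>\<^sup>+z. ennreal (kap a t (y - z)) * ennreal ((dexp k h z - dexp k h y)\<^sup>2) \<partial>lborel \<partial>lborel)
     \<le> ennreal (cosc CARD('n) a) * (\<Sum>i. ennreal (qq a ^ i) * (\<integral>\<^sup>+y. ennreal ((dd (k + int i) h y)\<^sup>2) \<partial>lborel))"
    (is "?X \<le> _ * ?S")
proof -
  have hm[measurable]: "h \<in> borel_measurable borel" using h by (simp add: sqi_def)
  let ?U = "\<lambda>u::real^'n. (infnorm u / 2 powr real_of_int k) powr (2 * dl a)"
  have "?X = (\<integral>\<^sup>+y. \<integral>\<^sup>+u. ennreal (kap a t u) * ennreal ((dexp k h (y + u) - dexp k h y)\<^sup>2) \<partial>lborel \<partial>lborel)"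
  proof (rule nn_integral_cong)
    fix y
    have "(\<integral>\<^sup>+z. ennreal (kap a t (y - z)) * ennreal ((dexp k h z - dexp k h y)\<^sup>2) \<partial>lborel)
      = (\<integral>\<^sup>+u. ennreal (kap a t (y - (y + u))) * ennreal ((dexp k h (y + u) - dexp k h y)\<^sup>2) \<partial>lborel)"
      by (rule nn_integral_lborel_shift[symmetric]) measurable
    then show "(\<integral>\<^sup>+z. ennreal (kap a t (y - z)) * ennreal ((dexp k h z - dexp k h y)\<^sup>2) \<partial>lborel)
      = (\<integral>\<^sup>+u. ennreal (kap a t u) * ennreal ((dexp k h (y + u) - dexp k h y)\<^sup>2) \<partial>lborel)"
      by (simp add: kap_minus)
  qed
  also have "\<dots> = (\<integral>\<^sup>+u. \<integral>\<^sup>+y. ennreal (kap a t u) * ennreal ((dexp k h (y + u) - dexp k h y)\<^sup>2) \<partial>lborel \<partial>lborel)"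
    by (rule lborel_pair.Fubini') measurable
  also have "\<dots> = (\<integral>\<^sup>+u. ennreal (kap a t u) * (\<integral>\<^sup>+y. ennreal ((dexp k h (y + u) - dexp k h y)\<^sup>2) \<partial>lborel) \<partial>lborel)"
    by (intro nn_integral_cong nn_integral_cmult) measurable
  also have "\<dots> \<le> (\<integral>\<^sup>+u. ennreal (kap a t u) * (ennreal (csh CARD('n) a * ?U u) * ?S) \<partial>lborel)"
    by (intro nn_integral_mono mult_left_mono shift_dexp_bound h a) auto
  also have "\<dots> \<le> (\<integral>\<^sup>+u. ennreal (kap (a - 2 * dl a) t (u::real^'n)) * (ennreal (csh CARD('n) a) * ?S) \<partial>lborel)"
  proof (intro nn_integral_mono)
    fix u :: "real^'n"
    have "ennreal (kap a t u) * (ennreal (csh CARD('n) a * ?U u) * ?S) = ennreal (kap a t u * ?U u) * (ennreal (csh CARD('n) a) * ?S)"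
      using csh_nonneg[OF a] by (simp add: ennreal_mult kap_nonneg mult_ac)
    also have "\<dots> \<le> ennreal (kap (a - 2 * dl a) t u) * (ennreal (csh CARD('n) a) * ?S)"
      by (intro mult_right_mono ennreal_leI kap_times_powr t a) auto
    finally show "ennreal (kap a t u) * (ennreal (csh CARD('n) a * ?U u) * ?S) \<le> ennreal (kap (a - 2 * dl a) t u) * (ennreal (csh CARD('n) a) * ?S)" .
  qed
  also have "\<dots> = (\<integral>\<^sup>+u. ennreal (kap (a - 2 * dl a) t (u::real^'n)) \<partial>lborel) * (ennreal (csh CARD('n) a) * ?S)"
    by (rule nn_integral_multc) measurable
  also have "\<dots> \<le> ennreal (ckap CARD('n) (a - 2 * dl a)) * (ennreal (csh CARD('n) a) * ?S)"
    using dl_bounds(3)[of a] a t by (intro mult_right_mono nn_integral_kap) auto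
  also have "\<dots> = ennreal (cosc CARD('n) a) * ?S"
    unfolding cosc_def using csh_nonneg[OF a, of "CARD('n)"] ckap_pos[of "a - 2 * dl a" "CARD('n)"] dl_bounds(3)[of a] a
    by (simp add: ennreal_mult less_imp_le mult_ac)
  finally show ?thesis .
qed

lemma nn_integral_kap_shift:
  assumes "0 < t" "0 < a"
  shows "(\<integral>\<^sup>+y. ennreal (kap a t (y - (z::real^'n))) \<partial>lborel) \<le> ennreal (ckap CARD('n) a)"
    "(\<integral>\<^sup>+y. ennreal (kap a t ((z::real^'n) - y)) \<partial>lborel) \<le> ennreal (ckap CARD('n) a)"
proof -
  have "(\<integral>\<^sup>+y. ennreal (kap a t (y - z)) \<partial>lborel) = (\<integral>\<^sup>+y. ennreal (kap a t (- z + y)) \<partial>lborel)"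
    by (simp add: algebra_simps)
  also have "\<dots> = (\<integral>\<^sup>+y. ennreal (kap a t (y::real^'n)) \<partial>lborel)"
    by (rule nn_integral_lborel_shift) measurable
  also have "\<dots> \<le> ennreal (ckap CARD('n) a)" using assms by (rule nn_integral_kap)
  finally show 1: "(\<integral>\<^sup>+y. ennreal (kap a t (y - z)) \<partial>lborel) \<le> ennreal (ckap CARD('n) a)" .
  then show "(\<integral>\<^sup>+y. ennreal (kap a t (z - y)) \<partial>lborel) \<le> ennreal (ckap CARD('n) a)"
    using kap_minus[of a t "_ - z"] by simp
qed

text \<open>3 = 1 + 2: the triangle inequality gives
  \<open>t + infnorm (y - z) \<le> t + infnorm (y - z') + 2 * t\<close>.\<close>

lemma kap_compare:
  assumes t: "0 < t" and a: "0 < a" and d: "infnorm (z - z') < 2 * t"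
  shows "kap a t (y - z') \<le> 3 powr (real CARD('n) + a) * kap a t (y - (z::real^'n))"
proof -
  have "infnorm (y - z) \<le> infnorm (y - z') + infnorm (z' - z)"
    using infnorm_triangle[of "y - z'" "z' - z"] by simp
  moreover have "infnorm (z' - z) = infnorm (z - z')" by (rule infnorm_sub)
  ultimately have le: "t + infnorm (y - z) \<le> 3 * (t + infnorm (y - z'))"
    using d t infnorm_pos_le[of "y - z'"] unfolding distrib_left by simp
  have p: "0 < t + infnorm (y - z')" "0 < t + infnorm (y - z)" using t infnorm_pos_le[of "y - z'"] infnorm_pos_le[of "y - z"] by linarith+
  have "(t + infnorm (y - z)) powr (real CARD('n) + a) \<le> 3 powr (real CARD('n) + a) * (t + infnorm (y - z')) powr (real CARD('n) + a)"
    using le p a by (subst powr_mult[symmetric]) (auto intro!: powr_mono2)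
  then have "1 / (t + infnorm (y - z')) powr (real CARD('n) + a) \<le> 3 powr (real CARD('n) + a) / (t + infnorm (y - z)) powr (real CARD('n) + a)"
    using p by (simp add: field_simps)
  from mult_left_mono[OF this, of "t powr a"] show ?thesis
    unfolding kap_def by (simp add: mult_ac)
qed

section \<open>A Schur test for operator-valued kernels\<close>

text \<open>Cauchy-Schwarz in \<open>z\<close> with \<open>kap a t (y - z)\<close> itself as weight:
  its integral produces \<open>ckap\<close>, and the squared operator norm divided by the weight
  leaves a single factor \<open>kap\<close>. The function \<open>g\<close> may depend on
  \<open>y\<close>, because it will be a difference between a value at \<open>z\<close> and an
  average at \<open>y\<close>; this is why \<open>kap\<close> is not yet integrated on the
  right.\<close>

lemma schur_bound:
  fixes Kk :: "(real^'n) \<times> (real^'n) \<times> 'v \<times> 'w \<Rightarrow> real"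
  assumes sM: "sigma_finite_measure M" and sN: "sigma_finite_measure N"
    and K[measurable]: "Kk \<in> borel_measurable (lborel \<Otimes>\<^sub>M lborel \<Otimes>\<^sub>M N \<Otimes>\<^sub>M M)"
    and g[measurable]: "g \<in> borel_measurable (lborel \<Otimes>\<^sub>M lborel \<Otimes>\<^sub>M M)"
    and a: "0 < a" and t: "0 < t"
    and op: "\<And>y z h. h \<in> borel_measurable M \<Longrightarrow> (\<integral>\<^sup>+v. ennreal ((\<integral>w. Kk (y, z, v, w) * h w \<partial>M)\<^sup>2) \<partial>N)
        \<le> ennreal ((B * kap a t (y - z))\<^sup>2) * (\<integral>\<^sup>+w. ennreal ((h w)\<^sup>2) \<partial>M)"
  shows "(\<integral>\<^sup>+y. \<integral>\<^sup>+v. ennreal ((\<integral>p. Kk (y, fst p, v, snd p) * g (y, fst p, snd p) \<partial>(lborel \<Otimes>\<^sub>M M))\<^sup>2) \<partial>N \<partial>lborel)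
     \<le> ennreal (ckap CARD('n) a * B\<^sup>2) * (\<integral>\<^sup>+y. \<integral>\<^sup>+z. ennreal (kap a t (y - z)) * (\<integral>\<^sup>+w. ennreal ((g (y, z, w))\<^sup>2) \<partial>M) \<partial>lborel \<partial>lborel)"
proof -
  interpret M: sigma_finite_measure M by fact
  interpret N: sigma_finite_measure N by fact
  interpret LM: pair_sigma_finite lborel M ..
  interpret LN: pair_sigma_finite lborel N ..
  interpret NL: pair_sigma_finite N lborel ..
  have c0: "0 \<le> ckap CARD('n) a" using ckap_pos[OF a] less_imp_le by blast
  let ?S = "\<lambda>y v z. \<integral>w. Kk (y, z, v, w) * g (y, z, w) \<partial>M"
  have "(\<integral>\<^sup>+v. ennreal ((\<integral>p. Kk (y, fst p, v, snd p) * g (y, fst p, snd p) \<partial>(lborel \<Otimes>\<^sub>M M))\<^sup>2) \<partial>N)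
    \<le> ennreal (ckap CARD('n) a * B\<^sup>2) * (\<integral>\<^sup>+z. ennreal (kap a t (y - z)) * (\<integral>\<^sup>+w. ennreal ((g (y, z, w))\<^sup>2) \<partial>M) \<partial>lborel)" for y :: "real^'n"
  proof -
    have "(\<integral>\<^sup>+v. ennreal ((\<integral>p. Kk (y, fst p, v, snd p) * g (y, fst p, snd p) \<partial>(lborel \<Otimes>\<^sub>M M))\<^sup>2) \<partial>N)
       \<le> (\<integral>\<^sup>+v. ennreal (ckap CARD('n) a) * (\<integral>\<^sup>+z. ennreal ((?S y v z)\<^sup>2 / kap a t (y - z)) \<partial>lborel) \<partial>N)"
    proof (intro nn_integral_mono)
      fix v assume v[measurable]: "v \<in> space N"
      let ?f = "\<lambda>p. Kk (y, fst p, v, snd p) * g (y, fst p, snd p)"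
      \<comment> \<open>If the product is not integrable, its Bochner integral is 0 and the
        inequality is trivial; otherwise Fubini gives equality.\<close>
      have "ennreal ((\<integral>p. ?f p \<partial>(lborel \<Otimes>\<^sub>M M))\<^sup>2) \<le> ennreal ((\<integral>z. ?S y v z \<partial>lborel)\<^sup>2)"
      proof (cases "integrable (lborel \<Otimes>\<^sub>M M) ?f")
        case True
        then show ?thesis by (subst LM.integral_fst'[OF True, symmetric]) simp
      next
        case False
        then show ?thesis by (simp add: not_integrable_integral_eq)
      qed
      also have "\<dots> \<le> (\<integral>\<^sup>+z. ennreal (kap a t (y - z)) \<partial>lborel) * (\<integral>\<^sup>+z. ennreal ((?S y v z)\<^sup>2 / kap a t (y - z)) \<partial>lborel)"
        using t by (intro nn_integral_abs_sq_bound) (auto simp: kap_pos)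
      also have "\<dots> \<le> ennreal (ckap CARD('n) a) * (\<integral>\<^sup>+z. ennreal ((?S y v z)\<^sup>2 / kap a t (y - z)) \<partial>lborel)"
        by (intro mult_right_mono nn_integral_kap_shift t a) auto
      finally show "ennreal ((\<integral>p. ?f p \<partial>(lborel \<Otimes>\<^sub>M M))\<^sup>2) \<le> \<dots>" .
    qed
    also have "\<dots> = ennreal (ckap CARD('n) a) * (\<integral>\<^sup>+v. \<integral>\<^sup>+z. ennreal ((?S y v z)\<^sup>2 / kap a t (y - z)) \<partial>lborel \<partial>N)"
      by (rule nn_integral_cmult) measurable
    also have "(\<integral>\<^sup>+v. \<integral>\<^sup>+z. ennreal ((?S y v z)\<^sup>2 / kap a t (y - z)) \<partial>lborel \<partial>N) = (\<integral>\<^sup>+z. \<integral>\<^sup>+v. ennreal ((?S y v z)\<^sup>2 / kap a t (y - z)) \<partial>N \<partial>lborel)"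
      by (rule NL.Fubini'[symmetric]) measurable
    also have "\<dots> = (\<integral>\<^sup>+z. ennreal (1 / kap a t (y - z)) * (\<integral>\<^sup>+v. ennreal ((?S y v z)\<^sup>2) \<partial>N) \<partial>lborel)"
    proof (rule nn_integral_cong)
      fix z :: "real^'n"
      have "(\<integral>\<^sup>+v. ennreal ((?S y v z)\<^sup>2 / kap a t (y - z)) \<partial>N) = (\<integral>\<^sup>+v. ennreal (1 / kap a t (y - z)) * ennreal ((?S y v z)\<^sup>2) \<partial>N)"
        by (intro nn_integral_cong) (simp add: ennreal_mult[symmetric] kap_nonneg)
      then show "(\<integral>\<^sup>+v. ennreal ((?S y v z)\<^sup>2 / kap a t (y - z)) \<partial>N) = ennreal (1 / kap a t (y - z)) * (\<integral>\<^sup>+v. ennreal ((?S y v z)\<^sup>2) \<partial>N)"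
        by (simp add: nn_integral_cmult)
    qed
    also have "\<dots> \<le> (\<integral>\<^sup>+z. ennreal (1 / kap a t (y - z)) * (ennreal ((B * kap a t (y - z))\<^sup>2) * (\<integral>\<^sup>+w. ennreal ((g (y, z, w))\<^sup>2) \<partial>M)) \<partial>lborel)"
      by (intro nn_integral_mono mult_left_mono op) auto
    also have "\<dots> = (\<integral>\<^sup>+z. ennreal (B\<^sup>2) * (ennreal (kap a t (y - z)) * (\<integral>\<^sup>+w. ennreal ((g (y, z, w))\<^sup>2) \<partial>M)) \<partial>lborel)"
    proof (intro nn_integral_cong)
      fix z :: "real^'n"
      have k: "0 < kap a t (y - z)" using t by (rule kap_pos)
      have "ennreal (1 / kap a t (y - z)) * ennreal ((B * kap a t (y - z))\<^sup>2) = ennreal (B\<^sup>2) * ennreal (kap a t (y - z))"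
      proof -
        have "1 / kap a t (y - z) * (B * kap a t (y - z))\<^sup>2 = B\<^sup>2 * kap a t (y - z)"
          using k by (simp add: power2_eq_square)
        then show ?thesis using k ennreal_mult[of "1 / kap a t (y - z)" "(B * kap a t (y - z))\<^sup>2"] ennreal_mult[of "B\<^sup>2" "kap a t (y - z)"]
          by simp
      qed
      then show "ennreal (1 / kap a t (y - z)) * (ennreal ((B * kap a t (y - z))\<^sup>2) * (\<integral>\<^sup>+w. ennreal ((g (y, z, w))\<^sup>2) \<partial>M)) = ennreal (B\<^sup>2) * (ennreal (kap a t (y - z)) * (\<integral>\<^sup>+w. ennreal ((g (y, z, w))\<^sup>2) \<partial>M))"
        by (simp add: mult.assoc[symmetric])
    qed
    also have "\<dots> = ennreal (B\<^sup>2) * (\<integral>\<^sup>+z. ennreal (kap a t (y - z)) * (\<integral>\<^sup>+w. ennreal ((g (y, z, w))\<^sup>2) \<partial>M) \<partial>lborel)"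
      by (rule nn_integral_cmult) measurable
    finally show ?thesis using c0 by (simp add: ennreal_mult mult.assoc mult_left_mono)
  qed
  then have "(\<integral>\<^sup>+y. \<integral>\<^sup>+v. ennreal ((\<integral>p. Kk (y, fst p, v, snd p) * g (y, fst p, snd p) \<partial>(lborel \<Otimes>\<^sub>M M))\<^sup>2) \<partial>N \<partial>lborel)
     \<le> (\<integral>\<^sup>+y. ennreal (ckap CARD('n) a * B\<^sup>2) * (\<integral>\<^sup>+z. ennreal (kap a t (y - z)) * (\<integral>\<^sup>+w. ennreal ((g (y, z, w))\<^sup>2) \<partial>M) \<partial>lborel) \<partial>lborel)"
    by (intro nn_integral_mono)
  also have "\<dots> = ennreal (ckap CARD('n) a * B\<^sup>2) * (\<integral>\<^sup>+y. \<integral>\<^sup>+z. ennreal (kap a t (y - z)) * (\<integral>\<^sup>+w. ennreal ((g (y, z, w))\<^sup>2) \<partial>M) \<partial>lborel \<partial>lborel)"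
    by (rule nn_integral_cmult) measurable
  finally show ?thesis .
qed

text \<open>When \<open>g\<close> does not depend on \<open>y\<close>, the remaining factor
  \<open>kap\<close> can be integrated in \<open>y\<close>, and this gives the second
  \<open>ckap\<close>.\<close>

lemma schur_bound_simple:
  fixes Kk :: "(real^'n) \<times> (real^'n) \<times> 'v \<times> 'w \<Rightarrow> real"
  assumes sM: "sigma_finite_measure M" and sN: "sigma_finite_measure N"
    and K[measurable]: "Kk \<in> borel_measurable (lborel \<Otimes>\<^sub>M lborel \<Otimes>\<^sub>M N \<Otimes>\<^sub>M M)"
    and g[measurable]: "g \<in> borel_measurable (lborel \<Otimes>\<^sub>M M)"
    and a: "0 < a" and t: "0 < t"
    and op: "\<And>y z h. h \<in> borel_measurable M \<Longrightarrow> (\<integral>\<^sup>+v. ennreal ((\<integral>w. Kk (y, z, v, w) * h w \<partial>M)\<^sup>2) \<partial>N)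
        \<le> ennreal ((B * kap a t (y - z))\<^sup>2) * (\<integral>\<^sup>+w. ennreal ((h w)\<^sup>2) \<partial>M)"
  shows "(\<integral>\<^sup>+y. \<integral>\<^sup>+v. ennreal ((\<integral>p. Kk (y, fst p, v, snd p) * g p \<partial>(lborel \<Otimes>\<^sub>M M))\<^sup>2) \<partial>N \<partial>lborel)
     \<le> ennreal ((ckap CARD('n) a * B)\<^sup>2) * (\<integral>\<^sup>+w. \<integral>\<^sup>+z. ennreal ((g (z, w))\<^sup>2) \<partial>lborel \<partial>M)"
proof -
  interpret M: sigma_finite_measure M by fact
  interpret LM: pair_sigma_finite lborel M ..
  have c0: "0 \<le> ckap CARD('n) a" using ckap_pos[OF a] less_imp_le by blast
  have "(\<integral>\<^sup>+y. \<integral>\<^sup>+v. ennreal ((\<integral>p. Kk (y, fst p, v, snd p) * g p \<partial>(lborel \<Otimes>\<^sub>M M))\<^sup>2) \<partial>N \<partial>lborel)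
    = (\<integral>\<^sup>+y. \<integral>\<^sup>+v. ennreal ((\<integral>p. Kk (y, fst p, v, snd p) * (\<lambda>q. g (snd q)) (y, fst p, snd p) \<partial>(lborel \<Otimes>\<^sub>M M))\<^sup>2) \<partial>N \<partial>lborel)"
    by simp
  also have "\<dots> \<le> ennreal (ckap CARD('n) a * B\<^sup>2) * (\<integral>\<^sup>+y. \<integral>\<^sup>+z. ennreal (kap a t (y - z)) * (\<integral>\<^sup>+w. ennreal (((\<lambda>q. g (snd q)) (y, z, w))\<^sup>2) \<partial>M) \<partial>lborel \<partial>lborel)"
    by (rule schur_bound[OF sM sN K _ a t op]) auto
  also have "(\<integral>\<^sup>+y. \<integral>\<^sup>+z. ennreal (kap a t (y - z)) * (\<integral>\<^sup>+w. ennreal (((\<lambda>q. g (snd q)) (y, z, w))\<^sup>2) \<partial>M) \<partial>lborel \<partial>lborel)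
     = (\<integral>\<^sup>+z. \<integral>\<^sup>+y. ennreal (kap a t (y - z)) * (\<integral>\<^sup>+w. ennreal ((g (z, w))\<^sup>2) \<partial>M) \<partial>lborel \<partial>lborel)"
    by (subst lborel_pair.Fubini') (simp_all, measurable)
  also have "\<dots> = (\<integral>\<^sup>+z. (\<integral>\<^sup>+y. ennreal (kap a t (y - z)) \<partial>lborel) * (\<integral>\<^sup>+w. ennreal ((g (z, w))\<^sup>2) \<partial>M) \<partial>lborel)"
    by (intro nn_integral_cong nn_integral_multc) measurable
  also have "\<dots> \<le> (\<integral>\<^sup>+z. ennreal (ckap CARD('n) a) * (\<integral>\<^sup>+w. ennreal ((g (z, w))\<^sup>2) \<partial>M) \<partial>lborel)"
    by (intro nn_integral_mono mult_right_mono nn_integral_kap_shift t a) auto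
  also have "\<dots> = ennreal (ckap CARD('n) a) * (\<integral>\<^sup>+z. \<integral>\<^sup>+w. ennreal ((g (z, w))\<^sup>2) \<partial>M \<partial>lborel)"
    by (rule nn_integral_cmult) measurable
  also have "(\<integral>\<^sup>+z. \<integral>\<^sup>+w. ennreal ((g (z, w))\<^sup>2) \<partial>M \<partial>lborel) = (\<integral>\<^sup>+w. \<integral>\<^sup>+z. ennreal ((g (z, w))\<^sup>2) \<partial>lborel \<partial>M)"
    by (rule LM.Fubini'[symmetric]) measurable
  also have "ennreal (ckap CARD('n) a * B\<^sup>2) * (ennreal (ckap CARD('n) a) * (\<integral>\<^sup>+w. \<integral>\<^sup>+z. ennreal ((g (z, w))\<^sup>2) \<partial>lborel \<partial>M))
    = ennreal ((ckap CARD('n) a * B)\<^sup>2) * (\<integral>\<^sup>+w. \<integral>\<^sup>+z. ennreal ((g (z, w))\<^sup>2) \<partial>lborel \<partial>M)"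
  proof -
    have "ennreal (ckap CARD('n) a * B\<^sup>2) * ennreal (ckap CARD('n) a) = ennreal ((ckap CARD('n) a * B)\<^sup>2)"
    proof -
      have "(ckap CARD('n) a * B)\<^sup>2 = ckap CARD('n) a * B\<^sup>2 * ckap CARD('n) a" by (simp add: power2_eq_square mult_ac)
      then show ?thesis using c0 by (simp add: ennreal_mult)
    qed
    then show ?thesis unfolding mult.assoc[symmetric] by simp
  qed
  finally show ?thesis by (simp add: mult_left_mono)
qed

text \<open>Price of extending the Hoelder estimate from distances below \<open>t / 2\<close> to
  distances below \<open>2 * t\<close>: the 2 and the power of 3 come from the triangle inequality
  and \<open>kap_compare\<close>, \<open>2 powr a\<close> from \<open>r \<ge> t / 2\<close>.\<close>

definition chol :: "nat \<Rightarrow> real \<Rightarrow> real" where "chol n a = 2 * 2 powr a * 3 powr (real n + a)"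

lemma chol_ge: "0 < a \<Longrightarrow> 1 \<le> chol n a"
proof -
  assume a: "0 < a"
  have "1 \<le> 2 powr a" "1 \<le> 3 powr (real n + a)" using a by (auto intro!: ge_one_powr_ge_zero)
  then have "1 * 1 \<le> 2 powr a * 3 powr (real n + a)" by (intro mult_mono) auto
  then show ?thesis unfolding chol_def by simp
qed

text \<open>
  \<open>Kk (y, z, v, w)\<close> is the kernel of an operator \<open>L\<^sup>2(M) \<rightarrow> L\<^sup>2(N)\<close> attached to the pair \<open>(y, z)\<close>. The bound
  \<open>dom\<close> only serves to make the integrals converge; all estimates come from \<open>op_size\<close> and its Hoelder analogue.
\<close>

locale op_kernel =
  fixes M :: "'w measure" and N :: "'v measure"
    and Kk :: "(real^'n) \<times> (real^'n) \<times> 'v \<times> 'w \<Rightarrow> real"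
    and b :: "'v \<Rightarrow> 'w \<Rightarrow> real" and A a t :: real and k :: int
  assumes sM: "sigma_finite_measure M" and sN: "sigma_finite_measure N"
    and K_meas[measurable]: "Kk \<in> borel_measurable (lborel \<Otimes>\<^sub>M lborel \<Otimes>\<^sub>M N \<Otimes>\<^sub>M M)"
    and A: "0 < A" and a: "0 < a"
    and t_lower: "2 powr (real_of_int k - 1) < t" and t_upper: "t \<le> 2 powr real_of_int k"
    and dom: "\<And>y z v w. \<bar>Kk (y, z, v, w)\<bar> \<le> kap a t (y - z) * b v w"
    and b_meas[measurable]: "\<And>v. b v \<in> borel_measurable M"
    and b_fin: "\<And>v. (\<integral>\<^sup>+w. ennreal ((b v w)\<^sup>2) \<partial>M) < \<infinity>"
    and op_size: "\<And>y z h. h \<in> borel_measurable M \<Longrightarrow>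
        (\<integral>\<^sup>+w. ennreal ((h w)\<^sup>2) \<partial>M) < \<infinity> \<Longrightarrow>
        (\<integral>\<^sup>+v. ennreal ((\<integral>w. Kk (y, z, v, w) * h w \<partial>M)\<^sup>2) \<partial>N)
        \<le> ennreal ((A * kap a t (y - z))\<^sup>2) * (\<integral>\<^sup>+w. ennreal ((h w)\<^sup>2) \<partial>M)"
    and op_holder: "\<And>y z z' h. h \<in> borel_measurable M \<Longrightarrow>
        (\<integral>\<^sup>+w. ennreal ((h w)\<^sup>2) \<partial>M) < \<infinity> \<Longrightarrow> infnorm (z - z') < t / 2 \<Longrightarrow> z \<noteq> z' \<Longrightarrow>
        (\<integral>\<^sup>+v. ennreal ((\<integral>w. (Kk (y, z, v, w) - Kk (y, z', v, w)) * h w \<partial>M)\<^sup>2) \<partial>N)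
        \<le> ennreal ((A * ((infnorm (z - z') / t) powr a * kap a t (y - z)))\<^sup>2) * (\<integral>\<^sup>+w. ennreal ((h w)\<^sup>2) \<partial>M)"
begin

lemma t: "0 < t"
  using t_lower powr_gt_zero[of 2 "real_of_int k - 1"] by linarith

lemma b_nonneg: "0 \<le> b v w"
proof -
  have "0 \<le> kap a t (0 - 0 :: real^'n) * b v w" using dom[of 0 0 v w] abs_ge_zero order_trans by blast
  then show ?thesis using kap_pos[OF t, of a "0 - 0 :: real^'n"] by (simp add: zero_le_mult_iff)
qed

sublocale M: sigma_finite_measure M by (rule sM)
sublocale N: sigma_finite_measure N by (rule sN)
sublocale LM: pair_sigma_finite lborel M ..

lemma nn_top_mult: "0 < c \<Longrightarrow> X \<le> ennreal c * \<infinity>"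
  by (simp add: ennreal_mult_eq_top_iff)

text \<open>The Schur test asks for the estimate for every measurable \<open>h\<close>. If
  \<open>h\<close> is not square integrable the right-hand side is infinite, because its coefficient
  is positive.\<close>

lemma op_size':
  assumes "h \<in> borel_measurable M"
  shows "(\<integral>\<^sup>+v. ennreal ((\<integral>w. Kk (y, z, v, w) * h w \<partial>M)\<^sup>2) \<partial>N)
        \<le> ennreal ((A * kap a t (y - z))\<^sup>2) * (\<integral>\<^sup>+w. ennreal ((h w)\<^sup>2) \<partial>M)"
proof (cases "(\<integral>\<^sup>+w. ennreal ((h w)\<^sup>2) \<partial>M) < \<infinity>")
  case True
  then show ?thesis using op_size assms by blast
next
  case False
  then have "(\<integral>\<^sup>+w. ennreal ((h w)\<^sup>2) \<partial>M) = \<infinity>" by (simp add: not_less top_unique)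
  then show ?thesis using A kap_pos[OF t, of a "y - z"] nn_top_mult[of "(A * kap a t (y - z))\<^sup>2"] by simp
qed

lemma bh_integrable:
  assumes [measurable]: "h \<in> borel_measurable M" and fin: "(\<integral>\<^sup>+w. ennreal ((h w)\<^sup>2) \<partial>M) < \<infinity>"
  shows "integrable M (\<lambda>w. b v w * h w)"
proof (rule integrableI_bounded)
  have "(\<integral>\<^sup>+w. ennreal (norm (b v w * h w)) \<partial>M) \<le> (\<integral>\<^sup>+w. ennreal ((b v w)\<^sup>2) + ennreal ((h w)\<^sup>2) \<partial>M)"
  proof (intro nn_integral_mono)
    fix w
    have "norm (b v w * h w) \<le> (b v w)\<^sup>2 + (h w)\<^sup>2"
      using sum_squares_bound[of "\<bar>b v w\<bar>" "\<bar>h w\<bar>"] mult_nonneg_nonneg[of "\<bar>b v w\<bar>" "\<bar>h w\<bar>"]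
      unfolding real_norm_def abs_mult power2_abs by linarith
    then show "ennreal (norm (b v w * h w)) \<le> ennreal ((b v w)\<^sup>2) + ennreal ((h w)\<^sup>2)"
      by (simp add: ennreal_plus[symmetric] del: ennreal_plus)
  qed
  also have "\<dots> < \<infinity>" using fin b_fin[of v] by (subst nn_integral_add) auto
  finally show "(\<integral>\<^sup>+w. ennreal (norm (b v w * h w)) \<partial>M) < \<infinity>" .
qed measurable

lemma Kh_integrable:
  assumes [measurable]: "h \<in> borel_measurable M" and fin: "(\<integral>\<^sup>+w. ennreal ((h w)\<^sup>2) \<partial>M) < \<infinity>" and [measurable]: "v \<in> space N"
  shows "integrable M (\<lambda>w. Kk (y, z, v, w) * h w)"
proof (rule Bochner_Integration.integrable_bound)
  show "integrable M (\<lambda>w. kap a t (y - z) * (b v w * h w))" using bh_integrable[OF assms(1,2)] by simp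
  show "AE w in M. norm (Kk (y, z, v, w) * h w) \<le> norm (kap a t (y - z) * (b v w * h w))"
    using dom[of y z v] b_nonneg by (intro AE_I2) (auto simp: abs_mult kap_nonneg mult.assoc[symmetric] intro!: mult_right_mono)
qed measurable

text \<open>A point will be compared with the corner of its cube of side at most 2^k, which is below
  \<open>2 * t\<close> but may exceed the range \<open>t / 2\<close> of \<open>op_holder\<close>.
  Beyond that range \<open>(r / t) powr a\<close> is bounded below, so there is no decay to prove
  and the size estimate at both points suffices.\<close>

lemma op_holder':
  assumes h[measurable]: "h \<in> borel_measurable M" and d: "infnorm (z - z') \<le> r" "r < 2 * t" "0 < r"
  shows "(\<integral>\<^sup>+v. ennreal ((\<integral>w. (Kk (y, z, v, w) - Kk (y, z', v, w)) * h w \<partial>M)\<^sup>2) \<partial>N)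
        \<le> ennreal ((A * chol CARD('n) a * (r / t) powr a * kap a t (y - z))\<^sup>2) * (\<integral>\<^sup>+w. ennreal ((h w)\<^sup>2) \<partial>M)"
    (is "?L \<le> ennreal (?c\<^sup>2) * ?H")
proof -
  have k: "0 < kap a t (y - z)" using t by (rule kap_pos)
  have c1: "1 \<le> chol CARD('n) a" using a by (rule chol_ge)
  have c: "0 < ?c" using A k c1 t d by (intro mult_pos_pos) auto
  show ?thesis
  proof (cases "?H < \<infinity>")
    case False
    then have "?H = \<infinity>" by (simp add: not_less top_unique)
    moreover have "ennreal (?c\<^sup>2) * \<infinity> = \<infinity>" using zero_less_power[OF c, of 2] by (simp add: ennreal_mult_eq_top_iff)
    ultimately show ?thesis by simp
  next
    case fin: True
    show ?thesis
    proof (cases "r < t / 2")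
      case True
      show ?thesis
      proof (cases "z = z'")
        case False
        have "?L \<le> ennreal ((A * ((infnorm (z - z') / t) powr a * kap a t (y - z)))\<^sup>2) * ?H"
          using True d fin False by (intro op_holder) auto
        also have "\<dots> \<le> ennreal (?c\<^sup>2) * ?H"
        proof (intro mult_right_mono ennreal_leI power_mono)
          have "(infnorm (z - z') / t) powr a \<le> (r / t) powr a"
            using d t a by (intro powr_mono2 divide_right_mono) (auto simp: infnorm_pos_le)
          then have "A * ((infnorm (z - z') / t) powr a * kap a t (y - z)) \<le> A * ((r / t) powr a * kap a t (y - z))"
            using A k by (intro mult_left_mono mult_right_mono) auto
          also have "\<dots> \<le> chol CARD('n) a * (A * ((r / t) powr a * kap a t (y - z)))"
            using A k c1 mult_right_mono[of 1 "chol CARD('n) a" "A * ((r / t) powr a * kap a t (y - z))"] by simp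
          finally show "A * ((infnorm (z - z') / t) powr a * kap a t (y - z)) \<le> ?c" by (simp add: mult_ac)
        qed (use A k in auto)
        finally show ?thesis .
      qed simp
    next
      case False
      let ?k = "kap a t (y - z)" and ?k' = "kap a t (y - z')"
      let ?s = "3 powr (real CARD('n) + a)"
      have k': "?k' \<le> ?s * ?k" using d by (intro kap_compare t a) auto
      have s1: "1 \<le> ?s" using a by (intro ge_one_powr_ge_zero) auto
      have "?L = (\<integral>\<^sup>+v. ennreal (((\<integral>w. Kk (y, z, v, w) * h w \<partial>M) - (\<integral>w. Kk (y, z', v, w) * h w \<partial>M))\<^sup>2) \<partial>N)"
      proof (intro nn_integral_cong)
        fix v assume "v \<in> space N"
        note i = Kh_integrable[OF h fin this]
        show "ennreal ((\<integral>w. (Kk (y, z, v, w) - Kk (y, z', v, w)) * h w \<partial>M)\<^sup>2) = ennreal (((\<integral>w. Kk (y, z, v, w) * h w \<partial>M) - (\<integral>w. Kk (y, z', v, w) * h w \<partial>M))\<^sup>2)"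
          by (simp add: left_diff_distrib Bochner_Integration.integral_diff[OF i i])
      qed
      also have "\<dots> \<le> (\<integral>\<^sup>+v. 2 * ennreal ((\<integral>w. Kk (y, z, v, w) * h w \<partial>M)\<^sup>2) + 2 * ennreal ((\<integral>w. Kk (y, z', v, w) * h w \<partial>M)\<^sup>2) \<partial>N)"
      proof (intro nn_integral_mono)
        fix v
        show "ennreal (((\<integral>w. Kk (y, z, v, w) * h w \<partial>M) - (\<integral>w. Kk (y, z', v, w) * h w \<partial>M))\<^sup>2) \<le> 2 * ennreal ((\<integral>w. Kk (y, z, v, w) * h w \<partial>M)\<^sup>2) + 2 * ennreal ((\<integral>w. Kk (y, z', v, w) * h w \<partial>M)\<^sup>2)"
          using ennreal_leI[OF square_diff_le[of "\<integral>w. Kk (y, z, v, w) * h w \<partial>M" "\<integral>w. Kk (y, z', v, w) * h w \<partial>M"]] by (simp add: ennreal_mult)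
      qed
      also have "\<dots> = 2 * (\<integral>\<^sup>+v. ennreal ((\<integral>w. Kk (y, z, v, w) * h w \<partial>M)\<^sup>2) \<partial>N) + 2 * (\<integral>\<^sup>+v. ennreal ((\<integral>w. Kk (y, z', v, w) * h w \<partial>M)\<^sup>2) \<partial>N)"
        by (simp add: nn_integral_add nn_integral_cmult)
      also have "\<dots> \<le> 2 * (ennreal ((A * ?k)\<^sup>2) * ?H) + 2 * (ennreal ((A * ?k')\<^sup>2) * ?H)"
        by (intro add_mono mult_left_mono op_size' h) auto
      also have "\<dots> = ennreal (2 * (A * ?k)\<^sup>2 + 2 * (A * ?k')\<^sup>2) * ?H"
        by (simp add: ennreal_mult distrib_right mult.assoc)
      also have "\<dots> \<le> ennreal (?c\<^sup>2) * ?H"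
      proof (intro mult_right_mono ennreal_leI)
        have "(A * ?k)\<^sup>2 \<le> (A * (?s * ?k))\<^sup>2"
          using A k s1 mult_right_mono[of 1 ?s ?k] by (intro power_mono mult_left_mono) auto
        moreover have "(A * ?k')\<^sup>2 \<le> (A * (?s * ?k))\<^sup>2"
          using A k' by (intro power_mono mult_left_mono) (auto simp: kap_nonneg)
        ultimately have "2 * (A * ?k)\<^sup>2 + 2 * (A * ?k')\<^sup>2 \<le> 4 * (A * (?s * ?k))\<^sup>2" by linarith
        also have "\<dots> = (2 * A * ?s * ?k)\<^sup>2" by (simp add: power2_eq_square)
        also have "\<dots> \<le> ?c\<^sup>2"
        proof (intro power_mono)
          have "(1 / 2) powr a \<le> (r / t) powr a" using False t a by (intro powr_mono2) (auto simp: field_simps)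
          then have "1 \<le> 2 powr a * (r / t) powr a" by (simp add: powr_divide field_simps)
          then have "2 * A * ?s * ?k * 1 \<le> 2 * A * ?s * ?k * (2 powr a * (r / t) powr a)"
            using A k by (intro mult_left_mono) auto
          then show "2 * A * ?s * ?k \<le> ?c" by (simp add: chol_def mult_ac)
        qed (use A k in auto)
        finally show "2 * (A * ?k)\<^sup>2 + 2 * (A * ?k')\<^sup>2 \<le> ?c\<^sup>2" .
      qed auto
      finally show ?thesis .
    qed
  qed
qed

lemma kap_sq_fin: "(\<integral>\<^sup>+z. ennreal ((kap a t (y - z :: real^'n))\<^sup>2) \<partial>lborel) < \<infinity>"
proof -
  have "(\<integral>\<^sup>+z. ennreal ((kap a t (y - z :: real^'n))\<^sup>2) \<partial>lborel) \<le> (\<integral>\<^sup>+z. ennreal (1 / t ^ CARD('n)) * ennreal (kap a t (y - z :: real^'n)) \<partial>lborel)"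
  proof (intro nn_integral_mono)
    fix z :: "real^'n"
    show "ennreal ((kap a t (y - z))\<^sup>2) \<le> ennreal (1 / t ^ CARD('n)) * ennreal (kap a t (y - z))"
      unfolding power2_eq_square using mult_right_mono[OF kap_le[of t a "y - z"] kap_nonneg[of a t "y - z"]] t a
      by (subst ennreal_mult[symmetric]) (auto intro!: ennreal_leI simp: kap_nonneg)
  qed
  also have "\<dots> = ennreal (1 / t ^ CARD('n)) * (\<integral>\<^sup>+z. ennreal (kap a t (y - z :: real^'n)) \<partial>lborel)"
    by (rule nn_integral_cmult) measurable
  also have "\<dots> \<le> ennreal (1 / t ^ CARD('n)) * ennreal (ckap CARD('n) a)"
    by (intro mult_left_mono nn_integral_kap_shift t a) auto
  also have "\<dots> < \<infinity>" by (simp add: ennreal_mult_less_top)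
  finally show ?thesis .
qed

text \<open>The majorant is square integrable in \<open>(z, w)\<close>, so its product with a square
  integrable \<open>g\<close> is integrable. The constant \<open>c\<close> makes room for the kernel
  evaluated at a cube corner, which is only dominated after \<open>kap_compare\<close>.\<close>

lemma Kg_integrable:
  fixes f g :: "(real^'n) \<times> 'w \<Rightarrow> real"
  assumes g[measurable]: "g \<in> borel_measurable (lborel \<Otimes>\<^sub>M M)"
    and fin: "(\<integral>\<^sup>+w. \<integral>\<^sup>+z. ennreal ((g (z, w))\<^sup>2) \<partial>lborel \<partial>M) < \<infinity>"
    and f[measurable]: "f \<in> borel_measurable (lborel \<Otimes>\<^sub>M M)"
    and fb: "\<And>z w. \<bar>f (z, w)\<bar> \<le> c * kap a t (y - z) * b v w"
  shows "integrable (lborel \<Otimes>\<^sub>M M) (\<lambda>p. f p * g p)"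
proof (rule integrableI_bounded)
  have "(\<integral>\<^sup>+p. ennreal (norm (f p * g p)) \<partial>(lborel \<Otimes>\<^sub>M M)) \<le> (\<integral>\<^sup>+p. ennreal ((f p)\<^sup>2) + ennreal ((g p)\<^sup>2) \<partial>(lborel \<Otimes>\<^sub>M M))"
  proof (intro nn_integral_mono)
    fix p
    have "norm (f p * g p) \<le> (f p)\<^sup>2 + (g p)\<^sup>2"
      using sum_squares_bound[of "\<bar>f p\<bar>" "\<bar>g p\<bar>"] mult_nonneg_nonneg[of "\<bar>f p\<bar>" "\<bar>g p\<bar>"]
      unfolding real_norm_def abs_mult power2_abs by linarith
    then show "ennreal (norm (f p * g p)) \<le> ennreal ((f p)\<^sup>2) + ennreal ((g p)\<^sup>2)"
      by (simp add: ennreal_plus[symmetric] del: ennreal_plus)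
  qed
  also have "\<dots> = (\<integral>\<^sup>+p. ennreal ((f p)\<^sup>2) \<partial>(lborel \<Otimes>\<^sub>M M)) + (\<integral>\<^sup>+p. ennreal ((g p)\<^sup>2) \<partial>(lborel \<Otimes>\<^sub>M M))"
    by (rule nn_integral_add) measurable
  also have "\<dots> < \<infinity>"
  proof -
    have "(\<integral>\<^sup>+p. ennreal ((g p)\<^sup>2) \<partial>(lborel \<Otimes>\<^sub>M M)) = (\<integral>\<^sup>+w. \<integral>\<^sup>+z. ennreal ((g (z, w))\<^sup>2) \<partial>lborel \<partial>M)"
      by (rule LM.nn_integral_snd[symmetric]) measurable
    then have 1: "(\<integral>\<^sup>+p. ennreal ((g p)\<^sup>2) \<partial>(lborel \<Otimes>\<^sub>M M)) < \<infinity>" using fin by simp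
    have "(\<integral>\<^sup>+p. ennreal ((f p)\<^sup>2) \<partial>(lborel \<Otimes>\<^sub>M M)) = (\<integral>\<^sup>+w. \<integral>\<^sup>+z. ennreal ((f (z, w))\<^sup>2) \<partial>lborel \<partial>M)"
      by (rule LM.nn_integral_snd[symmetric]) measurable
    also have "\<dots> \<le> (\<integral>\<^sup>+w. \<integral>\<^sup>+z. (ennreal (c\<^sup>2) * ennreal ((b v w)\<^sup>2)) * ennreal ((kap a t (y - z))\<^sup>2) \<partial>lborel \<partial>M)"
    proof (intro nn_integral_mono)
      fix w z
      have "(f (z, w))\<^sup>2 \<le> (c * kap a t (y - z) * b v w)\<^sup>2"
        using power_mono[OF fb[of z w], of 2] by simp
      also have "\<dots> = c\<^sup>2 * (b v w)\<^sup>2 * (kap a t (y - z))\<^sup>2" by (simp add: power_mult_distrib)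
      finally show "ennreal ((f (z, w))\<^sup>2) \<le> (ennreal (c\<^sup>2) * ennreal ((b v w)\<^sup>2)) * ennreal ((kap a t (y - z))\<^sup>2)"
        by (simp add: ennreal_mult[symmetric] ennreal_leI)
    qed
    also have "\<dots> = (ennreal (c\<^sup>2) * (\<integral>\<^sup>+w. ennreal ((b v w)\<^sup>2) \<partial>M)) * (\<integral>\<^sup>+z. ennreal ((kap a t (y - z))\<^sup>2) \<partial>lborel)"
      by (simp add: nn_integral_cmult nn_integral_multc)
    also have "\<dots> < \<infinity>" using b_fin[of v] kap_sq_fin[of y] by (simp add: ennreal_mult_less_top)
    finally show ?thesis using 1 by simp
  qed
  finally show "(\<integral>\<^sup>+p. ennreal (norm (f p * g p)) \<partial>(lborel \<Otimes>\<^sub>M M)) < \<infinity>" .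
qed measurable

text \<open>A function constant in \<open>z\<close> is outside the reach of
  \<open>Kg_integrable\<close>. Here the integrability of \<open>kap\<close> in \<open>z\<close>
  takes the place of square integrability on the product.\<close>

lemma Kconst_integrable:
  assumes h[measurable]: "h \<in> borel_measurable M"
    and fin: "(\<integral>\<^sup>+w. ennreal ((h w)\<^sup>2) \<partial>M) < \<infinity>" and v[measurable]: "v \<in> space N"
  shows "integrable (lborel \<Otimes>\<^sub>M M) (\<lambda>p. Kk (y, fst p, v, snd p) * h (snd p))"
proof (rule integrableI_bounded)
  have "(\<integral>\<^sup>+p. ennreal (norm (Kk (y, fst p, v, snd p) * h (snd p))) \<partial>(lborel \<Otimes>\<^sub>M M))
    = (\<integral>\<^sup>+w. \<integral>\<^sup>+z. ennreal (norm (Kk (y, z, v, w) * h w)) \<partial>lborel \<partial>M)"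
    by (subst LM.nn_integral_snd[symmetric]) (simp_all, measurable)
  also have "\<dots> \<le> (\<integral>\<^sup>+w. \<integral>\<^sup>+z. ennreal (norm (b v w * h w)) * ennreal (kap a t (y - z)) \<partial>lborel \<partial>M)"
  proof (intro nn_integral_mono)
    fix w z
    have "norm (Kk (y, z, v, w) * h w) \<le> norm (b v w * h w) * kap a t (y - z)"
      using mult_right_mono[OF dom[of y z v w], of "\<bar>h w\<bar>"] b_nonneg[of v w] by (simp add: abs_mult mult_ac)
    then show "ennreal (norm (Kk (y, z, v, w) * h w)) \<le> ennreal (norm (b v w * h w)) * ennreal (kap a t (y - z))"
      by (subst ennreal_mult[symmetric]) (auto simp: kap_nonneg ennreal_leI)
  qed
  also have "\<dots> = (\<integral>\<^sup>+w. ennreal (norm (b v w * h w)) \<partial>M) * (\<integral>\<^sup>+z. ennreal (kap a t (y - z)) \<partial>lborel)"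
    by (simp add: nn_integral_cmult nn_integral_multc)
  also have "\<dots> < \<infinity>"
    using bh_integrable[OF h fin, of v] nn_integral_kap_shift(2)[OF t a, of y]
    by (auto simp: integrable_iff_bounded ennreal_mult_less_top intro: le_less_trans)
  finally show "(\<integral>\<^sup>+p. ennreal (norm (Kk (y, fst p, v, snd p) * h (snd p))) \<partial>(lborel \<Otimes>\<^sub>M M)) < \<infinity>" .
qed measurable

text \<open>Because \<open>g\<close> has mean zero on cubes of scale \<open>j\<close>, the kernel
  may be replaced by its difference \<open>KK\<close> from the value at the corner
  \<open>dcor j z\<close>. The two points lie in one cube, so the Hoelder estimate gains
  \<open>(2 powr j / t) powr a\<close>, and the Schur test finishes.\<close>

lemma mean_zero_bound:
  fixes g :: "(real^'n) \<times> 'w \<Rightarrow> real"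
  assumes g[measurable]: "g \<in> borel_measurable (lborel \<Otimes>\<^sub>M M)"
    and fin: "(\<integral>\<^sup>+w. \<integral>\<^sup>+z. ennreal ((g (z, w))\<^sup>2) \<partial>lborel \<partial>M) < \<infinity>"
    and j: "j \<le> k"
    and zero: "\<And>w \<phi>. w \<in> space M \<Longrightarrow> sqi \<phi> \<Longrightarrow> dconst j \<phi> \<Longrightarrow> (\<integral>z. \<phi> z * g (z, w) \<partial>lborel) = 0"
  shows "(\<integral>\<^sup>+y. \<integral>\<^sup>+v. ennreal ((\<integral>p. Kk (y, fst p, v, snd p) * g p \<partial>(lborel \<Otimes>\<^sub>M M))\<^sup>2) \<partial>N \<partial>lborel)
     \<le> ennreal ((ckap CARD('n) a * (A * chol CARD('n) a * (2 powr real_of_int j / t) powr a))\<^sup>2)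
        * (\<integral>\<^sup>+w. \<integral>\<^sup>+z. ennreal ((g (z, w))\<^sup>2) \<partial>lborel \<partial>M)"
proof -
  define KK where "KK = (\<lambda>q. Kk q - Kk (fst q, dcor j (fst (snd q)), snd (snd q)))"
  have KK[measurable]: "KK \<in> borel_measurable (lborel \<Otimes>\<^sub>M lborel \<Otimes>\<^sub>M N \<Otimes>\<^sub>M M)"
    unfolding KK_def by measurable
  have tj: "2 powr real_of_int j < 2 * t"
  proof -
    have "2 powr real_of_int j \<le> 2 powr real_of_int k" using j by simp
    also have "\<dots> = 2 * 2 powr (real_of_int k - 1)" by (simp add: powr_diff)
    also have "\<dots> < 2 * t" using t_lower by simp
    finally show ?thesis .
  qed
  have dz: "infnorm (z - dcor j z) < 2 powr real_of_int j" for z :: "real^'n" by (rule dcor_dist) simp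
  have eq: "(\<integral>p. Kk (y, fst p, v, snd p) * g p \<partial>(lborel \<Otimes>\<^sub>M M)) = (\<integral>p. KK (y, fst p, v, snd p) * g p \<partial>(lborel \<Otimes>\<^sub>M M))"
    if v[measurable]: "v \<in> space N" for y v
  proof -
    let ?f = "\<lambda>p. Kk (y, dcor j (fst p), v, snd p)"
    let ?s = "3 powr (real CARD('n) + a)"
    have fb: "\<bar>Kk (y, dcor j z, v, w)\<bar> \<le> ?s * kap a t (y - z) * b v w" for z w
    proof -
      have "\<bar>Kk (y, dcor j z, v, w)\<bar> \<le> kap a t (y - dcor j z) * b v w" by (rule dom)
      also have "\<dots> \<le> ?s * kap a t (y - z) * b v w"
        using dz[of z] tj by (intro mult_right_mono kap_compare b_nonneg t a) auto
      finally show ?thesis .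
    qed
    have i1: "integrable (lborel \<Otimes>\<^sub>M M) (\<lambda>p. Kk (y, fst p, v, snd p) * g p)"
      using dom[of y _ v] by (intro Kg_integrable[OF g fin, where c=1 and y=y and v=v]) auto
    have i2: "integrable (lborel \<Otimes>\<^sub>M M) (\<lambda>p. ?f p * g p)"
      using fb by (intro Kg_integrable[OF g fin, where c="?s" and y=y and v=v]) auto
    have "(\<integral>p. ?f p * g p \<partial>(lborel \<Otimes>\<^sub>M M)) = (\<integral>p. (\<lambda>(z, w). Kk (y, dcor j z, v, w) * g (z, w)) p \<partial>(lborel \<Otimes>\<^sub>M M))"
      by (simp add: split_beta')
    also have "\<dots> = (\<integral>w. (\<integral>z. Kk (y, dcor j z, v, w) * g (z, w) \<partial>lborel) \<partial>M)"
      using i2 by (intro LM.integral_snd[symmetric]) (simp add: split_beta')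
    also have "\<dots> = (\<integral>w. 0 \<partial>M)"
    proof (intro Bochner_Integration.integral_cong refl)
      fix w assume w[measurable]: "w \<in> space M"
      \<comment> \<open>As a function of \<open>z\<close> the kernel at the corner is a step
        function of scale \<open>j\<close>; square integrability makes it an admissible test
        function for \<open>zero\<close>.\<close>
      have "sqi (\<lambda>z. Kk (y, dcor j z, v, w))"
      proof -
        have "(\<integral>\<^sup>+z. ennreal ((Kk (y, dcor j z, v, w))\<^sup>2) \<partial>lborel) \<le> (\<integral>\<^sup>+z. ennreal ((?s * b v w)\<^sup>2) * ennreal ((kap a t (y - z))\<^sup>2) \<partial>lborel)"
        proof (intro nn_integral_mono)
          fix z
          have "(Kk (y, dcor j z, v, w))\<^sup>2 \<le> (?s * kap a t (y - z) * b v w)\<^sup>2"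
            using power_mono[OF fb[of z w], of 2] by simp
          then show "ennreal ((Kk (y, dcor j z, v, w))\<^sup>2) \<le> ennreal ((?s * b v w)\<^sup>2) * ennreal ((kap a t (y - z))\<^sup>2)"
            by (simp add: ennreal_mult[symmetric] ennreal_leI power_mult_distrib mult_ac)
        qed
        also have "\<dots> = ennreal ((?s * b v w)\<^sup>2) * (\<integral>\<^sup>+z. ennreal ((kap a t (y - z))\<^sup>2) \<partial>lborel)"
          by (rule nn_integral_cmult) measurable
        also have "\<dots> < \<infinity>" using kap_sq_fin[of y] by (simp add: ennreal_mult_less_top)
        finally show ?thesis unfolding sqi_def by simp
      qed
      then show "(\<integral>z. Kk (y, dcor j z, v, w) * g (z, w) \<partial>lborel) = 0"
        by (intro zero w) (auto simp: dconst_def)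
    qed
    finally have z0: "(\<integral>p. ?f p * g p \<partial>(lborel \<Otimes>\<^sub>M M)) = 0" by simp
    have "(\<integral>p. KK (y, fst p, v, snd p) * g p \<partial>(lborel \<Otimes>\<^sub>M M)) = (\<integral>p. Kk (y, fst p, v, snd p) * g p - ?f p * g p \<partial>(lborel \<Otimes>\<^sub>M M))"
      by (simp add: KK_def left_diff_distrib)
    also have "\<dots> = (\<integral>p. Kk (y, fst p, v, snd p) * g p \<partial>(lborel \<Otimes>\<^sub>M M))"
      using i1 i2 z0 by simp
    finally show ?thesis by simp
  qed
  have "(\<integral>\<^sup>+y. \<integral>\<^sup>+v. ennreal ((\<integral>p. Kk (y, fst p, v, snd p) * g p \<partial>(lborel \<Otimes>\<^sub>M M))\<^sup>2) \<partial>N \<partial>lborel)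
    = (\<integral>\<^sup>+y. \<integral>\<^sup>+v. ennreal ((\<integral>p. KK (y, fst p, v, snd p) * g p \<partial>(lborel \<Otimes>\<^sub>M M))\<^sup>2) \<partial>N \<partial>lborel)"
    by (intro nn_integral_cong) (simp add: eq)
  also have "\<dots> \<le> ennreal ((ckap CARD('n) a * (A * chol CARD('n) a * (2 powr real_of_int j / t) powr a))\<^sup>2)
        * (\<integral>\<^sup>+w. \<integral>\<^sup>+z. ennreal ((g (z, w))\<^sup>2) \<partial>lborel \<partial>M)"
  proof (rule schur_bound_simple[OF sM sN KK g a t])
    fix y z and h :: "'w \<Rightarrow> real" assume "h \<in> borel_measurable M"
    then show "(\<integral>\<^sup>+v. ennreal ((\<integral>w. KK (y, z, v, w) * h w \<partial>M)\<^sup>2) \<partial>N)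
        \<le> ennreal ((A * chol CARD('n) a * (2 powr real_of_int j / t) powr a * kap a t (y - z))\<^sup>2) * (\<integral>\<^sup>+w. ennreal ((h w)\<^sup>2) \<partial>M)"
      unfolding KK_def using dz[of z] tj by (simp, intro op_holder') auto
  qed
  finally show ?thesis .
qed

end

section \<open>Almost orthogonality between the kernel and the martingale differences\<close>

lemma dd_telescope_down: "dexp (k - int N) h x = (\<Sum>i<N. dd (k - 1 - int i) h x) + dexp k h x"
proof (induction N)
  case (Suc N)
  have "dd (k - 1 - int N) h x = dexp (k - int (Suc N)) h x - dexp (k - int N) h x"
    by (simp add: dd_def algebra_simps)
  then show ?case using Suc by simp
qed simp

lemma square_add3_le: "((a::real) + b + c)\<^sup>2 \<le> 4 * a\<^sup>2 + 4 * b\<^sup>2 + 2 * c\<^sup>2"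
  using square_add_le[of "a + b" c] square_add_le[of a b] by linarith

text \<open>The first summand belongs to the scales above \<open>k\<close> (Schur test and
  oscillation), the second to the scales below (cancellation), where \<open>2 powr a\<close> comes
  from 2^k < 2 t.\<close>

definition corth :: "nat \<Rightarrow> real \<Rightarrow> real" where
  "corth n a = 2 * ckap n a * cosc n a + 4 * (ckap n a * chol n a * 2 powr a)\<^sup>2 / (1 - qq a)"

lemma corth_nonneg: "0 < a \<Longrightarrow> 0 \<le> corth n a"
  unfolding corth_def using ckap_pos[of a n] cosc_nonneg[of a n] qq_bounds(2)[of a]
  by (intro add_nonneg_nonneg mult_nonneg_nonneg divide_nonneg_nonneg) auto

context op_kernel
begin

text \<open>The lower bound on \<open>t\<close> gives 2^(k - i) / t \<le> 2 * 2^(-i), and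
  \<open>dl a < a\<close> turns the power \<open>a\<close> of 2^(-i) into at most
  \<open>qq a ^ i\<close>.\<close>

lemma scale_power_bound:
  "((2 powr real_of_int (k - int i) / t) powr a)\<^sup>2 \<le> (2 powr a)\<^sup>2 * (qq a ^ i)\<^sup>2"
proof -
  have "2 powr real_of_int (k - int i) / t \<le> 2 * 2 powr (- real i)"
  proof -
    have "2 powr real_of_int (k - int i) = 2 * 2 powr (- real i) * 2 powr (real_of_int k - 1)"
      by (simp add: powr_diff powr_minus field_simps)
    also have "\<dots> \<le> 2 * 2 powr (- real i) * t" using t_lower by (intro mult_left_mono) auto
    finally show ?thesis using t by (simp add: field_simps)
  qed
  then have "(2 powr real_of_int (k - int i) / t) powr a \<le> (2 * 2 powr (- real i)) powr a"
    using a t by (intro powr_mono2) auto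
  also have "\<dots> = 2 powr a * 2 powr (- (a * real i))" by (simp add: powr_mult powr_powr mult.commute)
  also have "\<dots> \<le> 2 powr a * qq a ^ i"
    unfolding qq_power using dl_bounds(1,3)[OF a] by (intro mult_left_mono powr_mono) (auto intro!: mult_right_mono)
  finally have "((2 powr real_of_int (k - int i) / t) powr a)\<^sup>2 \<le> (2 powr a * qq a ^ i)\<^sup>2"
    by (intro power_mono) auto
  then show ?thesis by (simp add: power_mult_distrib)
qed

text \<open>The sum below the scale \<open>k\<close> uses cancellation of \<open>dd j h\<close> against the smooth kernel, the sum above it the
  smallness of the oscillation of \<open>dexp j h\<close> at distance \<open>t\<close>.\<close>

theorem orthogonality:
  fixes F :: "(real^'n) \<times> 'w \<Rightarrow> real"
  assumes F[measurable]: "F \<in> borel_measurable (lborel \<Otimes>\<^sub>M M)"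
    and sF: "\<And>w. w \<in> space M \<Longrightarrow> sqi (\<lambda>z. F (z, w))"
    and fin: "(\<integral>\<^sup>+w. \<integral>\<^sup>+z. ennreal ((F (z, w))\<^sup>2) \<partial>lborel \<partial>M) < \<infinity>"
  defines "d \<equiv> \<lambda>j. \<integral>\<^sup>+w. \<integral>\<^sup>+z. ennreal ((dd j (\<lambda>z. F (z, w)) z)\<^sup>2) \<partial>lborel \<partial>M"
  shows "(\<integral>\<^sup>+y. \<integral>\<^sup>+v. ennreal ((\<integral>p. Kk (y, fst p, v, snd p) * (F p - dexp k (\<lambda>z. F (z, snd p)) y) \<partial>(lborel \<Otimes>\<^sub>M M))\<^sup>2) \<partial>N \<partial>lborel)
     \<le> ennreal (corth CARD('n) a * A\<^sup>2) * (\<Sum>i. ennreal (qq a ^ i) * (d (k + int i) + d (k - 1 - int i)))"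
    (is "?X \<le> _")
proof -
  define H where "H = enn2real (\<integral>\<^sup>+w. \<integral>\<^sup>+z. ennreal ((F (z, w))\<^sup>2) \<partial>lborel \<partial>M)"
  have H: "(\<integral>\<^sup>+w. \<integral>\<^sup>+z. ennreal ((F (z, w))\<^sup>2) \<partial>lborel \<partial>M) = ennreal H"
    unfolding H_def using fin by simp
  have H0: "0 \<le> H" by (simp add: H_def)
  let ?q = "qq a"
  have q: "0 < ?q" "?q < 1" using qq_bounds a by auto
  have Fw[measurable]: "(\<lambda>z. F (z, w)) \<in> borel_measurable borel" if "w \<in> space M" for w
    using sF[OF that] by (simp add: sqi_def)
  let ?c = "ckap CARD('n) a"
  have c0: "0 < ?c" using a by (rule ckap_pos)
  let ?C2 = "(?c * chol CARD('n) a * 2 powr a)\<^sup>2 * A\<^sup>2"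

  let ?E = "\<lambda>j p. dexp j (\<lambda>z. F (z, snd p)) (fst p)"
  let ?D = "\<lambda>j p. dd j (\<lambda>z. F (z, snd p)) (fst p)"
  have Em[measurable]: "?E j \<in> borel_measurable (lborel \<Otimes>\<^sub>M M)" for j by measurable
  have Dm[measurable]: "?D j \<in> borel_measurable (lborel \<Otimes>\<^sub>M M)" for j by measurable
  have Efin: "(\<integral>\<^sup>+w. \<integral>\<^sup>+z. ennreal ((?E j (z, w))\<^sup>2) \<partial>lborel \<partial>M) \<le> ennreal H" for j
    unfolding H[symmetric] by (rule nn_integral_mono) (simp add: nn_integral_dexp_sq)
  have difffin: "(\<integral>\<^sup>+w. \<integral>\<^sup>+z. ennreal ((g1 (z, w) - g2 (z, w))\<^sup>2) \<partial>lborel \<partial>M) \<le> ennreal (4 * H)"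
    if g: "(\<integral>\<^sup>+w. \<integral>\<^sup>+z. ennreal ((g1 (z, w))\<^sup>2) \<partial>lborel \<partial>M) \<le> ennreal H" "(\<integral>\<^sup>+w. \<integral>\<^sup>+z. ennreal ((g2 (z, w))\<^sup>2) \<partial>lborel \<partial>M) \<le> ennreal H"
    and [measurable]: "g1 \<in> borel_measurable (lborel \<Otimes>\<^sub>M M)" "g2 \<in> borel_measurable (lborel \<Otimes>\<^sub>M M)"
    for g1 g2 :: "(real^'n) \<times> 'w \<Rightarrow> real"
  proof -
    have "(\<integral>\<^sup>+w. \<integral>\<^sup>+z. ennreal ((g1 (z, w) - g2 (z, w))\<^sup>2) \<partial>lborel \<partial>M) \<le> (\<integral>\<^sup>+w. \<integral>\<^sup>+z. 2 * ennreal ((g1 (z, w))\<^sup>2) + 2 * ennreal ((g2 (z, w))\<^sup>2) \<partial>lborel \<partial>M)"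
    proof (intro nn_integral_mono)
      fix z w show "ennreal ((g1 (z, w) - g2 (z, w))\<^sup>2) \<le> 2 * ennreal ((g1 (z, w))\<^sup>2) + 2 * ennreal ((g2 (z, w))\<^sup>2)"
        using ennreal_leI[OF square_diff_le[of "g1 (z, w)" "g2 (z, w)"]] by (simp add: ennreal_mult)
    qed
    also have "\<dots> = (\<integral>\<^sup>+w. 2 * (\<integral>\<^sup>+z. ennreal ((g1 (z, w))\<^sup>2) \<partial>lborel) + 2 * (\<integral>\<^sup>+z. ennreal ((g2 (z, w))\<^sup>2) \<partial>lborel) \<partial>M)"
      by (intro nn_integral_cong) (simp add: nn_integral_add nn_integral_cmult)
    also have "\<dots> = 2 * (\<integral>\<^sup>+w. \<integral>\<^sup>+z. ennreal ((g1 (z, w))\<^sup>2) \<partial>lborel \<partial>M) + 2 * (\<integral>\<^sup>+w. \<integral>\<^sup>+z. ennreal ((g2 (z, w))\<^sup>2) \<partial>lborel \<partial>M)"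
      by (simp add: nn_integral_add nn_integral_cmult)
    also have "\<dots> \<le> 2 * ennreal H + 2 * ennreal H" by (intro add_mono mult_left_mono g) auto
    also have "\<dots> = ennreal (4 * H)"
      using H0 by (simp add: ennreal_mult[of 4] flip: distrib_right)
    finally show ?thesis .
  qed
  have Dfin: "d j < \<infinity>" for j
  proof -
    have "d j \<le> ennreal (4 * H)" unfolding d_def dd_def
      using difffin[OF Efin Efin Em Em, of j "j + 1"] by simp
    then show ?thesis by (auto intro: le_less_trans)
  qed

  \<comment> \<open>Scales above \<open>k\<close>: the argument of the Schur test is the difference
    of one average at \<open>z\<close> and at \<open>y\<close>. The integral over \<open>w\<close>
    is then moved to the outside so that \<open>dexp_oscillation\<close> applies to each slice of
    \<open>F\<close>.\<close>
  have osc: "(\<integral>\<^sup>+y. \<integral>\<^sup>+v. ennreal ((\<integral>p. Kk (y, fst p, v, snd p) * (?E k p - dexp k (\<lambda>z. F (z, snd p)) y) \<partial>(lborel \<Otimes>\<^sub>M M))\<^sup>2) \<partial>N \<partial>lborel)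
    \<le> ennreal (?c * cosc CARD('n) a * A\<^sup>2) * (\<Sum>i. ennreal (?q ^ i) * d (k + int i))" (is "?X3 \<le> _")
  proof -
    let ?g = "\<lambda>q. dexp k (\<lambda>z. F (z, snd (snd q))) (fst (snd q)) - dexp k (\<lambda>z. F (z, snd (snd q))) (fst q)"
    let ?G = "\<lambda>y z w. dexp k (\<lambda>z. F (z, w)) z - dexp k (\<lambda>z. F (z, w)) y"
    have g: "?g \<in> borel_measurable (lborel \<Otimes>\<^sub>M lborel \<Otimes>\<^sub>M M)" by measurable
    have "?X3 \<le> ennreal (?c * A\<^sup>2) * (\<integral>\<^sup>+y. \<integral>\<^sup>+z. ennreal (kap a t (y - z)) * (\<integral>\<^sup>+w. ennreal ((?G y z w)\<^sup>2) \<partial>M) \<partial>lborel \<partial>lborel)"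
      using schur_bound[OF sM sN K_meas g a t op_size'] by simp
    also have "(\<integral>\<^sup>+y. \<integral>\<^sup>+z. ennreal (kap a t (y - z)) * (\<integral>\<^sup>+w. ennreal ((?G y z w)\<^sup>2) \<partial>M) \<partial>lborel \<partial>lborel)
       = (\<integral>\<^sup>+y. \<integral>\<^sup>+z. \<integral>\<^sup>+w. ennreal (kap a t (y - z)) * ennreal ((?G y z w)\<^sup>2) \<partial>M \<partial>lborel \<partial>lborel)"
      by (intro nn_integral_cong nn_integral_cmult[symmetric]) measurable
    also have "\<dots> = (\<integral>\<^sup>+y. \<integral>\<^sup>+w. \<integral>\<^sup>+z. ennreal (kap a t (y - z)) * ennreal ((?G y z w)\<^sup>2) \<partial>lborel \<partial>M \<partial>lborel)"
      by (intro nn_integral_cong LM.Fubini'[symmetric]) measurable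
    also have "\<dots> = (\<integral>\<^sup>+w. \<integral>\<^sup>+y. \<integral>\<^sup>+z. ennreal (kap a t (y - z)) * ennreal ((?G y z w)\<^sup>2) \<partial>lborel \<partial>lborel \<partial>M)"
      by (intro LM.Fubini'[symmetric]) measurable
    also have "\<dots> \<le> (\<integral>\<^sup>+w. ennreal (cosc CARD('n) a) * (\<Sum>i. ennreal (?q ^ i) * (\<integral>\<^sup>+z. ennreal ((dd (k + int i) (\<lambda>z. F (z, w)) z)\<^sup>2) \<partial>lborel)) \<partial>M)"
      using dexp_oscillation[OF sF a t t_upper] by (intro nn_integral_mono) simp
    also have "\<dots> = ennreal (cosc CARD('n) a) * (\<Sum>i. ennreal (?q ^ i) * d (k + int i))"
      unfolding d_def by (simp add: nn_integral_cmult nn_integral_suminf)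
    finally have "?X3 \<le> ennreal (?c * A\<^sup>2) * (ennreal (cosc CARD('n) a) * (\<Sum>i. ennreal (?q ^ i) * d (k + int i)))"
      by (simp add: mult_left_mono)
    then show ?thesis using c0 cosc_nonneg[OF a, of "CARD('n)"]
      by (simp add: ennreal_mult mult_ac)
  qed

  \<comment> \<open>Scales below \<open>k\<close>: whatever has mean zero on cubes of scale
    \<open>k - int i\<close> gains the factor \<open>(qq a ^ i)^2\<close>.\<close>
  have down: "(\<integral>\<^sup>+y. \<integral>\<^sup>+v. ennreal ((\<integral>p. Kk (y, fst p, v, snd p) * g p \<partial>(lborel \<Otimes>\<^sub>M M))\<^sup>2) \<partial>N \<partial>lborel)
     \<le> ennreal (?C2 * (?q ^ i)\<^sup>2) * (\<integral>\<^sup>+w. \<integral>\<^sup>+z. ennreal ((g (z, w))\<^sup>2) \<partial>lborel \<partial>M)"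
    if g: "g \<in> borel_measurable (lborel \<Otimes>\<^sub>M M)" and gf: "(\<integral>\<^sup>+w. \<integral>\<^sup>+z. ennreal ((g (z, w))\<^sup>2) \<partial>lborel \<partial>M) < \<infinity>"
      and z: "\<And>w \<phi>. w \<in> space M \<Longrightarrow> sqi \<phi> \<Longrightarrow> dconst (k - int i) \<phi> \<Longrightarrow> (\<integral>z. \<phi> z * g (z, w) \<partial>lborel) = 0"
    for g :: "(real^'n) \<times> 'w \<Rightarrow> real" and i
  proof -
    have "(?c * (A * chol CARD('n) a * (2 powr real_of_int (k - int i) / t) powr a))\<^sup>2
      = (?c * chol CARD('n) a)\<^sup>2 * A\<^sup>2 * ((2 powr real_of_int (k - int i) / t) powr a)\<^sup>2" by (simp add: power_mult_distrib)
    also have "\<dots> \<le> (?c * chol CARD('n) a)\<^sup>2 * A\<^sup>2 * ((2 powr a)\<^sup>2 * (?q ^ i)\<^sup>2)"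
      by (intro mult_left_mono scale_power_bound) auto
    also have "\<dots> = ?C2 * (?q ^ i)\<^sup>2" by (simp add: power_mult_distrib)
    finally have le: "ennreal ((?c * (A * chol CARD('n) a * (2 powr real_of_int (k - int i) / t) powr a))\<^sup>2) \<le> ennreal (?C2 * (?q ^ i)\<^sup>2)"
      by (rule ennreal_leI)
    show ?thesis
      by (rule order_trans[OF mean_zero_bound[OF g gf _ z] mult_right_mono[OF le]]) auto
  qed
  have zero_diff: "(\<integral>z. \<phi> z * (g1 z - g2 z) \<partial>lborel) = 0"
    if "sqi \<phi>" "sqi g1" "sqi g2" "(\<integral>z. \<phi> z * g1 z \<partial>lborel) = (\<integral>z. \<phi> z * g2 z \<partial>lborel)" for \<phi> g1 g2 :: "real^'n \<Rightarrow> real"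
    using that by (simp add: right_diff_distrib sqi_prod_integrable)

  let ?T = "\<lambda>g y v. \<integral>p. Kk (y, fst p, v, snd p) * g p \<partial>(lborel \<Otimes>\<^sub>M M)"
  \<comment> \<open>\<open>L\<close> truncates the sum over finer scales. The remainder
    \<open>?R\<close> has itself mean zero on cubes of scale \<open>k - int L\<close>, so
    cancellation makes its contribution tend to 0 at the rate of the last summand.\<close>
  have "?X \<le> ennreal (corth CARD('n) a * A\<^sup>2) * (\<Sum>i. ennreal (?q ^ i) * (d (k + int i) + d (k - 1 - int i))) + ennreal ((16 * ?C2 * H) * (?q\<^sup>2) ^ L)" for L
  proof -
    let ?R = "\<lambda>p. F p - ?E (k - int L) p"
    let ?O = "\<lambda>y p. ?E k p - dexp k (\<lambda>z. F (z, snd p)) y"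
    have Rfin: "(\<integral>\<^sup>+w. \<integral>\<^sup>+z. ennreal ((?R (z, w))\<^sup>2) \<partial>lborel \<partial>M) \<le> ennreal (4 * H)"
      by (rule difffin[OF _ Efin]) (use H in auto)
    have u1: "(\<integral>\<^sup>+y. \<integral>\<^sup>+v. ennreal ((?T ?R y v)\<^sup>2) \<partial>N \<partial>lborel) \<le> ennreal (?C2 * (?q ^ L)\<^sup>2) * ennreal (4 * H)"
    proof (rule order_trans[OF down mult_left_mono[OF Rfin]])
      fix w and \<phi> :: "real^'n \<Rightarrow> real" assume w: "w \<in> space M" and \<phi>: "sqi \<phi>" "dconst (k - int L) \<phi>"
      show "(\<integral>z. \<phi> z * ?R (z, w) \<partial>lborel) = 0"
        using integral_dconst_dexp[OF \<phi>(1) sF[OF w] \<phi>(2)]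
        by (simp, intro zero_diff \<phi> sF w sqi_dexp) simp
    qed (use Rfin in \<open>auto intro: le_less_trans\<close>)
    have u2: "(\<integral>\<^sup>+y. \<integral>\<^sup>+v. ennreal ((?T (?D (k - 1 - int i)) y v)\<^sup>2) \<partial>N \<partial>lborel) \<le> ennreal (?C2 * (?q ^ i)\<^sup>2) * d (k - 1 - int i)" for i
    proof -
      have "(\<integral>\<^sup>+y. \<integral>\<^sup>+v. ennreal ((?T (?D (k - 1 - int i)) y v)\<^sup>2) \<partial>N \<partial>lborel)
        \<le> ennreal (?C2 * (?q ^ i)\<^sup>2) * (\<integral>\<^sup>+w. \<integral>\<^sup>+z. ennreal ((?D (k - 1 - int i) (z, w))\<^sup>2) \<partial>lborel \<partial>M)"
      proof (rule down)
        show "(\<integral>\<^sup>+w. \<integral>\<^sup>+z. ennreal ((?D (k - 1 - int i) (z, w))\<^sup>2) \<partial>lborel \<partial>M) < \<infinity>"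
          using Dfin[of "k - 1 - int i"] by (simp add: d_def)
        fix w and \<phi> :: "real^'n \<Rightarrow> real" assume w: "w \<in> space M" and \<phi>: "sqi \<phi>" "dconst (k - int i) \<phi>"
        \<comment> \<open>An off-by-one that matters: \<open>dd j\<close> has mean zero one scale
          above \<open>j\<close>, so \<open>dd (k - 1 - int i)\<close> is tested against step
          functions of scale \<open>k - int i\<close>.\<close>
        have e: "k - 1 - int i + 1 = k - int i" by simp
        show "(\<integral>z. \<phi> z * ?D (k - 1 - int i) (z, w) \<partial>lborel) = 0"
          unfolding dd_def e
          using integral_dconst_dexp[OF \<phi>(1) sF[OF w] \<phi>(2)]
            integral_dconst_dexp[OF \<phi>(1) sF[OF w] dconst_mono[OF \<phi>(2), of "k - 1 - int i"]]
          by (simp, intro zero_diff \<phi> sF w sqi_dexp) simp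
      qed measurable
      then show ?thesis by (simp add: d_def)
    qed
    have split: "?T (\<lambda>p. F p - dexp k (\<lambda>z. F (z, snd p)) y) y v = ?T ?R y v + (\<Sum>i<L. ?T (?D (k - 1 - int i)) y v) + ?T (?O y) y v"
      if v[measurable]: "v \<in> space N" for y v
    proof -
      have Ki: "integrable (lborel \<Otimes>\<^sub>M M) (\<lambda>p. Kk (y, fst p, v, snd p) * g p)"
        if "g \<in> borel_measurable (lborel \<Otimes>\<^sub>M M)" "(\<integral>\<^sup>+w. \<integral>\<^sup>+z. ennreal ((g (z, w))\<^sup>2) \<partial>lborel \<partial>M) < \<infinity>" for g :: "(real^'n) \<times> 'w \<Rightarrow> real"
        using that dom[of y _ v] by (intro Kg_integrable[where c=1 and y=y and v=v]) auto
      have iR: "integrable (lborel \<Otimes>\<^sub>M M) (\<lambda>p. Kk (y, fst p, v, snd p) * ?R p)"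
        using Rfin by (intro Ki) (auto intro: le_less_trans)
      have iD: "integrable (lborel \<Otimes>\<^sub>M M) (\<lambda>p. Kk (y, fst p, v, snd p) * ?D j p)" for j
        using Dfin[of j] by (intro Ki) (auto simp: d_def)
      have iE: "integrable (lborel \<Otimes>\<^sub>M M) (\<lambda>p. Kk (y, fst p, v, snd p) * ?E k p)"
        using Efin[of k] by (intro Ki) (auto intro: le_less_trans)
      \<comment> \<open>The average at \<open>y\<close> does not depend on \<open>z\<close>, so this
        piece of \<open>?O\<close> needs the other integrability criterion.\<close>
      have iC: "integrable (lborel \<Otimes>\<^sub>M M) (\<lambda>p. Kk (y, fst p, v, snd p) * dexp k (\<lambda>z. F (z, snd p)) y)"
      proof (rule Kconst_integrable[of "\<lambda>w. dexp k (\<lambda>z. F (z, w)) y", OF _ _ v])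
        have "(\<integral>\<^sup>+w. ennreal ((dexp k (\<lambda>z. F (z, w)) y)\<^sup>2) \<partial>M) \<le> (\<integral>\<^sup>+w. ennreal ((1 / 2 powr real_of_int k) ^ CARD('n)) * (\<integral>\<^sup>+z. ennreal ((F (z, w))\<^sup>2) \<partial>lborel) \<partial>M)"
          by (intro nn_integral_mono dexp_sq_le_const) auto
        also have "\<dots> = ennreal ((1 / 2 powr real_of_int k) ^ CARD('n)) * ennreal H"
          by (subst nn_integral_cmult) (simp_all add: H)
        also have "\<dots> < \<infinity>" by (simp add: ennreal_mult_less_top)
        finally show "(\<integral>\<^sup>+w. ennreal ((dexp k (\<lambda>z. F (z, w)) y)\<^sup>2) \<partial>M) < \<infinity>" .
      qed measurable
      have iO: "integrable (lborel \<Otimes>\<^sub>M M) (\<lambda>p. Kk (y, fst p, v, snd p) * ?O y p)"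
        using iE iC by (simp add: right_diff_distrib)
      have "F p - dexp k (\<lambda>z. F (z, snd p)) y = ?R p + (\<Sum>i<L. ?D (k - 1 - int i) p) + ?O y p" for p
        using dd_telescope_down[of k L "\<lambda>z. F (z, snd p)" "fst p"] by simp
      then have "?T (\<lambda>p. F p - dexp k (\<lambda>z. F (z, snd p)) y) y v
        = (\<integral>p. Kk (y, fst p, v, snd p) * ?R p + (\<Sum>i<L. Kk (y, fst p, v, snd p) * ?D (k - 1 - int i) p) + Kk (y, fst p, v, snd p) * ?O y p \<partial>(lborel \<Otimes>\<^sub>M M))"
        by (simp only: distrib_left sum_distrib_left)
      also have "\<dots> = ?T ?R y v + (\<Sum>i<L. ?T (?D (k - 1 - int i)) y v) + ?T (?O y) y v"
        using iR iD iO by (subst Bochner_Integration.integral_add; (subst Bochner_Integration.integral_add)?) (auto simp: Bochner_Integration.integral_sum)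
      finally show ?thesis .
    qed
    have "?X \<le> (\<integral>\<^sup>+y. \<integral>\<^sup>+v. 4 * ennreal ((?T ?R y v)\<^sup>2)
        + ennreal (4 / (1 - ?q)) * (\<Sum>i<L. ennreal (1 / ?q ^ i) * ennreal ((?T (?D (k - 1 - int i)) y v)\<^sup>2))
        + 2 * ennreal ((?T (?O y) y v)\<^sup>2) \<partial>N \<partial>lborel)"
    proof (intro nn_integral_mono)
      fix y v assume "v \<in> space N"
      let ?u = "\<lambda>i. ?T (?D (k - 1 - int i)) y v"
      have "(?T (\<lambda>p. F p - dexp k (\<lambda>z. F (z, snd p)) y) y v)\<^sup>2 \<le> 4 * (?T ?R y v)\<^sup>2 + 4 * (\<Sum>i<L. ?u i)\<^sup>2 + 2 * (?T (?O y) y v)\<^sup>2"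
        unfolding split[OF \<open>v \<in> space N\<close>] by (rule square_add3_le)
      also have "\<dots> \<le> 4 * (?T ?R y v)\<^sup>2 + 4 * (1 / (1 - ?q) * (\<Sum>i<L. (?u i)\<^sup>2 / ?q ^ i)) + 2 * (?T (?O y) y v)\<^sup>2"
        by (intro add_right_mono add_left_mono mult_left_mono weighted_sum_square q) auto
      also have "\<dots> = 4 * (?T ?R y v)\<^sup>2 + (4 / (1 - ?q) * (\<Sum>i<L. 1 / ?q ^ i * (?u i)\<^sup>2) + 2 * (?T (?O y) y v)\<^sup>2)" by simp
      finally have "ennreal ((?T (\<lambda>p. F p - dexp k (\<lambda>z. F (z, snd p)) y) y v)\<^sup>2) \<le> ennreal (4 * (?T ?R y v)\<^sup>2 + (4 / (1 - ?q) * (\<Sum>i<L. 1 / ?q ^ i * (?u i)\<^sup>2) + 2 * (?T (?O y) y v)\<^sup>2))"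
        by (rule ennreal_leI)
      also have "\<dots> = ennreal (4 * (?T ?R y v)\<^sup>2) + ennreal (4 / (1 - ?q) * (\<Sum>i<L. 1 / ?q ^ i * (?u i)\<^sup>2) + 2 * (?T (?O y) y v)\<^sup>2)"
        using q by (intro ennreal_plus add_nonneg_nonneg mult_nonneg_nonneg sum_nonneg) auto
      also have "\<dots> = 4 * ennreal ((?T ?R y v)\<^sup>2) + (ennreal (4 / (1 - ?q)) * (\<Sum>i<L. ennreal (1 / ?q ^ i) * ennreal ((?u i)\<^sup>2)) + 2 * ennreal ((?T (?O y) y v)\<^sup>2))"
        using q by (intro arg_cong2[where f="(+)"] ennreal_weighted_sum) (auto simp: ennreal_mult)
      finally show "ennreal ((?T (\<lambda>p. F p - dexp k (\<lambda>z. F (z, snd p)) y) y v)\<^sup>2) \<le> 4 * ennreal ((?T ?R y v)\<^sup>2)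
        + ennreal (4 / (1 - ?q)) * (\<Sum>i<L. ennreal (1 / ?q ^ i) * ennreal ((?u i)\<^sup>2)) + 2 * ennreal ((?T (?O y) y v)\<^sup>2)"
        by (simp add: add.assoc)
    qed
    also have "\<dots> = 4 * (\<integral>\<^sup>+y. \<integral>\<^sup>+v. ennreal ((?T ?R y v)\<^sup>2) \<partial>N \<partial>lborel)
        + ennreal (4 / (1 - ?q)) * (\<Sum>i<L. ennreal (1 / ?q ^ i) * (\<integral>\<^sup>+y. \<integral>\<^sup>+v. ennreal ((?T (?D (k - 1 - int i)) y v)\<^sup>2) \<partial>N \<partial>lborel))
        + 2 * (\<integral>\<^sup>+y. \<integral>\<^sup>+v. ennreal ((?T (?O y) y v)\<^sup>2) \<partial>N \<partial>lborel)"
      by (simp add: nn_integral_add nn_integral_cmult nn_integral_sum)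
    also have "\<dots> \<le> 4 * (ennreal (?C2 * (?q ^ L)\<^sup>2) * ennreal (4 * H))
        + ennreal (4 / (1 - ?q)) * (\<Sum>i<L. ennreal (1 / ?q ^ i) * (ennreal (?C2 * (?q ^ i)\<^sup>2) * d (k - 1 - int i)))
        + 2 * (ennreal (?c * cosc CARD('n) a * A\<^sup>2) * (\<Sum>i. ennreal (?q ^ i) * d (k + int i)))"
      by (intro add_mono mult_left_mono sum_mono u1 u2 osc) auto
    also have "4 * (ennreal (?C2 * (?q ^ L)\<^sup>2) * ennreal (4 * H)) = ennreal ((16 * ?C2 * H) * (?q\<^sup>2) ^ L)"
    proof -
      have "4 * (ennreal (?C2 * (?q ^ L)\<^sup>2) * ennreal (4 * H)) = ennreal (4 * (?C2 * (?q ^ L)\<^sup>2 * (4 * H)))"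
        using H0 ennreal_mult[of "?C2 * (?q ^ L)\<^sup>2" "4 * H"] ennreal_mult[of 4 "?C2 * (?q ^ L)\<^sup>2 * (4 * H)"]
        unfolding ennreal_numeral by (simp del: ennreal_mult'')
      also have "4 * (?C2 * (?q ^ L)\<^sup>2 * (4 * H)) = (16 * ?C2 * H) * (?q\<^sup>2) ^ L"
        by (simp add: power_mult[symmetric] mult.commute[of 2 L])
      finally show ?thesis .
    qed
    also have "ennreal (4 / (1 - ?q)) * (\<Sum>i<L. ennreal (1 / ?q ^ i) * (ennreal (?C2 * (?q ^ i)\<^sup>2) * d (k - 1 - int i)))
       = ennreal (4 * ?C2 / (1 - ?q)) * (\<Sum>i<L. ennreal (?q ^ i) * d (k - 1 - int i))"
    proof -
      have "ennreal (1 / ?q ^ i) * (ennreal (?C2 * (?q ^ i)\<^sup>2) * d (k - 1 - int i)) = ennreal ?C2 * (ennreal (?q ^ i) * d (k - 1 - int i))" for i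
      proof -
        have "1 / ?q ^ i * (?C2 * (?q ^ i)\<^sup>2) = ?C2 * ?q ^ i" using q by (simp add: power2_eq_square)
        then have "ennreal (1 / ?q ^ i) * ennreal (?C2 * (?q ^ i)\<^sup>2) = ennreal ?C2 * ennreal (?q ^ i)"
          using q ennreal_mult[of "1 / ?q ^ i" "?C2 * (?q ^ i)\<^sup>2"] ennreal_mult[of ?C2 "?q ^ i"] by simp
        then show ?thesis unfolding mult.assoc[symmetric] by simp
      qed
      then have "(\<Sum>i<L. ennreal (1 / ?q ^ i) * (ennreal (?C2 * (?q ^ i)\<^sup>2) * d (k - 1 - int i))) = ennreal ?C2 * (\<Sum>i<L. ennreal (?q ^ i) * d (k - 1 - int i))"
        by (simp only: sum_distrib_left)
      moreover have "ennreal (4 / (1 - ?q)) * ennreal ?C2 = ennreal (4 * ?C2 / (1 - ?q))"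
        using q ennreal_mult[of "4 / (1 - ?q)" ?C2] by simp
      ultimately show ?thesis by (simp only: mult.assoc[symmetric])
    qed
    also have "ennreal ((16 * ?C2 * H) * (?q\<^sup>2) ^ L) + ennreal (4 * ?C2 / (1 - ?q)) * (\<Sum>i<L. ennreal (?q ^ i) * d (k - 1 - int i))
        + 2 * (ennreal (?c * cosc CARD('n) a * A\<^sup>2) * (\<Sum>i. ennreal (?q ^ i) * d (k + int i)))
      \<le> ennreal ((16 * ?C2 * H) * (?q\<^sup>2) ^ L) + ennreal (4 * ?C2 / (1 - ?q)) * (\<Sum>i. ennreal (?q ^ i) * d (k - 1 - int i))
        + ennreal (2 * ?c * cosc CARD('n) a * A\<^sup>2) * (\<Sum>i. ennreal (?q ^ i) * d (k + int i))"
    proof (intro add_mono mult_left_mono sum_le_suminf)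
      have "2 * (ennreal (?c * cosc CARD('n) a * A\<^sup>2)) = ennreal (2 * ?c * cosc CARD('n) a * A\<^sup>2)"
        using c0 cosc_nonneg[OF a, of "CARD('n)"] ennreal_mult[of 2 "?c * cosc CARD('n) a * A\<^sup>2"] by (simp add: mult.assoc)
      then show "2 * (ennreal (?c * cosc CARD('n) a * A\<^sup>2) * (\<Sum>i. ennreal (?q ^ i) * d (k + int i))) \<le> ennreal (2 * ?c * cosc CARD('n) a * A\<^sup>2) * (\<Sum>i. ennreal (?q ^ i) * d (k + int i))"
        unfolding mult.assoc[symmetric] by simp
    qed auto
    also have "\<dots> \<le> ennreal (corth CARD('n) a * A\<^sup>2) * (\<Sum>i. ennreal (?q ^ i) * (d (k + int i) + d (k - 1 - int i))) + ennreal ((16 * ?C2 * H) * (?q\<^sup>2) ^ L)"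
    proof -
      let ?S1 = "\<Sum>i. ennreal (?q ^ i) * d (k - 1 - int i)" and ?S2 = "\<Sum>i. ennreal (?q ^ i) * d (k + int i)"
      have S: "(\<Sum>i. ennreal (?q ^ i) * (d (k + int i) + d (k - 1 - int i))) = ?S2 + ?S1"
        unfolding distrib_left by (rule suminf_add[symmetric]) auto
      have "ennreal (4 * ?C2 / (1 - ?q)) * ?S1 \<le> ennreal (corth CARD('n) a * A\<^sup>2) * ?S1"
      proof (intro mult_right_mono ennreal_leI)
        have "0 \<le> 2 * ?c * cosc CARD('n) a * A\<^sup>2" using c0 cosc_nonneg[OF a, of "CARD('n)"] by simp
        then show "4 * ?C2 / (1 - ?q) \<le> corth CARD('n) a * A\<^sup>2" unfolding corth_def by (simp add: distrib_right)
      qed auto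
      moreover have "ennreal (2 * ?c * cosc CARD('n) a * A\<^sup>2) * ?S2 \<le> ennreal (corth CARD('n) a * A\<^sup>2) * ?S2"
      proof (rule mult_right_mono[OF ennreal_leI])
        have "0 \<le> 4 * ?C2 / (1 - ?q)" using q by simp
        then show "2 * ?c * cosc CARD('n) a * A\<^sup>2 \<le> corth CARD('n) a * A\<^sup>2" unfolding corth_def by (simp add: distrib_right)
      qed auto
      ultimately have "ennreal (4 * ?C2 / (1 - ?q)) * ?S1 + ennreal (2 * ?c * cosc CARD('n) a * A\<^sup>2) * ?S2 \<le> ennreal (corth CARD('n) a * A\<^sup>2) * ?S1 + ennreal (corth CARD('n) a * A\<^sup>2) * ?S2"
        by (rule add_mono)
      then show ?thesis unfolding S by (simp add: distrib_left add_ac add_left_mono)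
    qed
    finally show ?thesis .
  qed
  then show ?thesis
    by (rule ennreal_le_of_tendsto) (use q in \<open>auto simp: power_less_one_iff abs_square_less_1\<close>)
qed

end

section \<open>From the continuous parameter to dyadic scales; layer cake formula\<close>

text \<open>With the ceiling, the cubes attached to \<open>t\<close> have side in [t, 2 t), which is
  what \<open>op_kernel\<close> demands of \<open>k\<close>.\<close>

definition kk :: "real \<Rightarrow> int" where "kk t = \<lceil>log 2 t\<rceil>"

lemma kk_bounds: "0 < t \<Longrightarrow> 2 powr (real_of_int (kk t) - 1) < t" "0 < t \<Longrightarrow> t \<le> 2 powr real_of_int (kk t)"
proof -
  assume t: "0 < t"
  have "real_of_int (kk t) - 1 < log 2 t" "log 2 t \<le> real_of_int (kk t)"
    unfolding kk_def by linarith+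
  then show "2 powr (real_of_int (kk t) - 1) < t" "t \<le> 2 powr real_of_int (kk t)"
    using t by (simp_all add: less_log_iff log_le_iff)
qed

lemma kk_le_iff: "0 < t \<Longrightarrow> kk t \<le> K \<longleftrightarrow> t \<le> 2 powr real_of_int K"
  unfolding kk_def by (simp add: ceiling_le_iff log_le_iff)

lemma kk_measurable [measurable]: "kk \<in> borel \<rightarrow>\<^sub>M count_space UNIV"
  unfolding kk_def[abs_def] by measurable

text \<open>The parameters of one scale form the interval from 2^(k - 1) to 2^k. Its length divided
  by its left endpoint is 1, and this bounds its measure for dt / t.\<close>

lemma nn_integral_kk:
  fixes g :: "int \<Rightarrow> ennreal"
  shows "(\<integral>\<^sup>+t. indicator {0<..} t * ennreal (1 / t) * g (kk t) \<partial>lborel) \<le> (\<integral>\<^sup>+k. g k \<partial>count_space UNIV)"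
proof -
  interpret P: pair_sigma_finite lborel "count_space (UNIV :: int set)"
    by (intro pair_sigma_finite.intro sigma_finite_lborel sigma_finite_measure_count_space)
  let ?I = "\<lambda>k t. indicator {t. 0 < t \<and> kk t = k} t * ennreal (1 / t)"
  have "(\<integral>\<^sup>+t. indicator {0<..} t * ennreal (1 / t) * g (kk t) \<partial>lborel)
    = (\<integral>\<^sup>+t. \<integral>\<^sup>+k. ?I k t * g k \<partial>count_space UNIV \<partial>lborel)"
  proof (rule nn_integral_cong)
    fix t :: real
    have "(\<integral>\<^sup>+k. ?I k t * g k \<partial>count_space UNIV) = (\<Sum>k\<in>{kk t}. ?I k t * g k)"
      by (rule nn_integral_count_space') auto
    then show "indicator {0<..} t * ennreal (1 / t) * g (kk t) = (\<integral>\<^sup>+k. ?I k t * g k \<partial>count_space UNIV)"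
      by (simp add: indicator_def)
  qed
  also have "\<dots> = (\<integral>\<^sup>+k. \<integral>\<^sup>+t. ?I k t * g k \<partial>lborel \<partial>count_space UNIV)"
    by (rule P.Fubini'[symmetric]) measurable
  also have "\<dots> \<le> (\<integral>\<^sup>+k. g k \<partial>count_space UNIV)"
  proof (rule nn_integral_mono)
    fix k :: int
    let ?p = "2 powr (real_of_int k - 1)"
    have p2: "2 powr real_of_int k = 2 * ?p" by (simp add: powr_diff)
    have "(\<integral>\<^sup>+t. ?I k t \<partial>lborel) \<le> (\<integral>\<^sup>+t. ennreal (1 / ?p) * indicator {?p<..2 powr real_of_int k} t \<partial>lborel)"
    proof (rule nn_integral_mono)
      fix t :: real
      show "?I k t \<le> ennreal (1 / ?p) * indicator {?p<..2 powr real_of_int k} t"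
      proof (cases "0 < t \<and> kk t = k")
        case True
        have b: "?p < t" "t \<le> 2 powr real_of_int k" using kk_bounds[of t] True by auto
        then have "1 / t \<le> 1 / ?p" by (intro divide_left_mono) (auto intro!: mult_pos_pos simp: True)
        then show ?thesis using b True by (simp add: ennreal_leI)
      qed simp
    qed
    also have "\<dots> = ennreal (1 / ?p) * ennreal (2 powr real_of_int k - ?p)"
      by (subst nn_integral_cmult_indicator) (auto simp: p2)
    also have "\<dots> = ennreal (1 / ?p * (2 powr real_of_int k - ?p))"
      by (rule ennreal_mult[symmetric]) (auto simp: p2)
    also have "1 / ?p * (2 powr real_of_int k - ?p) = 1" unfolding p2 by simp
    finally have "(\<integral>\<^sup>+t. ?I k t \<partial>lborel) \<le> 1" by simp
    then have "(\<integral>\<^sup>+t. ?I k t \<partial>lborel) * g k \<le> 1 * g k" by (rule mult_right_mono) simp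
    then show "(\<integral>\<^sup>+t. ?I k t * g k \<partial>lborel) \<le> g k"
      by (subst nn_integral_multc) auto
  qed
  finally show ?thesis .
qed

lemma nn_integral_int_shift:
  fixes g :: "int \<Rightarrow> ennreal"
  shows "(\<integral>\<^sup>+k. g (k + s) \<partial>count_space UNIV) = (\<integral>\<^sup>+k. g k \<partial>count_space UNIV)"
  by (rule nn_integral_bij_count_space) (auto intro!: bij_betwI[where g="\<lambda>k. k - s"])

lemma nn_integral_int_le:
  fixes g :: "int \<Rightarrow> ennreal"
  assumes "\<And>N k. (\<Sum>i<N. g (k + int i)) \<le> B"
  shows "(\<integral>\<^sup>+k. g k \<partial>count_space UNIV) \<le> B"
proof -
  let ?f = "\<lambda>N::nat. \<lambda>k. g k * indicator {- int N..<int N} k"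
  have "g k = (SUP N. ?f N k)" for k
  proof (rule antisym)
    have "k \<in> {- int (nat \<bar>k\<bar> + 1)..<int (nat \<bar>k\<bar> + 1)}" by auto
    then have "g k = ?f (nat \<bar>k\<bar> + 1) k" by simp
    then show "g k \<le> (SUP N. ?f N k)" using SUP_upper[of "nat \<bar>k\<bar> + 1" UNIV "\<lambda>N. ?f N k"] by simp
  qed (auto intro!: SUP_least simp: indicator_def)
  then have "(\<integral>\<^sup>+k. g k \<partial>count_space UNIV) = (\<integral>\<^sup>+k. (SUP N. ?f N k) \<partial>count_space UNIV)" by simp
  also have "\<dots> = (SUP N. \<integral>\<^sup>+k. ?f N k \<partial>count_space UNIV)"
    by (rule nn_integral_monotone_convergence_SUP) (auto simp: incseq_def le_fun_def indicator_def)
  also have "\<dots> \<le> B"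
  proof (rule SUP_least)
    fix N :: nat
    have "(\<integral>\<^sup>+k. ?f N k \<partial>count_space UNIV) = (\<Sum>k\<in>{- int N..<int N}. ?f N k)"
      by (rule nn_integral_count_space') (auto simp: indicator_def)
    also have "\<dots> = (\<Sum>k\<in>{- int N..<int N}. g k)" by (rule sum.cong) auto
    also have "\<dots> = (\<Sum>i<2 * N. g (- int N + int i))"
      by (rule sum.reindex_bij_witness[of _ "\<lambda>i. - int N + int i" "\<lambda>k. nat (k + int N)"]) auto
    also have "\<dots> \<le> B" by (rule assms)
    finally show "(\<integral>\<^sup>+k. ?f N k \<partial>count_space UNIV) \<le> B" .
  qed
  finally show ?thesis .
qed

lemma layer_cake: "(\<integral>\<^sup>+s. indicator {0<..} s * indicator {s. ennreal s < G} s \<partial>lborel) = (G::ennreal)"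
proof (cases G)
  case (real r)
  have "(\<integral>\<^sup>+s. indicator {0<..} s * indicator {s. ennreal s < G} s \<partial>lborel) = (\<integral>\<^sup>+s. indicator {0<..<r} s \<partial>lborel)"
    using real by (intro nn_integral_cong) (auto simp: indicator_def ennreal_less_iff)
  also have "\<dots> = ennreal r" using real by simp
  finally show ?thesis using real by simp
next
  case top
  have "(\<integral>\<^sup>+s. indicator {0<..} s * indicator {s. ennreal s < G} s \<partial>lborel) = (\<integral>\<^sup>+s. indicator {0<..} (s::real) \<partial>lborel)"
    using top by (intro nn_integral_cong) (auto simp: indicator_def)
  also have "\<dots> = emeasure lborel {0::real<..}" by simp
  also have "\<dots> = \<infinity>"
  proof (rule ccontr)
    assume "emeasure lborel {0::real<..} \<noteq> \<infinity>"
    then obtain r where r: "emeasure lborel {0::real<..} = ennreal r" "0 \<le> r" by (cases "emeasure lborel {0::real<..}") auto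
    have "ennreal (r + 1) = emeasure lborel {0<..<r + 1}" using r by simp
    also have "\<dots> \<le> emeasure lborel {0::real<..}" by (intro emeasure_mono) auto
    finally show False using r by simp
  qed
  finally show ?thesis using top by simp
qed

lemma bessel_sum:
  assumes sM: "sigma_finite_measure M" and F[measurable]: "F \<in> borel_measurable (lborel \<Otimes>\<^sub>M M)"
    and sF: "\<And>w. w \<in> space M \<Longrightarrow> sqi (\<lambda>z::real^'n. F (z, w))"
  shows "(\<integral>\<^sup>+j. (\<integral>\<^sup>+w. \<integral>\<^sup>+z. ennreal ((dd j (\<lambda>z. F (z, w)) z)\<^sup>2) \<partial>lborel \<partial>M) \<partial>count_space UNIV)
     \<le> (\<integral>\<^sup>+w. \<integral>\<^sup>+z. ennreal ((F (z, w))\<^sup>2) \<partial>lborel \<partial>M)"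
proof (rule nn_integral_int_le)
  interpret sigma_finite_measure M by fact
  fix N and k :: int
  have "(\<Sum>i<N. \<integral>\<^sup>+w. \<integral>\<^sup>+z. ennreal ((dd (k + int i) (\<lambda>z. F (z, w)) z)\<^sup>2) \<partial>lborel \<partial>M)
    = (\<integral>\<^sup>+w. (\<Sum>i<N. \<integral>\<^sup>+z. ennreal ((dd (k + int i) (\<lambda>z. F (z, w)) z)\<^sup>2) \<partial>lborel) \<partial>M)"
    by (rule nn_integral_sum[symmetric]) measurable
  also have "\<dots> \<le> (\<integral>\<^sup>+w. \<integral>\<^sup>+z. ennreal ((F (z, w))\<^sup>2) \<partial>lborel \<partial>M)"
    by (rule nn_integral_mono) (rule dd_bessel[OF sF])
  finally show "(\<Sum>i<N. \<integral>\<^sup>+w. \<integral>\<^sup>+z. ennreal ((dd (k + int i) (\<lambda>z. F (z, w)) z)\<^sup>2) \<partial>lborel \<partial>M)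
    \<le> (\<integral>\<^sup>+w. \<integral>\<^sup>+z. ennreal ((F (z, w))\<^sup>2) \<partial>lborel \<partial>M)" .
qed

definition corthi :: "nat \<Rightarrow> real \<Rightarrow> real" where "corthi n a = corth n a * (2 / (1 - qq a))"

lemma corthi_nonneg: "0 < a \<Longrightarrow> 0 \<le> corthi n a"
  unfolding corthi_def using corth_nonneg[of a n] qq_bounds(2)[of a] by simp

text \<open>After summation over the scale of \<open>t\<close>, every shifted sequence
  \<open>d (k + int i)\<close> and \<open>d (k - 1 - int i)\<close> sums to at most the full energy
  of \<open>F\<close>, by translation invariance of counting measure and Bessel. The weights
  \<open>qq a ^ i\<close> form a geometric series, and the two families account for the 2 in
  \<open>corthi\<close>.\<close>

lemma orthogonality_integrated:
  fixes F :: "(real^'n) \<times> 'w \<Rightarrow> real" and Kt :: "real \<Rightarrow> (real^'n) \<times> (real^'n) \<times> 'v \<times> 'w \<Rightarrow> real"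
  assumes op: "\<And>t. 0 < t \<Longrightarrow> op_kernel M N (Kt t) (b t) A a t (kk t)"
    and F[measurable]: "F \<in> borel_measurable (lborel \<Otimes>\<^sub>M M)"
    and sF: "\<And>w. w \<in> space M \<Longrightarrow> sqi (\<lambda>z. F (z, w))"
    and fin: "(\<integral>\<^sup>+w. \<integral>\<^sup>+z. ennreal ((F (z, w))\<^sup>2) \<partial>lborel \<partial>M) < \<infinity>"
  shows "(\<integral>\<^sup>+t. indicator {0<..} t * ennreal (1 / t) *
      (\<integral>\<^sup>+y. \<integral>\<^sup>+v. ennreal ((\<integral>p. Kt t (y, fst p, v, snd p) * (F p - dexp (kk t) (\<lambda>z. F (z, snd p)) y) \<partial>(lborel \<Otimes>\<^sub>M M))\<^sup>2) \<partial>N \<partial>lborel) \<partial>lborel)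
     \<le> ennreal (corthi CARD('n) a * A\<^sup>2) * (\<integral>\<^sup>+w. \<integral>\<^sup>+z. ennreal ((F (z, w))\<^sup>2) \<partial>lborel \<partial>M)"
    (is "(\<integral>\<^sup>+t. _ * _ * ?X t \<partial>lborel) \<le> _ * ?H")
proof -
  interpret o1: op_kernel M N "Kt 1" "b 1" A a 1 "kk 1" by (rule op) simp
  have a: "0 < a" by (rule o1.a)
  let ?q = "qq a" and ?c = "corth CARD('n) a * A\<^sup>2"
  have q: "0 < ?q" "?q < 1" using qq_bounds a by auto
  define d where "d = (\<lambda>j. \<integral>\<^sup>+w. \<integral>\<^sup>+z. ennreal ((dd j (\<lambda>z. F (z, w)) z)\<^sup>2) \<partial>lborel \<partial>M)"
  have X: "?X t \<le> ennreal ?c * (\<Sum>i. ennreal (?q ^ i) * (d (kk t + int i) + d (kk t - 1 - int i)))" if "0 < t" for t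
    using op_kernel.orthogonality[OF op[OF that] F sF fin] by (simp add: d_def)
  have D: "(\<integral>\<^sup>+k. d (k + s) \<partial>count_space UNIV) \<le> ?H" for s
    unfolding nn_integral_int_shift[of d] unfolding d_def by (rule bessel_sum[OF o1.sM F sF])
  have "(\<integral>\<^sup>+t. indicator {0<..} t * ennreal (1 / t) * ?X t \<partial>lborel)
    \<le> (\<integral>\<^sup>+t. indicator {0<..} t * ennreal (1 / t) * (ennreal ?c * (\<Sum>i. ennreal (?q ^ i) * (d (kk t + int i) + d (kk t - 1 - int i)))) \<partial>lborel)"
  proof (rule nn_integral_mono)
    fix t :: real
    show "indicator {0<..} t * ennreal (1 / t) * ?X t \<le> indicator {0<..} t * ennreal (1 / t) * (ennreal ?c * (\<Sum>i. ennreal (?q ^ i) * (d (kk t + int i) + d (kk t - 1 - int i))))"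
    proof (cases "0 < t")
      case True
      show ?thesis by (rule mult_left_mono[OF X[OF True]]) simp
    qed simp
  qed
  also have "\<dots> \<le> (\<integral>\<^sup>+k. ennreal ?c * (\<Sum>i. ennreal (?q ^ i) * (d (k + int i) + d (k - 1 - int i))) \<partial>count_space UNIV)"
    by (rule nn_integral_kk)
  also have "\<dots> = ennreal ?c * (\<Sum>i. ennreal (?q ^ i) * ((\<integral>\<^sup>+k. d (k + int i) \<partial>count_space UNIV) + (\<integral>\<^sup>+k. d (k - 1 - int i) \<partial>count_space UNIV)))"
    by (simp add: nn_integral_cmult nn_integral_suminf nn_integral_add)
  also have "\<dots> \<le> ennreal ?c * (\<Sum>i. ennreal (?q ^ i) * (2 * ?H))"
  proof (intro mult_left_mono suminf_le allI)
    fix i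
    have "(\<integral>\<^sup>+k. d (k + int i) \<partial>count_space UNIV) + (\<integral>\<^sup>+k. d (k - 1 - int i) \<partial>count_space UNIV) \<le> ?H + ?H"
      using D[of "int i"] D[of "- 1 - int i"] by (intro add_mono) (simp_all add: algebra_simps)
    then show "(\<integral>\<^sup>+k. d (k + int i) \<partial>count_space UNIV) + (\<integral>\<^sup>+k. d (k - 1 - int i) \<partial>count_space UNIV) \<le> 2 * ?H"
      by (simp add: mult_2)
  qed auto
  also have "(\<Sum>i. ennreal (?q ^ i) * (2 * ?H)) = (\<Sum>i. ennreal (?q ^ i)) * (2 * ?H)"
    by simp
  also have "(\<Sum>i. ennreal (?q ^ i)) = ennreal (1 / (1 - ?q))"
    using q by (intro suminf_ennreal_eq geometric_sums) auto
  also have "ennreal ?c * (ennreal (1 / (1 - ?q)) * (2 * ?H)) = ennreal (corthi CARD('n) a * A\<^sup>2) * ?H"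
  proof -
    have "corthi CARD('n) a * A\<^sup>2 = ?c * (1 / (1 - ?q) * 2)" by (simp add: corthi_def mult_ac)
    moreover have "ennreal (?c * (1 / (1 - ?q) * 2)) = ennreal ?c * (ennreal (1 / (1 - ?q)) * 2)"
      using q corth_nonneg[OF a, of "CARD('n)"] by (simp add: ennreal_mult[symmetric] ennreal_mult''[symmetric] flip: ennreal_numeral)
    ultimately show ?thesis by (simp add: mult.assoc)
  qed
  finally show ?thesis .
qed

subsection \<open>The dyadic maximal function\<close>

text \<open>Running maximum over the scales \<open>b\<close>, \<open>b - 1\<close>, ...,
  \<open>b - i\<close>. It proceeds from coarse to fine, so that after step \<open>i\<close> it is a
  step function of the scale just reached.\<close>

primrec dmx :: "int \<Rightarrow> (real^'n \<Rightarrow> real) \<Rightarrow> nat \<Rightarrow> real^'n \<Rightarrow> real" where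
  "dmx b h 0 x = dexp b h x"
| "dmx b h (Suc i) x = max (dmx b h i x) (dexp (b - int (Suc i)) h x)"

lemma dmx_ge: "j \<le> i \<Longrightarrow> dexp (b - int j) h x \<le> dmx b h i x"
  by (induction i) (auto simp: le_Suc_eq intro: le_max_iff_disj[THEN iffD2])

lemma dmx_props:
  assumes h: "sqi h"
  shows "sqi (dmx b h i)" "dconst (b - int i) (dmx b h i)"
proof (induction i)
  case 0
  have e: "dmx b h 0 = dexp b h" by (rule ext) simp
  show "sqi (dmx b h 0)" unfolding e by (rule sqi_dexp[OF h])
  show "dconst (b - int 0) (dmx b h 0)" unfolding e using dexp_dconst[of b h] by simp
next
  case (Suc i)
  have m[measurable]: "dmx b h i \<in> borel_measurable borel" "dexp (b - int (Suc i)) h \<in> borel_measurable borel"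
    using Suc(1) sqi_dexp[OF h] by (auto simp: sqi_def)
  have "(\<integral>\<^sup>+x. ennreal ((dmx b h (Suc i) x)\<^sup>2) \<partial>lborel) \<le> (\<integral>\<^sup>+x. ennreal ((dmx b h i x)\<^sup>2) + ennreal ((dexp (b - int (Suc i)) h x)\<^sup>2) \<partial>lborel)"
    by (intro nn_integral_mono) (auto simp: max_def)
  also have "\<dots> < \<infinity>"
    using Suc(1) sqi_dexp[OF h, of "b - int (Suc i)"] by (subst nn_integral_add) (auto simp: sqi_def)
  moreover have "dmx b h (Suc i) \<in> borel_measurable borel" unfolding dmx.simps(2)[abs_def] by measurable
  ultimately show "sqi (dmx b h (Suc i))" unfolding sqi_def by simp
  have "dconst (b - int (Suc i)) (dmx b h i)" by (rule dconst_mono[OF Suc(2)]) simp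
  then show "dconst (b - int (Suc i)) (dmx b h (Suc i))"
    using dexp_dconst[of "b - int (Suc i)" h] unfolding dconst_def dmx.simps by metis
qed

text \<open>Doob's inequality from a pointwise telescoping. For S' = max S X one has S'^2 \<le> S^2
  + 2 (S' - S) X, which is (X - S)^2 \<ge> 0 where the maximum moves. The increment S' - S is a step
  function at the scale of the average X, so X may be replaced by \<open>h\<close> under the
  integral, and the increments telescope.\<close>

lemma dmx_energy:
  assumes h: "sqi h" and h0: "\<And>x. 0 \<le> h x"
  shows "(\<integral>x. (dmx b h i x)\<^sup>2 \<partial>lborel) \<le> 2 * (\<integral>x. dmx b h i x * h x \<partial>lborel)"
proof (induction i)
  case 0
  have "0 \<le> (\<integral>x. (dexp b h x)\<^sup>2 \<partial>lborel)" by simp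
  moreover have "(\<integral>x. (dexp b h x)\<^sup>2 \<partial>lborel) = (\<integral>x. dexp b h x * h x \<partial>lborel)"
    unfolding power2_eq_square by (rule integral_dconst_dexp[OF sqi_dexp[OF h] h dexp_dconst])
  ultimately show ?case by simp
next
  case (Suc i)
  let ?S = "dmx b h i" and ?S' = "dmx b h (Suc i)" and ?X = "dexp (b - int (Suc i)) h"
  have s: "sqi ?S" "sqi ?S'" "sqi ?X" using dmx_props[OF h] sqi_dexp[OF h] by auto
  have sd: "sqi (\<lambda>x. ?S' x - ?S x)" by (rule sqi_diff[OF s(2,1)])
  have dc: "dconst (b - int (Suc i)) (\<lambda>x. ?S' x - ?S x)"
  proof -
    have "dconst (b - int (Suc i)) ?S" by (rule dconst_mono[OF dmx_props(2)[OF h]]) simp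
    then show ?thesis using dmx_props(2)[OF h, of b "Suc i"] unfolding dconst_def by metis
  qed
  have S0: "0 \<le> ?S x" for x
  proof -
    have "0 \<le> dexp b h x" unfolding dexp_def using h0 by (intro Bochner_Integration.integral_nonneg) auto
    then show ?thesis using dmx_ge[of 0 i b h x] by simp
  qed
  have "(\<integral>x. (?S' x)\<^sup>2 \<partial>lborel) \<le> (\<integral>x. (?S x)\<^sup>2 + 2 * ((?S' x - ?S x) * ?X x) \<partial>lborel)"
  proof (rule integral_mono)
    show "integrable lborel (\<lambda>x. (?S x)\<^sup>2 + 2 * ((?S' x - ?S x) * ?X x))"
      by (intro Bochner_Integration.integrable_add integrable_mult_right sqi_integrable s sqi_prod_integrable[OF sd s(3)])
    fix x
    show "(?S' x)\<^sup>2 \<le> (?S x)\<^sup>2 + 2 * ((?S' x - ?S x) * ?X x)"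
    proof (cases "?S x \<le> ?X x")
      case True
      then have "?S' x = ?X x" by simp
      moreover have "0 \<le> (?X x - ?S x)\<^sup>2" by simp
      ultimately show ?thesis by (simp add: power2_eq_square algebra_simps)
    next
      case False
      then show ?thesis by simp
    qed
  qed (rule sqi_integrable[OF s(2)])
  also have "\<dots> = (\<integral>x. (?S x)\<^sup>2 \<partial>lborel) + 2 * (\<integral>x. (?S' x - ?S x) * ?X x \<partial>lborel)"
    using sqi_integrable[OF s(1)] sqi_prod_integrable[OF sd s(3)] by simp
  also have "(\<integral>x. (?S' x - ?S x) * ?X x \<partial>lborel) = (\<integral>x. (?S' x - ?S x) * h x \<partial>lborel)"
    by (rule integral_dconst_dexp[OF sd h dc])
  also have "\<dots> = (\<integral>x. ?S' x * h x \<partial>lborel) - (\<integral>x. ?S x * h x \<partial>lborel)"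
    using sqi_prod_integrable[OF s(2) h] sqi_prod_integrable[OF s(1) h] by (simp add: left_diff_distrib)
  finally have *: "(\<integral>x. (?S' x)\<^sup>2 \<partial>lborel) \<le> (\<integral>x. (?S x)\<^sup>2 \<partial>lborel) + 2 * ((\<integral>x. ?S' x * h x \<partial>lborel) - (\<integral>x. ?S x * h x \<partial>lborel))" .
  have "p \<le> q + 2 * (r - s) \<Longrightarrow> q \<le> 2 * s \<Longrightarrow> p \<le> 2 * r" for p q r s :: real by (simp add: algebra_simps)
  from this[OF * Suc] show ?case .
qed

text \<open>2 S h \<le> S^2 / 2 + 2 h^2, and the first term is absorbed on the left, where the
  integral is finite by \<open>dmx_props\<close>. The constant is independent of the number of
  scales, which allows the supremum afterwards.\<close>

lemma dmx_bound:
  assumes h: "sqi h" and h0: "\<And>x. 0 \<le> h x"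
  shows "(\<integral>\<^sup>+x. ennreal ((dmx b h i x)\<^sup>2) \<partial>lborel) \<le> 4 * (\<integral>\<^sup>+x. ennreal ((h x)\<^sup>2) \<partial>lborel)"
proof -
  let ?S = "dmx b h i"
  have s: "sqi ?S" using dmx_props[OF h] by auto
  have "2 * (\<integral>x. ?S x * h x \<partial>lborel) = (\<integral>x. 2 * (?S x * h x) \<partial>lborel)" by simp
  also have "\<dots> \<le> (\<integral>x. (1/2) * (?S x)\<^sup>2 + 2 * (h x)\<^sup>2 \<partial>lborel)"
  proof (rule integral_mono)
    fix x
    have "0 \<le> (?S x - 2 * h x)\<^sup>2" by simp
    then show "2 * (?S x * h x) \<le> (1/2) * (?S x)\<^sup>2 + 2 * (h x)\<^sup>2" by (simp add: power2_eq_square algebra_simps)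
  qed (use sqi_prod_integrable[OF s h] sqi_integrable[OF s] sqi_integrable[OF h] in auto)
  also have "\<dots> = (1/2) * (\<integral>x. (?S x)\<^sup>2 \<partial>lborel) + 2 * (\<integral>x. (h x)\<^sup>2 \<partial>lborel)"
    using sqi_integrable[OF s] sqi_integrable[OF h] by simp
  finally have "(\<integral>x. (?S x)\<^sup>2 \<partial>lborel) \<le> 4 * (\<integral>x. (h x)\<^sup>2 \<partial>lborel)"
    using dmx_energy[OF h h0, of b i] by linarith
  then show ?thesis using ennreal_leI by (fastforce simp: sqi_nn[OF s] sqi_nn[OF h] ennreal_mult)
qed

text \<open>Extended values allow the operator to be iterated in the two variables without knowing
  that the inner maximal function is finite.\<close>

definition dmax :: "(real^'n \<Rightarrow> ennreal) \<Rightarrow> real^'n \<Rightarrow> ennreal" where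
  "dmax f x = (SUP k. \<integral>\<^sup>+z. ennreal (dker k x z) * f z \<partial>lborel)"

lemma dmax_measurable [measurable (raw)]:
  assumes [measurable]: "f \<in> borel_measurable M" "case_prod g \<in> borel_measurable (M \<Otimes>\<^sub>M lborel)"
  shows "(\<lambda>x. dmax (g x) (f x)) \<in> borel_measurable M"
  unfolding dmax_def by measurable

lemma SUP_int_eq_SUP_nat:
  fixes g :: "int \<Rightarrow> ennreal"
  shows "(SUP k. g k) = (SUP N. SUP k\<in>{- int N..int N}. g k)"
proof (rule antisym)
  show "(SUP k. g k) \<le> (SUP N. SUP k\<in>{- int N..int N}. g k)"
  proof (rule SUP_least)
    fix k :: int
    have "g k \<le> (SUP j\<in>{- int (nat \<bar>k\<bar>)..int (nat \<bar>k\<bar>)}. g j)" by (rule SUP_upper) auto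
    also have "\<dots> \<le> (SUP N. SUP k\<in>{- int N..int N}. g k)" by (rule SUP_upper) auto
    finally show "g k \<le> (SUP N. SUP k\<in>{- int N..int N}. g k)" .
  qed
qed (auto intro!: SUP_least SUP_upper)

lemma SUP_power2_ennreal:
  fixes g :: "nat \<Rightarrow> ennreal"
  assumes "incseq g" shows "(SUP N. g N)\<^sup>2 = (SUP N. (g N)\<^sup>2)"
proof (rule antisym)
  have "(SUP N. g N)\<^sup>2 = (SUP i. SUP j. g i * g j)"
    unfolding power2_eq_square by (subst SUP_mult_right_ennreal) (simp_all add: SUP_mult_left_ennreal)
  also have "\<dots> \<le> (SUP N. (g N)\<^sup>2)"
  proof (intro SUP_least)
    fix i j
    have "g i * g j \<le> (g (max i j))\<^sup>2" unfolding power2_eq_square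
      by (intro mult_mono incseqD[OF assms]) auto
    also have "\<dots> \<le> (SUP N. (g N)\<^sup>2)" by (rule SUP_upper) simp
    finally show "g i * g j \<le> (SUP N. (g N)\<^sup>2)" .
  qed
  finally show "(SUP N. g N)\<^sup>2 \<le> (SUP N. (g N)\<^sup>2)" .
qed (auto intro!: SUP_least power_mono SUP_upper)

text \<open>If the right-hand side is finite, \<open>f\<close> agrees almost everywhere with a real
  square integrable \<open>h\<close>. The supremum over all scales is then the increasing limit of
  the maxima over the windows from \<open>N\<close> down to \<open>-N\<close>, that is of
  \<open>dmx (int N) h (2 * N)\<close>, and monotone convergence applies.\<close>

lemma dmax_bound:
  assumes [measurable]: "f \<in> borel_measurable borel"
  shows "(\<integral>\<^sup>+x. (dmax f x)\<^sup>2 \<partial>lborel) \<le> 4 * (\<integral>\<^sup>+x. (f x)\<^sup>2 \<partial>lborel)"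
proof (cases "(\<integral>\<^sup>+x. (f x)\<^sup>2 \<partial>lborel) = \<infinity>")
  case True
  then show ?thesis by (simp add: ennreal_mult_top)
next
  case False
  define h where "h = (\<lambda>x. enn2real (f x))"
  have h[measurable]: "h \<in> borel_measurable borel" unfolding h_def by measurable
  have h0: "0 \<le> h x" for x by (simp add: h_def)
  have "AE x in lborel. (f x)\<^sup>2 \<noteq> \<infinity>" using False by (intro nn_integral_PInf_AE) auto
  then have AE: "AE x in lborel. f x = ennreal (h x)"
    by eventually_elim (auto simp: h_def power2_eq_square ennreal_mult_eq_top_iff less_top)
  have eq: "(\<integral>\<^sup>+x. (f x)\<^sup>2 \<partial>lborel) = (\<integral>\<^sup>+x. ennreal ((h x)\<^sup>2) \<partial>lborel)"
    by (rule nn_integral_cong_AE) (use AE in eventually_elim, simp add: ennreal_power h0)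
  have sh: "sqi h" unfolding sqi_def using eq False h by (simp add: less_top)
  have E: "(\<integral>\<^sup>+z. ennreal (dker k x z) * f z \<partial>lborel) = ennreal (dexp k h x)" for k x
  proof -
    have "(\<integral>\<^sup>+z. ennreal (dker k x z) * f z \<partial>lborel) = (\<integral>\<^sup>+z. ennreal (dker k x z * h z) \<partial>lborel)"
      by (rule nn_integral_cong_AE) (use AE in eventually_elim, simp add: ennreal_mult h0)
    also have "\<dots> = ennreal (dexp k h x)" unfolding dexp_def
      using h0 by (intro nn_integral_eq_integral sqi_prod_integrable sqi_dker sh) auto
    finally show ?thesis .
  qed
  have sup: "(dmax f x)\<^sup>2 = (SUP N. ennreal ((dmx (int N) h (2 * N) x)\<^sup>2)) \<and> incseq (\<lambda>N. ennreal ((dmx (int N) h (2 * N) x)\<^sup>2))" for x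
  proof -
    have d0: "0 \<le> dexp k h x" for k x unfolding dexp_def using h0 by (intro Bochner_Integration.integral_nonneg) auto
    have up: "dmx b h i x \<in> {dexp (b - int j) h x |j. j \<le> i}" for b i x
    proof (induction i)
      case (Suc i)
      show ?case
      proof (cases "dmx b h i x \<le> dexp (b - int (Suc i)) h x")
        case True
        then have "dmx b h (Suc i) x = dexp (b - int (Suc i)) h x" by (simp add: max_absorb2)
        then show ?thesis by blast
      next
        case False
        then have "dmx b h (Suc i) x = dmx b h i x" by (simp add: max_absorb1)
        then show ?thesis using Suc le_SucI by fastforce
      qed
    qed auto
    have mx: "(SUP k\<in>{- int N..int N}. ennreal (dexp k h x)) = ennreal (dmx (int N) h (2 * N) x)" for N
    proof (rule antisym)
      show "(SUP k\<in>{- int N..int N}. ennreal (dexp k h x)) \<le> ennreal (dmx (int N) h (2 * N) x)"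
      proof (rule SUP_least)
        fix k assume k: "k \<in> {- int N..int N}"
        have "dexp (int N - int (nat (int N - k))) h x \<le> dmx (int N) h (2 * N) x"
          using k by (intro dmx_ge) auto
        then show "ennreal (dexp k h x) \<le> ennreal (dmx (int N) h (2 * N) x)" using k by (simp add: ennreal_leI)
      qed
      obtain j where "j \<le> 2 * N" "dmx (int N) h (2 * N) x = dexp (int N - int j) h x" using up[of "int N" "2 * N" x] by auto
      then show "ennreal (dmx (int N) h (2 * N) x) \<le> (SUP k\<in>{- int N..int N}. ennreal (dexp k h x))"
        by (auto intro!: SUP_upper)
    qed
    have m0: "0 \<le> dmx b h i x" for b i x using dmx_ge[of 0 i b h x] d0[of b x] by simp
    have "dmax f x = (SUP N. ennreal (dmx (int N) h (2 * N) x))"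
      unfolding dmax_def E SUP_int_eq_SUP_nat mx ..
    moreover have "incseq (\<lambda>N. ennreal (dmx (int N) h (2 * N) x))"
      unfolding mx[symmetric] incseq_def by (auto intro!: SUP_subset_mono)
    moreover from this have "incseq (\<lambda>N. (ennreal (dmx (int N) h (2 * N) x))\<^sup>2)"
      unfolding incseq_def by (auto intro: power_mono)
    ultimately show ?thesis
      using SUP_power2_ennreal[of "\<lambda>N. ennreal (dmx (int N) h (2 * N) x)"] by (simp add: ennreal_power m0)
  qed
  have [measurable]: "dmx b h i \<in> borel_measurable borel" for b i
    using dmx_props(1)[OF sh] by (simp add: sqi_def)
  have "(\<integral>\<^sup>+x. (dmax f x)\<^sup>2 \<partial>lborel) = (\<integral>\<^sup>+x. (SUP N. ennreal ((dmx (int N) h (2 * N) x)\<^sup>2)) \<partial>lborel)" using sup by simp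
  also have "\<dots> = (SUP N. \<integral>\<^sup>+x. ennreal ((dmx (int N) h (2 * N) x)\<^sup>2) \<partial>lborel)"
    using sup by (intro nn_integral_monotone_convergence_SUP) (auto simp: incseq_def le_fun_def)
  also have "\<dots> \<le> 4 * (\<integral>\<^sup>+x. ennreal ((h x)\<^sup>2) \<partial>lborel)"
    by (intro SUP_least dmx_bound sh h0)
  finally show ?thesis unfolding eq .
qed

text \<open>\<open>kk\<close> takes countably many values, so measurability can be checked at each
  fixed scale.\<close>

lemma dexp_kk_measurable [measurable (raw)]:
  assumes [measurable]: "T \<in> borel_measurable M" "f \<in> borel_measurable M" "case_prod g \<in> borel_measurable (M \<Otimes>\<^sub>M lborel)"
  shows "(\<lambda>x. dexp (kk (T x)) (g x) (f x)) \<in> borel_measurable M"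
  by (rule measurable_compose_countable[where g="\<lambda>x. kk (T x)" and f="\<lambda>k x. dexp k (g x) (f x)"]) measurable

lemma dker_kk_measurable [measurable (raw)]:
  assumes [measurable]: "T \<in> borel_measurable M" "f \<in> borel_measurable M" "g \<in> borel_measurable M"
  shows "(\<lambda>x. dker (kk (T x)) (f x) (g x)) \<in> borel_measurable M"
  by (rule measurable_compose_countable[where g="\<lambda>x. kk (T x)" and f="\<lambda>k x. dker k (f x) (g x)"]) measurable

lemma dexp_abs_le: "ennreal \<bar>dexp k h x\<bar> \<le> (\<integral>\<^sup>+z. ennreal (dker k x z) * ennreal \<bar>h z\<bar> \<partial>lborel)"
proof -
  have "ennreal \<bar>dexp k h x\<bar> \<le> (\<integral>\<^sup>+z. ennreal \<bar>dker k x z * h z\<bar> \<partial>lborel)"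
    unfolding dexp_def
    using integral_norm_bound_ennreal[of lborel "\<lambda>z. dker k x z * h z"] not_integrable_integral_eq[of lborel "\<lambda>z. dker k x z * h z"]
    by (cases "integrable lborel (\<lambda>z. dker k x z * h z)") auto
  then show ?thesis by (simp add: abs_mult ennreal_mult)
qed

lemma dexp_sq_le_dmax: "ennreal ((dexp k h x)\<^sup>2) \<le> (dmax (\<lambda>z. ennreal \<bar>h z\<bar>) x)\<^sup>2"
proof -
  have "ennreal \<bar>dexp k h x\<bar> \<le> dmax (\<lambda>z. ennreal \<bar>h z\<bar>) x"
    unfolding dmax_def by (rule order_trans[OF dexp_abs_le]) (rule SUP_upper, simp)
  then have "(ennreal \<bar>dexp k h x\<bar>)\<^sup>2 \<le> (dmax (\<lambda>z. ennreal \<bar>h z\<bar>) x)\<^sup>2" by (rule power_mono) simp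
  then show ?thesis by (simp add: ennreal_power)
qed

text \<open>The squared average over a cube of side 2^j is at most 2^(-j n) times the energy of
  \<open>h\<close>. Hence a point has a largest scale at which the level \<open>s\<close> is
  exceeded, if there is any: this is the stopping scale of
  \<open>carleson_embedding\<close>.\<close>

lemma dexp_exceed_bdd:
  fixes h :: "real^'n \<Rightarrow> real"
  assumes h: "sqi h" and s: "0 < s"
  shows "\<exists>K. \<forall>j>K. (dexp j h y)\<^sup>2 \<le> s"
proof -
  define H where "H = (\<integral>z. (h z)\<^sup>2 \<partial>lborel)"
  have H0: "0 \<le> H" by (simp add: H_def)
  obtain N :: nat where N: "H / s < 2 ^ N" using real_arch_pow[of 2 "H / s"] by auto
  have "(dexp j h y)\<^sup>2 \<le> s" if j: "j > int N" for j
  proof -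
    have "ennreal ((dexp j h y)\<^sup>2) \<le> ennreal ((1 / 2 powr real_of_int j) ^ CARD('n)) * ennreal H"
      using dexp_sq_le_const[of h j y] h unfolding H_def sqi_nn[OF h, symmetric] by (simp add: sqi_def)
    also have "\<dots> = ennreal ((1 / 2 powr real_of_int j) ^ CARD('n) * H)" using H0 by (simp add: ennreal_mult)
    finally have 1: "(dexp j h y)\<^sup>2 \<le> (1 / 2 powr real_of_int j) ^ CARD('n) * H" using H0 by (simp add: ennreal_le_iff)
    have p: "2 ^ N \<le> 2 powr real_of_int j" using j by (simp add: powr_realpow[symmetric])
    have "(1 / 2 powr real_of_int j) ^ CARD('n) \<le> (1 / 2 powr real_of_int j) ^ 1"
      using j by (intro power_decreasing) (auto simp: ge_one_powr_ge_zero Suc_le_eq)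
    also have "\<dots> \<le> 1 / 2 ^ N" using p by (simp add: frac_le)
    finally have "(1 / 2 powr real_of_int j) ^ CARD('n) * H \<le> 1 / 2 ^ N * H" using H0 by (rule mult_right_mono)
    also have "\<dots> \<le> s" using N s by (simp add: field_simps)
    finally show ?thesis using 1 by linarith
  qed
  then show ?thesis by blast
qed

lemma measurable_pair_count_space:
  assumes [measurable]: "\<And>k::int. f k \<in> borel_measurable M"
  shows "(\<lambda>(x, k). f k x) \<in> borel_measurable (M \<Otimes>\<^sub>M count_space UNIV)"
  unfolding split_beta'
  by (rule measurable_compose_countable[where g=snd and f="\<lambda>k p. f k (fst p)"]) measurable

text \<open>At a level \<open>s\<close>, \<open>P s K y\<close> says that \<open>K\<close> is the
  stopping scale of \<open>y\<close>, the largest one at which the squared average exceeds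
  \<open>s\<close>. Every \<open>t\<close> that counts at \<open>y\<close> has
  \<open>kk t \<le> K\<close>, so it lies in the tent over the stopping cube, where
  \<open>car\<close> bounds the mass. The stopping cubes are disjoint and lie in the level set of
  the maximal function; integrating in \<open>s\<close> gives its L^2 norm, and the 4 is Doob's
  constant.\<close>

lemma carleson_embedding:
  fixes h :: "real^'n \<Rightarrow> real" and \<mu> :: "real \<times> (real^'n) \<Rightarrow> ennreal"
  assumes \<mu>[measurable]: "\<mu> \<in> borel_measurable borel" and h: "sqi h"
    and car: "\<And>k x. (\<integral>\<^sup>+y. indicator {y. dcor k y = dcor k x} y * (\<integral>\<^sup>+t. indicator {0<..2 powr real_of_int k} t * \<mu> (t, y) \<partial>lborel) \<partial>lborel)
        \<le> B * ennreal ((2 powr real_of_int k) ^ CARD('n))"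
  shows "(\<integral>\<^sup>+y. \<integral>\<^sup>+t. indicator {0<..} t * \<mu> (t, y) * ennreal ((dexp (kk t) h y)\<^sup>2) \<partial>lborel \<partial>lborel) \<le> 4 * B * (\<integral>\<^sup>+y. ennreal ((h y)\<^sup>2) \<partial>lborel)"
proof -
  interpret LC: pair_sigma_finite lborel "count_space (UNIV :: int set)"
    by (intro pair_sigma_finite.intro sigma_finite_lborel sigma_finite_measure_count_space)
  have hm[measurable]: "h \<in> borel_measurable borel" using h by (simp add: sqi_def)
  let ?g = "\<lambda>k y. (dexp k h y)\<^sup>2"
  let ?G = "\<lambda>y. (dmax (\<lambda>z. ennreal \<bar>h z\<bar>) y)\<^sup>2"
  define P where "P = (\<lambda>s K y. s < ?g K y \<and> (\<forall>j. K < j \<longrightarrow> ?g j y \<le> s))"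
  have P[measurable]: "Measurable.pred borel (P s K)" for s K unfolding P_def by measurable
  have level: "(\<integral>\<^sup>+y. \<integral>\<^sup>+t. indicator {0<..} t * \<mu> (t, y) * indicator {t. s < ?g (kk t) y} t \<partial>lborel \<partial>lborel)
      \<le> B * (\<integral>\<^sup>+y. indicator {y. ennreal s < ?G y} y \<partial>lborel)" if s: "0 < s" for s
  proof -
    let ?m = "\<lambda>K y. \<integral>\<^sup>+t. indicator {0<..2 powr real_of_int K} t * \<mu> (t, y) \<partial>lborel"
    have "(\<integral>\<^sup>+t. indicator {0<..} t * \<mu> (t, y) * indicator {t. s < ?g (kk t) y} t \<partial>lborel)
        \<le> (\<integral>\<^sup>+K. indicator {y. P s K y} y * ?m K y \<partial>count_space UNIV)" for y
    proof (cases "\<exists>K. P s K y")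
      case True
      then obtain K where K: "P s K y" by blast
      have "(\<integral>\<^sup>+t. indicator {0<..} t * \<mu> (t, y) * indicator {t. s < ?g (kk t) y} t \<partial>lborel) \<le> ?m K y"
      proof (rule nn_integral_mono)
        fix t :: real
        show "indicator {0<..} t * \<mu> (t, y) * indicator {t. s < ?g (kk t) y} t \<le> indicator {0<..2 powr real_of_int K} t * \<mu> (t, y)"
        proof (cases "0 < t \<and> s < ?g (kk t) y")
          case True
          then have "kk t \<le> K" using K unfolding P_def by (meson not_le)
          then show ?thesis using True by (simp add: kk_le_iff)
        qed auto
      qed
      also have "\<dots> = (\<Sum>K\<in>{K}. indicator {y. P s K y} y * ?m K y)" using K by simp
      also have "\<dots> = (\<integral>\<^sup>+K. indicator {y. P s K y} y * ?m K y \<partial>count_space UNIV)"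
      proof (rule nn_integral_count_space'[symmetric])
        fix j assume "j \<notin> {K}"
        then have "\<not> P s j y" using K unfolding P_def by (metis linorder_neqE_linordered_idom not_le singletonI)
        then show "indicator {y. P s j y} y * ?m j y = 0" by simp
      qed auto
      finally show ?thesis .
    next
      case False
      have "\<not> s < ?g k y" for k
      proof
        assume k: "s < ?g k y"
        obtain K where K: "\<forall>j>K. ?g j y \<le> s" using dexp_exceed_bdd[OF h s] by blast
        define J where "J = {j \<in> {k..K}. s < ?g j y}"
        have fin: "finite J" unfolding J_def by (rule finite_subset[of _ "{k..K}"]) auto
        have "k \<in> J" using k K by (auto simp: J_def) (meson not_le)
        then have M: "Max J \<in> J" using fin by (intro Max_in) auto
        have "P s (Max J) y"
          unfolding P_def
        proof (intro conjI allI impI)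
          show "s < ?g (Max J) y" using M by (simp add: J_def)
          fix j assume j: "Max J < j"
          show "?g j y \<le> s"
          proof (rule ccontr)
            assume "\<not> ?g j y \<le> s"
            moreover from this have "j \<le> K" using K not_le by blast
            moreover have "k \<le> j" using j M by (auto simp: J_def)
            ultimately have "j \<in> J" by (simp add: J_def)
            then show False using Max_ge[OF fin] j by fastforce
          qed
        qed
        then show False using False by blast
      qed
      then show ?thesis by simp
    qed
    then have "(\<integral>\<^sup>+y. \<integral>\<^sup>+t. indicator {0<..} t * \<mu> (t, y) * indicator {t. s < ?g (kk t) y} t \<partial>lborel \<partial>lborel)
       \<le> (\<integral>\<^sup>+y. \<integral>\<^sup>+K. indicator {y. P s K y} y * ?m K y \<partial>count_space UNIV \<partial>lborel)"
      by (rule nn_integral_mono)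
    also have "\<dots> = (\<integral>\<^sup>+K. \<integral>\<^sup>+y. indicator {y. P s K y} y * ?m K y \<partial>lborel \<partial>count_space UNIV)"
      by (rule LC.Fubini'[symmetric]) (rule measurable_pair_count_space, measurable)
    also have "\<dots> \<le> (\<integral>\<^sup>+K. \<integral>\<^sup>+y. indicator {y. P s K y} y * B \<partial>lborel \<partial>count_space UNIV)"
    proof (rule nn_integral_mono)
      fix K :: int
      \<comment> \<open>\<open>P s K\<close> only involves averages at scale \<open>K\<close> and
        above, so the stopping set is a union of cubes of scale \<open>K\<close>. Averaging over
        these cubes brings in the Carleson bound of each.\<close>
      have dc: "dconst K (\<lambda>y. indicator {y. P s K y} y :: ennreal)"
      proof -
        have "dexp j h x = dexp j h z" if "K \<le> j" "dcor K x = dcor K z" for j x z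
          using dconstD[OF dconst_mono[OF dexp_dconst \<open>K \<le> j\<close>] that(2)] .
        then have iff: "P s K x \<longleftrightarrow> P s K z" if "dcor K x = dcor K z" for x z
          using that unfolding P_def by (metis less_imp_le order_refl)
        show ?thesis unfolding dconst_def
        proof (intro allI impI)
          fix x z :: "real^'n" assume "dcor K x = dcor K z"
          from iff[OF this] show "indicator {y. P s K y} x = (indicator {y. P s K y} z :: ennreal)" by (simp add: indicator_def)
        qed
      qed
      have "(\<integral>\<^sup>+y. indicator {y. P s K y} y * ?m K y \<partial>lborel) = (\<integral>\<^sup>+z. indicator {y. P s K y} z * (\<integral>\<^sup>+y. ennreal (dker K z y) * ?m K y \<partial>lborel) \<partial>lborel)"
        by (rule nn_integral_dconst[OF _ _ dc]) measurable
      also have "\<dots> \<le> (\<integral>\<^sup>+z. indicator {y. P s K y} z * B \<partial>lborel)"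
      proof (intro nn_integral_mono mult_left_mono)
        fix z :: "real^'n"
        let ?p = "2 powr real_of_int K"
        have "(\<integral>\<^sup>+y. ennreal (dker K z y) * ?m K y \<partial>lborel) = (\<integral>\<^sup>+y. ennreal ((1 / ?p) ^ CARD('n)) * (indicator {y. dcor K y = dcor K z} y * ?m K y) \<partial>lborel)"
          by (intro nn_integral_cong) (auto simp: dker_def indicator_def)
        also have "\<dots> = ennreal ((1 / ?p) ^ CARD('n)) * (\<integral>\<^sup>+y. indicator {y. dcor K y = dcor K z} y * ?m K y \<partial>lborel)"
          by (rule nn_integral_cmult) measurable
        also have "\<dots> \<le> ennreal ((1 / ?p) ^ CARD('n)) * (B * ennreal (?p ^ CARD('n)))"
          by (intro mult_left_mono car) simp
        also have "\<dots> = B * (ennreal ((1 / ?p) ^ CARD('n)) * ennreal (?p ^ CARD('n)))" by (simp add: mult_ac)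
        also have "ennreal ((1 / ?p) ^ CARD('n)) * ennreal (?p ^ CARD('n)) = 1"
          by (simp add: ennreal_mult[symmetric] power_divide)
        finally show "(\<integral>\<^sup>+y. ennreal (dker K z y) * ?m K y \<partial>lborel) \<le> B" by simp
      qed simp
      finally show "(\<integral>\<^sup>+y. indicator {y. P s K y} y * ?m K y \<partial>lborel) \<le> (\<integral>\<^sup>+y. indicator {y. P s K y} y * B \<partial>lborel)" .
    qed
    also have "\<dots> = (\<integral>\<^sup>+y. \<integral>\<^sup>+K. indicator {y. P s K y} y * B \<partial>count_space UNIV \<partial>lborel)"
      by (rule LC.Fubini') (rule measurable_pair_count_space, measurable)
    \<comment> \<open>A point has at most one stopping scale, so the sum over \<open>K\<close> has
      at most one term.\<close>
    also have "\<dots> \<le> (\<integral>\<^sup>+y. B * indicator {y. ennreal s < ?G y} y \<partial>lborel)"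
    proof (rule nn_integral_mono)
      fix y
      show "(\<integral>\<^sup>+K. indicator {y. P s K y} y * B \<partial>count_space UNIV) \<le> B * indicator {y. ennreal s < ?G y} y"
      proof (cases "\<exists>K. P s K y")
        case True
        then obtain K where K: "P s K y" by blast
        have "(\<integral>\<^sup>+K. indicator {y. P s K y} y * B \<partial>count_space UNIV) = (\<Sum>K\<in>{K}. indicator {y. P s K y} y * B)"
        proof (rule nn_integral_count_space')
          fix j assume "j \<notin> {K}"
          then have "\<not> P s j y" using K unfolding P_def by (metis linorder_neqE_linordered_idom not_le singletonI)
          then show "indicator {y. P s j y} y * B = 0" by simp
        qed auto
        also have "\<dots> = B" using K by simp
        finally have e: "(\<integral>\<^sup>+K. indicator {y. P s K y} y * B \<partial>count_space UNIV) = B" .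
        have "ennreal s < ennreal (?g K y)" using K s unfolding P_def by (simp add: ennreal_less_iff)
        also have "\<dots> \<le> ?G y" by (rule dexp_sq_le_dmax)
        finally show ?thesis unfolding e by simp
      next
        case False
        then show ?thesis by simp
      qed
    qed
    also have "\<dots> = B * (\<integral>\<^sup>+y. indicator {y. ennreal s < ?G y} y \<partial>lborel)"
      by (rule nn_integral_cmult) measurable
    finally show ?thesis .
  qed
  have "(\<integral>\<^sup>+y. \<integral>\<^sup>+t. indicator {0<..} t * \<mu> (t, y) * ennreal (?g (kk t) y) \<partial>lborel \<partial>lborel)
    = (\<integral>\<^sup>+y. \<integral>\<^sup>+t. \<integral>\<^sup>+s. indicator {0<..} t * \<mu> (t, y) * (indicator {0<..} s * indicator {s. ennreal s < ennreal (?g (kk t) y)} s) \<partial>lborel \<partial>lborel \<partial>lborel)"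
    by (simp add: nn_integral_cmult layer_cake)
  also have "\<dots> = (\<integral>\<^sup>+y. \<integral>\<^sup>+s. \<integral>\<^sup>+t. indicator {0<..} t * \<mu> (t, y) * (indicator {0<..} s * indicator {s. ennreal s < ennreal (?g (kk t) y)} s) \<partial>lborel \<partial>lborel \<partial>lborel)"
    by (intro nn_integral_cong lborel_pair.Fubini') measurable
  also have "\<dots> = (\<integral>\<^sup>+s. \<integral>\<^sup>+y. \<integral>\<^sup>+t. indicator {0<..} t * \<mu> (t, y) * (indicator {0<..} s * indicator {s. ennreal s < ennreal (?g (kk t) y)} s) \<partial>lborel \<partial>lborel \<partial>lborel)"
    by (intro lborel_pair.Fubini') measurable
  also have "\<dots> \<le> (\<integral>\<^sup>+s. indicator {0<..} s * (B * (\<integral>\<^sup>+y. indicator {y. ennreal s < ?G y} y \<partial>lborel)) \<partial>lborel)"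
  proof (rule nn_integral_mono)
    fix s :: real
    show "(\<integral>\<^sup>+y. \<integral>\<^sup>+t. indicator {0<..} t * \<mu> (t, y) * (indicator {0<..} s * indicator {s. ennreal s < ennreal (?g (kk t) y)} s) \<partial>lborel \<partial>lborel)
      \<le> indicator {0<..} s * (B * (\<integral>\<^sup>+y. indicator {y. ennreal s < ?G y} y \<partial>lborel))"
    proof (cases "0 < s")
      case True
      then have "(\<integral>\<^sup>+y. \<integral>\<^sup>+t. indicator {0<..} t * \<mu> (t, y) * (indicator {0<..} s * indicator {s. ennreal s < ennreal (?g (kk t) y)} s) \<partial>lborel \<partial>lborel)
        = (\<integral>\<^sup>+y. \<integral>\<^sup>+t. indicator {0<..} t * \<mu> (t, y) * indicator {t. s < ?g (kk t) y} t \<partial>lborel \<partial>lborel)"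
        by (intro nn_integral_cong) (auto simp: indicator_def ennreal_less_iff)
      then show ?thesis using level[OF True] True by simp
    qed simp
  qed
  also have "\<dots> = (\<integral>\<^sup>+s. \<integral>\<^sup>+y. B * (indicator {0<..} s * indicator {s. ennreal s < ?G y} s) \<partial>lborel \<partial>lborel)"
  proof (rule nn_integral_cong)
    fix s :: real
    have "(\<integral>\<^sup>+y. B * (indicator {0<..} s * indicator {s. ennreal s < ?G y} s) \<partial>lborel) = (\<integral>\<^sup>+y. B * indicator {0<..} s * indicator {y. ennreal s < ?G y} y \<partial>lborel)"
      by (intro nn_integral_cong) (auto simp: indicator_def)
    also have "\<dots> = B * indicator {0<..} s * (\<integral>\<^sup>+y. indicator {y. ennreal s < ?G y} y \<partial>lborel)"
      by (rule nn_integral_cmult) measurable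
    finally show "indicator {0<..} s * (B * (\<integral>\<^sup>+y. indicator {y. ennreal s < ?G y} y \<partial>lborel)) = (\<integral>\<^sup>+y. B * (indicator {0<..} s * indicator {s. ennreal s < ?G y} s) \<partial>lborel)"
      by (simp add: mult_ac)
  qed
  also have "\<dots> = (\<integral>\<^sup>+y. \<integral>\<^sup>+s. B * (indicator {0<..} s * indicator {s. ennreal s < ?G y} s) \<partial>lborel \<partial>lborel)"
    by (intro lborel_pair.Fubini') measurable
  also have "\<dots> = (\<integral>\<^sup>+y. B * ?G y \<partial>lborel)"
    by (simp add: nn_integral_cmult layer_cake)
  also have "\<dots> = B * (\<integral>\<^sup>+y. ?G y \<partial>lborel)" by (rule nn_integral_cmult) measurable
  also have "(\<integral>\<^sup>+y. ?G y \<partial>lborel) \<le> 4 * (\<integral>\<^sup>+y. (ennreal \<bar>h y\<bar>)\<^sup>2 \<partial>lborel)" by (rule dmax_bound) measurable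
  also have "(\<integral>\<^sup>+y. (ennreal \<bar>h y\<bar>)\<^sup>2 \<partial>lborel) = (\<integral>\<^sup>+y. ennreal ((h y)\<^sup>2) \<partial>lborel)" by (simp add: ennreal_power)
  finally have "(\<integral>\<^sup>+y. \<integral>\<^sup>+t. indicator {0<..} t * \<mu> (t, y) * ennreal (?g (kk t) y) \<partial>lborel \<partial>lborel) \<le> B * (4 * (\<integral>\<^sup>+y. ennreal ((h y)\<^sup>2) \<partial>lborel))"
    by (simp add: mult_left_mono)
  then show ?thesis by (simp add: mult_ac)
qed

subsection \<open>The one-parameter estimate\<close>

lemma ennreal_double_sum: "0 \<le> p \<Longrightarrow> 0 \<le> q \<Longrightarrow> ennreal (2 * p + 2 * q) = 2 * ennreal p + 2 * ennreal q"
  by (simp add: ennreal_mult)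

text \<open>The one-point space plays the role of both \<open>M\<close> and \<open>N\<close> when
  \<open>op_kernel\<close> is specialised to scalar kernels; the next facts remove this factor from
  the resulting integrals.\<close>

lemma distr_fst_unit:
  "distr (lborel \<Otimes>\<^sub>M count_space (UNIV :: unit set)) lborel fst = (lborel :: 'a::euclidean_space measure)"
proof (rule measure_eqI)
  interpret sigma_finite_measure "count_space (UNIV :: unit set)"
    by (rule sigma_finite_measure_count_space)
  fix A assume "A \<in> sets (distr (lborel \<Otimes>\<^sub>M count_space (UNIV :: unit set)) (lborel :: 'a measure) fst)"
  then have A[measurable]: "A \<in> sets (lborel :: 'a measure)" by simp
  have "fst -` A \<inter> space (lborel \<Otimes>\<^sub>M count_space (UNIV :: unit set)) = A \<times> (UNIV :: unit set)"
    by (auto simp: space_pair_measure)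
  then show "emeasure (distr (lborel \<Otimes>\<^sub>M count_space (UNIV :: unit set)) lborel fst) A = emeasure lborel A"
    using emeasure_pair_measure_Times[of A lborel "UNIV :: unit set"] A by (subst emeasure_distr) (auto simp: emeasure_count_space)
qed simp

lemma integral_fst_unit:
  fixes f :: "'a::euclidean_space \<Rightarrow> real"
  assumes [measurable]: "f \<in> borel_measurable borel"
  shows "(\<integral>p. f (fst p) \<partial>(lborel \<Otimes>\<^sub>M count_space (UNIV :: unit set))) = (\<integral>z. f z \<partial>lborel)"
proof -
  have "(\<integral>z. f z \<partial>lborel) = (\<integral>z. f z \<partial>distr (lborel \<Otimes>\<^sub>M count_space (UNIV :: unit set)) lborel fst)"
    by (simp only: distr_fst_unit)
  also have "\<dots> = (\<integral>p. f (fst p) \<partial>(lborel \<Otimes>\<^sub>M count_space (UNIV :: unit set)))"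
    by (rule integral_distr) measurable
  finally show ?thesis by simp
qed

lemma nn_integral_unit: "(\<integral>\<^sup>+v. f v \<partial>count_space (UNIV :: unit set)) = f ()"
  by (subst nn_integral_count_space_finite) (auto simp: UNIV_unit)

lemma integral_unit: "(\<integral>v. f v \<partial>count_space (UNIV :: unit set)) = (f () :: real)"
  by (subst lebesgue_integral_count_space_finite) (auto simp: UNIV_unit)

lemma kap_int:
  assumes "0 < t" "0 < a"
  shows "integrable lborel (\<lambda>z::real^'n. kap a t (y - z))"
  by (rule integrableI_bounded) (use nn_integral_kap_shift(2)[OF assms, of y] in \<open>auto simp: kap_nonneg intro: le_less_trans\<close>)

definition ccar :: "nat \<Rightarrow> real \<Rightarrow> real" where "ccar n a = 2 + 2 * corthi n a"
definition csq :: "nat \<Rightarrow> real \<Rightarrow> real" where "csq n a = 2 * corthi n a + 8 * ccar n a"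

lemma ccar_pos: "0 < a \<Longrightarrow> 0 < ccar n a"
  using corthi_nonneg[of a n] by (simp add: ccar_def)

lemma csq_pos: "0 < a \<Longrightarrow> 0 < csq n a"
  using corthi_nonneg[of a n] ccar_pos[of a n] by (simp add: csq_def)

text \<open>Hypotheses of a local T1 theorem: in \<open>carl\<close> the kernel acts on the
  indicator of a cube and only the tent over the same cube is measured. The constant
  \<open>B\<close> scales all three conditions alike; later it will be the size of a kernel in
  frozen variables, and the final bound has to be proportional to its square.\<close>

locale one_parameter =
  fixes L :: "real \<times> (real^'n) \<times> (real^'n) \<Rightarrow> real" and B a :: real
  assumes L_meas[measurable]: "L \<in> borel_measurable borel" and B: "0 < B" and a: "0 < a"
    and size: "\<And>t y z. 0 < t \<Longrightarrow> \<bar>L (t, y, z)\<bar> \<le> B * kap a t (y - z)"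
    and holder: "\<And>t y z z'. 0 < t \<Longrightarrow> infnorm (z - z') < t / 2 \<Longrightarrow> z \<noteq> z' \<Longrightarrow>
        \<bar>L (t, y, z) - L (t, y, z')\<bar> \<le> B * ((infnorm (z - z') / t) powr a * kap a t (y - z))"
    and carl: "\<And>k x. (\<integral>\<^sup>+y. indicator {y. dcor k y = dcor k x} y * (\<integral>\<^sup>+t. indicator {0<..2 powr real_of_int k} t *
          (ennreal (1 / t) * ennreal ((\<integral>z. indicator {z. dcor k z = dcor k x} z * L (t, y, z) \<partial>lborel)\<^sup>2)) \<partial>lborel) \<partial>lborel)
        \<le> ennreal (B\<^sup>2 * (2 powr real_of_int k) ^ CARD('n))"
begin

lemma L_int: "0 < t \<Longrightarrow> integrable lborel (\<lambda>z. L (t, y, z))"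
  by (rule Bochner_Integration.integrable_bound[OF integrable_mult_right[OF kap_int[of t a y], of B]])
    (use size a in \<open>auto intro!: AE_I2 order_trans[OF size] simp: kap_nonneg\<close>)

lemma L_sqi: "0 < t \<Longrightarrow> sqi (\<lambda>z. L (t, y, z))"
proof -
  assume t: "0 < t"
  have "(\<integral>\<^sup>+z. ennreal ((L (t, y, z))\<^sup>2) \<partial>lborel) \<le> (\<integral>\<^sup>+z. ennreal (B\<^sup>2 / t ^ CARD('n)) * ennreal (kap a t (y - z)) \<partial>lborel)"
  proof (rule nn_integral_mono)
    fix z
    have "(L (t, y, z))\<^sup>2 \<le> (B * kap a t (y - z))\<^sup>2" using power_mono[OF size[OF t, of y z], of 2] by simp
    also have "\<dots> = B\<^sup>2 * kap a t (y - z) * kap a t (y - z)" by (simp add: power2_eq_square)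
    also have "\<dots> \<le> B\<^sup>2 * (1 / t ^ CARD('n)) * kap a t (y - z)"
      using t a by (intro mult_right_mono mult_left_mono kap_le) (auto simp: kap_nonneg)
    finally show "ennreal ((L (t, y, z))\<^sup>2) \<le> ennreal (B\<^sup>2 / t ^ CARD('n)) * ennreal (kap a t (y - z))"
      using t by (subst ennreal_mult[symmetric]) (auto simp: kap_nonneg ennreal_leI)
  qed
  also have "\<dots> = ennreal (B\<^sup>2 / t ^ CARD('n)) * (\<integral>\<^sup>+z. ennreal (kap a t (y - z)) \<partial>lborel)"
    by (rule nn_integral_cmult) measurable
  also have "\<dots> \<le> ennreal (B\<^sup>2 / t ^ CARD('n)) * ennreal (ckap CARD('n) a)"
    using t a by (intro mult_left_mono nn_integral_kap_shift) auto
  also have "\<dots> < \<infinity>" by (simp add: ennreal_mult_less_top)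
  finally show ?thesis unfolding sqi_def by simp
qed

lemma op: "0 < t \<Longrightarrow> op_kernel (count_space (UNIV :: unit set)) (count_space (UNIV :: unit set)) (\<lambda>q. L (t, fst q, fst (snd q))) (\<lambda>_ _. B) B a t (kk t)"
proof (rule op_kernel.intro)
  assume t: "0 < t"
  show "(\<lambda>q. L (t, fst q, fst (snd q))) \<in> borel_measurable (lborel \<Otimes>\<^sub>M lborel \<Otimes>\<^sub>M count_space (UNIV :: unit set) \<Otimes>\<^sub>M count_space (UNIV :: unit set))"
    by measurable
  show "(\<lambda>_. B) \<in> borel_measurable (count_space (UNIV :: unit set))" by simp
  show "sigma_finite_measure (count_space (UNIV :: unit set))" "sigma_finite_measure (count_space (UNIV :: unit set))"
    by (rule sigma_finite_measure_count_space)+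
  show "0 < B" "0 < a" by (rule B, rule a)
  show "2 powr (real_of_int (kk t) - 1) < t" "t \<le> 2 powr real_of_int (kk t)" using kk_bounds[OF t] .
  show "\<bar>L (t, fst (y, z, v, w), fst (snd (y, z, v, w)))\<bar> \<le> kap a t (y - z) * B" for y z and v w :: unit
    using size[OF t, of y z] by (simp add: mult.commute)
  show "(\<integral>\<^sup>+w. ennreal (B\<^sup>2) \<partial>count_space (UNIV :: unit set)) < \<infinity>" by (simp add: nn_integral_unit)
  fix y z :: "real^'n" and h :: "unit \<Rightarrow> real"
  show "(\<integral>\<^sup>+v. ennreal ((\<integral>w. L (t, fst (y, z, v, w), fst (snd (y, z, v, w))) * h w \<partial>count_space (UNIV :: unit set))\<^sup>2) \<partial>count_space (UNIV :: unit set))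
        \<le> ennreal ((B * kap a t (y - z))\<^sup>2) * (\<integral>\<^sup>+w. ennreal ((h w)\<^sup>2) \<partial>count_space UNIV)"
    using power_mono[OF size[OF t, of y z], of 2]
    by (simp add: nn_integral_unit integral_unit ennreal_mult[symmetric] power_mult_distrib) (intro ennreal_leI mult_right_mono, auto)
  fix z' :: "real^'n" assume d: "infnorm (z - z') < t / 2" "z \<noteq> z'"
  show "(\<integral>\<^sup>+v. ennreal ((\<integral>w. (L (t, fst (y, z, v, w), fst (snd (y, z, v, w))) - L (t, fst (y, z', v, w), fst (snd (y, z', v, w)))) * h w \<partial>count_space (UNIV :: unit set))\<^sup>2) \<partial>count_space (UNIV :: unit set))
        \<le> ennreal ((B * ((infnorm (z - z') / t) powr a * kap a t (y - z)))\<^sup>2) * (\<integral>\<^sup>+w. ennreal ((h w)\<^sup>2) \<partial>count_space UNIV)"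
    using power_mono[OF holder[OF t d, of y], of 2]
    by (simp add: nn_integral_unit integral_unit ennreal_mult[symmetric] power_mult_distrib) (intro ennreal_leI mult_right_mono, auto)
qed

lemma orth:
  assumes h: "sqi h"
  shows "(\<integral>\<^sup>+t. indicator {0<..} t * ennreal (1 / t) * (\<integral>\<^sup>+y. ennreal ((\<integral>z. L (t, y, z) * (h z - dexp (kk t) h y) \<partial>lborel)\<^sup>2) \<partial>lborel) \<partial>lborel)
     \<le> ennreal (corthi CARD('n) a * B\<^sup>2) * (\<integral>\<^sup>+z. ennreal ((h z)\<^sup>2) \<partial>lborel)"
proof -
  have [measurable]: "h \<in> borel_measurable borel" using h by (simp add: sqi_def)
  let ?U = "count_space (UNIV :: unit set)"
  have "(\<integral>z. L (t, y, z) * (h z - dexp (kk t) h y) \<partial>lborel) = (\<integral>p. L (t, y, fst p) * (h (fst p) - dexp (kk t) h y) \<partial>(lborel \<Otimes>\<^sub>M ?U))" for t y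
    by (rule integral_fst_unit[symmetric]) measurable
  then show ?thesis
    using orthogonality_integrated[OF op, of "\<lambda>p. h (fst p)"] h by (simp add: nn_integral_unit sqi_def)
qed

lemma orth':
  assumes h: "sqi h"
  shows "(\<integral>\<^sup>+y. \<integral>\<^sup>+t. indicator {0<..} t * (ennreal (1 / t) * ennreal ((\<integral>z. L (t, y, z) * (h z - dexp (kk t) h y) \<partial>lborel)\<^sup>2)) \<partial>lborel \<partial>lborel)
     \<le> ennreal (corthi CARD('n) a * B\<^sup>2) * (\<integral>\<^sup>+z. ennreal ((h z)\<^sup>2) \<partial>lborel)"
proof -
  have [measurable]: "h \<in> borel_measurable borel" using h by (simp add: sqi_def)
  have "(\<integral>\<^sup>+y. \<integral>\<^sup>+t. indicator {0<..} t * (ennreal (1 / t) * ennreal ((\<integral>z. L (t, y, z) * (h z - dexp (kk t) h y) \<partial>lborel)\<^sup>2)) \<partial>lborel \<partial>lborel)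
    = (\<integral>\<^sup>+t. \<integral>\<^sup>+y. indicator {0<..} t * (ennreal (1 / t) * ennreal ((\<integral>z. L (t, y, z) * (h z - dexp (kk t) h y) \<partial>lborel)\<^sup>2)) \<partial>lborel \<partial>lborel)"
    by (rule lborel_pair.Fubini') measurable
  also have "\<dots> = (\<integral>\<^sup>+t. indicator {0<..} t * ennreal (1 / t) * (\<integral>\<^sup>+y. ennreal ((\<integral>z. L (t, y, z) * (h z - dexp (kk t) h y) \<partial>lborel)\<^sup>2) \<partial>lborel) \<partial>lborel)"
    by (simp add: nn_integral_cmult mult.assoc)
  finally show ?thesis using orth[OF h] by simp
qed

lemma L_h_diff: "0 < t \<Longrightarrow> sqi h \<Longrightarrow> (\<integral>z. L (t, y, z) * (h z - c) \<partial>lborel) = (\<integral>z. L (t, y, z) * h z \<partial>lborel) - (\<integral>z. L (t, y, z) \<partial>lborel) * c"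
  using L_int[of t y] sqi_prod_integrable[OF L_sqi[of t y]] by (simp add: right_diff_distrib)

text \<open>For \<open>y\<close> in the cube Q and \<open>t\<close> at most its side, the cube of
  scale \<open>kk t\<close> around \<open>y\<close> lies inside Q, so the average of the indicator
  there is 1 (\<open>E1\<close>). Thus L 1 is L 1_Q minus L applied to 1_Q minus its average at
  \<open>y\<close>: the first term is \<open>carl\<close>, the second is exactly what
  \<open>orth'\<close> bounds, with data of energy |Q|.\<close>

lemma carl_full:
  "(\<integral>\<^sup>+y. indicator {y. dcor k y = dcor k x} y * (\<integral>\<^sup>+t. indicator {0<..2 powr real_of_int k} t *
      (ennreal (1 / t) * ennreal ((\<integral>z. L (t, y, z) \<partial>lborel)\<^sup>2)) \<partial>lborel) \<partial>lborel)
    \<le> ennreal (ccar CARD('n) a * B\<^sup>2) * ennreal ((2 powr real_of_int k) ^ CARD('n))"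
proof -
  let ?Q = "{y. dcor k y = dcor k x}" and ?p = "2 powr real_of_int k"
  let ?h = "\<lambda>z. indicator ?Q z :: real"
  have Q[measurable]: "?Q \<in> sets borel" unfolding dcor_cube by measurable
  have H: "(\<integral>\<^sup>+z. ennreal ((?h z)\<^sup>2) \<partial>lborel) = ennreal (?p ^ CARD('n))"
  proof -
    have "(\<integral>\<^sup>+z. ennreal ((?h z)\<^sup>2) \<partial>lborel) = (\<integral>\<^sup>+z. indicator ?Q z \<partial>lborel)"
      by (intro nn_integral_cong) (auto simp: indicator_def)
    also have "\<dots> = emeasure lborel (hcube (dcor k x) ?p)" by (simp add: dcor_cube)
    also have "\<dots> = ennreal (?p ^ CARD('n))" by (rule emeasure_hcube) simp
    finally show ?thesis .
  qed
  have h: "sqi ?h" unfolding sqi_def H by (auto intro: borel_measurable_indicator)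
  have E1: "dexp (kk t) ?h y = 1" if "y \<in> ?Q" "0 < t" "t \<le> ?p" for t y
  proof -
    have k: "kk t \<le> k" using that kk_le_iff by blast
    have "dexp (kk t) ?h y = (\<integral>z. dker (kk t) y z \<partial>lborel)"
      unfolding dexp_def
    proof (rule Bochner_Integration.integral_cong)
      fix z show "dker (kk t) y z * ?h z = dker (kk t) y z"
      proof (cases "dcor (kk t) y = dcor (kk t) z")
        case True
        then have "dcor k z = dcor k x" using dcor_eq_mono[OF k True] that(1) by simp
        then show ?thesis by simp
      qed (simp add: dker_def)
    qed simp
    also have "\<dots> = 1" using nn_integral_dker[of "kk t" y] by (subst integral_eq_nn_integral) auto
    finally show ?thesis .
  qed
  let ?I1 = "\<lambda>t y. (\<integral>z. indicator ?Q z * L (t, y, z) \<partial>lborel)\<^sup>2"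
  let ?I2 = "\<lambda>t y. (\<integral>z. L (t, y, z) * (?h z - dexp (kk t) ?h y) \<partial>lborel)\<^sup>2"
  have "(\<integral>\<^sup>+y. indicator ?Q y * (\<integral>\<^sup>+t. indicator {0<..?p} t * (ennreal (1 / t) * ennreal ((\<integral>z. L (t, y, z) \<partial>lborel)\<^sup>2)) \<partial>lborel) \<partial>lborel)
    \<le> (\<integral>\<^sup>+y. 2 * (indicator ?Q y * (\<integral>\<^sup>+t. indicator {0<..?p} t * (ennreal (1 / t) * ennreal (?I1 t y)) \<partial>lborel))
        + 2 * (\<integral>\<^sup>+t. indicator {0<..} t * (ennreal (1 / t) * ennreal (?I2 t y)) \<partial>lborel) \<partial>lborel)"
  proof (rule nn_integral_mono)
    fix y
    show "indicator ?Q y * (\<integral>\<^sup>+t. indicator {0<..?p} t * (ennreal (1 / t) * ennreal ((\<integral>z. L (t, y, z) \<partial>lborel)\<^sup>2)) \<partial>lborel)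
      \<le> 2 * (indicator ?Q y * (\<integral>\<^sup>+t. indicator {0<..?p} t * (ennreal (1 / t) * ennreal (?I1 t y)) \<partial>lborel))
        + 2 * (\<integral>\<^sup>+t. indicator {0<..} t * (ennreal (1 / t) * ennreal (?I2 t y)) \<partial>lborel)"
    proof (cases "y \<in> ?Q")
      case True
      have "(\<integral>\<^sup>+t. indicator {0<..?p} t * (ennreal (1 / t) * ennreal ((\<integral>z. L (t, y, z) \<partial>lborel)\<^sup>2)) \<partial>lborel)
        \<le> (\<integral>\<^sup>+t. 2 * (indicator {0<..?p} t * (ennreal (1 / t) * ennreal (?I1 t y))) + 2 * (indicator {0<..} t * (ennreal (1 / t) * ennreal (?I2 t y))) \<partial>lborel)"
      proof (rule nn_integral_mono)
        fix t :: real
        show "indicator {0<..?p} t * (ennreal (1 / t) * ennreal ((\<integral>z. L (t, y, z) \<partial>lborel)\<^sup>2))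
          \<le> 2 * (indicator {0<..?p} t * (ennreal (1 / t) * ennreal (?I1 t y))) + 2 * (indicator {0<..} t * (ennreal (1 / t) * ennreal (?I2 t y)))"
        proof (cases "0 < t \<and> t \<le> ?p")
          case t: True
          have "(\<integral>z. L (t, y, z) \<partial>lborel) = (\<integral>z. indicator ?Q z * L (t, y, z) \<partial>lborel) - (\<integral>z. L (t, y, z) * (?h z - dexp (kk t) ?h y) \<partial>lborel)"
            using t L_h_diff[OF _ h, of t y 1] by (simp add: E1[OF True] mult.commute)
          then have "(\<integral>z. L (t, y, z) \<partial>lborel)\<^sup>2 \<le> 2 * ?I1 t y + 2 * ?I2 t y" by (simp only: square_diff_le)
          then have "1 / t * (\<integral>z. L (t, y, z) \<partial>lborel)\<^sup>2 \<le> 1 / t * (2 * ?I1 t y + 2 * ?I2 t y)" using t by (intro mult_left_mono) auto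
          also have "\<dots> = 2 * (1 / t * ?I1 t y) + 2 * (1 / t * ?I2 t y)" by (simp add: distrib_left)
          finally have "ennreal (1 / t * (\<integral>z. L (t, y, z) \<partial>lborel)\<^sup>2) \<le> ennreal (2 * (1 / t * ?I1 t y) + 2 * (1 / t * ?I2 t y))"
            by (rule ennreal_leI)
          also have "\<dots> = 2 * ennreal (1 / t * ?I1 t y) + 2 * ennreal (1 / t * ?I2 t y)" using t by (intro ennreal_double_sum) auto
          finally show ?thesis using t by (simp add: ennreal_mult[symmetric])
        qed auto
      qed
      also have "\<dots> = 2 * (\<integral>\<^sup>+t. indicator {0<..?p} t * (ennreal (1 / t) * ennreal (?I1 t y)) \<partial>lborel) + 2 * (\<integral>\<^sup>+t. indicator {0<..} t * (ennreal (1 / t) * ennreal (?I2 t y)) \<partial>lborel)"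
        by (simp add: nn_integral_add nn_integral_cmult)
      finally show ?thesis using True by simp
    qed simp
  qed
  also have "\<dots> = 2 * (\<integral>\<^sup>+y. indicator ?Q y * (\<integral>\<^sup>+t. indicator {0<..?p} t * (ennreal (1 / t) * ennreal (?I1 t y)) \<partial>lborel) \<partial>lborel)
     + 2 * (\<integral>\<^sup>+y. \<integral>\<^sup>+t. indicator {0<..} t * (ennreal (1 / t) * ennreal (?I2 t y)) \<partial>lborel \<partial>lborel)"
    by (simp add: nn_integral_add nn_integral_cmult)
  also have "\<dots> \<le> 2 * ennreal (B\<^sup>2 * ?p ^ CARD('n)) + 2 * (ennreal (corthi CARD('n) a * B\<^sup>2) * ennreal (?p ^ CARD('n)))"
    using carl[of k x] orth'[OF h] unfolding H by (intro add_mono mult_left_mono) auto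
  also have "\<dots> = ennreal (2 * (B\<^sup>2 * ?p ^ CARD('n)) + 2 * (corthi CARD('n) a * B\<^sup>2 * ?p ^ CARD('n)))"
    using corthi_nonneg[OF a, of "CARD('n)"] by (simp add: ennreal_mult)
  also have "2 * (B\<^sup>2 * ?p ^ CARD('n)) + 2 * (corthi CARD('n) a * B\<^sup>2 * ?p ^ CARD('n)) = (ccar CARD('n) a * B\<^sup>2) * ?p ^ CARD('n)"
    by (simp add: ccar_def algebra_simps)
  also have "ennreal \<dots> = ennreal (ccar CARD('n) a * B\<^sup>2) * ennreal (?p ^ CARD('n))"
    using ccar_pos[OF a, of "CARD('n)"] by (intro ennreal_mult) auto
  finally show ?thesis .
qed

text \<open>Kept apart from \<open>bound\<close> because the middle term of the bi-parameter
  decomposition uses this half alone.\<close>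

lemma paraproduct:
  assumes h: "sqi h"
  shows "(\<integral>\<^sup>+y. \<integral>\<^sup>+t. indicator {0<..} t * (ennreal (1 / t) * ennreal ((\<integral>z. L (t, y, z) \<partial>lborel)\<^sup>2)) * ennreal ((dexp (kk t) h y)\<^sup>2) \<partial>lborel \<partial>lborel)
    \<le> ennreal (4 * ccar CARD('n) a * B\<^sup>2) * (\<integral>\<^sup>+y. ennreal ((h y)\<^sup>2) \<partial>lborel)"
proof -
  have e: "4 * ennreal (ccar CARD('n) a * B\<^sup>2) = ennreal (4 * ccar CARD('n) a * B\<^sup>2)"
    using ccar_pos[OF a, of "CARD('n)"] by (simp add: ennreal_mult mult.assoc)
  have m: "(\<lambda>p. ennreal (1 / fst p) * ennreal ((\<integral>z. L (fst p, snd p, z) \<partial>lborel)\<^sup>2)) \<in> borel_measurable (borel :: (real \<times> (real^'n)) measure)"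
    unfolding borel_prod[symmetric] by measurable
  show ?thesis
    using carleson_embedding[OF m h, of "ennreal (ccar CARD('n) a * B\<^sup>2)"] carl_full
    unfolding e by simp
qed

theorem bound:
  assumes h: "sqi h"
  shows "(\<integral>\<^sup>+y. \<integral>\<^sup>+t. indicator {0<..} t * (ennreal (1 / t) * ennreal ((\<integral>z. L (t, y, z) * h z \<partial>lborel)\<^sup>2)) \<partial>lborel \<partial>lborel)
    \<le> ennreal (csq CARD('n) a * B\<^sup>2) * (\<integral>\<^sup>+y. ennreal ((h y)\<^sup>2) \<partial>lborel)"
proof -
  have [measurable]: "h \<in> borel_measurable borel" using h by (simp add: sqi_def)
  let ?H = "\<integral>\<^sup>+y. ennreal ((h y)\<^sup>2) \<partial>lborel"
  let ?I1 = "\<lambda>t y. indicator {0<..} t * (ennreal (1 / t) * ennreal ((\<integral>z. L (t, y, z) * (h z - dexp (kk t) h y) \<partial>lborel)\<^sup>2))"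
  let ?I2 = "\<lambda>t y. indicator {0<..} t * (ennreal (1 / t) * ennreal ((\<integral>z. L (t, y, z) \<partial>lborel)\<^sup>2)) * ennreal ((dexp (kk t) h y)\<^sup>2)"
  have "(\<integral>\<^sup>+y. \<integral>\<^sup>+t. indicator {0<..} t * (ennreal (1 / t) * ennreal ((\<integral>z. L (t, y, z) * h z \<partial>lborel)\<^sup>2)) \<partial>lborel \<partial>lborel)
    \<le> (\<integral>\<^sup>+y. \<integral>\<^sup>+t. 2 * ?I1 t y + 2 * ?I2 t y \<partial>lborel \<partial>lborel)"
  proof (intro nn_integral_mono)
    fix y :: "real^'n" and t :: real
    show "indicator {0<..} t * (ennreal (1 / t) * ennreal ((\<integral>z. L (t, y, z) * h z \<partial>lborel)\<^sup>2)) \<le> 2 * ?I1 t y + 2 * ?I2 t y"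
    proof (cases "0 < t")
      case t: True
      let ?A = "\<integral>z. L (t, y, z) * (h z - dexp (kk t) h y) \<partial>lborel" and ?B = "(\<integral>z. L (t, y, z) \<partial>lborel) * dexp (kk t) h y"
      have "(\<integral>z. L (t, y, z) * h z \<partial>lborel) = ?A + ?B" using L_h_diff[OF t h] by simp
      then have "1 / t * (\<integral>z. L (t, y, z) * h z \<partial>lborel)\<^sup>2 \<le> 1 / t * (2 * ?A\<^sup>2 + 2 * ?B\<^sup>2)"
        using t square_add_le[of ?A ?B] by (intro mult_left_mono) auto
      also have "\<dots> = 2 * (1 / t * ?A\<^sup>2) + 2 * (1 / t * (\<integral>z. L (t, y, z) \<partial>lborel)\<^sup>2 * (dexp (kk t) h y)\<^sup>2)" by (simp add: distrib_left power_mult_distrib)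
      finally have "ennreal (1 / t * (\<integral>z. L (t, y, z) * h z \<partial>lborel)\<^sup>2) \<le> ennreal (2 * (1 / t * ?A\<^sup>2) + 2 * (1 / t * (\<integral>z. L (t, y, z) \<partial>lborel)\<^sup>2 * (dexp (kk t) h y)\<^sup>2))"
        by (rule ennreal_leI)
      also have "\<dots> = 2 * ennreal (1 / t * ?A\<^sup>2) + 2 * ennreal (1 / t * (\<integral>z. L (t, y, z) \<partial>lborel)\<^sup>2 * (dexp (kk t) h y)\<^sup>2)"
        using t by (intro ennreal_double_sum) auto
      finally show ?thesis using t by (simp add: ennreal_mult[symmetric])
    qed simp
  qed
  also have "\<dots> = 2 * (\<integral>\<^sup>+y. \<integral>\<^sup>+t. ?I1 t y \<partial>lborel \<partial>lborel) + 2 * (\<integral>\<^sup>+y. \<integral>\<^sup>+t. ?I2 t y \<partial>lborel \<partial>lborel)"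
    by (simp add: nn_integral_add nn_integral_cmult)
  also have "\<dots> \<le> 2 * (ennreal (corthi CARD('n) a * B\<^sup>2) * ?H) + 2 * (ennreal (4 * ccar CARD('n) a * B\<^sup>2) * ?H)"
    by (intro add_mono mult_left_mono orth' paraproduct h) auto
  also have "\<dots> = ennreal (2 * (corthi CARD('n) a * B\<^sup>2) + 2 * (4 * ccar CARD('n) a * B\<^sup>2)) * ?H"
    using corthi_nonneg[OF a, of "CARD('n)"] ccar_pos[OF a, of "CARD('n)"]
    by (simp add: ennreal_mult distrib_right mult.assoc)
  also have "2 * (corthi CARD('n) a * B\<^sup>2) + 2 * (4 * ccar CARD('n) a * B\<^sup>2) = csq CARD('n) a * B\<^sup>2"
    by (simp add: csq_def algebra_simps)
  finally show ?thesis .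
qed

end

subsection \<open>The bi-parameter decomposition\<close>

text \<open>The kernel is real here; real and imaginary parts of the original one are inserted
  separately. \<open>carl1\<close> to \<open>carl2'\<close> are the testing conditions for the
  kernel frozen in one variable and for its differences there. In \<open>carl12\<close> the set
  attached to a pair of scales is a union of dyadic rectangles of these scales, the shape in which
  level sets of averages occur, and the union over all scales is the set of the Carleson
  condition.\<close>

locale bi_parameter =
  fixes K :: "real \<times> real \<times> ((real^'n) \<times> (real^'m)) \<times> ((real^'n) \<times> (real^'m)) \<Rightarrow> real"
    and A a b D :: real
  assumes K_meas[measurable]: "K \<in> borel_measurable borel" and A: "0 < A" and a: "0 < a" and b: "0 < b" and D: "0 \<le> D"
    and size: "\<And>t1 t2 y1 y2 z1 z2. 0 < t1 \<Longrightarrow> 0 < t2 \<Longrightarrow>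
      \<bar>K (t1, t2, (y1, y2), (z1, z2))\<bar> \<le> A * kap a t1 (y1 - z1) * kap b t2 (y2 - z2)"
    and holder12: "\<And>t1 t2 y1 y2 z1 z2 z1' z2'. 0 < t1 \<Longrightarrow> 0 < t2 \<Longrightarrow> infnorm (z1 - z1') < t1 / 2 \<Longrightarrow> infnorm (z2 - z2') < t2 / 2 \<Longrightarrow>
      \<bar>K (t1, t2, (y1, y2), (z1, z2)) - K (t1, t2, (y1, y2), (z1, z2')) - K (t1, t2, (y1, y2), (z1', z2)) + K (t1, t2, (y1, y2), (z1', z2'))\<bar>
        \<le> A * ((infnorm (z1 - z1') / t1) powr a * kap a t1 (y1 - z1)) * ((infnorm (z2 - z2') / t2) powr b * kap b t2 (y2 - z2))"
    and holder2: "\<And>t1 t2 y1 y2 z1 z2 z2'. 0 < t1 \<Longrightarrow> 0 < t2 \<Longrightarrow> infnorm (z2 - z2') < t2 / 2 \<Longrightarrow>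
      \<bar>K (t1, t2, (y1, y2), (z1, z2)) - K (t1, t2, (y1, y2), (z1, z2'))\<bar>
        \<le> A * kap a t1 (y1 - z1) * ((infnorm (z2 - z2') / t2) powr b * kap b t2 (y2 - z2))"
    and holder1: "\<And>t1 t2 y1 y2 z1 z2 z1'. 0 < t1 \<Longrightarrow> 0 < t2 \<Longrightarrow> infnorm (z1 - z1') < t1 / 2 \<Longrightarrow>
      \<bar>K (t1, t2, (y1, y2), (z1, z2)) - K (t1, t2, (y1, y2), (z1', z2))\<bar>
        \<le> A * ((infnorm (z1 - z1') / t1) powr a * kap a t1 (y1 - z1)) * kap b t2 (y2 - z2)"
    and carl1: "\<And>k x t2 y2 z2. 0 < t2 \<Longrightarrow>
      (\<integral>\<^sup>+y1. indicator {y. dcor k y = dcor k x} y1 * (\<integral>\<^sup>+t1. indicator {0<..2 powr real_of_int k} t1 *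
          (ennreal (1 / t1) * ennreal ((\<integral>z1. indicator {z. dcor k z = dcor k x} z1 * K (t1, t2, (y1, y2), (z1, z2)) \<partial>lborel)\<^sup>2)) \<partial>lborel) \<partial>lborel)
        \<le> ennreal ((A * kap b t2 (y2 - z2))\<^sup>2 * (2 powr real_of_int k) ^ CARD('n))"
    and carl1': "\<And>k x t2 y2 z2 z2'. 0 < t2 \<Longrightarrow> infnorm (z2 - z2') < t2 / 2 \<Longrightarrow> z2 \<noteq> z2' \<Longrightarrow>
      (\<integral>\<^sup>+y1. indicator {y. dcor k y = dcor k x} y1 * (\<integral>\<^sup>+t1. indicator {0<..2 powr real_of_int k} t1 *
          (ennreal (1 / t1) * ennreal ((\<integral>z1. indicator {z. dcor k z = dcor k x} z1 * (K (t1, t2, (y1, y2), (z1, z2)) - K (t1, t2, (y1, y2), (z1, z2'))) \<partial>lborel)\<^sup>2)) \<partial>lborel) \<partial>lborel)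
        \<le> ennreal ((A * ((infnorm (z2 - z2') / t2) powr b * kap b t2 (y2 - z2)))\<^sup>2 * (2 powr real_of_int k) ^ CARD('n))"
    and carl2: "\<And>k x t1 y1 z1. 0 < t1 \<Longrightarrow>
      (\<integral>\<^sup>+y2. indicator {y. dcor k y = dcor k x} y2 * (\<integral>\<^sup>+t2. indicator {0<..2 powr real_of_int k} t2 *
          (ennreal (1 / t2) * ennreal ((\<integral>z2. indicator {z. dcor k z = dcor k x} z2 * K (t1, t2, (y1, y2), (z1, z2)) \<partial>lborel)\<^sup>2)) \<partial>lborel) \<partial>lborel)
        \<le> ennreal ((A * kap a t1 (y1 - z1))\<^sup>2 * (2 powr real_of_int k) ^ CARD('m))"
    and carl2': "\<And>k x t1 y1 z1 z1'. 0 < t1 \<Longrightarrow> infnorm (z1 - z1') < t1 / 2 \<Longrightarrow> z1 \<noteq> z1' \<Longrightarrow>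
      (\<integral>\<^sup>+y2. indicator {y. dcor k y = dcor k x} y2 * (\<integral>\<^sup>+t2. indicator {0<..2 powr real_of_int k} t2 *
          (ennreal (1 / t2) * ennreal ((\<integral>z2. indicator {z. dcor k z = dcor k x} z2 * (K (t1, t2, (y1, y2), (z1, z2)) - K (t1, t2, (y1, y2), (z1', z2))) \<partial>lborel)\<^sup>2)) \<partial>lborel) \<partial>lborel)
        \<le> ennreal ((A * ((infnorm (z1 - z1') / t1) powr a * kap a t1 (y1 - z1)))\<^sup>2 * (2 powr real_of_int k) ^ CARD('m))"
    and carl12: "\<And>S. (\<And>k1 k2. S k1 k2 \<in> sets borel) \<Longrightarrow>
      (\<And>k1 k2 y z. y \<in> S k1 k2 \<Longrightarrow> dcor k1 (fst z) = dcor k1 (fst y) \<Longrightarrow> dcor k2 (snd z) = dcor k2 (snd y) \<Longrightarrow> z \<in> S k1 k2) \<Longrightarrow>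
      emeasure lborel (\<Union>k1 k2. S k1 k2) < \<infinity> \<Longrightarrow>
      (\<integral>\<^sup>+t1. \<integral>\<^sup>+t2. \<integral>\<^sup>+y. indicator {0<..} t1 * indicator {0<..} t2 * ennreal (1 / (t1 * t2) * (\<integral>z. K (t1, t2, y, z) \<partial>lborel)\<^sup>2)
          * indicator (S (kk t1) (kk t2)) y \<partial>lborel \<partial>lborel \<partial>lborel)
        \<le> ennreal D * emeasure lborel (\<Union>k1 k2. S k1 k2)"
begin

text \<open>Freezing \<open>t1\<close>, \<open>y1\<close>, \<open>z1\<close> leaves a one-parameter
  kernel in the second variable. Its constant \<open>A * kap a t1 (y1 - z1)\<close> has the
  dependence on \<open>(y1, z1)\<close> that \<open>op_kernel\<close> requires of an operator
  norm.\<close>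

lemma one2:
  assumes t1: "0 < t1"
  shows "one_parameter (\<lambda>(t2, y2, z2). K (t1, t2, (y1, y2), (z1, z2))) (A * kap a t1 (y1 - z1)) b"
proof (rule one_parameter.intro)
  show "(\<lambda>(t2, y2, z2). K (t1, t2, (y1, y2), (z1, z2))) \<in> borel_measurable borel"
    unfolding borel_prod[symmetric] by measurable
  show "0 < A * kap a t1 (y1 - z1)" using A kap_pos[OF t1, of a "y1 - z1"] by simp
qed (use t1 b size[OF t1] holder2[OF t1] carl2[OF t1] in auto)

text \<open>For a difference in \<open>z1\<close>, the smoothness in the second variable is the
  mixed estimate \<open>holder12\<close>. The condition \<open>z1 \<noteq> z1'\<close> makes the
  constant strictly positive, as \<open>one_parameter\<close> asks; the same condition in
  \<open>op_kernel\<close> goes back to this.\<close>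

lemma one2':
  assumes t1: "0 < t1" and d: "infnorm (z1 - z1') < t1 / 2" "z1 \<noteq> z1'"
  shows "one_parameter (\<lambda>(t2, y2, z2). K (t1, t2, (y1, y2), (z1, z2)) - K (t1, t2, (y1, y2), (z1', z2)))
     (A * ((infnorm (z1 - z1') / t1) powr a * kap a t1 (y1 - z1))) b"
proof (rule one_parameter.intro)
  show "(\<lambda>(t2, y2, z2). K (t1, t2, (y1, y2), (z1, z2)) - K (t1, t2, (y1, y2), (z1', z2))) \<in> borel_measurable borel"
    unfolding borel_prod[symmetric] by measurable
  have "0 < infnorm (z1 - z1')" using d(2) by (simp add: infnorm_pos_lt)
  then show "0 < A * ((infnorm (z1 - z1') / t1) powr a * kap a t1 (y1 - z1))" using A kap_pos[OF t1, of a "y1 - z1"] t1 by simp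
  fix t2 :: real and y2 z2 z2' :: "real^'m" assume t2: "0 < t2" and d2: "infnorm (z2 - z2') < t2 / 2"
  show "\<bar>(case (t2, y2, z2) of (t2, y2, z2) \<Rightarrow> K (t1, t2, (y1, y2), (z1, z2)) - K (t1, t2, (y1, y2), (z1', z2)))
     - (case (t2, y2, z2') of (t2, y2, z2) \<Rightarrow> K (t1, t2, (y1, y2), (z1, z2)) - K (t1, t2, (y1, y2), (z1', z2)))\<bar>
     \<le> A * ((infnorm (z1 - z1') / t1) powr a * kap a t1 (y1 - z1)) * ((infnorm (z2 - z2') / t2) powr b * kap b t2 (y2 - z2))"
    using holder12[OF t1 t2 d(1) d2, of y1 y2] by (simp add: algebra_simps)
qed (use t1 b d holder1[OF t1 _ d(1)] carl2'[OF t1 d] in auto)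

lemma one1:
  assumes t2: "0 < t2"
  shows "one_parameter (\<lambda>(t1, y1, z1). K (t1, t2, (y1, y2), (z1, z2))) (A * kap b t2 (y2 - z2)) a"
proof (rule one_parameter.intro)
  show "(\<lambda>(t1, y1, z1). K (t1, t2, (y1, y2), (z1, z2))) \<in> borel_measurable borel"
    unfolding borel_prod[symmetric] by measurable
  show "0 < A * kap b t2 (y2 - z2)" using A kap_pos[OF t2, of b "y2 - z2"] by simp
  show "\<bar>case (t1, y1, z1) of (t1, y1, z1) \<Rightarrow> K (t1, t2, (y1, y2), (z1, z2))\<bar> \<le> A * kap b t2 (y2 - z2) * kap a t1 (y1 - z1)" if "0 < t1" for t1 y1 z1
    using size[OF that t2, of y1 y2 z1 z2] by (simp add: mult_ac)
  show "\<bar>(case (t1, y1, z1) of (t1, y1, z1) \<Rightarrow> K (t1, t2, (y1, y2), (z1, z2))) - (case (t1, y1, z1') of (t1, y1, z1) \<Rightarrow> K (t1, t2, (y1, y2), (z1, z2)))\<bar>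
     \<le> A * kap b t2 (y2 - z2) * ((infnorm (z1 - z1') / t1) powr a * kap a t1 (y1 - z1))" if "0 < t1" "infnorm (z1 - z1') < t1 / 2" for t1 y1 z1 z1'
    using holder1[OF that(1) t2 that(2), of y1 y2 z2] by (simp add: mult_ac)
qed (use a carl1[OF t2] in auto)

lemma one1':
  assumes t2: "0 < t2" and d: "infnorm (z2 - z2') < t2 / 2" "z2 \<noteq> z2'"
  shows "one_parameter (\<lambda>(t1, y1, z1). K (t1, t2, (y1, y2), (z1, z2)) - K (t1, t2, (y1, y2), (z1, z2')))
     (A * ((infnorm (z2 - z2') / t2) powr b * kap b t2 (y2 - z2))) a"
proof (rule one_parameter.intro)
  show "(\<lambda>(t1, y1, z1). K (t1, t2, (y1, y2), (z1, z2)) - K (t1, t2, (y1, y2), (z1, z2'))) \<in> borel_measurable borel"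
    unfolding borel_prod[symmetric] by measurable
  have "0 < infnorm (z2 - z2')" using d(2) by (simp add: infnorm_pos_lt)
  then show "0 < A * ((infnorm (z2 - z2') / t2) powr b * kap b t2 (y2 - z2))" using A kap_pos[OF t2, of b "y2 - z2"] t2 by simp
  show "\<bar>case (t1, y1, z1) of (t1, y1, z1) \<Rightarrow> K (t1, t2, (y1, y2), (z1, z2)) - K (t1, t2, (y1, y2), (z1, z2'))\<bar>
    \<le> A * ((infnorm (z2 - z2') / t2) powr b * kap b t2 (y2 - z2)) * kap a t1 (y1 - z1)" if "0 < t1" for t1 y1 z1
    using holder2[OF that t2 d(1), of y1 y2 z1] by (simp add: mult_ac)
  fix t1 :: real and y1 z1 z1' :: "real^'n" assume t1: "0 < t1" and d1: "infnorm (z1 - z1') < t1 / 2"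
  show "\<bar>(case (t1, y1, z1) of (t1, y1, z1) \<Rightarrow> K (t1, t2, (y1, y2), (z1, z2)) - K (t1, t2, (y1, y2), (z1, z2')))
     - (case (t1, y1, z1') of (t1, y1, z1) \<Rightarrow> K (t1, t2, (y1, y2), (z1, z2)) - K (t1, t2, (y1, y2), (z1, z2')))\<bar>
     \<le> A * ((infnorm (z2 - z2') / t2) powr b * kap b t2 (y2 - z2)) * ((infnorm (z1 - z1') / t1) powr a * kap a t1 (y1 - z1))"
    using holder12[OF t1 t2 d1 d(1), of y1 y2] by (simp add: algebra_simps)
qed (use a carl1'[OF t2 d] in auto)

text \<open>The factor \<open>1 / sqrt t2\<close> absorbs the measure \<open>dt2 / t2\<close>, so that the target space has Lebesgue measure.\<close>

definition "K1 t1 = (\<lambda>(y1, z1, v, z2). if 0 < snd v then K (t1, snd v, (y1, fst v), (z1, z2)) / sqrt (snd v) else 0)"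

lemma K1_meas[measurable]: "K1 t1 \<in> borel_measurable (lborel \<Otimes>\<^sub>M lborel \<Otimes>\<^sub>M (lborel \<Otimes>\<^sub>M lborel) \<Otimes>\<^sub>M lborel)"
  unfolding K1_def by measurable

lemma op1:
  assumes t1: "0 < t1"
  shows "op_kernel lborel (lborel \<Otimes>\<^sub>M lborel) (K1 t1) (\<lambda>(y2, t2) z2. if 0 < t2 then A * kap b t2 (y2 - z2) / sqrt t2 else 0)
     (A * sqrt (csq CARD('m) b)) a t1 (kk t1)"
proof (rule op_kernel.intro)
  have cp: "0 < csq CARD('m) b" using b by (rule csq_pos)
  show "sigma_finite_measure (lborel :: (real^'m) measure)" by (rule sigma_finite_lborel)
  show "sigma_finite_measure (lborel \<Otimes>\<^sub>M lborel :: ((real^'m) \<times> real) measure)" by (simp add: lborel_prod sigma_finite_lborel)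
  show "K1 t1 \<in> borel_measurable (lborel \<Otimes>\<^sub>M lborel \<Otimes>\<^sub>M (lborel \<Otimes>\<^sub>M lborel) \<Otimes>\<^sub>M lborel)" by measurable
  show "0 < A * sqrt (csq CARD('m) b)" using A cp by simp
  show "0 < a" by (rule a)
  show "2 powr (real_of_int (kk t1) - 1) < t1" "t1 \<le> 2 powr real_of_int (kk t1)" using kk_bounds[OF t1] .
  show "\<bar>K1 t1 (y, z, v, w)\<bar> \<le> kap a t1 (y - z) * (case v of (y2, t2) \<Rightarrow> \<lambda>z2. if 0 < t2 then A * kap b t2 (y2 - z2) / sqrt t2 else 0) w" for y z v w
  proof (cases v)
    case (Pair y2 t2)
    show ?thesis
    proof (cases "0 < t2")
      case True
      have "\<bar>K (t1, t2, (y, y2), (z, w))\<bar> / sqrt t2 \<le> A * kap a t1 (y - z) * kap b t2 (y2 - w) / sqrt t2"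
        using True by (intro divide_right_mono size t1) auto
      then show ?thesis using Pair True by (simp add: K1_def mult_ac)
    qed (simp add: Pair K1_def)
  qed
  show "(case v of (y2, t2) \<Rightarrow> \<lambda>z2. if 0 < t2 then A * kap b t2 (y2 - z2) / sqrt t2 else 0) \<in> borel_measurable lborel" for v :: "(real^'m) \<times> real"
    by (cases v) (simp, measurable)
  show "(\<integral>\<^sup>+w. ennreal (((case v of (y2, t2) \<Rightarrow> \<lambda>z2. if 0 < t2 then A * kap b t2 (y2 - z2) / sqrt t2 else 0) w)\<^sup>2) \<partial>lborel) < \<infinity>" for v :: "(real^'m) \<times> real"
  proof (cases v)
    case (Pair y2 t2)
    show ?thesis
    proof (cases "0 < t2")
      case True
      have "sqi (\<lambda>z2. kap b t2 (y2 - z2))"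
      proof -
        have "(\<integral>\<^sup>+z. ennreal ((kap b t2 (y2 - z))\<^sup>2) \<partial>lborel) \<le> (\<integral>\<^sup>+z. ennreal (1 / t2 ^ CARD('m)) * ennreal (kap b t2 (y2 - z)) \<partial>lborel)"
        proof (rule nn_integral_mono)
          fix z :: "real^'m"
          show "ennreal ((kap b t2 (y2 - z))\<^sup>2) \<le> ennreal (1 / t2 ^ CARD('m)) * ennreal (kap b t2 (y2 - z))"
            unfolding power2_eq_square using mult_right_mono[OF kap_le[of t2 b "y2 - z"] kap_nonneg[of b t2 "y2 - z"]] True b
            by (subst ennreal_mult[symmetric]) (auto intro!: ennreal_leI simp: kap_nonneg)
        qed
        also have "\<dots> = ennreal (1 / t2 ^ CARD('m)) * (\<integral>\<^sup>+z. ennreal (kap b t2 (y2 - z)) \<partial>lborel)"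
          by (rule nn_integral_cmult) measurable
        also have "\<dots> \<le> ennreal (1 / t2 ^ CARD('m)) * ennreal (ckap CARD('m) b)"
          using True b by (intro mult_left_mono nn_integral_kap_shift) auto
        also have "\<dots> < \<infinity>" by (simp add: ennreal_mult_less_top)
        finally show ?thesis unfolding sqi_def by simp
      qed
      then have "(\<integral>\<^sup>+z. ennreal ((A / sqrt t2)\<^sup>2) * ennreal ((kap b t2 (y2 - z))\<^sup>2) \<partial>lborel) < \<infinity>"
        by (subst nn_integral_cmult) (auto simp: sqi_def ennreal_mult_less_top)
      moreover have "((A / sqrt t2)\<^sup>2) * ((kap b t2 (y2 - z))\<^sup>2) = (A * kap b t2 (y2 - z) / sqrt t2)\<^sup>2" for z
        by (simp add: power_divide power_mult_distrib)
      ultimately show ?thesis using Pair True by (simp add: ennreal_mult[symmetric])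
    qed (simp add: Pair)
  qed
  fix y z :: "real^'n" and h :: "real^'m \<Rightarrow> real"
  assume h: "h \<in> borel_measurable lborel" "(\<integral>\<^sup>+w. ennreal ((h w)\<^sup>2) \<partial>lborel) < \<infinity>"
  then have sh: "sqi h" and [measurable]: "h \<in> borel_measurable borel" by (auto simp: sqi_def)
  have key: "(\<integral>\<^sup>+v. ennreal ((\<integral>w. (if 0 < snd v then G (snd v, fst v, w) / sqrt (snd v) else 0) * h w \<partial>lborel)\<^sup>2) \<partial>(lborel \<Otimes>\<^sub>M lborel))
      \<le> ennreal ((sqrt (csq CARD('m) b) * B)\<^sup>2) * (\<integral>\<^sup>+w. ennreal ((h w)\<^sup>2) \<partial>lborel)"
    if G: "one_parameter G B b" for G :: "real \<times> (real^'m) \<times> (real^'m) \<Rightarrow> real" and B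
  proof -
    interpret one_parameter G B b by fact
    have e: "ennreal ((\<integral>w. (if 0 < t2 then G (t2, y2, w) / sqrt t2 else 0) * h w \<partial>lborel)\<^sup>2)
       = indicator {0<..} t2 * (ennreal (1 / t2) * ennreal ((\<integral>w. G (t2, y2, w) * h w \<partial>lborel)\<^sup>2))" for y2 t2
      by (cases "0 < t2") (simp_all add: ennreal_mult[symmetric] power_divide)
    have "(\<integral>\<^sup>+v. ennreal ((\<integral>w. (if 0 < snd v then G (snd v, fst v, w) / sqrt (snd v) else 0) * h w \<partial>lborel)\<^sup>2) \<partial>(lborel \<Otimes>\<^sub>M lborel))
       = (\<integral>\<^sup>+y2. \<integral>\<^sup>+t2. ennreal ((\<integral>w. (if 0 < t2 then G (t2, y2, w) / sqrt t2 else 0) * h w \<partial>lborel)\<^sup>2) \<partial>lborel \<partial>lborel)"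
      by (subst lborel.nn_integral_fst[symmetric]) (simp_all cong: if_cong, measurable)
    also have "\<dots> \<le> ennreal (csq CARD('m) b * B\<^sup>2) * (\<integral>\<^sup>+w. ennreal ((h w)\<^sup>2) \<partial>lborel)"
      unfolding e by (rule bound[OF sh])
    also have "csq CARD('m) b * B\<^sup>2 = (sqrt (csq CARD('m) b) * B)\<^sup>2" using cp by (simp add: power_mult_distrib)
    finally show ?thesis .
  qed
  show "(\<integral>\<^sup>+v. ennreal ((\<integral>w. K1 t1 (y, z, v, w) * h w \<partial>lborel)\<^sup>2) \<partial>(lborel \<Otimes>\<^sub>M lborel))
      \<le> ennreal ((A * sqrt (csq CARD('m) b) * kap a t1 (y - z))\<^sup>2) * (\<integral>\<^sup>+w. ennreal ((h w)\<^sup>2) \<partial>lborel)"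
    using key[OF one2[OF t1, of y z]] by (simp add: K1_def mult_ac cong: if_cong)
  fix z' assume d: "infnorm (z - z') < t1 / 2" "z \<noteq> z'"
  have "K1 t1 (y, z, v, w) - K1 t1 (y, z', v, w) = (if 0 < snd v then (K (t1, snd v, (y, fst v), (z, w)) - K (t1, snd v, (y, fst v), (z', w))) / sqrt (snd v) else 0)" for v w
    by (simp add: K1_def split_beta' diff_divide_distrib)
  then show "(\<integral>\<^sup>+v. ennreal ((\<integral>w. (K1 t1 (y, z, v, w) - K1 t1 (y, z', v, w)) * h w \<partial>lborel)\<^sup>2) \<partial>(lborel \<Otimes>\<^sub>M lborel))
      \<le> ennreal ((A * sqrt (csq CARD('m) b) * ((infnorm (z - z') / t1) powr a * kap a t1 (y - z)))\<^sup>2) * (\<integral>\<^sup>+w. ennreal ((h w)\<^sup>2) \<partial>lborel)"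
    using key[OF one2'[OF t1 d, of y]] by (simp add: mult_ac cong: if_cong)
qed

text \<open>The kernel tested on 1 in the first variable only.\<close>

definition "Ka t1 t2 y1 y2 z2 = (\<integral>z1. K (t1, t2, (y1, y2), (z1, z2)) \<partial>lborel)"

lemma Ka_meas[measurable (raw)]:
  assumes [measurable]: "f1 \<in> borel_measurable M" "f2 \<in> borel_measurable M" "g1 \<in> borel_measurable M" "g2 \<in> borel_measurable M" "g3 \<in> borel_measurable M"
  shows "(\<lambda>x. Ka (f1 x) (f2 x) (g1 x) (g2 x) (g3 x)) \<in> borel_measurable M"
  unfolding Ka_def by measurable

lemma K_int1: "0 < t1 \<Longrightarrow> 0 < t2 \<Longrightarrow> integrable lborel (\<lambda>z1. K (t1, t2, (y1, y2), (z1, z2)))"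
  using one_parameter.L_int[OF one1[of t2 y2 z2], of t1 y1] by simp

lemma Ka_bound:
  assumes t: "0 < t1" "0 < t2"
  shows "\<bar>Ka t1 t2 y1 y2 z2\<bar> \<le> A * ckap CARD('n) a * kap b t2 (y2 - z2)"
proof -
  have c0: "0 \<le> ckap CARD('n) a" using ckap_pos[OF a] less_imp_le by blast
  have "\<bar>Ka t1 t2 y1 y2 z2\<bar> \<le> (\<integral>z1. \<bar>K (t1, t2, (y1, y2), (z1, z2))\<bar> \<partial>lborel)"
    unfolding Ka_def by (rule integral_abs_bound)
  also have "\<dots> \<le> (\<integral>z1. (A * kap b t2 (y2 - z2)) * kap a t1 (y1 - z1) \<partial>lborel)"
    using size[OF t, of y1 y2 _ z2] by (intro integral_mono integrable_abs K_int1 t integrable_mult_right kap_int a) (simp add: mult_ac)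
  also have "\<dots> = (A * kap b t2 (y2 - z2)) * (\<integral>z1. kap a t1 (y1 - z1) \<partial>lborel)" by simp
  also have "\<dots> \<le> (A * kap b t2 (y2 - z2)) * ckap CARD('n) a"
  proof (rule mult_left_mono)
    have "ennreal (\<integral>z1. kap a t1 (y1 - z1) \<partial>lborel) = (\<integral>\<^sup>+z1. ennreal (kap a t1 (y1 - z1)) \<partial>lborel)"
      by (rule nn_integral_eq_integral[symmetric]) (auto intro: kap_int t a simp: kap_nonneg)
    also have "\<dots> \<le> ennreal (ckap CARD('n) a)" by (rule nn_integral_kap_shift(2)[OF t(1) a])
    finally show "(\<integral>z1. kap a t1 (y1 - z1) \<partial>lborel) \<le> ckap CARD('n) a" using c0 by simp
  qed (use A in \<open>simp add: kap_nonneg\<close>)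
  finally show ?thesis by (simp add: mult_ac)
qed

text \<open>Kernel of the middle term, with the roles of the variables exchanged. To the pair
  \<open>(y2, z2)\<close> it attaches a paraproduct in the first variable: the average of a function
  of z1 at \<open>(y1, t1)\<close>, multiplied by \<open>Ka\<close>. As for \<open>K1\<close>, the
  square root turns dt1 / t1 into Lebesgue measure.\<close>

definition "K2 t2 = (\<lambda>(y2, z2, v, z1). if 0 < snd v then Ka (snd v) t2 (fst v) y2 z2 * dker (kk (snd v)) (fst v) z1 / sqrt (snd v) else 0)"

lemma K2_meas[measurable]: "K2 t2 \<in> borel_measurable (lborel \<Otimes>\<^sub>M lborel \<Otimes>\<^sub>M (lborel \<Otimes>\<^sub>M lborel) \<Otimes>\<^sub>M lborel)"
  unfolding K2_def by measurable

text \<open>The operator norms are \<open>one_parameter.paraproduct\<close> for the kernel frozen in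
  the second variable and for its difference there; the constant \<open>4 * ccar\<close> is the one
  of that estimate.\<close>

lemma op2:
  assumes t2: "0 < t2"
  shows "op_kernel lborel (lborel \<Otimes>\<^sub>M lborel) (K2 t2) (\<lambda>(y1, t1) z1. if 0 < t1 then A * ckap CARD('n) a * dker (kk t1) y1 z1 / sqrt t1 else 0)
     (A * sqrt (4 * ccar CARD('n) a)) b t2 (kk t2)"
proof (rule op_kernel.intro)
  have cp: "0 < ccar CARD('n) a" using a by (rule ccar_pos)
  show "sigma_finite_measure (lborel :: (real^'n) measure)" by (rule sigma_finite_lborel)
  show "sigma_finite_measure (lborel \<Otimes>\<^sub>M lborel :: ((real^'n) \<times> real) measure)" by (simp add: lborel_prod sigma_finite_lborel)
  show "K2 t2 \<in> borel_measurable (lborel \<Otimes>\<^sub>M lborel \<Otimes>\<^sub>M (lborel \<Otimes>\<^sub>M lborel) \<Otimes>\<^sub>M lborel)" by measurable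
  show "0 < A * sqrt (4 * ccar CARD('n) a)" using A cp by simp
  show "0 < b" by (rule b)
  show "2 powr (real_of_int (kk t2) - 1) < t2" "t2 \<le> 2 powr real_of_int (kk t2)" using kk_bounds[OF t2] .
  show "\<bar>K2 t2 (y, z, v, w)\<bar> \<le> kap b t2 (y - z) * (case v of (y1, t1) \<Rightarrow> \<lambda>z1. if 0 < t1 then A * ckap CARD('n) a * dker (kk t1) y1 z1 / sqrt t1 else 0) w" for y z v w
  proof (cases v)
    case (Pair y1 t1)
    show ?thesis
    proof (cases "0 < t1")
      case True
      have "\<bar>Ka t1 t2 y1 y z\<bar> * dker (kk t1) y1 w / sqrt t1 \<le> (A * ckap CARD('n) a * kap b t2 (y - z)) * dker (kk t1) y1 w / sqrt t1"
        using True by (intro divide_right_mono mult_right_mono Ka_bound t2) auto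
      then show ?thesis using Pair True by (simp add: K2_def mult_ac abs_mult)
    qed (simp add: Pair K2_def)
  qed
  show "(case v of (y1, t1) \<Rightarrow> \<lambda>z1. if 0 < t1 then A * ckap CARD('n) a * dker (kk t1) y1 z1 / sqrt t1 else 0) \<in> borel_measurable lborel" for v :: "(real^'n) \<times> real"
    by (cases v) (simp, measurable)
  show "(\<integral>\<^sup>+w. ennreal (((case v of (y1, t1) \<Rightarrow> \<lambda>z1. if 0 < t1 then A * ckap CARD('n) a * dker (kk t1) y1 z1 / sqrt t1 else 0) w)\<^sup>2) \<partial>lborel) < \<infinity>" for v :: "(real^'n) \<times> real"
  proof (cases v)
    case (Pair y1 t1)
    show ?thesis
    proof (cases "0 < t1")
      case True
      have "(\<integral>\<^sup>+z. ennreal ((A * ckap CARD('n) a / sqrt t1)\<^sup>2) * ennreal ((dker (kk t1) y1 z)\<^sup>2) \<partial>lborel) < \<infinity>"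
        using sqi_dker[of "kk t1" y1] by (subst nn_integral_cmult) (auto simp: sqi_def ennreal_mult_less_top)
      moreover have "((A * ckap CARD('n) a / sqrt t1)\<^sup>2) * ((dker (kk t1) y1 z)\<^sup>2) = (A * ckap CARD('n) a * dker (kk t1) y1 z / sqrt t1)\<^sup>2" for z
        by (simp add: power_divide power_mult_distrib)
      ultimately show ?thesis using Pair True by (simp add: ennreal_mult[symmetric])
    qed (simp add: Pair)
  qed
  fix y z :: "real^'m" and h :: "real^'n \<Rightarrow> real"
  assume h: "h \<in> borel_measurable lborel" "(\<integral>\<^sup>+w. ennreal ((h w)\<^sup>2) \<partial>lborel) < \<infinity>"
  then have sh: "sqi h" and [measurable]: "h \<in> borel_measurable borel" by (auto simp: sqi_def)
  have key: "(\<integral>\<^sup>+v. ennreal ((\<integral>w. (if 0 < snd v then (\<integral>z1. G (snd v, fst v, z1) \<partial>lborel) * dker (kk (snd v)) (fst v) w / sqrt (snd v) else 0) * h w \<partial>lborel)\<^sup>2) \<partial>(lborel \<Otimes>\<^sub>M lborel))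
      \<le> ennreal ((sqrt (4 * ccar CARD('n) a) * B)\<^sup>2) * (\<integral>\<^sup>+w. ennreal ((h w)\<^sup>2) \<partial>lborel)"
    if G: "one_parameter G B a" for G :: "real \<times> (real^'n) \<times> (real^'n) \<Rightarrow> real" and B
  proof -
    interpret one_parameter G B a by fact
    have e: "ennreal ((\<integral>w. (if 0 < t1 then (\<integral>z1. G (t1, y1, z1) \<partial>lborel) * dker (kk t1) y1 w / sqrt t1 else 0) * h w \<partial>lborel)\<^sup>2)
       = indicator {0<..} t1 * (ennreal (1 / t1) * ennreal ((\<integral>z. G (t1, y1, z) \<partial>lborel)\<^sup>2)) * ennreal ((dexp (kk t1) h y1)\<^sup>2)" for y1 t1
    proof (cases "0 < t1")
      case True
      have "(\<integral>w. (\<integral>z1. G (t1, y1, z1) \<partial>lborel) * dker (kk t1) y1 w / sqrt t1 * h w \<partial>lborel) = (\<integral>w. (\<integral>z1. G (t1, y1, z1) \<partial>lborel) / sqrt t1 * (dker (kk t1) y1 w * h w) \<partial>lborel)"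
        by (simp add: mult_ac)
      also have "\<dots> = (\<integral>z1. G (t1, y1, z1) \<partial>lborel) / sqrt t1 * dexp (kk t1) h y1" unfolding dexp_def by simp
      finally show ?thesis using True by (simp add: ennreal_mult[symmetric] power_divide power_mult_distrib)
    qed simp
    have "(\<integral>\<^sup>+v. ennreal ((\<integral>w. (if 0 < snd v then (\<integral>z1. G (snd v, fst v, z1) \<partial>lborel) * dker (kk (snd v)) (fst v) w / sqrt (snd v) else 0) * h w \<partial>lborel)\<^sup>2) \<partial>(lborel \<Otimes>\<^sub>M lborel))
       = (\<integral>\<^sup>+y1. \<integral>\<^sup>+t1. ennreal ((\<integral>w. (if 0 < t1 then (\<integral>z1. G (t1, y1, z1) \<partial>lborel) * dker (kk t1) y1 w / sqrt t1 else 0) * h w \<partial>lborel)\<^sup>2) \<partial>lborel \<partial>lborel)"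
      by (subst lborel.nn_integral_fst[symmetric]) (simp_all cong: if_cong, measurable)
    also have "\<dots> \<le> ennreal (4 * ccar CARD('n) a * B\<^sup>2) * (\<integral>\<^sup>+w. ennreal ((h w)\<^sup>2) \<partial>lborel)"
      unfolding e by (rule paraproduct[OF sh])
    also have "4 * ccar CARD('n) a * B\<^sup>2 = (sqrt (4 * ccar CARD('n) a) * B)\<^sup>2"
      using cp by (simp add: power_mult_distrib del: real_sqrt_mult)
    finally show ?thesis .
  qed
  show "(\<integral>\<^sup>+v. ennreal ((\<integral>w. K2 t2 (y, z, v, w) * h w \<partial>lborel)\<^sup>2) \<partial>(lborel \<Otimes>\<^sub>M lborel))
      \<le> ennreal ((A * sqrt (4 * ccar CARD('n) a) * kap b t2 (y - z))\<^sup>2) * (\<integral>\<^sup>+w. ennreal ((h w)\<^sup>2) \<partial>lborel)"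
    using key[OF one1[OF t2, of y z]] by (simp add: K2_def Ka_def mult_ac cong: if_cong)
  fix z' assume d: "infnorm (z - z') < t2 / 2" "z \<noteq> z'"
  have "K2 t2 (y, z, v, w) - K2 t2 (y, z', v, w) = (if 0 < snd v then (\<integral>z1. K (snd v, t2, (fst v, y), (z1, z)) - K (snd v, t2, (fst v, y), (z1, z')) \<partial>lborel) * dker (kk (snd v)) (fst v) w / sqrt (snd v) else 0)" for v w
  proof (cases "0 < snd v")
    case True
    have "(\<integral>z1. K (snd v, t2, (fst v, y), (z1, z)) - K (snd v, t2, (fst v, y), (z1, z')) \<partial>lborel) = Ka (snd v) t2 (fst v) y z - Ka (snd v) t2 (fst v) y z'"
      unfolding Ka_def by (rule Bochner_Integration.integral_diff) (intro K_int1 True t2)+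
    then show ?thesis using True by (simp add: K2_def split_beta' diff_divide_distrib left_diff_distrib)
  qed (simp add: K2_def split_beta')
  then show "(\<integral>\<^sup>+v. ennreal ((\<integral>w. (K2 t2 (y, z, v, w) - K2 t2 (y, z', v, w)) * h w \<partial>lborel)\<^sup>2) \<partial>(lborel \<Otimes>\<^sub>M lborel))
      \<le> ennreal ((A * sqrt (4 * ccar CARD('n) a) * ((infnorm (z - z') / t2) powr b * kap b t2 (y - z)))\<^sup>2) * (\<integral>\<^sup>+w. ennreal ((h w)\<^sup>2) \<partial>lborel)"
    using key[OF one1'[OF t2 d, of y]] by (simp add: mult_ac cong: if_cong)
qed

end

section \<open>Iterated averages and the Carleson embedding in two parameters\<close>

text \<open>Brings the integrals into the order of \<open>op_kernel\<close>: the main point variable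
  outside, and inside the target space made of the other point variable and its scale.\<close>

lemma nn_integral_reorder1:
  fixes g :: "real \<times> ('a::euclidean_space) \<times> ('b::euclidean_space) \<Rightarrow> ennreal"
  assumes [measurable]: "g \<in> borel_measurable (lborel \<Otimes>\<^sub>M lborel \<Otimes>\<^sub>M lborel)"
  shows "(\<integral>\<^sup>+t. \<integral>\<^sup>+y. g (t, fst y, snd y) \<partial>lborel \<partial>lborel) = (\<integral>\<^sup>+x. \<integral>\<^sup>+v. g (snd v, x, fst v) \<partial>(lborel \<Otimes>\<^sub>M lborel) \<partial>lborel)"
proof -
  have "(\<integral>\<^sup>+t. \<integral>\<^sup>+y. g (t, fst y, snd y) \<partial>lborel \<partial>lborel) = (\<integral>\<^sup>+t. \<integral>\<^sup>+x. \<integral>\<^sup>+y. g (t, x, y) \<partial>lborel \<partial>lborel \<partial>lborel)"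
    unfolding lborel_prod[symmetric]
    by (intro nn_integral_cong) (subst lborel.nn_integral_fst[symmetric], simp_all)
  also have "\<dots> = (\<integral>\<^sup>+x. \<integral>\<^sup>+t. \<integral>\<^sup>+y. g (t, x, y) \<partial>lborel \<partial>lborel \<partial>lborel)"
    by (rule lborel_pair.Fubini') measurable
  also have "\<dots> = (\<integral>\<^sup>+x. \<integral>\<^sup>+y. \<integral>\<^sup>+t. g (t, x, y) \<partial>lborel \<partial>lborel \<partial>lborel)"
    by (intro nn_integral_cong lborel_pair.Fubini') measurable
  also have "\<dots> = (\<integral>\<^sup>+x. \<integral>\<^sup>+v. g (snd v, x, fst v) \<partial>(lborel \<Otimes>\<^sub>M lborel) \<partial>lborel)"
    by (intro nn_integral_cong) (subst lborel.nn_integral_fst[symmetric], simp_all)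
  finally show ?thesis .
qed

lemma nn_integral_reorder2:
  fixes g :: "real \<times> ('a::euclidean_space) \<times> ('b::euclidean_space) \<Rightarrow> ennreal"
  assumes [measurable]: "g \<in> borel_measurable (lborel \<Otimes>\<^sub>M lborel \<Otimes>\<^sub>M lborel)"
  shows "(\<integral>\<^sup>+t. \<integral>\<^sup>+y. g (t, fst y, snd y) \<partial>lborel \<partial>lborel) = (\<integral>\<^sup>+y. \<integral>\<^sup>+v. g (snd v, fst v, y) \<partial>(lborel \<Otimes>\<^sub>M lborel) \<partial>lborel)"
proof -
  have "(\<integral>\<^sup>+t. \<integral>\<^sup>+y. g (t, fst y, snd y) \<partial>lborel \<partial>lborel) = (\<integral>\<^sup>+t. \<integral>\<^sup>+y. \<integral>\<^sup>+x. g (t, x, y) \<partial>lborel \<partial>lborel \<partial>lborel)"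
    unfolding lborel_prod[symmetric]
    by (intro nn_integral_cong) (subst lborel_pair.nn_integral_snd[symmetric], simp_all)
  also have "\<dots> = (\<integral>\<^sup>+y. \<integral>\<^sup>+t. \<integral>\<^sup>+x. g (t, x, y) \<partial>lborel \<partial>lborel \<partial>lborel)"
    by (rule lborel_pair.Fubini') measurable
  also have "\<dots> = (\<integral>\<^sup>+y. \<integral>\<^sup>+x. \<integral>\<^sup>+t. g (t, x, y) \<partial>lborel \<partial>lborel \<partial>lborel)"
    by (intro nn_integral_cong lborel_pair.Fubini') measurable
  also have "\<dots> = (\<integral>\<^sup>+y. \<integral>\<^sup>+v. g (snd v, fst v, y) \<partial>(lborel \<Otimes>\<^sub>M lborel) \<partial>lborel)"
    by (intro nn_integral_cong) (subst lborel.nn_integral_fst[symmetric], simp_all)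
  finally show ?thesis .
qed

definition ee :: "((real^'n) \<times> (real^'m) \<Rightarrow> real) \<Rightarrow> int \<Rightarrow> int \<Rightarrow> (real^'n) \<times> (real^'m) \<Rightarrow> real" where
  "ee f k1 k2 y = dexp k1 (\<lambda>w. dexp k2 (\<lambda>z. f (w, z)) (snd y)) (fst y)"

text \<open>The iterated dyadic maximal function, second variable first. It dominates the averages
  over all dyadic rectangles containing the point, whatever their eccentricity.\<close>

definition mm :: "((real^'n) \<times> (real^'m) \<Rightarrow> real) \<Rightarrow> (real^'n) \<times> (real^'m) \<Rightarrow> ennreal" where
  "mm f y = dmax (\<lambda>w. dmax (\<lambda>z. ennreal \<bar>f (w, z)\<bar>) (snd y)) (fst y)"

lemma ee_le_mm: "ennreal ((ee f k1 k2 y)\<^sup>2) \<le> (mm f y)\<^sup>2"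
proof -
  have "ennreal \<bar>ee f k1 k2 y\<bar> \<le> (\<integral>\<^sup>+w. ennreal (dker k1 (fst y) w) * ennreal \<bar>dexp k2 (\<lambda>z. f (w, z)) (snd y)\<bar> \<partial>lborel)"
    unfolding ee_def by (rule dexp_abs_le)
  also have "\<dots> \<le> (\<integral>\<^sup>+w. ennreal (dker k1 (fst y) w) * dmax (\<lambda>z. ennreal \<bar>f (w, z)\<bar>) (snd y) \<partial>lborel)"
  proof (intro nn_integral_mono mult_left_mono)
    fix w
    show "ennreal \<bar>dexp k2 (\<lambda>z. f (w, z)) (snd y)\<bar> \<le> dmax (\<lambda>z. ennreal \<bar>f (w, z)\<bar>) (snd y)"
      unfolding dmax_def by (rule order_trans[OF dexp_abs_le]) (rule SUP_upper, simp)
  qed simp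
  also have "\<dots> \<le> mm f y" unfolding mm_def dmax_def[of _ "fst y"] by (rule SUP_upper) simp
  finally have "(ennreal \<bar>ee f k1 k2 y\<bar>)\<^sup>2 \<le> (mm f y)\<^sup>2" by (rule power_mono) simp
  then show ?thesis by (simp add: ennreal_power)
qed

lemma mm_measurable [measurable]:
  assumes [measurable]: "f \<in> borel_measurable borel"
  shows "mm f \<in> borel_measurable borel"
  unfolding mm_def[abs_def] borel_prod[symmetric] by measurable

lemma ee_measurable [measurable (raw)]:
  assumes [measurable]: "f \<in> borel_measurable borel" "T1 \<in> borel_measurable M" "T2 \<in> borel_measurable M" "y \<in> borel_measurable M"
  shows "(\<lambda>x. ee f (kk (T1 x)) (kk (T2 x)) (y x)) \<in> borel_measurable M"
proof -
  have [measurable]: "(\<lambda>x. fst (y x)) \<in> borel_measurable M" "(\<lambda>x. snd (y x)) \<in> borel_measurable M"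
    using assms(4) unfolding borel_prod[symmetric] by measurable
  show ?thesis unfolding ee_def by measurable
qed

text \<open>16 = 4 * 4: Doob's inequality in the first variable for each fixed second coordinate, an
  exchange of the integrals, and Doob's inequality in the second variable.\<close>

lemma mm_bound:
  assumes [measurable]: "f \<in> borel_measurable borel"
  shows "(\<integral>\<^sup>+y. (mm f y)\<^sup>2 \<partial>lborel) \<le> 16 * (\<integral>\<^sup>+y. ennreal ((f y)\<^sup>2) \<partial>lborel)"
proof -
  let ?g = "\<lambda>y2 w. dmax (\<lambda>z. ennreal \<bar>f (w, z)\<bar>) y2"
  have "(\<integral>\<^sup>+y. (mm f y)\<^sup>2 \<partial>lborel) = (\<integral>\<^sup>+y2. \<integral>\<^sup>+y1. (dmax (?g y2) y1)\<^sup>2 \<partial>lborel \<partial>lborel)"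
    unfolding lborel_prod[symmetric] mm_def by (subst lborel_pair.nn_integral_snd[symmetric]) (simp_all, measurable)
  also have "\<dots> \<le> (\<integral>\<^sup>+y2. 4 * (\<integral>\<^sup>+w. (?g y2 w)\<^sup>2 \<partial>lborel) \<partial>lborel)"
    by (rule nn_integral_mono) (rule dmax_bound, measurable)
  also have "\<dots> = 4 * (\<integral>\<^sup>+y2. \<integral>\<^sup>+w. (?g y2 w)\<^sup>2 \<partial>lborel \<partial>lborel)"
    by (rule nn_integral_cmult) measurable
  also have "(\<integral>\<^sup>+y2. \<integral>\<^sup>+w. (?g y2 w)\<^sup>2 \<partial>lborel \<partial>lborel) = (\<integral>\<^sup>+w. \<integral>\<^sup>+y2. (?g y2 w)\<^sup>2 \<partial>lborel \<partial>lborel)"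
    by (rule lborel_pair.Fubini') measurable
  also have "\<dots> \<le> (\<integral>\<^sup>+w. 4 * (\<integral>\<^sup>+z. (ennreal \<bar>f (w, z)\<bar>)\<^sup>2 \<partial>lborel) \<partial>lborel)"
    by (rule nn_integral_mono) (rule dmax_bound, measurable)
  also have "\<dots> = 4 * (\<integral>\<^sup>+w. \<integral>\<^sup>+z. ennreal ((f (w, z))\<^sup>2) \<partial>lborel \<partial>lborel)"
    by (simp add: nn_integral_cmult ennreal_power)
  also have "(\<integral>\<^sup>+w. \<integral>\<^sup>+z. ennreal ((f (w, z))\<^sup>2) \<partial>lborel \<partial>lborel) = (\<integral>\<^sup>+y. ennreal ((f y)\<^sup>2) \<partial>lborel)"
    unfolding lborel_prod[symmetric] by (rule lborel.nn_integral_fst) (simp add: lborel_prod)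
  finally have "(\<integral>\<^sup>+y. (mm f y)\<^sup>2 \<partial>lborel) \<le> 4 * (4 * (\<integral>\<^sup>+y. ennreal ((f y)\<^sup>2) \<partial>lborel))"
    by (simp add: mult_left_mono)
  then show ?thesis by (simp add: mult.assoc[symmetric])
qed

context bi_parameter
begin

definition "mu t1 t2 y = indicator {0<..} t1 * indicator {0<..} t2 * ennreal (1 / (t1 * t2) * (\<integral>z. K (t1, t2, y, z) \<partial>lborel)\<^sup>2)"

lemma mu_meas[measurable (raw)]:
  assumes [measurable]: "f1 \<in> borel_measurable M" "f2 \<in> borel_measurable M" "g1 \<in> borel_measurable M"
  shows "(\<lambda>x. mu (f1 x) (f2 x) (g1 x)) \<in> borel_measurable M"
  unfolding mu_def by measurable

text \<open>In two parameters there need not be a largest rectangle above a given level at which to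
  stop. Therefore all of them are taken at once: their union lies in a level set of
  \<open>mm f\<close>, and \<open>carl12\<close> is applied to this union. Integration over the
  levels then replaces the sum over stopping cubes.\<close>

lemma carleson_embedding2:
  assumes f[measurable]: "f \<in> borel_measurable borel" and fin: "(\<integral>\<^sup>+y. ennreal ((f y)\<^sup>2) \<partial>lborel) < \<infinity>"
  shows "(\<integral>\<^sup>+t1. \<integral>\<^sup>+t2. \<integral>\<^sup>+y. mu t1 t2 y * ennreal ((ee f (kk t1) (kk t2) y)\<^sup>2) \<partial>lborel \<partial>lborel \<partial>lborel)
     \<le> ennreal (16 * D) * (\<integral>\<^sup>+y. ennreal ((f y)\<^sup>2) \<partial>lborel)"
proof -
  let ?g = "\<lambda>k1 k2 y. (ee f k1 k2 y)\<^sup>2"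
  let ?G = "\<lambda>y. (mm f y)\<^sup>2"
  have Gfin: "(\<integral>\<^sup>+y. ?G y \<partial>lborel) < \<infinity>"
    by (rule le_less_trans[OF mm_bound[OF f]]) (use fin in \<open>simp add: ennreal_mult_less_top\<close>)
  have eem[measurable]: "ee f k1 k2 \<in> borel_measurable borel" for k1 k2
    unfolding ee_def[abs_def] borel_prod[symmetric] by measurable
  have level: "(\<integral>\<^sup>+t1. \<integral>\<^sup>+t2. \<integral>\<^sup>+y. mu t1 t2 y * indicator {y. s < ?g (kk t1) (kk t2) y} y \<partial>lborel \<partial>lborel \<partial>lborel)
      \<le> ennreal D * (\<integral>\<^sup>+y. indicator {y. ennreal s < ?G y} y \<partial>lborel)" if s: "0 < s" for s
  proof -
    let ?S = "\<lambda>k1 k2. {y. s < ?g k1 k2 y}"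
    have Sm[measurable]: "?S k1 k2 \<in> sets borel" for k1 k2 by measurable
    have Um[measurable]: "{y. ennreal s < ?G y} \<in> sets borel" by measurable
    have sub: "(\<Union>k1 k2. ?S k1 k2) \<subseteq> {y. ennreal s < ?G y}"
    proof clarify
      fix k1 k2 y1 y2 assume "s < ?g k1 k2 (y1, y2)"
      then have "ennreal s < ennreal (?g k1 k2 (y1, y2))" using s by (simp add: ennreal_less_iff)
      also have "\<dots> \<le> ?G (y1, y2)" by (rule ee_le_mm)
      finally show "ennreal s < ?G (y1, y2)" .
    qed
    have le: "emeasure lborel (\<Union>k1 k2. ?S k1 k2) \<le> emeasure lborel {y. ennreal s < ?G y}"
      by (rule emeasure_mono[OF sub]) simp
    \<comment> \<open>Chebyshev's inequality, which supplies the finite measure demanded by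
      \<open>carl12\<close>.\<close>
    have "ennreal s * emeasure lborel {y. ennreal s < ?G y} = (\<integral>\<^sup>+y. ennreal s * indicator {y. ennreal s < ?G y} y \<partial>lborel)"
      by (simp add: nn_integral_cmult_indicator)
    also have "\<dots> \<le> (\<integral>\<^sup>+y. ?G y \<partial>lborel)" by (rule nn_integral_mono) (auto simp: indicator_def)
    also have "\<dots> < \<infinity>" by (rule Gfin)
    finally have "emeasure lborel {y. ennreal s < ?G y} < \<infinity>" using s by (auto simp: ennreal_mult_less_top ennreal_mult_eq_top_iff less_top)
    then have fin: "emeasure lborel (\<Union>k1 k2. ?S k1 k2) < \<infinity>" using le by (rule le_less_trans[rotated])
    have "(\<integral>\<^sup>+t1. \<integral>\<^sup>+t2. \<integral>\<^sup>+y. mu t1 t2 y * indicator (?S (kk t1) (kk t2)) y \<partial>lborel \<partial>lborel \<partial>lborel) \<le> ennreal D * emeasure lborel (\<Union>k1 k2. ?S k1 k2)"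
      unfolding mu_def
    proof (rule carl12[OF Sm _ fin])
      fix k1 k2 y z assume y: "y \<in> ?S k1 k2" and d: "dcor k1 (fst z) = dcor k1 (fst y)" "dcor k2 (snd z) = dcor k2 (snd y)"
      have "ee f k1 k2 z = ee f k1 k2 y"
        unfolding ee_def dconstD[OF dexp_dconst d(1)] dconstD[OF dexp_dconst d(2)] ..
      then show "z \<in> ?S k1 k2" using y by simp
    qed
    also have "\<dots> \<le> ennreal D * emeasure lborel {y. ennreal s < ?G y}" by (rule mult_left_mono[OF le]) simp
    also have "emeasure lborel {y. ennreal s < ?G y} = (\<integral>\<^sup>+y. indicator {y. ennreal s < ?G y} y \<partial>lborel)" by simp
    finally show ?thesis .
  qed
  let ?I = "\<lambda>s t1 t2 y. mu t1 t2 y * (indicator {0<..} s * indicator {s. ennreal s < ennreal (?g (kk t1) (kk t2) y)} s)"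
  have "(\<integral>\<^sup>+t1. \<integral>\<^sup>+t2. \<integral>\<^sup>+y. mu t1 t2 y * ennreal (?g (kk t1) (kk t2) y) \<partial>lborel \<partial>lborel \<partial>lborel)
    = (\<integral>\<^sup>+t1. \<integral>\<^sup>+t2. \<integral>\<^sup>+y. \<integral>\<^sup>+s. ?I s t1 t2 y \<partial>lborel \<partial>lborel \<partial>lborel \<partial>lborel)"
    by (simp add: nn_integral_cmult layer_cake)
  also have "\<dots> = (\<integral>\<^sup>+t1. \<integral>\<^sup>+t2. \<integral>\<^sup>+s. \<integral>\<^sup>+y. ?I s t1 t2 y \<partial>lborel \<partial>lborel \<partial>lborel \<partial>lborel)"
    by (intro nn_integral_cong lborel_pair.Fubini') measurable
  also have "\<dots> = (\<integral>\<^sup>+t1. \<integral>\<^sup>+s. \<integral>\<^sup>+t2. \<integral>\<^sup>+y. ?I s t1 t2 y \<partial>lborel \<partial>lborel \<partial>lborel \<partial>lborel)"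
    by (intro nn_integral_cong lborel_pair.Fubini') measurable
  also have "\<dots> = (\<integral>\<^sup>+s. \<integral>\<^sup>+t1. \<integral>\<^sup>+t2. \<integral>\<^sup>+y. ?I s t1 t2 y \<partial>lborel \<partial>lborel \<partial>lborel \<partial>lborel)"
    by (intro lborel_pair.Fubini') measurable
  also have "\<dots> \<le> (\<integral>\<^sup>+s. indicator {0<..} s * (ennreal D * (\<integral>\<^sup>+y. indicator {y. ennreal s < ?G y} y \<partial>lborel)) \<partial>lborel)"
  proof (rule nn_integral_mono)
    fix s :: real
    show "(\<integral>\<^sup>+t1. \<integral>\<^sup>+t2. \<integral>\<^sup>+y. ?I s t1 t2 y \<partial>lborel \<partial>lborel \<partial>lborel) \<le> indicator {0<..} s * (ennreal D * (\<integral>\<^sup>+y. indicator {y. ennreal s < ?G y} y \<partial>lborel))"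
    proof (cases "0 < s")
      case True
      then have "(\<integral>\<^sup>+t1. \<integral>\<^sup>+t2. \<integral>\<^sup>+y. ?I s t1 t2 y \<partial>lborel \<partial>lborel \<partial>lborel)
        = (\<integral>\<^sup>+t1. \<integral>\<^sup>+t2. \<integral>\<^sup>+y. mu t1 t2 y * indicator {y. s < ?g (kk t1) (kk t2) y} y \<partial>lborel \<partial>lborel \<partial>lborel)"
        by (intro nn_integral_cong) (auto simp: indicator_def ennreal_less_iff)
      then show ?thesis using level[OF True] True by simp
    qed simp
  qed
  also have "\<dots> = (\<integral>\<^sup>+s. \<integral>\<^sup>+y. ennreal D * (indicator {0<..} s * indicator {s. ennreal s < ?G y} s) \<partial>lborel \<partial>lborel)"
  proof (rule nn_integral_cong)
    fix s :: real
    have "(\<integral>\<^sup>+y. ennreal D * (indicator {0<..} s * indicator {s. ennreal s < ?G y} s) \<partial>lborel) = (\<integral>\<^sup>+y. ennreal D * indicator {0<..} s * indicator {y. ennreal s < ?G y} y \<partial>lborel)"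
      by (intro nn_integral_cong) (auto simp: indicator_def)
    also have "\<dots> = ennreal D * indicator {0<..} s * (\<integral>\<^sup>+y. indicator {y. ennreal s < ?G y} y \<partial>lborel)"
      by (rule nn_integral_cmult) measurable
    finally show "indicator {0<..} s * (ennreal D * (\<integral>\<^sup>+y. indicator {y. ennreal s < ?G y} y \<partial>lborel)) = (\<integral>\<^sup>+y. ennreal D * (indicator {0<..} s * indicator {s. ennreal s < ?G y} s) \<partial>lborel)"
      by (simp add: mult_ac)
  qed
  also have "\<dots> = (\<integral>\<^sup>+y. \<integral>\<^sup>+s. ennreal D * (indicator {0<..} s * indicator {s. ennreal s < ?G y} s) \<partial>lborel \<partial>lborel)"
    by (intro lborel_pair.Fubini') measurable
  also have "\<dots> = (\<integral>\<^sup>+y. ennreal D * ?G y \<partial>lborel)"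
    by (simp add: nn_integral_cmult layer_cake)
  also have "\<dots> = ennreal D * (\<integral>\<^sup>+y. ?G y \<partial>lborel)" by (rule nn_integral_cmult) measurable
  also have "\<dots> \<le> ennreal D * (16 * (\<integral>\<^sup>+y. ennreal ((f y)\<^sup>2) \<partial>lborel))" by (intro mult_left_mono mm_bound f) simp
  also have "\<dots> = ennreal (16 * D) * (\<integral>\<^sup>+y. ennreal ((f y)\<^sup>2) \<partial>lborel)" using D by (simp add: ennreal_mult mult_ac)
  finally show ?thesis .
qed

end

section \<open>Decomposition of the bi-parameter operator and its L^2 bound\<close>

lemma ennreal_triple_sum:
  "0 \<le> p \<Longrightarrow> 0 \<le> q \<Longrightarrow> 0 \<le> r \<Longrightarrow> ennreal (4 * p + 4 * q + 2 * r) = 4 * ennreal p + 4 * ennreal q + 2 * ennreal r"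
  by (simp add: ennreal_mult)

text \<open>The factors 4, 4, 2 are those of \<open>square_add3_le\<close>; the rest are the
  constants of \<open>Ta_bound\<close>, \<open>Tb_bound\<close> and
  \<open>carleson_embedding2\<close>.\<close>

definition cbi :: "nat \<Rightarrow> nat \<Rightarrow> real \<Rightarrow> real \<Rightarrow> real \<Rightarrow> real \<Rightarrow> real" where
  "cbi n m A a b D = 4 * (corthi n a * (A * sqrt (csq m b))\<^sup>2) + 4 * (corthi m b * (A * sqrt (4 * ccar n a))\<^sup>2) + 2 * (16 * D)"

context bi_parameter
begin

lemma cbi_nonneg: "0 \<le> cbi CARD('n) CARD('m) A a b D"
  unfolding cbi_def using corthi_nonneg[OF a] corthi_nonneg[OF b] D
  by (intro add_nonneg_nonneg mult_nonneg_nonneg) auto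

text \<open>All slices of \<open>f\<close> are taken to be square integrable, so that averages in
  one variable make sense for every value of the other. \<open>bi_parameter_bound_L2\<close> reaches
  this situation by changing \<open>f\<close> on a null set.\<close>

context
  fixes f :: "(real^'n) \<times> (real^'m) \<Rightarrow> real"
  assumes f[measurable]: "f \<in> borel_measurable borel"
    and fin: "(\<integral>\<^sup>+y. ennreal ((f y)\<^sup>2) \<partial>lborel) < \<infinity>"
    and s1: "\<And>z2. sqi (\<lambda>z1. f (z1, z2))" and s2: "\<And>z1. sqi (\<lambda>z2. f (z1, z2))"
begin

text \<open>Image of f - E1 f, with the average E1 f taken at the first coordinate of
  \<open>y\<close>.\<close>

definition "Ta t1 t2 y = (\<integral>p. K (t1, t2, y, p) * (f p - dexp (kk t1) (\<lambda>z. f (z, snd p)) (fst y)) \<partial>(lborel \<Otimes>\<^sub>M lborel))"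
text \<open>Image of E1 (f - E2 f). The integration variable is p = (z2, z1), with the coordinates
  swapped to match the order of \<open>op2\<close>.\<close>

definition "Tb t1 t2 y = (\<integral>p. Ka t1 t2 (fst y) (snd y) (fst p) * dker (kk t1) (fst y) (snd p) * (f (snd p, fst p) - dexp (kk t2) (\<lambda>z. f (snd p, z)) (snd y)) \<partial>(lborel \<Otimes>\<^sub>M lborel))"

lemma fin12: "(\<integral>\<^sup>+w. \<integral>\<^sup>+z. ennreal ((f (z, w))\<^sup>2) \<partial>lborel \<partial>lborel) = (\<integral>\<^sup>+y. ennreal ((f y)\<^sup>2) \<partial>lborel)"
  "(\<integral>\<^sup>+w. \<integral>\<^sup>+z. ennreal ((f (w, z))\<^sup>2) \<partial>lborel \<partial>lborel) = (\<integral>\<^sup>+y. ennreal ((f y)\<^sup>2) \<partial>lborel)"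
  unfolding lborel_prod[symmetric]
  by (rule lborel_pair.nn_integral_snd, simp add: lborel_prod) (rule lborel.nn_integral_fst, simp add: lborel_prod)

lemma K_integrable:
  assumes t: "0 < t1" "0 < t2"
  shows "integrable (lborel \<Otimes>\<^sub>M lborel) (\<lambda>p. K (t1, t2, y, p))"
proof (rule integrableI_bounded)
  obtain y1 y2 where y: "y = (y1, y2)" by (cases y)
  have "(\<integral>\<^sup>+p. ennreal (norm (K (t1, t2, y, p))) \<partial>(lborel \<Otimes>\<^sub>M lborel)) = (\<integral>\<^sup>+z1. \<integral>\<^sup>+z2. ennreal \<bar>K (t1, t2, (y1, y2), (z1, z2))\<bar> \<partial>lborel \<partial>lborel)"
    unfolding y by (subst lborel.nn_integral_fst[symmetric]) (simp_all add: lborel_prod)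
  also have "\<dots> \<le> (\<integral>\<^sup>+z1. \<integral>\<^sup>+z2. ennreal (A * kap a t1 (y1 - z1)) * ennreal (kap b t2 (y2 - z2)) \<partial>lborel \<partial>lborel)"
    using size[OF t, of y1 y2] A by (intro nn_integral_mono) (simp add: ennreal_mult[symmetric] kap_nonneg ennreal_leI)
  also have "\<dots> = ennreal A * (\<integral>\<^sup>+z1. ennreal (kap a t1 (y1 - z1)) \<partial>lborel) * (\<integral>\<^sup>+z2. ennreal (kap b t2 (y2 - z2)) \<partial>lborel)"
    using A by (simp add: nn_integral_cmult nn_integral_multc ennreal_mult kap_nonneg mult.assoc)
  also have "\<dots> < \<infinity>"
    using nn_integral_kap_shift(2)[OF t(1) a, of y1] nn_integral_kap_shift(2)[OF t(2) b, of y2]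
    by (auto simp: ennreal_mult_less_top intro: le_less_trans)
  finally show "(\<integral>\<^sup>+p. ennreal (norm (K (t1, t2, y, p))) \<partial>(lborel \<Otimes>\<^sub>M lborel)) < \<infinity>" .
qed (simp add: lborel_prod)

text \<open>The average E1 f at \<open>y\<close> does not depend on z1, so integrating the kernel in
  z1 turns it into \<open>Ka\<close> (\<open>e1\<close>). Writing E1 as an integral against
  \<open>dker\<close> then produces a double integral in z2 and z1 (\<open>e2\<close>), in which E2
  f at \<open>y\<close> can be split off; it is free of z2, and \<open>Ka\<close> integrates to the
  image of 1 (\<open>e3\<close>, \<open>e4\<close>).\<close>

lemma decomposition:
  assumes t: "0 < t1" "0 < t2"
  shows "(\<integral>z. K (t1, t2, y, z) * f z \<partial>lborel) = Ta t1 t2 y + Tb t1 t2 y + (\<integral>z. K (t1, t2, y, z) \<partial>lborel) * ee f (kk t1) (kk t2) y"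
proof -
  obtain y1 y2 where y: "y = (y1, y2)" by (cases y)
  interpret o1: op_kernel lborel "lborel \<Otimes>\<^sub>M lborel" "K1 t1" "\<lambda>(y2, t2) z2. if 0 < t2 then A * kap b t2 (y2 - z2) / sqrt t2 else 0"
     "A * sqrt (csq CARD('m) b)" a t1 "kk t1" by (rule op1[OF t(1)])
  interpret o2: op_kernel lborel "lborel \<Otimes>\<^sub>M lborel" "K2 t2" "\<lambda>(y1, t1) z1. if 0 < t1 then A * ckap CARD('n) a * dker (kk t1) y1 z1 / sqrt t1 else 0"
     "A * sqrt (4 * ccar CARD('n) a)" b t2 "kk t2" by (rule op2[OF t(2)])
  let ?P = "\<lambda>z2. dexp (kk t1) (\<lambda>z. f (z, z2)) y1"
  let ?G = "\<lambda>w. dexp (kk t2) (\<lambda>z. f (w, z)) y2"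
  let ?L = "lborel \<Otimes>\<^sub>M lborel"
  have sp: "(y2, t2) \<in> space (lborel \<Otimes>\<^sub>M lborel)" "(y1, t1) \<in> space (lborel \<Otimes>\<^sub>M lborel)" by (auto simp: space_pair_measure)
  have K1e: "K1 t1 (y1, z1, (y2, t2), z2) = K (t1, t2, y, (z1, z2)) / sqrt t2" for z1 z2 using t by (simp add: K1_def y)
  have K2e: "K2 t2 (y2, z2, (y1, t1), z1) = Ka t1 t2 y1 y2 z2 * dker (kk t1) y1 z1 / sqrt t1" for z1 z2 using t by (simp add: K2_def)
  have Pm: "?P \<in> borel_measurable lborel" by measurable
  have Gm: "?G \<in> borel_measurable lborel" by measurable
  have Pf: "(\<integral>\<^sup>+w. ennreal ((?P w)\<^sup>2) \<partial>lborel) < \<infinity>"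
  proof -
    have "(\<integral>\<^sup>+w. ennreal ((?P w)\<^sup>2) \<partial>lborel) \<le> (\<integral>\<^sup>+w. ennreal ((1 / 2 powr real_of_int (kk t1)) ^ CARD('n)) * (\<integral>\<^sup>+z. ennreal ((f (z, w))\<^sup>2) \<partial>lborel) \<partial>lborel)"
      by (rule nn_integral_mono) (rule dexp_sq_le_const, measurable)
    also have "\<dots> = ennreal ((1 / 2 powr real_of_int (kk t1)) ^ CARD('n)) * (\<integral>\<^sup>+w. \<integral>\<^sup>+z. ennreal ((f (z, w))\<^sup>2) \<partial>lborel \<partial>lborel)"
      by (rule nn_integral_cmult) measurable
    also have "\<dots> < \<infinity>" unfolding fin12 using fin by (simp add: ennreal_mult_less_top)
    finally show ?thesis .
  qed
  have Gf: "(\<integral>\<^sup>+w. ennreal ((?G w)\<^sup>2) \<partial>lborel) < \<infinity>"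
  proof -
    have "(\<integral>\<^sup>+w. ennreal ((?G w)\<^sup>2) \<partial>lborel) \<le> (\<integral>\<^sup>+w. ennreal ((1 / 2 powr real_of_int (kk t2)) ^ CARD('m)) * (\<integral>\<^sup>+z. ennreal ((f (w, z))\<^sup>2) \<partial>lborel) \<partial>lborel)"
      by (rule nn_integral_mono) (rule dexp_sq_le_const, measurable)
    also have "\<dots> = ennreal ((1 / 2 powr real_of_int (kk t2)) ^ CARD('m)) * (\<integral>\<^sup>+w. \<integral>\<^sup>+z. ennreal ((f (w, z))\<^sup>2) \<partial>lborel \<partial>lborel)"
      by (rule nn_integral_cmult) measurable
    also have "\<dots> < \<infinity>" unfolding fin12 using fin by (simp add: ennreal_mult_less_top)
    finally show ?thesis .
  qed
  have fm: "f \<in> borel_measurable (lborel \<Otimes>\<^sub>M lborel)" by (simp add: lborel_prod)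
  have fm': "(\<lambda>p. f (snd p, fst p)) \<in> borel_measurable (lborel \<Otimes>\<^sub>M lborel)" by measurable
  have ff: "(\<integral>\<^sup>+w. \<integral>\<^sup>+z. ennreal ((f (z, w))\<^sup>2) \<partial>lborel \<partial>lborel) < \<infinity>" "(\<integral>\<^sup>+w. \<integral>\<^sup>+z. ennreal (((\<lambda>p. f (snd p, fst p)) (z, w))\<^sup>2) \<partial>lborel \<partial>lborel) < \<infinity>"
    using fin fin12 by simp_all
  \<comment> \<open>All four integrability facts are taken from the operator kernels
    \<open>K1\<close> and \<open>K2\<close>; the positive factor \<open>sqrt t2\<close> or
    \<open>sqrt t1\<close> undoes their normalisation.\<close>
  have i1: "integrable ?L (\<lambda>p. K (t1, t2, y, p) * f p)"
  proof -
    have "integrable ?L (\<lambda>p. K1 t1 (y1, fst p, (y2, t2), snd p) * f p)"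
      using o1.dom[of y1 _ "(y2, t2)"] by (intro o1.Kg_integrable[OF fm ff(1), where c=1 and y=y1 and v="(y2, t2)"]) (auto simp del: split_paired_All, measurable)
    then have "integrable ?L (\<lambda>p. sqrt t2 * (K1 t1 (y1, fst p, (y2, t2), snd p) * f p))" by (rule integrable_mult_right)
    then show ?thesis using t by (simp add: K1e)
  qed
  have i2: "integrable ?L (\<lambda>p. K (t1, t2, y, p) * ?P (snd p))"
  proof -
    have "integrable ?L (\<lambda>p. sqrt t2 * (K1 t1 (y1, fst p, (y2, t2), snd p) * ?P (snd p)))"
      by (rule integrable_mult_right[OF o1.Kconst_integrable[OF Pm Pf sp(1)]])
    then show ?thesis using t by (simp add: K1e)
  qed
  have i3: "integrable ?L (\<lambda>p. Ka t1 t2 y1 y2 (fst p) * dker (kk t1) y1 (snd p) * f (snd p, fst p))"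
  proof -
    have "integrable ?L (\<lambda>p. K2 t2 (y2, fst p, (y1, t1), snd p) * f (snd p, fst p))"
      using o2.dom[of y2 _ "(y1, t1)"] by (intro o2.Kg_integrable[OF fm' ff(2), where c=1 and y=y2 and v="(y1, t1)"]) (auto simp del: split_paired_All, measurable)
    then have "integrable ?L (\<lambda>p. sqrt t1 * (K2 t2 (y2, fst p, (y1, t1), snd p) * f (snd p, fst p)))" by (rule integrable_mult_right)
    then show ?thesis using t by (simp add: K2e)
  qed
  have i4: "integrable ?L (\<lambda>p. Ka t1 t2 y1 y2 (fst p) * dker (kk t1) y1 (snd p) * ?G (snd p))"
  proof -
    have "integrable ?L (\<lambda>p. sqrt t1 * (K2 t2 (y2, fst p, (y1, t1), snd p) * ?G (snd p)))"
      by (rule integrable_mult_right[OF o2.Kconst_integrable[OF Gm Gf sp(2)]])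
    then show ?thesis using t by (simp add: K2e)
  qed
  have e1: "(\<integral>p. K (t1, t2, y, p) * ?P (snd p) \<partial>?L) = (\<integral>z2. Ka t1 t2 y1 y2 z2 * ?P z2 \<partial>lborel)"
  proof -
    have "(\<integral>p. K (t1, t2, y, p) * ?P (snd p) \<partial>?L) = (\<integral>z2. \<integral>z1. K (t1, t2, y, (z1, z2)) * ?P z2 \<partial>lborel \<partial>lborel)"
      using lborel_pair.integral_snd[of "\<lambda>z1 z2. K (t1, t2, y, (z1, z2)) * ?P z2"] i2 by (simp add: split_beta')
    then show ?thesis by (simp add: Ka_def y)
  qed
  have e2: "(\<integral>p. Ka t1 t2 y1 y2 (fst p) * dker (kk t1) y1 (snd p) * f (snd p, fst p) \<partial>?L) = (\<integral>z2. Ka t1 t2 y1 y2 z2 * ?P z2 \<partial>lborel)"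
  proof -
    have "(\<integral>p. Ka t1 t2 y1 y2 (fst p) * dker (kk t1) y1 (snd p) * f (snd p, fst p) \<partial>?L) = (\<integral>z2. \<integral>w. Ka t1 t2 y1 y2 z2 * dker (kk t1) y1 w * f (w, z2) \<partial>lborel \<partial>lborel)"
      using lborel_pair.integral_fst'[OF i3] by simp
    then show ?thesis by (simp add: dexp_def mult.assoc)
  qed
  have e3: "(\<integral>p. Ka t1 t2 y1 y2 (fst p) * dker (kk t1) y1 (snd p) * ?G (snd p) \<partial>?L) = (\<integral>z2. Ka t1 t2 y1 y2 z2 \<partial>lborel) * ee f (kk t1) (kk t2) y"
  proof -
    have "(\<integral>p. Ka t1 t2 y1 y2 (fst p) * dker (kk t1) y1 (snd p) * ?G (snd p) \<partial>?L) = (\<integral>z2. \<integral>w. Ka t1 t2 y1 y2 z2 * dker (kk t1) y1 w * ?G w \<partial>lborel \<partial>lborel)"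
      using lborel_pair.integral_fst'[OF i4] by simp
    then show ?thesis by (simp add: ee_def y dexp_def[of "kk t1"] mult.assoc)
  qed
  have e4: "(\<integral>z. K (t1, t2, y, z) \<partial>lborel) = (\<integral>z2. Ka t1 t2 y1 y2 z2 \<partial>lborel)"
  proof -
    have "(\<integral>z. K (t1, t2, y, z) \<partial>?L) = (\<integral>z2. \<integral>z1. K (t1, t2, y, (z1, z2)) \<partial>lborel \<partial>lborel)"
      using lborel_pair.integral_snd[of "\<lambda>z1 z2. K (t1, t2, y, (z1, z2))"] K_integrable[OF t, of y] by (simp add: split_beta')
    then show ?thesis by (simp add: Ka_def y lborel_prod)
  qed
  have "Ta t1 t2 y = (\<integral>p. K (t1, t2, y, p) * f p \<partial>?L) - (\<integral>z2. Ka t1 t2 y1 y2 z2 * ?P z2 \<partial>lborel)"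
    unfolding Ta_def e1[symmetric] right_diff_distrib using i1 i2 by (simp add: y)
  moreover have "Tb t1 t2 y = (\<integral>z2. Ka t1 t2 y1 y2 z2 * ?P z2 \<partial>lborel) - (\<integral>z2. Ka t1 t2 y1 y2 z2 \<partial>lborel) * ee f (kk t1) (kk t2) y"
    unfolding Tb_def e2[symmetric] e3[symmetric] right_diff_distrib using i3 i4 by (simp add: y)
  ultimately show ?thesis unfolding e4 by (simp add: lborel_prod)
qed

lemma Ta_meas[measurable (raw)]:
  assumes [measurable]: "f1 \<in> borel_measurable M" "f2 \<in> borel_measurable M" "g \<in> borel_measurable M"
  shows "(\<lambda>x. Ta (f1 x) (f2 x) (g x)) \<in> borel_measurable M"
proof -
  have [measurable]: "(\<lambda>x. fst (g x)) \<in> borel_measurable M" "(\<lambda>x. snd (g x)) \<in> borel_measurable M"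
    using assms(3) unfolding borel_prod[symmetric] by measurable
  have "(\<lambda>x. Ta (f1 x) (f2 x) (g x)) = (\<lambda>x. \<integral>p. K (f1 x, f2 x, g x, (fst p, snd p)) * (f (fst p, snd p) - dexp (kk (f1 x)) (\<lambda>z. f (z, snd p)) (fst (g x))) \<partial>lborel)"
    by (simp add: Ta_def lborel_prod)
  also have "\<dots> \<in> borel_measurable M" unfolding lborel_prod[symmetric] by measurable
  finally show ?thesis .
qed

lemma Tb_meas[measurable (raw)]:
  assumes [measurable]: "f1 \<in> borel_measurable M" "f2 \<in> borel_measurable M" "g \<in> borel_measurable M"
  shows "(\<lambda>x. Tb (f1 x) (f2 x) (g x)) \<in> borel_measurable M"
proof -
  have [measurable]: "(\<lambda>x. fst (g x)) \<in> borel_measurable M" "(\<lambda>x. snd (g x)) \<in> borel_measurable M"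
    using assms(3) unfolding borel_prod[symmetric] by measurable
  have "(\<lambda>x. Tb (f1 x) (f2 x) (g x)) = (\<lambda>x. \<integral>p. Ka (f1 x) (f2 x) (fst (g x)) (snd (g x)) (fst p) * dker (kk (f1 x)) (fst (g x)) (snd p) * (f (snd p, fst p) - dexp (kk (f2 x)) (\<lambda>z. f (snd p, z)) (snd (g x))) \<partial>lborel)"
    by (simp add: Tb_def lborel_prod)
  also have "\<dots> \<in> borel_measurable M" unfolding lborel_prod[symmetric] by measurable
  finally show ?thesis .
qed

lemma Ta_bound:
  "(\<integral>\<^sup>+t1. \<integral>\<^sup>+t2. \<integral>\<^sup>+y. indicator {0<..} t1 * indicator {0<..} t2 * ennreal (1 / (t1 * t2) * (Ta t1 t2 y)\<^sup>2) \<partial>lborel \<partial>lborel \<partial>lborel)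
    \<le> ennreal (corthi CARD('n) a * (A * sqrt (csq CARD('m) b))\<^sup>2) * (\<integral>\<^sup>+y. ennreal ((f y)\<^sup>2) \<partial>lborel)"
proof -
  have fm: "f \<in> borel_measurable (lborel \<Otimes>\<^sub>M lborel)" by (simp add: lborel_prod)
  \<comment> \<open>For fixed \<open>t1\<close> the integrals in \<open>t2\<close> and
    \<open>y\<close> become a norm with values in the target space of \<open>(y2, t2)\<close>; the
    weight \<open>1 / t2\<close> disappears into \<open>K1\<close>.\<close>
  have eq: "(\<integral>\<^sup>+t2. \<integral>\<^sup>+y. indicator {0<..} t1 * indicator {0<..} t2 * ennreal (1 / (t1 * t2) * (Ta t1 t2 y)\<^sup>2) \<partial>lborel \<partial>lborel)
     = indicator {0<..} t1 * ennreal (1 / t1) * (\<integral>\<^sup>+y. \<integral>\<^sup>+v. ennreal ((\<integral>p. K1 t1 (y, fst p, v, snd p) * (f p - dexp (kk t1) (\<lambda>z. f (z, snd p)) y) \<partial>(lborel \<Otimes>\<^sub>M lborel))\<^sup>2) \<partial>(lborel \<Otimes>\<^sub>M lborel) \<partial>lborel)" for t1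
  proof -
    define g :: "real \<times> (real^'n) \<times> (real^'m) \<Rightarrow> ennreal" where "g = (\<lambda>(t2, y1, y2). indicator {0<..} t2 * ennreal (1 / t2 * (Ta t1 t2 (y1, y2))\<^sup>2))"
    have g[measurable]: "g \<in> borel_measurable (lborel \<Otimes>\<^sub>M lborel \<Otimes>\<^sub>M lborel)" unfolding g_def by measurable
    have gv: "g (snd v, y, fst v) = ennreal ((\<integral>p. K1 t1 (y, fst p, v, snd p) * (f p - dexp (kk t1) (\<lambda>z. f (z, snd p)) y) \<partial>(lborel \<Otimes>\<^sub>M lborel))\<^sup>2)" for v y
    proof (cases "0 < snd v")
      case True
      have "(\<integral>p. K1 t1 (y, fst p, v, snd p) * (f p - dexp (kk t1) (\<lambda>z. f (z, snd p)) y) \<partial>(lborel \<Otimes>\<^sub>M lborel)) = (\<integral>p. 1 / sqrt (snd v) * (K (t1, snd v, (y, fst v), p) * (f p - dexp (kk t1) (\<lambda>z. f (z, snd p)) y)) \<partial>(lborel \<Otimes>\<^sub>M lborel))"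
        using True by (simp add: K1_def)
      also have "\<dots> = 1 / sqrt (snd v) * Ta t1 (snd v) (y, fst v)" unfolding Ta_def by simp
      finally show ?thesis using True by (simp add: g_def power_mult_distrib power_divide)
    qed (simp add: g_def K1_def)
    have "(\<integral>\<^sup>+t2. \<integral>\<^sup>+y. indicator {0<..} t1 * indicator {0<..} t2 * ennreal (1 / (t1 * t2) * (Ta t1 t2 y)\<^sup>2) \<partial>lborel \<partial>lborel)
      = (\<integral>\<^sup>+t2. \<integral>\<^sup>+y. indicator {0<..} t1 * ennreal (1 / t1) * g (t2, fst y, snd y) \<partial>lborel \<partial>lborel)"
      by (intro nn_integral_cong) (auto simp: g_def indicator_def ennreal_mult[symmetric])
    also have "\<dots> = indicator {0<..} t1 * ennreal (1 / t1) * (\<integral>\<^sup>+t2. \<integral>\<^sup>+y. g (t2, fst y, snd y) \<partial>lborel \<partial>lborel)"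
    proof -
      have "(\<integral>\<^sup>+y. c * g (t2, fst y, snd y) \<partial>lborel) = c * (\<integral>\<^sup>+y. g (t2, fst y, snd y) \<partial>lborel)" for c t2
        unfolding lborel_prod[symmetric] by (rule nn_integral_cmult) measurable
      moreover have "(\<lambda>t2. \<integral>\<^sup>+y. g (t2, fst y, snd y) \<partial>lborel) \<in> borel_measurable lborel"
        unfolding lborel_prod[symmetric] by measurable
      ultimately show ?thesis by (simp add: nn_integral_cmult)
    qed
    also have "(\<integral>\<^sup>+t2. \<integral>\<^sup>+y. g (t2, fst y, snd y) \<partial>lborel \<partial>lborel) = (\<integral>\<^sup>+y. \<integral>\<^sup>+v. g (snd v, y, fst v) \<partial>(lborel \<Otimes>\<^sub>M lborel) \<partial>lborel)"
      by (rule nn_integral_reorder1[OF g])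
    finally show ?thesis unfolding gv .
  qed
  show ?thesis unfolding eq
    using orthogonality_integrated[OF op1 fm] s1 fin by (simp add: fin12)
qed

lemma Tb_bound:
  "(\<integral>\<^sup>+t1. \<integral>\<^sup>+t2. \<integral>\<^sup>+y. indicator {0<..} t1 * indicator {0<..} t2 * ennreal (1 / (t1 * t2) * (Tb t1 t2 y)\<^sup>2) \<partial>lborel \<partial>lborel \<partial>lborel)
    \<le> ennreal (corthi CARD('m) b * (A * sqrt (4 * ccar CARD('n) a))\<^sup>2) * (\<integral>\<^sup>+y. ennreal ((f y)\<^sup>2) \<partial>lborel)"
proof -
  have fm: "(\<lambda>p. f (snd p, fst p)) \<in> borel_measurable (lborel \<Otimes>\<^sub>M lborel)" by measurable
  \<comment> \<open>The main variable is now the second one, so \<open>t2\<close> has to become the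
    outermost integral.\<close>
  have sw: "(\<integral>\<^sup>+t1. \<integral>\<^sup>+t2. \<integral>\<^sup>+y. indicator {0<..} t1 * indicator {0<..} t2 * ennreal (1 / (t1 * t2) * (Tb t1 t2 y)\<^sup>2) \<partial>lborel \<partial>lborel \<partial>lborel)
    = (\<integral>\<^sup>+t2. \<integral>\<^sup>+t1. \<integral>\<^sup>+y. indicator {0<..} t1 * indicator {0<..} t2 * ennreal (1 / (t1 * t2) * (Tb t1 t2 (fst y, snd y))\<^sup>2) \<partial>lborel \<partial>lborel \<partial>lborel)"
    unfolding prod.collapse lborel_prod[symmetric, where ?'a="real^'n" and ?'b="real^'m"]
    by (rule lborel_pair.Fubini') (subst prod.collapse[symmetric], measurable)
  have eq: "(\<integral>\<^sup>+t1. \<integral>\<^sup>+y. indicator {0<..} t1 * indicator {0<..} t2 * ennreal (1 / (t1 * t2) * (Tb t1 t2 (fst y, snd y))\<^sup>2) \<partial>lborel \<partial>lborel)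
     = indicator {0<..} t2 * ennreal (1 / t2) * (\<integral>\<^sup>+y. \<integral>\<^sup>+v. ennreal ((\<integral>p. K2 t2 (y, fst p, v, snd p) * (f (snd p, fst p) - dexp (kk t2) (\<lambda>z. f (snd p, z)) y) \<partial>(lborel \<Otimes>\<^sub>M lborel))\<^sup>2) \<partial>(lborel \<Otimes>\<^sub>M lborel) \<partial>lborel)" for t2
  proof -
    define g :: "real \<times> (real^'n) \<times> (real^'m) \<Rightarrow> ennreal" where "g = (\<lambda>(t1, y1, y2). indicator {0<..} t1 * ennreal (1 / t1 * (Tb t1 t2 (y1, y2))\<^sup>2))"
    have g[measurable]: "g \<in> borel_measurable (lborel \<Otimes>\<^sub>M lborel \<Otimes>\<^sub>M lborel)" unfolding g_def by measurable
    have gv: "g (snd v, fst v, y) = ennreal ((\<integral>p. K2 t2 (y, fst p, v, snd p) * (f (snd p, fst p) - dexp (kk t2) (\<lambda>z. f (snd p, z)) y) \<partial>(lborel \<Otimes>\<^sub>M lborel))\<^sup>2)" for v y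
    proof (cases "0 < snd v")
      case True
      have "(\<integral>p. K2 t2 (y, fst p, v, snd p) * (f (snd p, fst p) - dexp (kk t2) (\<lambda>z. f (snd p, z)) y) \<partial>(lborel \<Otimes>\<^sub>M lborel))
        = (\<integral>p. 1 / sqrt (snd v) * (Ka (snd v) t2 (fst v) y (fst p) * dker (kk (snd v)) (fst v) (snd p) * (f (snd p, fst p) - dexp (kk t2) (\<lambda>z. f (snd p, z)) y)) \<partial>(lborel \<Otimes>\<^sub>M lborel))"
        using True by (simp add: K2_def)
      also have "\<dots> = 1 / sqrt (snd v) * Tb (snd v) t2 (fst v, y)" unfolding Tb_def by simp
      finally show ?thesis using True by (simp add: g_def power_mult_distrib power_divide)
    qed (simp add: g_def K2_def)
    have "(\<integral>\<^sup>+t1. \<integral>\<^sup>+y. indicator {0<..} t1 * indicator {0<..} t2 * ennreal (1 / (t1 * t2) * (Tb t1 t2 (fst y, snd y))\<^sup>2) \<partial>lborel \<partial>lborel)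
      = (\<integral>\<^sup>+t1. \<integral>\<^sup>+y. indicator {0<..} t2 * ennreal (1 / t2) * g (t1, fst y, snd y) \<partial>lborel \<partial>lborel)"
      by (intro nn_integral_cong) (auto simp: g_def indicator_def ennreal_mult[symmetric] mult_ac)
    also have "\<dots> = indicator {0<..} t2 * ennreal (1 / t2) * (\<integral>\<^sup>+t1. \<integral>\<^sup>+y. g (t1, fst y, snd y) \<partial>lborel \<partial>lborel)"
    proof -
      have "(\<integral>\<^sup>+y. c * g (t1, fst y, snd y) \<partial>lborel) = c * (\<integral>\<^sup>+y. g (t1, fst y, snd y) \<partial>lborel)" for c t1
        unfolding lborel_prod[symmetric] by (rule nn_integral_cmult) measurable
      moreover have "(\<lambda>t1. \<integral>\<^sup>+y. g (t1, fst y, snd y) \<partial>lborel) \<in> borel_measurable lborel"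
        unfolding lborel_prod[symmetric] by measurable
      ultimately show ?thesis by (simp add: nn_integral_cmult)
    qed
    also have "(\<integral>\<^sup>+t1. \<integral>\<^sup>+y. g (t1, fst y, snd y) \<partial>lborel \<partial>lborel) = (\<integral>\<^sup>+y. \<integral>\<^sup>+v. g (snd v, fst v, y) \<partial>(lborel \<Otimes>\<^sub>M lborel) \<partial>lborel)"
      by (rule nn_integral_reorder2[OF g])
    finally show ?thesis unfolding gv .
  qed
  show ?thesis unfolding sw eq
    using orthogonality_integrated[OF op2 fm] s2 fin by (simp add: fin12)
qed

theorem bi_parameter_bound:
  "(\<integral>\<^sup>+t1. \<integral>\<^sup>+t2. \<integral>\<^sup>+y. indicator {0<..} t1 * indicator {0<..} t2 * ennreal (1 / (t1 * t2) * (\<integral>z. K (t1, t2, y, z) * f z \<partial>lborel)\<^sup>2) \<partial>lborel \<partial>lborel \<partial>lborel)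
    \<le> ennreal (cbi CARD('n) CARD('m) A a b D) * (\<integral>\<^sup>+y. ennreal ((f y)\<^sup>2) \<partial>lborel)"
proof -
  let ?H = "\<integral>\<^sup>+y. ennreal ((f y)\<^sup>2) \<partial>lborel"
  let ?i = "\<lambda>t1 t2. indicator {0<..} (t1::real) * indicator {0<..} (t2::real) :: ennreal"
  let ?X1 = "\<lambda>t1 t2 y. ?i t1 t2 * ennreal (1 / (t1 * t2) * (Ta t1 t2 y)\<^sup>2)"
  let ?X2 = "\<lambda>t1 t2 y. ?i t1 t2 * ennreal (1 / (t1 * t2) * (Tb t1 t2 y)\<^sup>2)"
  let ?X3 = "\<lambda>t1 t2 y. mu t1 t2 y * ennreal ((ee f (kk t1) (kk t2) y)\<^sup>2)"
  have "(\<integral>\<^sup>+t1. \<integral>\<^sup>+t2. \<integral>\<^sup>+y. ?i t1 t2 * ennreal (1 / (t1 * t2) * (\<integral>z. K (t1, t2, y, z) * f z \<partial>lborel)\<^sup>2) \<partial>lborel \<partial>lborel \<partial>lborel)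
    \<le> (\<integral>\<^sup>+t1. \<integral>\<^sup>+t2. \<integral>\<^sup>+y. 4 * ?X1 t1 t2 y + 4 * ?X2 t1 t2 y + 2 * ?X3 t1 t2 y \<partial>lborel \<partial>lborel \<partial>lborel)"
  proof (intro nn_integral_mono)
    fix t1 t2 :: real and y
    show "?i t1 t2 * ennreal (1 / (t1 * t2) * (\<integral>z. K (t1, t2, y, z) * f z \<partial>lborel)\<^sup>2) \<le> 4 * ?X1 t1 t2 y + 4 * ?X2 t1 t2 y + 2 * ?X3 t1 t2 y"
    proof (cases "0 < t1 \<and> 0 < t2")
      case True
      let ?c = "1 / (t1 * t2)" and ?p = "(Ta t1 t2 y)\<^sup>2" and ?q = "(Tb t1 t2 y)\<^sup>2" and ?k = "(\<integral>z. K (t1, t2, y, z) \<partial>lborel)\<^sup>2" and ?e = "(ee f (kk t1) (kk t2) y)\<^sup>2"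
      have c: "0 \<le> ?c" using True by simp
      have "(\<integral>z. K (t1, t2, y, z) * f z \<partial>lborel)\<^sup>2 \<le> 4 * ?p + 4 * ?q + 2 * (?k * ?e)"
        using square_add3_le[of "Ta t1 t2 y" "Tb t1 t2 y" "(\<integral>z. K (t1, t2, y, z) \<partial>lborel) * ee f (kk t1) (kk t2) y"] True
        by (simp add: decomposition power_mult_distrib)
      then have "?c * (\<integral>z. K (t1, t2, y, z) * f z \<partial>lborel)\<^sup>2 \<le> ?c * (4 * ?p + 4 * ?q + 2 * (?k * ?e))" using c by (rule mult_left_mono)
      also have "\<dots> = 4 * (?c * ?p) + 4 * (?c * ?q) + 2 * (?c * ?k * ?e)" by (simp add: distrib_left)
      finally have "ennreal (?c * (\<integral>z. K (t1, t2, y, z) * f z \<partial>lborel)\<^sup>2) \<le> ennreal (4 * (?c * ?p) + 4 * (?c * ?q) + 2 * (?c * ?k * ?e))"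
        by (rule ennreal_leI)
      also have "\<dots> = 4 * ennreal (?c * ?p) + 4 * ennreal (?c * ?q) + 2 * (ennreal (?c * ?k) * ennreal ?e)"
      proof -
        have "0 \<le> ?c * ?p" "0 \<le> ?c * ?q" "0 \<le> ?c * ?k" "0 \<le> ?e" using c by (auto intro!: mult_nonneg_nonneg simp del: times_divide_eq_left)
        then show ?thesis by (simp del: times_divide_eq_left add: ennreal_mult)
      qed
      finally show ?thesis using True by (simp add: mu_def)
    qed auto
  qed
  also have "\<dots> = 4 * (\<integral>\<^sup>+t1. \<integral>\<^sup>+t2. \<integral>\<^sup>+y. ?X1 t1 t2 y \<partial>lborel \<partial>lborel \<partial>lborel) + 4 * (\<integral>\<^sup>+t1. \<integral>\<^sup>+t2. \<integral>\<^sup>+y. ?X2 t1 t2 y \<partial>lborel \<partial>lborel \<partial>lborel)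
      + 2 * (\<integral>\<^sup>+t1. \<integral>\<^sup>+t2. \<integral>\<^sup>+y. ?X3 t1 t2 y \<partial>lborel \<partial>lborel \<partial>lborel)"
    by (simp add: nn_integral_add nn_integral_cmult)
  also have "\<dots> \<le> 4 * (ennreal (corthi CARD('n) a * (A * sqrt (csq CARD('m) b))\<^sup>2) * ?H) + 4 * (ennreal (corthi CARD('m) b * (A * sqrt (4 * ccar CARD('n) a))\<^sup>2) * ?H)
      + 2 * (ennreal (16 * D) * ?H)"
    by (intro add_mono mult_left_mono Ta_bound Tb_bound carleson_embedding2 f fin) auto
  also have "\<dots> = ennreal (cbi CARD('n) CARD('m) A a b D) * ?H"
  proof -
    have "0 \<le> corthi CARD('n) a * (A * sqrt (csq CARD('m) b))\<^sup>2" "0 \<le> corthi CARD('m) b * (A * sqrt (4 * ccar CARD('n) a))\<^sup>2" "0 \<le> 16 * D"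
      using corthi_nonneg[OF a] corthi_nonneg[OF b] D by auto
    then have "ennreal (cbi CARD('n) CARD('m) A a b D) = 4 * ennreal (corthi CARD('n) a * (A * sqrt (csq CARD('m) b))\<^sup>2) + 4 * ennreal (corthi CARD('m) b * (A * sqrt (4 * ccar CARD('n) a))\<^sup>2) + 2 * ennreal (16 * D)"
      unfolding cbi_def by (rule ennreal_triple_sum)
    then show ?thesis by (simp add: distrib_right mult.assoc)
  qed
  finally show ?thesis .
qed

end

end

context bi_parameter
begin

lemma Kf_integrable:
  fixes f :: "(real^'n) \<times> (real^'m) \<Rightarrow> real"
  assumes f[measurable]: "f \<in> borel_measurable borel" and fin: "(\<integral>\<^sup>+y. ennreal ((f y)\<^sup>2) \<partial>lborel) < \<infinity>"
    and t: "0 < t1" "0 < t2"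
  shows "integrable lborel (\<lambda>p. K (t1, t2, y, p) * f p)"
proof -
  obtain y1 y2 where y: "y = (y1, y2)" by (cases y)
  interpret o1: op_kernel lborel "lborel \<Otimes>\<^sub>M lborel" "K1 t1" "\<lambda>(y2, t2) z2. if 0 < t2 then A * kap b t2 (y2 - z2) / sqrt t2 else 0"
     "A * sqrt (csq CARD('m) b)" a t1 "kk t1" by (rule op1[OF t(1)])
  have fm: "f \<in> borel_measurable (lborel \<Otimes>\<^sub>M lborel)" by (simp add: lborel_prod)
  have K1e: "K1 t1 (y1, z1, (y2, t2), z2) = K (t1, t2, y, (z1, z2)) / sqrt t2" for z1 z2 using t by (simp add: K1_def y)
  have "(\<integral>\<^sup>+w. \<integral>\<^sup>+z. ennreal ((f (z, w))\<^sup>2) \<partial>lborel \<partial>lborel) = (\<integral>\<^sup>+y. ennreal ((f y)\<^sup>2) \<partial>lborel)"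
    unfolding lborel_prod[symmetric] by (rule lborel_pair.nn_integral_snd) (simp add: lborel_prod)
  then have ff: "(\<integral>\<^sup>+w. \<integral>\<^sup>+z. ennreal ((f (z, w))\<^sup>2) \<partial>lborel \<partial>lborel) < \<infinity>" using fin by simp
  have "integrable (lborel \<Otimes>\<^sub>M lborel) (\<lambda>p. K1 t1 (y1, fst p, (y2, t2), snd p) * f p)"
    using o1.dom[of y1 _ "(y2, t2)"] by (intro o1.Kg_integrable[OF fm ff, where c=1 and y=y1 and v="(y2, t2)"]) (auto simp del: split_paired_All, measurable)
  then have "integrable (lborel \<Otimes>\<^sub>M lborel) (\<lambda>p. sqrt t2 * (K1 t1 (y1, fst p, (y2, t2), snd p) * f p))" by (rule integrable_mult_right)
  then show ?thesis using t by (simp add: K1e lborel_prod)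
qed

text \<open>By Fubini almost every slice of \<open>f\<close> in either variable is square
  integrable. Setting \<open>f\<close> to 0 on the other slices changes it on a null set, hence
  changes neither side of the integrals against the kernel, and makes all slices admissible.\<close>

theorem bi_parameter_bound_L2:
  fixes f :: "(real^'n) \<times> (real^'m) \<Rightarrow> real"
  assumes f[measurable]: "f \<in> borel_measurable borel" and fin: "(\<integral>\<^sup>+y. ennreal ((f y)\<^sup>2) \<partial>lborel) < \<infinity>"
  shows "(\<integral>\<^sup>+t1. \<integral>\<^sup>+t2. \<integral>\<^sup>+y. indicator {0<..} t1 * indicator {0<..} t2 * ennreal (1 / (t1 * t2) * (\<integral>z. K (t1, t2, y, z) * f z \<partial>lborel)\<^sup>2) \<partial>lborel \<partial>lborel \<partial>lborel)
    \<le> ennreal (cbi CARD('n) CARD('m) A a b D) * (\<integral>\<^sup>+y. ennreal ((f y)\<^sup>2) \<partial>lborel)"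
proof -
  have P1: "(\<lambda>z1. \<integral>\<^sup>+z2. ennreal ((f (z1, z2))\<^sup>2) \<partial>lborel) \<in> borel_measurable borel"
    and P2: "(\<lambda>z2. \<integral>\<^sup>+z1. ennreal ((f (z1, z2))\<^sup>2) \<partial>lborel) \<in> borel_measurable borel" by measurable
  note [measurable] = P1 P2
  define g where "g = (\<lambda>p. if (\<integral>\<^sup>+z2. ennreal ((f (fst p, z2))\<^sup>2) \<partial>lborel) < \<infinity> \<and> (\<integral>\<^sup>+z1. ennreal ((f (z1, snd p))\<^sup>2) \<partial>lborel) < \<infinity> then f (fst p, snd p) else 0)"
  have g[measurable]: "g \<in> borel_measurable borel" unfolding g_def borel_prod[symmetric] by measurable
  have gf: "(g p)\<^sup>2 \<le> (f p)\<^sup>2" for p unfolding g_def by simp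
  have ae: "AE p in lborel. f p = g p"
  proof -
    have 1: "(\<integral>\<^sup>+z1. \<integral>\<^sup>+z2. ennreal ((f (z1, z2))\<^sup>2) \<partial>lborel \<partial>lborel) = (\<integral>\<^sup>+y. ennreal ((f y)\<^sup>2) \<partial>lborel)"
      unfolding lborel_prod[symmetric] by (rule lborel.nn_integral_fst) (simp add: lborel_prod)
    have 2: "(\<integral>\<^sup>+z2. \<integral>\<^sup>+z1. ennreal ((f (z1, z2))\<^sup>2) \<partial>lborel \<partial>lborel) = (\<integral>\<^sup>+y. ennreal ((f y)\<^sup>2) \<partial>lborel)"
      unfolding lborel_prod[symmetric] by (rule lborel_pair.nn_integral_snd) (simp add: lborel_prod)
    have a1: "AE z1 in lborel. (\<integral>\<^sup>+z2. ennreal ((f (z1, z2))\<^sup>2) \<partial>lborel) \<noteq> \<infinity>"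
      by (rule nn_integral_PInf_AE) (use 1 fin in auto)
    have a2: "AE z2 in lborel. (\<integral>\<^sup>+z1. ennreal ((f (z1, z2))\<^sup>2) \<partial>lborel) \<noteq> \<infinity>"
      by (rule nn_integral_PInf_AE) (use 2 fin in auto)
    have "AE p in lborel \<Otimes>\<^sub>M lborel. (\<integral>\<^sup>+z2. ennreal ((f (fst p, z2))\<^sup>2) \<partial>lborel) < \<infinity> \<and> (\<integral>\<^sup>+z1. ennreal ((f (z1, snd p))\<^sup>2) \<partial>lborel) < \<infinity>"
    proof (rule lborel_pair.AE_pair_measure)
      show "{x \<in> space (lborel \<Otimes>\<^sub>M lborel). (\<integral>\<^sup>+z2. ennreal ((f (fst x, z2))\<^sup>2) \<partial>lborel) < \<infinity> \<and> (\<integral>\<^sup>+z1. ennreal ((f (z1, snd x))\<^sup>2) \<partial>lborel) < \<infinity>} \<in> sets (lborel \<Otimes>\<^sub>M lborel)"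
        by measurable
      show "AE x in lborel. AE y in lborel. (\<integral>\<^sup>+z2. ennreal ((f (fst (x, y), z2))\<^sup>2) \<partial>lborel) < \<infinity> \<and> (\<integral>\<^sup>+z1. ennreal ((f (z1, snd (x, y)))\<^sup>2) \<partial>lborel) < \<infinity>"
        using a1
      proof eventually_elim
        case (elim x)
        show ?case using a2 by eventually_elim (use elim in \<open>simp add: less_top\<close>)
      qed
    qed
    then have "AE p in lborel \<Otimes>\<^sub>M lborel. f p = g p" by eventually_elim (simp add: g_def)
    then show ?thesis unfolding lborel_prod .
  qed
  have eq: "(\<integral>z. K (t1, t2, y, z) * f z \<partial>lborel) = (\<integral>z. K (t1, t2, y, z) * g z \<partial>lborel)" for t1 t2 y
    by (rule integral_cong_AE) (measurable, use ae in eventually_elim, simp)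
  have le: "(\<integral>\<^sup>+y. ennreal ((g y)\<^sup>2) \<partial>lborel) \<le> (\<integral>\<^sup>+y. ennreal ((f y)\<^sup>2) \<partial>lborel)"
    using gf by (intro nn_integral_mono ennreal_leI)
  have gfin: "(\<integral>\<^sup>+y. ennreal ((g y)\<^sup>2) \<partial>lborel) < \<infinity>" using le fin by (rule le_less_trans)
  have s1: "sqi (\<lambda>z1. g (z1, z2))" for z2
  proof (cases "(\<integral>\<^sup>+z1. ennreal ((f (z1, z2))\<^sup>2) \<partial>lborel) < \<infinity>")
    case True
    have "(\<integral>\<^sup>+z1. ennreal ((g (z1, z2))\<^sup>2) \<partial>lborel) \<le> (\<integral>\<^sup>+z1. ennreal ((f (z1, z2))\<^sup>2) \<partial>lborel)"
      using gf by (intro nn_integral_mono ennreal_leI)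
    then show ?thesis unfolding sqi_def using True by (auto intro: le_less_trans)
  next
    case False
    then have "g (z1, z2) = 0" for z1 by (simp add: g_def)
    then show ?thesis by (simp add: sqi_def)
  qed
  have s2: "sqi (\<lambda>z2. g (z1, z2))" for z1
  proof (cases "(\<integral>\<^sup>+z2. ennreal ((f (z1, z2))\<^sup>2) \<partial>lborel) < \<infinity>")
    case True
    have "(\<integral>\<^sup>+z2. ennreal ((g (z1, z2))\<^sup>2) \<partial>lborel) \<le> (\<integral>\<^sup>+z2. ennreal ((f (z1, z2))\<^sup>2) \<partial>lborel)"
      using gf by (intro nn_integral_mono ennreal_leI)
    then show ?thesis unfolding sqi_def using True by (auto intro: le_less_trans)
  next
    case False
    then have "g (z1, z2) = 0" for z2 by (simp add: g_def)
    then show ?thesis by (simp add: sqi_def)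
  qed
  show ?thesis unfolding eq
    by (rule order_trans[OF bi_parameter_bound[OF g gfin s1 s2] mult_left_mono[OF le]]) simp
qed

end

subsection \<open>Weights\<close>

text \<open>Normalised by t^n, the weight is \<open>kap\<close> with exponent \<open>p - n\<close>.
  For \<open>p = n * lam\<close> and \<open>lam > 1\<close> its integral is therefore bounded
  uniformly in \<open>t\<close>.\<close>

lemma weight_eq_kap:
  assumes t: "0 < t"
  shows "(t / (t + infnorm (u::real^'n))) powr p / t ^ CARD('n) = kap (p - real CARD('n)) t u"
proof -
  have u: "0 < t + infnorm u" using t infnorm_pos_le[of u] by linarith
  show ?thesis using t u by (simp add: kap_def powr_divide powr_diff powr_realpow)
qed

lemma nn_integral_weight_upper:
  fixes g :: "real \<times> (real^'n) \<Rightarrow> ennreal"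
  assumes g[measurable]: "g \<in> borel_measurable borel" and p: "real CARD('n) < p"
  shows "(\<integral>\<^sup>+x. \<integral>\<^sup>+y. \<integral>\<^sup>+t. indicator {0<..} t * ennreal ((t / (t + infnorm (x - y))) powr p / t ^ (CARD('n) + 1)) * g (t, y) \<partial>lborel \<partial>lborel \<partial>lborel)
    \<le> ennreal (ckap CARD('n) (p - real CARD('n))) * (\<integral>\<^sup>+y. \<integral>\<^sup>+t. indicator {0<..} t * ennreal (1 / t) * g (t, y) \<partial>lborel \<partial>lborel)"
proof -
  let ?k = "\<lambda>t u. kap (p - real CARD('n)) t (u :: real^'n)" and ?c = "ennreal (ckap CARD('n) (p - real CARD('n)))"
  have e: "indicator {0<..} t * ennreal ((t / (t + infnorm (x - y))) powr p / t ^ (CARD('n) + 1)) * g (t, y)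
      = indicator {0<..} t * ennreal (1 / t) * g (t, y) * ennreal (?k t (x - y))" for x y :: "real^'n" and t
  proof (cases "0 < t")
    case True
    have "(t / (t + infnorm (x - y))) powr p / t ^ (CARD('n) + 1) = (1 / t) * ?k t (x - y)"
      unfolding weight_eq_kap[OF True, of "x - y" p, symmetric] by simp
    then have "ennreal ((t / (t + infnorm (x - y))) powr p / t ^ (CARD('n) + 1)) = ennreal (1 / t) * ennreal (?k t (x - y))"
      using True by (simp only:) (intro ennreal_mult, auto simp: kap_nonneg)
    then show ?thesis by (simp add: mult_ac)
  qed simp
  have km[measurable]: "(\<lambda>q. kap c (T q) (u q)) \<in> borel_measurable M" if "T \<in> borel_measurable M" "u \<in> borel_measurable M" for c T and u :: "'z \<Rightarrow> real^'n" and M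
    using that unfolding kap_def by measurable
  have "(\<integral>\<^sup>+x. \<integral>\<^sup>+y. \<integral>\<^sup>+t. indicator {0<..} t * ennreal (1 / t) * g (t, y) * ennreal (?k t (x - y)) \<partial>lborel \<partial>lborel \<partial>lborel)
     = (\<integral>\<^sup>+y. \<integral>\<^sup>+x. \<integral>\<^sup>+t. indicator {0<..} t * ennreal (1 / t) * g (t, y) * ennreal (?k t (x - y)) \<partial>lborel \<partial>lborel \<partial>lborel)"
    by (rule lborel_pair.Fubini') (unfold kap_def, measurable)
  also have "\<dots> = (\<integral>\<^sup>+y. \<integral>\<^sup>+t. \<integral>\<^sup>+x. indicator {0<..} t * ennreal (1 / t) * g (t, y) * ennreal (?k t (x - y)) \<partial>lborel \<partial>lborel \<partial>lborel)"
    by (intro nn_integral_cong lborel_pair.Fubini') (unfold kap_def, measurable)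
  also have "\<dots> \<le> (\<integral>\<^sup>+y. \<integral>\<^sup>+t. ?c * (indicator {0<..} t * ennreal (1 / t) * g (t, y)) \<partial>lborel \<partial>lborel)"
  proof (intro nn_integral_mono)
    fix y :: "real^'n" and t :: real
    show "(\<integral>\<^sup>+x. indicator {0<..} t * ennreal (1 / t) * g (t, y) * ennreal (?k t (x - y)) \<partial>lborel) \<le> ?c * (indicator {0<..} t * ennreal (1 / t) * g (t, y))"
    proof (cases "0 < t")
      case True
      have "(\<integral>\<^sup>+x. indicator {0<..} t * ennreal (1 / t) * g (t, y) * ennreal (?k t (x - y)) \<partial>lborel) = indicator {0<..} t * ennreal (1 / t) * g (t, y) * (\<integral>\<^sup>+x. ennreal (?k t (x - y)) \<partial>lborel)"
        by (rule nn_integral_cmult) measurable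
      also have "\<dots> \<le> indicator {0<..} t * ennreal (1 / t) * g (t, y) * ?c"
        using p True by (intro mult_left_mono nn_integral_kap_shift) auto
      finally show ?thesis by (simp add: mult_ac)
    qed simp
  qed
  also have "\<dots> = ?c * (\<integral>\<^sup>+y. \<integral>\<^sup>+t. indicator {0<..} t * ennreal (1 / t) * g (t, y) \<partial>lborel \<partial>lborel)"
    by (simp add: nn_integral_cmult)
  finally show ?thesis unfolding e .
qed

lemma nn_integral_lborel_reflect:
  fixes x :: "'a::euclidean_space"
  assumes [measurable]: "f \<in> borel_measurable borel"
  shows "(\<integral>\<^sup>+y. f (x - y) \<partial>lborel) = (\<integral>\<^sup>+y. f y \<partial>lborel)"
proof -
  have "(lborel :: 'a measure) = distr lborel borel (\<lambda>y. x - y)"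
    using lborel_affine[of "-1" x] by (simp add: density_1)
  then have "(\<integral>\<^sup>+y. f y \<partial>lborel) = (\<integral>\<^sup>+y. f y \<partial>distr lborel borel (\<lambda>y. x - y))" by simp
  also have "\<dots> = (\<integral>\<^sup>+y. f (x - y) \<partial>lborel)" by (rule nn_integral_distr) measurable
  finally show ?thesis by simp
qed

text \<open>The set contains a whole cube of side \<open>t\<close>: in coordinate i the interval
  from u_i - t to u_i if it stays inside, and otherwise the interval of length \<open>t\<close>
  starting at c_i, which then contains u_i.\<close>

lemma emeasure_hcube_ball:
  fixes u :: "real^'n"
  assumes u: "u \<in> hcube c l" and t: "0 < t" "t < l"
  shows "ennreal (t ^ CARD('n)) \<le> emeasure lborel {x \<in> hcube c l. infnorm (x - u) \<le> t}"
proof -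
  let ?d = "\<chi> i. if t \<le> u$i - c$i then u$i - t else c$i"
  have "hcube ?d t \<subseteq> {x \<in> hcube c l. infnorm (x - u) \<le> t}"
    unfolding hcube_def infnorm_le_iff_cart
  proof (clarsimp, intro conjI allI)
    fix x i assume x: "\<forall>i. (t \<le> u$i - c$i \<longrightarrow> u$i - t \<le> x$i \<and> x$i < u$i) \<and> (\<not> t \<le> u$i - c$i \<longrightarrow> c$i \<le> x$i \<and> x$i < c$i + t)"
    have "c$i \<le> u$i" "u$i < c$i + l" using u by (auto simp: hcube_def)
    then show "c$i \<le> x$i" "x$i < c$i + l" "\<bar>x$i - u$i\<bar> \<le> t"
      using spec[OF x, of i] t by (cases "t \<le> u$i - c$i"; auto)+
  qed
  then have "emeasure lborel (hcube ?d t) \<le> emeasure lborel {x \<in> hcube c l. infnorm (x - u) \<le> t}"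
    by (intro emeasure_mono) auto
  then show ?thesis using t by (simp add: emeasure_hcube)
qed

text \<open>Put u = x - y. Every \<open>u\<close> in the cube has within distance \<open>t\<close> a
  set of points \<open>x\<close> of the same cube of measure at least t^n
  (\<open>emeasure_hcube_ball\<close>), and there the weight is at least
  \<open>2 powr (- p)\<close>. So the testing integral of Assumption 2, averaged in \<open>x\<close>
  and weighted in \<open>y\<close>, dominates the unweighted one at \<open>u\<close>.\<close>

lemma nn_integral_weight_lower:
  fixes g :: "real \<times> (real^'n) \<Rightarrow> ennreal"
  assumes g[measurable]: "g \<in> borel_measurable borel" and l: "0 < l" and p: "0 \<le> p"
  shows "(\<integral>\<^sup>+u. indicator (hcube c l) u * (\<integral>\<^sup>+t. indicator {0<..l} t * (ennreal (1 / t) * g (t, u)) \<partial>lborel) \<partial>lborel)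
    \<le> ennreal (2 powr p) * (\<integral>\<^sup>+x. \<integral>\<^sup>+t. \<integral>\<^sup>+y. indicator (hcube c l) x * indicator {0<..<l} t * (ennreal ((t / (t + infnorm y)) powr p / t ^ (CARD('n) + 1)) * g (t, x - y)) \<partial>lborel \<partial>lborel \<partial>lborel)"
proof -
  let ?Q = "hcube c l"
  let ?w = "\<lambda>t u. ennreal ((t / (t + infnorm (u :: real^'n))) powr p / t ^ (CARD('n) + 1))"
  have key: "indicator ?Q u * indicator {0<..<l} t * (ennreal (1 / t) * g (t, u)) \<le> ennreal (2 powr p) * (indicator {0<..<l} t * g (t, u) * (\<integral>\<^sup>+x. indicator ?Q x * ?w t (x - u) \<partial>lborel))" for t u
  proof (cases "u \<in> ?Q \<and> 0 < t \<and> t < l")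
    case True
    have "ennreal (1 / t) = ennreal (1 / t ^ (CARD('n) + 1)) * ennreal (t ^ CARD('n))"
      using True by (subst ennreal_mult[symmetric]) auto
    also have "\<dots> \<le> ennreal (1 / t ^ (CARD('n) + 1)) * emeasure lborel {x \<in> ?Q. infnorm (x - u) \<le> t}"
      using True by (intro mult_left_mono emeasure_hcube_ball) auto
    also have "\<dots> = (\<integral>\<^sup>+x. ennreal (1 / t ^ (CARD('n) + 1)) * indicator {x \<in> ?Q. infnorm (x - u) \<le> t} x \<partial>lborel)"
      by (rule nn_integral_cmult_indicator[symmetric]) auto
    also have "\<dots> \<le> (\<integral>\<^sup>+x. ennreal (2 powr p) * (indicator ?Q x * ?w t (x - u)) \<partial>lborel)"
    proof (rule nn_integral_mono)
      fix x
      show "ennreal (1 / t ^ (CARD('n) + 1)) * indicator {x \<in> ?Q. infnorm (x - u) \<le> t} x \<le> ennreal (2 powr p) * (indicator ?Q x * ?w t (x - u))"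
      proof (cases "x \<in> ?Q \<and> infnorm (x - u) \<le> t")
        case x: True
        have n: "0 \<le> infnorm (x - u)" by (rule infnorm_pos_le)
        have "1 \<le> 2 * (t / (t + infnorm (x - u)))" using True x n by (simp add: field_simps)
        then have "1 \<le> (2 * (t / (t + infnorm (x - u)))) powr p" using p by (intro ge_one_powr_ge_zero) auto
        also have "\<dots> = 2 powr p * (t / (t + infnorm (x - u))) powr p" by (rule powr_mult)
        finally have "1 * (1 / t ^ (CARD('n) + 1)) \<le> 2 powr p * (t / (t + infnorm (x - u))) powr p * (1 / t ^ (CARD('n) + 1))"
          using True by (intro mult_right_mono) auto
        then have "ennreal (1 / t ^ (CARD('n) + 1)) \<le> ennreal (2 powr p * ((t / (t + infnorm (x - u))) powr p / t ^ (CARD('n) + 1)))"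
          by (intro ennreal_leI) simp
        also have "\<dots> = ennreal (2 powr p) * ?w t (x - u)" using True by (intro ennreal_mult) auto
        finally show ?thesis using x by simp
      qed simp
    qed
    also have "\<dots> = ennreal (2 powr p) * (\<integral>\<^sup>+x. indicator ?Q x * ?w t (x - u) \<partial>lborel)"
      by (rule nn_integral_cmult) measurable
    finally have "ennreal (1 / t) * g (t, u) \<le> ennreal (2 powr p) * (\<integral>\<^sup>+x. indicator ?Q x * ?w t (x - u) \<partial>lborel) * g (t, u)"
      by (rule mult_right_mono) simp
    then show ?thesis using True by (simp add: mult_ac)
  qed auto
  have "(\<integral>\<^sup>+u. indicator ?Q u * (\<integral>\<^sup>+t. indicator {0<..l} t * (ennreal (1 / t) * g (t, u)) \<partial>lborel) \<partial>lborel)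
    = (\<integral>\<^sup>+u. \<integral>\<^sup>+t. indicator ?Q u * indicator {0<..<l} t * (ennreal (1 / t) * g (t, u)) \<partial>lborel \<partial>lborel)"
  proof (rule nn_integral_cong)
    fix u
    \<comment> \<open>The tents used with dyadic scales contain the endpoint \<open>l\<close>, those
      of Assumption 2 do not; a single point is null.\<close>
    have "(\<integral>\<^sup>+t. indicator {0<..l} t * (ennreal (1 / t) * g (t, u)) \<partial>lborel) = (\<integral>\<^sup>+t. indicator {0<..<l} t * (ennreal (1 / t) * g (t, u)) \<partial>lborel)"
      by (rule nn_integral_cong_AE) (use AE_lborel_singleton[of l] in eventually_elim, auto simp: indicator_def)
    then show "indicator ?Q u * (\<integral>\<^sup>+t. indicator {0<..l} t * (ennreal (1 / t) * g (t, u)) \<partial>lborel) = (\<integral>\<^sup>+t. indicator ?Q u * indicator {0<..<l} t * (ennreal (1 / t) * g (t, u)) \<partial>lborel)"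
      by (simp add: nn_integral_cmult mult.assoc)
  qed
  also have "\<dots> \<le> (\<integral>\<^sup>+u. \<integral>\<^sup>+t. ennreal (2 powr p) * (indicator {0<..<l} t * g (t, u) * (\<integral>\<^sup>+x. indicator ?Q x * ?w t (x - u) \<partial>lborel)) \<partial>lborel \<partial>lborel)"
    by (intro nn_integral_mono key)
  also have "\<dots> = ennreal (2 powr p) * (\<integral>\<^sup>+u. \<integral>\<^sup>+t. \<integral>\<^sup>+x. indicator {0<..<l} t * g (t, u) * (indicator ?Q x * ?w t (x - u)) \<partial>lborel \<partial>lborel \<partial>lborel)"
    by (simp add: nn_integral_cmult)
  also have "(\<integral>\<^sup>+u. \<integral>\<^sup>+t. \<integral>\<^sup>+x. indicator {0<..<l} t * g (t, u) * (indicator ?Q x * ?w t (x - u)) \<partial>lborel \<partial>lborel \<partial>lborel)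
    = (\<integral>\<^sup>+u. \<integral>\<^sup>+x. \<integral>\<^sup>+t. indicator {0<..<l} t * g (t, u) * (indicator ?Q x * ?w t (x - u)) \<partial>lborel \<partial>lborel \<partial>lborel)"
    by (intro nn_integral_cong lborel_pair.Fubini') measurable
  also have "\<dots> = (\<integral>\<^sup>+x. \<integral>\<^sup>+u. \<integral>\<^sup>+t. indicator {0<..<l} t * g (t, u) * (indicator ?Q x * ?w t (x - u)) \<partial>lborel \<partial>lborel \<partial>lborel)"
    by (rule lborel_pair.Fubini') measurable
  also have "\<dots> = (\<integral>\<^sup>+x. \<integral>\<^sup>+t. \<integral>\<^sup>+u. indicator {0<..<l} t * g (t, u) * (indicator ?Q x * ?w t (x - u)) \<partial>lborel \<partial>lborel \<partial>lborel)"
    by (intro nn_integral_cong lborel_pair.Fubini') measurable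
  also have "\<dots> = (\<integral>\<^sup>+x. \<integral>\<^sup>+t. \<integral>\<^sup>+y. indicator ?Q x * indicator {0<..<l} t * (?w t y * g (t, x - y)) \<partial>lborel \<partial>lborel \<partial>lborel)"
  proof (rule nn_integral_cong, rule nn_integral_cong)
    fix x :: "real^'n" and t :: real
    have "(\<integral>\<^sup>+u. indicator {0<..<l} t * g (t, u) * (indicator ?Q x * ?w t (x - u)) \<partial>lborel) = (\<integral>\<^sup>+y. indicator {0<..<l} t * g (t, x - y) * (indicator ?Q x * ?w t (x - (x - y))) \<partial>lborel)"
      by (rule nn_integral_lborel_reflect[symmetric]) measurable
    then show "(\<integral>\<^sup>+u. indicator {0<..<l} t * g (t, u) * (indicator ?Q x * ?w t (x - u)) \<partial>lborel) = (\<integral>\<^sup>+y. indicator ?Q x * indicator {0<..<l} t * (?w t y * g (t, x - y)) \<partial>lborel)"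
      by (simp add: mult_ac)
  qed
  finally show ?thesis .
qed

section \<open>Passage from the three assumptions to the abstract hypotheses\<close>

text \<open>The Carleson condition is stated with an unconditional infinite sum. Enumerating the
  countable index set compares it with an integral over counting measure, which can be exchanged
  with the other integrals.\<close>

lemma nn_integral_le_infsum:
  fixes f :: "'a \<Rightarrow> ennreal"
  assumes X: "countable X"
  shows "(\<integral>\<^sup>+x. f x \<partial>count_space X) \<le> (\<Sum>\<^sub>\<infinity>x\<in>X. f x)"
proof -
  have le: "(\<Sum>x\<in>F. f x) \<le> (\<Sum>\<^sub>\<infinity>x\<in>X. f x)" if "finite F" "F \<subseteq> X" for F
    using that by (subst nonneg_infsum_complete) (auto intro!: SUP_upper)
  show ?thesis
  proof (cases "finite X")
    case True
    then show ?thesis using le[of X] by (simp add: nn_integral_count_space_finite)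
  next
    case False
    have b: "bij_betw (from_nat_into X) UNIV X" using X False by (rule bij_betw_from_nat_into)
    have "(\<integral>\<^sup>+x. f x \<partial>count_space X) = (\<integral>\<^sup>+i. f (from_nat_into X i) \<partial>count_space UNIV)"
      by (rule nn_integral_bij_count_space[OF b, symmetric])
    also have "\<dots> = (\<Sum>i. f (from_nat_into X i))" by (rule nn_integral_count_space_nat)
    also have "\<dots> = (SUP N. \<Sum>i<N. f (from_nat_into X i))" by (rule suminf_eq_SUP)
    also have "\<dots> \<le> (\<Sum>\<^sub>\<infinity>x\<in>X. f x)"
    proof (rule SUP_least)
      fix N
      have "inj_on (from_nat_into X) {..<N}" using b by (auto simp: bij_betw_def intro: inj_on_subset)
      then have "(\<Sum>i<N. f (from_nat_into X i)) = (\<Sum>x\<in>from_nat_into X ` {..<N}. f x)" by (simp add: sum.reindex)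
      also have "\<dots> \<le> (\<Sum>\<^sub>\<infinity>x\<in>X. f x)" using b by (intro le) (auto simp: bij_betw_def)
      finally show "(\<Sum>i<N. f (from_nat_into X i)) \<le> (\<Sum>\<^sub>\<infinity>x\<in>X. f x)" .
    qed
    finally show ?thesis .
  qed
qed

lemma ensqrt_power2: "(ensqrt v)\<^sup>2 = v"
  by (cases v) (auto simp: ensqrt_def ennreal_power)

lemma ensqrt_le_ennrealD: "ensqrt v \<le> ennreal c \<Longrightarrow> v \<le> ennreal (c\<^sup>2)"
proof -
  assume a: "ensqrt v \<le> ennreal c"
  then have "ensqrt v \<le> ennreal \<bar>c\<bar>" by (rule order_trans) (simp add: ennreal_leI)
  then have "(ensqrt v)\<^sup>2 \<le> (ennreal \<bar>c\<bar>)\<^sup>2" by (rule power_mono) simp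
  then show ?thesis by (simp add: ensqrt_power2 ennreal_power)
qed

lemma ensqrt_le_ennrealI: "v \<le> ennreal (c\<^sup>2) \<Longrightarrow> 0 \<le> c \<Longrightarrow> ensqrt v \<le> ennreal c"
  by (cases v) (auto simp: ensqrt_def top_unique intro!: ennreal_leI real_le_lsqrt)

lemma borel_measurable_fst_comp [measurable (raw)]:
  "f \<in> borel_measurable M \<Longrightarrow> (\<lambda>x. fst (f x :: 'a::second_countable_topology \<times> 'b::second_countable_topology)) \<in> borel_measurable M"
  unfolding borel_prod[symmetric] by measurable

lemma borel_measurable_snd_comp [measurable (raw)]:
  "f \<in> borel_measurable M \<Longrightarrow> (\<lambda>x. snd (f x :: 'a::second_countable_topology \<times> 'b::second_countable_topology)) \<in> borel_measurable M"
  unfolding borel_prod[symmetric] by measurable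

text \<open>Measurability of the kernel is given for positive parameters only. Extension by 0 makes
  it a measurable function on the whole space, and the integrals are restricted to positive
  parameters in any case.\<close>

definition trunc :: "('n::finite, 'm::finite) kernel \<Rightarrow> real \<times> real \<times> ((real^'n) \<times> (real^'m)) \<times> ((real^'n) \<times> (real^'m)) \<Rightarrow> complex" where
  "trunc K = (\<lambda>(t1, t2, x, y). if 0 < t1 \<and> 0 < t2 then K t1 t2 x y else 0)"

lemma trunc_eq: "0 < t1 \<Longrightarrow> 0 < t2 \<Longrightarrow> trunc K (t1, t2, x, y) = K t1 t2 x y"
  by (simp add: trunc_def)

lemma carleson_from_testing:
  fixes L :: "real \<times> (real^'n) \<times> (real^'n) \<Rightarrow> complex"
  assumes L[measurable]: "L \<in> borel_measurable borel"
    and int: "\<And>t u. 0 < t \<Longrightarrow> integrable lborel (\<lambda>z. L (t, u, z))"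
    and eq: "\<And>t u z. 0 < t \<Longrightarrow> L (t, u, z) = L0 t u z"
    and r: "bounded_linear r" "\<And>z. \<bar>r z\<bar> \<le> cmod z"
    and l: "0 < l" and p: "0 \<le> p"
    and V: "ensqrt (\<integral>\<^sup>+ x. \<integral>\<^sup>+ t. \<integral>\<^sup>+ y. indicator (hcube c l) x * indicator {0<..<l} t *
          ennreal ((cmod (\<integral>z\<in>hcube c l. L0 t (x - y) z \<partial>lborel))\<^sup>2 * (t / (t + infnorm y)) powr p / t ^ (CARD('n) + 1))
        \<partial>lborel \<partial>lborel \<partial>lborel) \<le> ennreal (B * sqrt (measure lborel (hcube c l)) * W)"
  shows "(\<integral>\<^sup>+u. indicator (hcube c l) u * (\<integral>\<^sup>+t. indicator {0<..l} t * (ennreal (1 / t) * ennreal ((\<integral>z. indicator (hcube c l) z * r (L (t, u, z)) \<partial>lborel)\<^sup>2)) \<partial>lborel) \<partial>lborel)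
    \<le> ennreal (2 powr p * (B * W)\<^sup>2 * l ^ CARD('n))"
proof -
  let ?Q = "hcube c l"
  have rm[measurable]: "r \<in> borel_measurable borel"
    using r(1) by (intro borel_measurable_continuous_onI linear_continuous_on)
  let ?g = "\<lambda>q. ennreal ((\<integral>z. indicator ?Q z * r (L (fst q, snd q, z)) \<partial>lborel)\<^sup>2)"
  have g: "?g \<in> borel_measurable borel" unfolding borel_prod[symmetric] by measurable
  let ?V = "\<integral>\<^sup>+ x. \<integral>\<^sup>+ t. \<integral>\<^sup>+ y. indicator ?Q x * indicator {0<..<l} t *
          ennreal ((cmod (\<integral>z\<in>?Q. L0 t (x - y) z \<partial>lborel))\<^sup>2 * (t / (t + infnorm y)) powr p / t ^ (CARD('n) + 1)) \<partial>lborel \<partial>lborel \<partial>lborel"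
  have "measure lborel ?Q = l ^ CARD('n)" using emeasure_hcube[of l c] l by (simp add: measure_def)
  then have V': "?V \<le> ennreal ((B * W)\<^sup>2 * l ^ CARD('n))"
    using ensqrt_le_ennrealD[OF V] l by (simp add: power_mult_distrib mult_ac)
  have gle: "(\<integral>z. indicator ?Q z * r (L (t, u, z)) \<partial>lborel)\<^sup>2 \<le> (cmod (\<integral>z\<in>?Q. L0 t u z \<partial>lborel))\<^sup>2" if t: "0 < t" for t u
  proof -
    have i: "integrable lborel (\<lambda>z. indicator ?Q z *\<^sub>R L (t, u, z))"
      using integrable_mult_indicator[OF _ int[OF t, of u], of ?Q] by simp
    have "(\<integral>z. indicator ?Q z * r (L (t, u, z)) \<partial>lborel) = (\<integral>z. r (indicator ?Q z *\<^sub>R L (t, u, z)) \<partial>lborel)"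
      using linear_simps(5)[OF r(1)] by simp
    also have "\<dots> = r (\<integral>z. indicator ?Q z *\<^sub>R L (t, u, z) \<partial>lborel)" by (rule integral_bounded_linear[OF r(1) i])
    also have "(\<integral>z. indicator ?Q z *\<^sub>R L (t, u, z) \<partial>lborel) = (\<integral>z\<in>?Q. L0 t u z \<partial>lborel)"
      unfolding set_lebesgue_integral_def eq[OF t] ..
    finally have "\<bar>\<integral>z. indicator ?Q z * r (L (t, u, z)) \<partial>lborel\<bar> \<le> cmod (\<integral>z\<in>?Q. L0 t u z \<partial>lborel)" using r(2) by simp
    then show ?thesis using power_mono[of "\<bar>\<integral>z. indicator ?Q z * r (L (t, u, z)) \<partial>lborel\<bar>" _ 2] by fastforce
  qed
  have "(\<integral>\<^sup>+u. indicator ?Q u * (\<integral>\<^sup>+t. indicator {0<..l} t * (ennreal (1 / t) * ?g (t, u)) \<partial>lborel) \<partial>lborel)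
    \<le> ennreal (2 powr p) * (\<integral>\<^sup>+x. \<integral>\<^sup>+t. \<integral>\<^sup>+y. indicator ?Q x * indicator {0<..<l} t * (ennreal ((t / (t + infnorm y)) powr p / t ^ (CARD('n) + 1)) * ?g (t, x - y)) \<partial>lborel \<partial>lborel \<partial>lborel)"
    by (rule nn_integral_weight_lower[OF g l p])
  also have "\<dots> \<le> ennreal (2 powr p) * ?V"
  proof (rule mult_left_mono, intro nn_integral_mono)
    fix x y :: "real^'n" and t :: real
    show "indicator ?Q x * indicator {0<..<l} t * (ennreal ((t / (t + infnorm y)) powr p / t ^ (CARD('n) + 1)) * ?g (t, x - y))
      \<le> indicator ?Q x * indicator {0<..<l} t * ennreal ((cmod (\<integral>z\<in>?Q. L0 t (x - y) z \<partial>lborel))\<^sup>2 * (t / (t + infnorm y)) powr p / t ^ (CARD('n) + 1))"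
    proof (cases "0 < t")
      case True
      let ?w = "(t / (t + infnorm y)) powr p / t ^ (CARD('n) + 1)"
      have "ennreal ?w * ?g (t, x - y) = ennreal (?w * (\<integral>z. indicator ?Q z * r (L (t, x - y, z)) \<partial>lborel)\<^sup>2)"
        using True by (simp only: fst_conv snd_conv) (intro ennreal_mult[symmetric], auto)
      also have "\<dots> \<le> ennreal (?w * (cmod (\<integral>z\<in>?Q. L0 t (x - y) z \<partial>lborel))\<^sup>2)"
        using True by (intro ennreal_leI mult_left_mono gle) auto
      finally show ?thesis by (intro mult_left_mono) (simp_all add: mult_ac)
    qed simp
  qed simp
  also have "\<dots> \<le> ennreal (2 powr p) * ennreal ((B * W)\<^sup>2 * l ^ CARD('n))" by (intro mult_left_mono V') simp
  also have "\<dots> = ennreal (2 powr p * (B * W)\<^sup>2 * l ^ CARD('n))" using l by (simp add: ennreal_mult mult.assoc)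
  finally show ?thesis by simp
qed

lemma holder_kap:
  assumes "0 < t"
  shows "infnorm (u::real^'n) powr a / (t + infnorm (v::real^'n)) powr (real CARD('n) + a) = (infnorm u / t) powr a * kap a t v"
  using assms by (simp add: kap_def powr_divide infnorm_pos_le)

lemma dyadic_cube_in_grid: "(dcor k y, 2 powr real_of_int k) \<in> dyadic_grid 0"
  unfolding dyadic_grid_def std_dyadic_def dcor_def
  by (auto simp: vec_eq_iff intro!: exI[of _ k] exI[of _ "\<lambda>i. \<lfloor>y $ i / 2 powr real_of_int k\<rfloor>"])

lemma countable_dyadic_grid: "countable (dyadic_grid (w :: real^'n))"
proof -
  let ?h = "\<lambda>(k::int, j::'n \<Rightarrow> int). (2 powr (real_of_int k) *\<^sub>R (\<chi> i. real_of_int (j i)) + w, 2 powr (real_of_int k))"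
  have "dyadic_grid w \<subseteq> range ?h" unfolding dyadic_grid_def std_dyadic_def by auto
  moreover have "countable (UNIV :: ('n \<Rightarrow> int) set)"
    using countable_PiE[of "UNIV :: 'n set" "\<lambda>_. UNIV :: int set"] by (simp add: PiE_UNIV_domain)
  then have "countable (UNIV :: (int \<times> ('n \<Rightarrow> int)) set)" unfolding UNIV_Times_UNIV[symmetric] by (intro countable_SIGMA) auto
  ultimately show ?thesis by (rule countable_subset[OF _ countable_image])
qed

lemma dyadic_grid_pos: "I \<in> dyadic_grid w \<Longrightarrow> 0 < snd I"
  unfolding dyadic_grid_def std_dyadic_def by auto

text \<open>Two points of a cube of side \<open>l\<close> are at distance less than
  \<open>l < 2 * t\<close>, so \<open>t + infnorm (x - y) < 3 * t\<close>.\<close>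

lemma weight_third:
  assumes x: "x \<in> hcube c l" "y \<in> hcube c (l::real)" and t: "l / 2 < t" "0 < t" and p: "0 \<le> p"
  shows "1 \<le> 3 powr p * (t / (t + infnorm (x - y :: real^'n))) powr p"
proof -
  have "infnorm (x - y) < l"
    using x by (auto simp: infnorm_less_iff_cart hcube_def abs_less_iff) (smt (verit))+
  then have "1 \<le> 3 * (t / (t + infnorm (x - y)))" using t infnorm_pos_le[of "x - y"] by (simp add: field_simps)
  then have "1 \<le> (3 * (t / (t + infnorm (x - y)))) powr p" using p by (intro ge_one_powr_ge_zero) auto
  also have "\<dots> = 3 powr p * (t / (t + infnorm (x - y))) powr p" by (rule powr_mult)
  finally show ?thesis .
qed

text \<open>Restricting \<open>y\<close> to the rectangle itself, the weights over a Whitney box are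
  bounded below by powers of 1/3 (\<open>weight_third\<close>). The coefficient is moreover an
  average in x over the rectangle up to constants, so it dominates the unweighted mass of the
  box.\<close>

lemma carleson_coeff_lower:
  fixes K :: "('n::finite, 'm::finite) kernel" and G :: "real \<times> real \<times> ((real^'n) \<times> (real^'m)) \<Rightarrow> real"
  assumes G[measurable]: "G \<in> borel_measurable borel" and Gt: "\<And>t1 t2 y. 0 < t1 \<Longrightarrow> 0 < t2 \<Longrightarrow> G (t1, t2, y) \<le> (cmod (theta K t1 t2 (\<lambda>_. 1) y))\<^sup>2"
    and G0: "\<And>q. 0 \<le> G q"
    and l: "0 < snd I" "0 < snd J" and lam: "0 \<le> lam1" "0 \<le> lam2"
  shows "(\<integral>\<^sup>+t1. \<integral>\<^sup>+t2. \<integral>\<^sup>+y. indicator {snd I / 2<..<snd I} t1 * indicator {snd J / 2<..<snd J} t2 * indicator (hcube (fst I) (snd I)) (fst y) * indicator (hcube (fst J) (snd J)) (snd y)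
       * ennreal (1 / (t1 * t2) * G (t1, t2, y)) \<partial>lborel \<partial>lborel \<partial>lborel)
     \<le> ennreal (3 powr (real CARD('n) * lam1) * 3 powr (real CARD('m) * lam2)) * carleson_coeff K lam1 lam2 I J"
proof -
  obtain c1 l1 c2 l2 where IJ: "I = (c1, l1)" "J = (c2, l2)" by (cases I, cases J)
  have l1: "0 < l1" and l2: "0 < l2" using l IJ by auto
  let ?Q1 = "hcube c1 l1" and ?Q2 = "hcube c2 l2" and ?p1 = "real CARD('n) * lam1" and ?p2 = "real CARD('m) * lam2"
  let ?c = "3 powr ?p1 * 3 powr ?p2"
  let ?i1 = "\<lambda>t1. indicator {l1 / 2<..<l1} (t1::real) :: ennreal" and ?i2 = "\<lambda>t2. indicator {l2 / 2<..<l2} (t2::real) :: ennreal"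
  let ?H = "\<lambda>t1 t2 y. ?i1 t1 * ?i2 t2 * indicator ?Q1 (fst y) * indicator ?Q2 (snd y) * ennreal (1 / (t1 * t2) * G (t1, t2, y))"
  have Hm[measurable]: "(\<lambda>x. ?H (T1 x) (T2 x) (Y x)) \<in> borel_measurable M"
    if [measurable]: "T1 \<in> borel_measurable M" "T2 \<in> borel_measurable M" "Y \<in> borel_measurable M" for T1 T2 Y and M :: "'z measure"
    by measurable
  let ?B = "\<lambda>t2. \<integral>\<^sup>+t1. \<integral>\<^sup>+y. ?H t1 t2 y \<partial>lborel \<partial>lborel"
  let ?X = "\<integral>\<^sup>+t1. \<integral>\<^sup>+t2. \<integral>\<^sup>+y. ?H t1 t2 y \<partial>lborel \<partial>lborel \<partial>lborel"
  \<comment> \<open>Normalised indicators that insert the variables \<open>x1\<close> and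
    \<open>x2\<close> of the coefficient: \<open>?c1\<close> has integral 1, and \<open>?c2\<close>
    has integral \<open>1 / ?c\<close>, storing the loss from the two weights.\<close>
  let ?c1 = "\<lambda>x1. ennreal (1 / l1 ^ CARD('n)) * indicator ?Q1 x1"
  let ?c2 = "\<lambda>x2. ennreal (1 / ?c * (1 / l2 ^ CARD('m))) * indicator ?Q2 x2"
  have cp: "0 < ?c" by simp
  have e1: "(\<integral>\<^sup>+x1. ?c1 x1 \<partial>lborel) = 1"
    using l1 by (subst nn_integral_cmult_indicator) (auto simp: emeasure_hcube ennreal_mult[symmetric])
  have e2: "(\<integral>\<^sup>+x2. ?c2 x2 \<partial>lborel) = ennreal (1 / ?c)"
    using l2 by (subst nn_integral_cmult_indicator) (auto simp: emeasure_hcube ennreal_mult[symmetric])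
  have Bm[measurable]: "?B \<in> borel_measurable lborel" by measurable
  have XB: "?X = (\<integral>\<^sup>+t2. ?B t2 \<partial>lborel)"
    by (rule lborel_pair.Fubini') measurable
  have inner: "?c2 x2 * (\<integral>\<^sup>+t2. ?B t2 \<partial>lborel) = (\<integral>\<^sup>+t2. \<integral>\<^sup>+x1. \<integral>\<^sup>+t1. \<integral>\<^sup>+y. ?c2 x2 * ?c1 x1 * ?H t1 t2 y \<partial>lborel \<partial>lborel \<partial>lborel \<partial>lborel)" for x2
  proof -
    have "?c2 x2 * (\<integral>\<^sup>+t2. ?B t2 \<partial>lborel) = (\<integral>\<^sup>+t2. ?c2 x2 * ?B t2 \<partial>lborel)" by (rule nn_integral_cmult[symmetric, OF Bm])
    also have "\<dots> = (\<integral>\<^sup>+t2. \<integral>\<^sup>+x1. ?c1 x1 * (?c2 x2 * ?B t2) \<partial>lborel \<partial>lborel)"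
      by (intro nn_integral_cong) (subst nn_integral_multc, simp_all add: e1)
    also have "\<dots> = (\<integral>\<^sup>+t2. \<integral>\<^sup>+x1. \<integral>\<^sup>+t1. \<integral>\<^sup>+y. ?c2 x2 * ?c1 x1 * ?H t1 t2 y \<partial>lborel \<partial>lborel \<partial>lborel \<partial>lborel)"
    proof (rule nn_integral_cong, rule nn_integral_cong)
      fix t2 :: real and x1 :: "real^'n"
      have "(\<integral>\<^sup>+t1. \<integral>\<^sup>+y. ?c2 x2 * ?c1 x1 * ?H t1 t2 y \<partial>lborel \<partial>lborel) = (\<integral>\<^sup>+t1. ?c2 x2 * ?c1 x1 * (\<integral>\<^sup>+y. ?H t1 t2 y \<partial>lborel) \<partial>lborel)"
        by (rule nn_integral_cong, rule nn_integral_cmult) measurable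
      also have "\<dots> = ?c2 x2 * ?c1 x1 * ?B t2" by (rule nn_integral_cmult) measurable
      finally show "?c1 x1 * (?c2 x2 * ?B t2) = (\<integral>\<^sup>+t1. \<integral>\<^sup>+y. ?c2 x2 * ?c1 x1 * ?H t1 t2 y \<partial>lborel \<partial>lborel)" by (simp only: mult_ac)
    qed
    finally show ?thesis .
  qed
  have "ennreal (1 / ?c) * ?X = (\<integral>\<^sup>+x2. ?c2 x2 * (\<integral>\<^sup>+t2. ?B t2 \<partial>lborel) \<partial>lborel)"
    unfolding XB e2[symmetric] by (rule nn_integral_multc[symmetric]) measurable
  also have "\<dots> = (\<integral>\<^sup>+x2. \<integral>\<^sup>+t2. \<integral>\<^sup>+x1. \<integral>\<^sup>+t1. \<integral>\<^sup>+y. ?c2 x2 * ?c1 x1 * ?H t1 t2 y \<partial>lborel \<partial>lborel \<partial>lborel \<partial>lborel \<partial>lborel)"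
    by (rule nn_integral_cong) (rule inner)
  also have "\<dots> \<le> carleson_coeff K lam1 lam2 I J"
    unfolding carleson_coeff_def IJ fst_conv snd_conv
  proof (intro nn_integral_mono)
    fix x2 :: "real^'m" and t2 :: real and x1 :: "real^'n" and t1 :: real and y :: "(real^'n) \<times> (real^'m)"
    let ?w1 = "(t1 / (t1 + infnorm (x1 - fst y))) powr ?p1" and ?w2 = "(t2 / (t2 + infnorm (x2 - snd y))) powr ?p2"
    let ?th = "(cmod (theta K t1 t2 (\<lambda>_. 1) y))\<^sup>2"
    show "?c2 x2 * ?c1 x1 * ?H t1 t2 y \<le> indicator ?Q2 x2 * ?i2 t2 * indicator ?Q1 x1 * ?i1 t1 *
       ennreal (?th * ?w1 * ?w2 / (t1 ^ CARD('n) * t2 ^ CARD('m)) / t1 / t2)"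
    proof (cases "x2 \<in> ?Q2 \<and> snd y \<in> ?Q2 \<and> x1 \<in> ?Q1 \<and> fst y \<in> ?Q1 \<and> t1 \<in> {l1 / 2<..<l1} \<and> t2 \<in> {l2 / 2<..<l2}")
      case True
      have t: "0 < t1" "0 < t2" using True l1 l2 by auto
      have "1 \<le> 3 powr ?p1 * ?w1" using True t lam by (intro weight_third[of _ c1 l1]) auto
      moreover have "1 \<le> 3 powr ?p2 * ?w2" using True t lam by (intro weight_third[of _ c2 l2]) auto
      ultimately have "1 * 1 \<le> (3 powr ?p1 * ?w1) * (3 powr ?p2 * ?w2)" by (intro mult_mono) auto
      then have w: "1 / ?c \<le> ?w1 * ?w2" by (simp add: field_simps)
      \<comment> \<open>\<open>t1 < l1\<close> turns the normalisation by the volume of the cube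
        into the power of \<open>t1\<close> that occurs in the coefficient.\<close>
      have p1: "1 / l1 ^ CARD('n) \<le> 1 / t1 ^ CARD('n)" using True t by (intro divide_left_mono power_mono) auto
      have p2: "1 / l2 ^ CARD('m) \<le> 1 / t2 ^ CARD('m)" using True t by (intro divide_left_mono power_mono) auto
      have "1 / ?c * (1 / l2 ^ CARD('m)) * (1 / l1 ^ CARD('n)) * (1 / (t1 * t2) * G (t1, t2, y)) \<le> ?w1 * ?w2 * (1 / t2 ^ CARD('m)) * (1 / t1 ^ CARD('n)) * (1 / (t1 * t2) * ?th)"
        using t l1 l2 G0 by (intro mult_mono w p1 p2 Gt order_refl) (auto intro!: mult_nonneg_nonneg)
      also have "\<dots> = ?th * ?w1 * ?w2 / (t1 ^ CARD('n) * t2 ^ CARD('m)) / t1 / t2" by (simp add: mult_ac)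
      finally have "ennreal (1 / ?c * (1 / l2 ^ CARD('m)) * (1 / l1 ^ CARD('n)) * (1 / (t1 * t2) * G (t1, t2, y))) \<le> ennreal (?th * ?w1 * ?w2 / (t1 ^ CARD('n) * t2 ^ CARD('m)) / t1 / t2)"
        by (rule ennreal_leI)
      moreover have "ennreal (1 / ?c * (1 / l2 ^ CARD('m)) * (1 / l1 ^ CARD('n)) * (1 / (t1 * t2) * G (t1, t2, y)))
        = ennreal (1 / ?c * (1 / l2 ^ CARD('m))) * ennreal (1 / l1 ^ CARD('n)) * ennreal (1 / (t1 * t2) * G (t1, t2, y))"
        using t l1 l2 G0 by (subst ennreal_mult; (subst ennreal_mult)?) (auto intro!: mult_nonneg_nonneg)
      ultimately show ?thesis using True by simp
    next
      case False
      then show ?thesis by (auto simp: indicator_def)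
    qed
  qed
  finally have "ennreal (1 / ?c) * ?X \<le> carleson_coeff K lam1 lam2 I J" .
  then have "ennreal ?c * (ennreal (1 / ?c) * ?X) \<le> ennreal ?c * carleson_coeff K lam1 lam2 I J" by (rule mult_left_mono) simp
  moreover have "ennreal ?c * (ennreal (1 / ?c) * ?X) = ?X"
    using cp by (simp add: mult.assoc[symmetric] ennreal_mult[symmetric])
  ultimately have "?X \<le> ennreal ?c * carleson_coeff K lam1 lam2 I J" by simp
  then show ?thesis by (simp add: IJ)
qed

text \<open>Whitney boxes are open in the scale, whereas the scales grouped by \<open>kk\<close>
  form half-open intervals. The difference consists of powers of 2, a countable set.\<close>

lemma AE_not_dyadic: "AE t in lborel. t \<notin> range (\<lambda>k::int. 2 powr real_of_int k)"
  by (rule AE_not_in) (rule countable_imp_null_set_lborel, simp)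

lemma kk_open:
  assumes "0 < t" "t \<notin> range (\<lambda>k::int. 2 powr real_of_int k)"
  shows "2 powr real_of_int (kk t) / 2 < t" "t < 2 powr real_of_int (kk t)"
proof -
  have "2 powr (real_of_int (kk t) - 1) = 2 powr real_of_int (kk t) / 2" by (simp add: powr_diff)
  then show "2 powr real_of_int (kk t) / 2 < t" using kk_bounds(1)[OF assms(1)] by simp
  have "t \<noteq> 2 powr real_of_int (kk t)" using assms(2) by auto
  then show "t < 2 powr real_of_int (kk t)" using kk_bounds(2)[OF assms(1)] by simp
qed

text \<open>A point \<open>(t1, t2, y)\<close> with \<open>y\<close> in
  \<open>S (kk t1) (kk t2)\<close> lies, for almost all parameters, in the Whitney box over the
  dyadic rectangle of these scales around \<open>y\<close>. By \<open>inv\<close> that rectangle is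
  contained in S at the same scales, hence in the union. So the integral is at most the sum of the
  masses of the boxes over all rectangles inside the union, and \<open>carleson_coeff_lower\<close>
  leads to Assumption 3.\<close>

lemma dyadic_rectangles_sum:
  fixes K :: "('n::finite, 'm::finite) kernel" and G :: "real \<times> real \<times> ((real^'n) \<times> (real^'m)) \<Rightarrow> real"
  assumes a3: "assumption3 A lam1 lam2 K"
    and G[measurable]: "G \<in> borel_measurable borel" and Gt: "\<And>t1 t2 y. 0 < t1 \<Longrightarrow> 0 < t2 \<Longrightarrow> G (t1, t2, y) \<le> (cmod (theta K t1 t2 (\<lambda>_. 1) y))\<^sup>2"
    and G0: "\<And>q. 0 \<le> G q" and lam: "0 \<le> lam1" "0 \<le> lam2"
    and S[measurable]: "\<And>k1 k2. S k1 k2 \<in> sets borel"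
    and inv: "\<And>k1 k2 y z. y \<in> S k1 k2 \<Longrightarrow> dcor k1 (fst z) = dcor k1 (fst y) \<Longrightarrow> dcor k2 (snd z) = dcor k2 (snd y) \<Longrightarrow> z \<in> S k1 k2"
    and fin: "emeasure lborel (\<Union>k1 k2. S k1 k2) < \<infinity>"
  shows "(\<integral>\<^sup>+t1. \<integral>\<^sup>+t2. \<integral>\<^sup>+y. indicator {0<..} t1 * indicator {0<..} t2 * ennreal (1 / (t1 * t2) * G (t1, t2, y))
          * indicator (S (kk t1) (kk t2)) y \<partial>lborel \<partial>lborel \<partial>lborel)
        \<le> ennreal (3 powr (real CARD('n) * lam1) * 3 powr (real CARD('m) * lam2) * \<bar>A\<bar>) * emeasure lborel (\<Union>k1 k2. S k1 k2)"
proof -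
  define \<Omega> where "\<Omega> = (\<Union>k1 k2. S k1 k2)"
  define R where "R = {(I, J). I \<in> dyadic_grid (0::real^'n) \<and> J \<in> dyadic_grid (0::real^'m) \<and> hcube (fst I) (snd I) \<times> hcube (fst J) (snd J) \<subseteq> \<Omega>}"
  let ?c = "3 powr (real CARD('n) * lam1) * 3 powr (real CARD('m) * lam2)"
  have \<Omega>: "\<Omega> \<in> sets lborel" unfolding \<Omega>_def by measurable
  have cube: "hcube (dcor k1 (fst y)) (2 powr real_of_int k1) \<times> hcube (dcor k2 (snd y)) (2 powr real_of_int k2) \<subseteq> \<Omega>" if "y \<in> S k1 k2" for y k1 k2
    using inv[OF that] unfolding \<Omega>_def by (auto simp: dcor_eq_cube[symmetric]) blast
  have mem: "y \<in> hcube (dcor k1 (fst y)) (2 powr real_of_int k1) \<times> hcube (dcor k2 (snd y)) (2 powr real_of_int k2)" for y :: "(real^'n) \<times> (real^'m)" and k1 k2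
    by (cases y) (simp add: dcor_eq_cube[symmetric])
  have sum: "(\<Sum>\<^sub>\<infinity>IJ\<in>R. carleson_coeff K lam1 lam2 (fst IJ) (snd IJ)) \<le> ennreal A * emeasure lborel \<Omega>"
  proof -
    have "\<forall>x\<in>\<Omega>. \<exists>I\<in>dyadic_grid (0::real^'n). \<exists>J\<in>dyadic_grid (0::real^'m). x \<in> hcube (fst I) (snd I) \<times> hcube (fst J) (snd J) \<and> hcube (fst I) (snd I) \<times> hcube (fst J) (snd J) \<subseteq> \<Omega>"
    proof
      fix x assume "x \<in> \<Omega>"
      then obtain k1 k2 where x: "x \<in> S k1 k2" unfolding \<Omega>_def by auto
      show "\<exists>I\<in>dyadic_grid (0::real^'n). \<exists>J\<in>dyadic_grid (0::real^'m). x \<in> hcube (fst I) (snd I) \<times> hcube (fst J) (snd J) \<and> hcube (fst I) (snd I) \<times> hcube (fst J) (snd J) \<subseteq> \<Omega>"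
        by (rule bexI[OF _ dyadic_cube_in_grid[of k1 "fst x"]], rule bexI[OF _ dyadic_cube_in_grid[of k2 "snd x"]]) (use cube[OF x] mem[of x k1 k2] in simp)
    qed
    then show ?thesis using a3 \<Omega> fin unfolding assumption3_def R_def \<Omega>_def[symmetric] by blast
  qed
  have cR: "countable R"
    by (rule countable_subset[of _ "dyadic_grid 0 \<times> dyadic_grid 0"]) (auto simp: R_def intro!: countable_SIGMA countable_dyadic_grid)
  let ?G = "\<lambda>t1 t2 y. ennreal (1 / (t1 * t2) * G (t1, t2, y))"
  let ?H = "\<lambda>IJ t1 t2 y. indicator {snd (fst IJ) / 2<..<snd (fst IJ)} t1 * indicator {snd (snd IJ) / 2<..<snd (snd IJ)} t2 * indicator (hcube (fst (fst IJ)) (snd (fst IJ))) (fst y) * indicator (hcube (fst (snd IJ)) (snd (snd IJ))) (snd y) * ?G t1 t2 y"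
  have Hm[measurable]: "(\<lambda>x. ?H IJ (T1 x) (T2 x) (Y x)) \<in> borel_measurable M"
    if [measurable]: "T1 \<in> borel_measurable M" "T2 \<in> borel_measurable M" "Y \<in> borel_measurable M" for IJ T1 T2 Y and M :: "'z measure"
    by measurable
  have "(\<integral>\<^sup>+t1. \<integral>\<^sup>+t2. \<integral>\<^sup>+y. indicator {0<..} t1 * indicator {0<..} t2 * ?G t1 t2 y * indicator (S (kk t1) (kk t2)) y \<partial>lborel \<partial>lborel \<partial>lborel)
    \<le> (\<integral>\<^sup>+t1. \<integral>\<^sup>+t2. \<integral>\<^sup>+y. \<integral>\<^sup>+IJ. ?H IJ t1 t2 y \<partial>count_space R \<partial>lborel \<partial>lborel \<partial>lborel)"
  proof (rule nn_integral_mono_AE, use AE_not_dyadic in eventually_elim, rule nn_integral_mono_AE, use AE_not_dyadic in eventually_elim, rule nn_integral_mono)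
    fix t1 t2 :: real and y :: "(real^'n) \<times> (real^'m)"
    assume n: "t1 \<notin> range (\<lambda>k::int. 2 powr real_of_int k)" "t2 \<notin> range (\<lambda>k::int. 2 powr real_of_int k)"
    show "indicator {0<..} t1 * indicator {0<..} t2 * ?G t1 t2 y * indicator (S (kk t1) (kk t2)) y \<le> (\<integral>\<^sup>+IJ. ?H IJ t1 t2 y \<partial>count_space R)"
    proof (cases "0 < t1 \<and> 0 < t2 \<and> y \<in> S (kk t1) (kk t2)")
      case True
      let ?r = "((dcor (kk t1) (fst y), 2 powr real_of_int (kk t1)), (dcor (kk t2) (snd y), 2 powr real_of_int (kk t2)))"
      have r: "?r \<in> R" unfolding R_def using cube[of y "kk t1" "kk t2"] True by (simp add: dyadic_cube_in_grid)
      have "indicator {0<..} t1 * indicator {0<..} t2 * ?G t1 t2 y * indicator (S (kk t1) (kk t2)) y = ?H ?r t1 t2 y"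
        using True kk_open[of t1] kk_open[of t2] n mem[of y "kk t1" "kk t2"] by (cases y) simp
      also have "\<dots> \<le> (\<integral>\<^sup>+IJ. ?H IJ t1 t2 y \<partial>count_space R)" by (rule nn_integral_ge_point[OF r])
      finally show ?thesis .
    qed auto
  qed
  also have "\<dots> = (\<integral>\<^sup>+t1. \<integral>\<^sup>+t2. \<integral>\<^sup>+IJ. \<integral>\<^sup>+y. ?H IJ t1 t2 y \<partial>lborel \<partial>count_space R \<partial>lborel \<partial>lborel)"
    by (intro nn_integral_cong nn_integral_count_space_nn_integral cR) measurable
  also have "\<dots> = (\<integral>\<^sup>+t1. \<integral>\<^sup>+IJ. \<integral>\<^sup>+t2. \<integral>\<^sup>+y. ?H IJ t1 t2 y \<partial>lborel \<partial>lborel \<partial>count_space R \<partial>lborel)"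
    by (intro nn_integral_cong nn_integral_count_space_nn_integral cR) measurable
  also have "\<dots> = (\<integral>\<^sup>+IJ. \<integral>\<^sup>+t1. \<integral>\<^sup>+t2. \<integral>\<^sup>+y. ?H IJ t1 t2 y \<partial>lborel \<partial>lborel \<partial>lborel \<partial>count_space R)"
    by (intro nn_integral_count_space_nn_integral cR) measurable
  also have "\<dots> \<le> (\<integral>\<^sup>+IJ. ennreal ?c * carleson_coeff K lam1 lam2 (fst IJ) (snd IJ) \<partial>count_space R)"
  proof (rule nn_integral_mono)
    fix IJ assume "IJ \<in> space (count_space R)"
    then have pos: "0 < snd (fst IJ)" "0 < snd (snd IJ)" using dyadic_grid_pos by (auto simp: R_def)
    show "(\<integral>\<^sup>+t1. \<integral>\<^sup>+t2. \<integral>\<^sup>+y. ?H IJ t1 t2 y \<partial>lborel \<partial>lborel \<partial>lborel) \<le> ennreal ?c * carleson_coeff K lam1 lam2 (fst IJ) (snd IJ)"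
      by (rule carleson_coeff_lower[OF G Gt G0 pos lam])
  qed
  also have "\<dots> = ennreal ?c * (\<integral>\<^sup>+IJ. carleson_coeff K lam1 lam2 (fst IJ) (snd IJ) \<partial>count_space R)"
    by (rule nn_integral_cmult) simp
  also have "\<dots> \<le> ennreal ?c * (ennreal A * emeasure lborel \<Omega>)"
    by (intro mult_left_mono order_trans[OF nn_integral_le_infsum[OF cR] sum]) simp
  also have "\<dots> \<le> ennreal ?c * (ennreal \<bar>A\<bar> * emeasure lborel \<Omega>)"
    by (intro mult_left_mono mult_right_mono ennreal_leI) auto
  also have "\<dots> = ennreal (?c * \<bar>A\<bar>) * emeasure lborel \<Omega>"
    by (simp add: ennreal_mult mult.assoc)
  finally show ?thesis unfolding \<Omega>_def .
qed

text \<open>One constant has to serve all conditions of \<open>bi_parameter\<close>: it must be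
  positive whatever the sign of \<open>A\<close>, dominate \<open>A\<close>, and have a square that
  absorbs the factors \<open>2 powr p\<close> of \<open>carleson_from_testing\<close> in both
  variables.\<close>

definition aconst :: "nat \<Rightarrow> nat \<Rightarrow> real \<Rightarrow> real \<Rightarrow> real \<Rightarrow> real" where
  "aconst n m A lam1 lam2 = (\<bar>A\<bar> + 1) * 2 powr (real n * lam1) * 2 powr (real m * lam2)"

definition dconstant :: "nat \<Rightarrow> nat \<Rightarrow> real \<Rightarrow> real \<Rightarrow> real \<Rightarrow> real" where
  "dconstant n m A lam1 lam2 = 3 powr (real n * lam1) * 3 powr (real m * lam2) * \<bar>A\<bar>"

lemma aconst_bounds:
  assumes "0 \<le> lam1" "0 \<le> lam2"
  shows "0 < aconst n m A lam1 lam2" "A \<le> aconst n m A lam1 lam2"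
    "2 powr (real n * lam1) * (A * W)\<^sup>2 \<le> (aconst n m A lam1 lam2 * W)\<^sup>2"
    "2 powr (real m * lam2) * (A * W)\<^sup>2 \<le> (aconst n m A lam1 lam2 * W)\<^sup>2"
proof -
  let ?x = "2 powr (real n * lam1)" and ?y = "2 powr (real m * lam2)"
  have x: "1 \<le> ?x" and y: "1 \<le> ?y" using assms by (auto intro!: ge_one_powr_ge_zero)
  have xy: "1 \<le> ?x * ?y" using mult_mono[OF x y] by simp
  show "0 < aconst n m A lam1 lam2" by (simp add: aconst_def)
  have "A \<le> (\<bar>A\<bar> + 1) * 1" by simp
  also have "\<dots> \<le> (\<bar>A\<bar> + 1) * (?x * ?y)" using xy by (intro mult_left_mono) auto
  finally show "A \<le> aconst n m A lam1 lam2" by (simp add: aconst_def mult.assoc)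
  have A2: "A\<^sup>2 \<le> (\<bar>A\<bar> + 1)\<^sup>2" using power_mono[of "\<bar>A\<bar>" "\<bar>A\<bar> + 1" 2] by simp
  have gen: "z * (A * W)\<^sup>2 \<le> (aconst n m A lam1 lam2 * W)\<^sup>2" if z: "0 \<le> z" "z \<le> (?x * ?y)\<^sup>2" for z
  proof -
    have "z * A\<^sup>2 \<le> (?x * ?y)\<^sup>2 * (\<bar>A\<bar> + 1)\<^sup>2" using z A2 by (intro mult_mono) auto
    then have "z * A\<^sup>2 * W\<^sup>2 \<le> (?x * ?y)\<^sup>2 * (\<bar>A\<bar> + 1)\<^sup>2 * W\<^sup>2" by (rule mult_right_mono) simp
    then show ?thesis by (simp add: aconst_def power_mult_distrib mult_ac)
  qed
  have sq: "?x * ?y \<le> (?x * ?y)\<^sup>2" using mult_left_mono[OF xy, of "?x * ?y"] by (simp add: power2_eq_square)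
  have xl: "?x \<le> ?x * ?y" and yl: "?y \<le> ?x * ?y" using x y mult_left_mono[OF y, of ?x] mult_right_mono[OF x, of ?y] by auto
  show "?x * (A * W)\<^sup>2 \<le> (aconst n m A lam1 lam2 * W)\<^sup>2" "?y * (A * W)\<^sup>2 \<le> (aconst n m A lam1 lam2 * W)\<^sup>2"
    by (rule gen[OF _ order_trans[OF xl sq]], simp) (rule gen[OF _ order_trans[OF yl sq]], simp)
qed

lemma trunc_integrable:
  fixes K :: "('n::finite, 'm::finite) kernel"
  assumes K: "kernel_measurable K" and a1: "assumption1 A \<alpha> \<beta> K" and ab: "0 < \<alpha>" "0 < \<beta>" and t: "0 < t1" "0 < t2"
  shows "integrable lborel (\<lambda>z1. trunc K (t1, t2, (y1, y2), (z1, z2)))" (is ?A)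
    "integrable lborel (\<lambda>z2. trunc K (t1, t2, (y1, y2), (z1, z2)))" (is ?B)
    "integrable lborel (\<lambda>z. trunc K (t1, t2, y, z))" (is ?C)
proof -
  have m[measurable]: "trunc K \<in> borel_measurable borel" using K by (simp add: kernel_measurable_def trunc_def)
  have b: "cmod (trunc K (t1, t2, (y1, y2), (z1, z2))) \<le> A * kap \<alpha> t1 (y1 - z1) * kap \<beta> t2 (y2 - z2)" for y1 y2 z1 z2
    using a1 t unfolding assumption1_def kap_def trunc_def by simp
  show ?A
  proof (rule Bochner_Integration.integrable_bound)
    show "integrable lborel (\<lambda>z1. A * kap \<beta> t2 (y2 - z2) * kap \<alpha> t1 (y1 - z1))" by (intro integrable_mult_right kap_int t ab)
    show "AE z1 in lborel. norm (trunc K (t1, t2, (y1, y2), (z1, z2))) \<le> norm (A * kap \<beta> t2 (y2 - z2) * kap \<alpha> t1 (y1 - z1))"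
      using order_trans[OF b abs_ge_self] by (intro AE_I2) (simp add: mult_ac)
  qed measurable
  show ?B
  proof (rule Bochner_Integration.integrable_bound)
    show "integrable lborel (\<lambda>z2. A * kap \<alpha> t1 (y1 - z1) * kap \<beta> t2 (y2 - z2))" by (intro integrable_mult_right kap_int t ab)
    show "AE z2 in lborel. norm (trunc K (t1, t2, (y1, y2), (z1, z2))) \<le> norm (A * kap \<alpha> t1 (y1 - z1) * kap \<beta> t2 (y2 - z2))"
      using order_trans[OF b abs_ge_self] by (intro AE_I2) simp
  qed measurable
  obtain y1 y2 where y: "y = (y1, y2)" by (cases y)
  show ?C
  proof (rule integrableI_bounded)
    have "(\<integral>\<^sup>+z. ennreal (norm (trunc K (t1, t2, y, z))) \<partial>lborel) = (\<integral>\<^sup>+z1. \<integral>\<^sup>+z2. ennreal (norm (trunc K (t1, t2, (y1, y2), (z1, z2)))) \<partial>lborel \<partial>lborel)"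
      unfolding y lborel_prod[symmetric] by (rule lborel.nn_integral_fst[symmetric]) (simp add: lborel_prod)
    also have "\<dots> \<le> (\<integral>\<^sup>+z1. \<integral>\<^sup>+z2. ennreal \<bar>A\<bar> * ennreal (kap \<alpha> t1 (y1 - z1)) * ennreal (kap \<beta> t2 (y2 - z2)) \<partial>lborel \<partial>lborel)"
    proof (intro nn_integral_mono)
      fix z1 z2
      have "norm (trunc K (t1, t2, (y1, y2), (z1, z2))) \<le> \<bar>A\<bar> * kap \<alpha> t1 (y1 - z1) * kap \<beta> t2 (y2 - z2)"
        by (rule order_trans[OF b]) (intro mult_right_mono, auto simp: kap_nonneg)
      then show "ennreal (norm (trunc K (t1, t2, (y1, y2), (z1, z2)))) \<le> ennreal \<bar>A\<bar> * ennreal (kap \<alpha> t1 (y1 - z1)) * ennreal (kap \<beta> t2 (y2 - z2))"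
        by (simp add: ennreal_mult[symmetric] kap_nonneg ennreal_leI)
    qed
    also have "\<dots> = ennreal \<bar>A\<bar> * (\<integral>\<^sup>+z1. ennreal (kap \<alpha> t1 (y1 - z1)) \<partial>lborel) * (\<integral>\<^sup>+z2. ennreal (kap \<beta> t2 (y2 - z2)) \<partial>lborel)"
      by (simp add: nn_integral_cmult nn_integral_multc)
    also have "\<dots> < \<infinity>"
      using nn_integral_kap_shift(2)[OF t(1) ab(1), of y1] nn_integral_kap_shift(2)[OF t(2) ab(2), of y2]
      by (auto simp: ennreal_mult_less_top intro: le_less_trans)
    finally show "(\<integral>\<^sup>+z. ennreal (norm (trunc K (t1, t2, y, z))) \<partial>lborel) < \<infinity>" .
  qed measurable
qed

text \<open>\<open>r\<close> is the real or the imaginary part. It is linear and does not increase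
  moduli, so the pointwise estimates pass to it at once, and it commutes with the integrals in the
  testing and Carleson conditions.\<close>

lemma bi_parameter_of_assumptions:
  fixes K :: "('n::finite, 'm::finite) kernel"
  assumes K: "kernel_measurable K" and a1: "assumption1 A \<alpha> \<beta> K" and a2: "assumption2 A \<alpha> \<beta> lam1 lam2 K" and a3: "assumption3 A lam1 lam2 K"
    and ab: "0 < \<alpha>" "0 < \<beta>" and lam: "0 \<le> lam1" "0 \<le> lam2"
    and r: "bounded_linear r" "\<And>z. \<bar>r z\<bar> \<le> cmod z"
  shows "bi_parameter (\<lambda>q. r (trunc K q)) (aconst CARD('n) CARD('m) A lam1 lam2) \<alpha> \<beta> (dconstant CARD('n) CARD('m) A lam1 lam2)"
proof (rule bi_parameter.intro)
  let ?A = "aconst CARD('n) CARD('m) A lam1 lam2"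
  note AA = aconst_bounds[OF lam, where n="CARD('n)" and m="CARD('m)" and A=A]
  have m[measurable]: "trunc K \<in> borel_measurable borel" using K by (simp add: kernel_measurable_def trunc_def)
  have rm[measurable]: "r \<in> borel_measurable borel"
    using r(1) by (intro borel_measurable_continuous_onI linear_continuous_on)
  have rd: "r z - r w = r (z - w)" "r z + r w = r (z + w)" for z w using linear_simps(1,2)[OF r(1)] by auto
  have mono: "A * X * Y \<le> ?A * X * Y" if "0 \<le> X" "0 \<le> Y" for X Y
    using AA(2) that by (intro mult_right_mono) auto
  show "(\<lambda>q. r (trunc K q)) \<in> borel_measurable borel" by measurable
  show "0 < ?A" by (rule AA(1))
  show "0 < \<alpha>" "0 < \<beta>" by (rule ab)+
  show "0 \<le> dconstant CARD('n) CARD('m) A lam1 lam2" by (simp add: dconstant_def)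
  show "\<bar>r (trunc K (t1, t2, (y1, y2), (z1, z2)))\<bar> \<le> ?A * kap \<alpha> t1 (y1 - z1) * kap \<beta> t2 (y2 - z2)"
    if "0 < t1" "0 < t2" for t1 t2 y1 y2 z1 z2
  proof -
    have "\<bar>r (trunc K (t1, t2, (y1, y2), (z1, z2)))\<bar> \<le> cmod (K t1 t2 (y1, y2) (z1, z2))" using r(2) that by (simp add: trunc_eq)
    also have "\<dots> \<le> A * kap \<alpha> t1 (y1 - z1) * kap \<beta> t2 (y2 - z2)" using a1 that unfolding assumption1_def kap_def by blast
    also have "\<dots> \<le> ?A * kap \<alpha> t1 (y1 - z1) * kap \<beta> t2 (y2 - z2)" by (intro mono kap_nonneg)
    finally show ?thesis .
  qed
  show "\<bar>r (trunc K (t1, t2, (y1, y2), (z1, z2))) - r (trunc K (t1, t2, (y1, y2), (z1, z2'))) - r (trunc K (t1, t2, (y1, y2), (z1', z2))) + r (trunc K (t1, t2, (y1, y2), (z1', z2')))\<bar>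
        \<le> ?A * ((infnorm (z1 - z1') / t1) powr \<alpha> * kap \<alpha> t1 (y1 - z1)) * ((infnorm (z2 - z2') / t2) powr \<beta> * kap \<beta> t2 (y2 - z2))"
    if t: "0 < t1" "0 < t2" and d: "infnorm (z1 - z1') < t1 / 2" "infnorm (z2 - z2') < t2 / 2" for t1 t2 y1 y2 z1 z2 z1' z2'
  proof -
    have "\<bar>r (trunc K (t1, t2, (y1, y2), (z1, z2))) - r (trunc K (t1, t2, (y1, y2), (z1, z2'))) - r (trunc K (t1, t2, (y1, y2), (z1', z2))) + r (trunc K (t1, t2, (y1, y2), (z1', z2')))\<bar>
      \<le> cmod (K t1 t2 (y1, y2) (z1, z2) - K t1 t2 (y1, y2) (z1, z2') - K t1 t2 (y1, y2) (z1', z2) + K t1 t2 (y1, y2) (z1', z2'))"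
      unfolding rd using r(2) t by (simp add: trunc_eq)
    also have "\<dots> \<le> A * ((infnorm (z1 - z1') / t1) powr \<alpha> * kap \<alpha> t1 (y1 - z1)) * ((infnorm (z2 - z2') / t2) powr \<beta> * kap \<beta> t2 (y2 - z2))"
      using a1 t d unfolding assumption1_def holder_kap[OF t(1), symmetric] holder_kap[OF t(2), symmetric] by blast
    also have "\<dots> \<le> ?A * ((infnorm (z1 - z1') / t1) powr \<alpha> * kap \<alpha> t1 (y1 - z1)) * ((infnorm (z2 - z2') / t2) powr \<beta> * kap \<beta> t2 (y2 - z2))"
      by (intro mono mult_nonneg_nonneg kap_nonneg) auto
    finally show ?thesis .
  qed
  show "\<bar>r (trunc K (t1, t2, (y1, y2), (z1, z2))) - r (trunc K (t1, t2, (y1, y2), (z1, z2')))\<bar>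
        \<le> ?A * kap \<alpha> t1 (y1 - z1) * ((infnorm (z2 - z2') / t2) powr \<beta> * kap \<beta> t2 (y2 - z2))"
    if t: "0 < t1" "0 < t2" and d: "infnorm (z2 - z2') < t2 / 2" for t1 t2 y1 y2 z1 z2 z2'
  proof -
    have "\<bar>r (trunc K (t1, t2, (y1, y2), (z1, z2))) - r (trunc K (t1, t2, (y1, y2), (z1, z2')))\<bar> \<le> cmod (K t1 t2 (y1, y2) (z1, z2) - K t1 t2 (y1, y2) (z1, z2'))"
      unfolding rd using r(2) t by (simp add: trunc_eq)
    also have "\<dots> \<le> A * kap \<alpha> t1 (y1 - z1) * ((infnorm (z2 - z2') / t2) powr \<beta> * kap \<beta> t2 (y2 - z2))"
      using a1 t d unfolding assumption1_def holder_kap[OF t(2), symmetric] kap_def[of \<alpha>] by blast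
    also have "\<dots> \<le> ?A * kap \<alpha> t1 (y1 - z1) * ((infnorm (z2 - z2') / t2) powr \<beta> * kap \<beta> t2 (y2 - z2))"
      by (intro mono mult_nonneg_nonneg kap_nonneg) auto
    finally show ?thesis .
  qed
  show "\<bar>r (trunc K (t1, t2, (y1, y2), (z1, z2))) - r (trunc K (t1, t2, (y1, y2), (z1', z2)))\<bar>
        \<le> ?A * ((infnorm (z1 - z1') / t1) powr \<alpha> * kap \<alpha> t1 (y1 - z1)) * kap \<beta> t2 (y2 - z2)"
    if t: "0 < t1" "0 < t2" and d: "infnorm (z1 - z1') < t1 / 2" for t1 t2 y1 y2 z1 z2 z1'
  proof -
    have "\<bar>r (trunc K (t1, t2, (y1, y2), (z1, z2))) - r (trunc K (t1, t2, (y1, y2), (z1', z2)))\<bar> \<le> cmod (K t1 t2 (y1, y2) (z1, z2) - K t1 t2 (y1, y2) (z1', z2))"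
      unfolding rd using r(2) t by (simp add: trunc_eq)
    also have "\<dots> \<le> A * ((infnorm (z1 - z1') / t1) powr \<alpha> * kap \<alpha> t1 (y1 - z1)) * kap \<beta> t2 (y2 - z2)"
      using a1 t d unfolding assumption1_def holder_kap[OF t(1), symmetric] kap_def[of \<beta>] by blast
    also have "\<dots> \<le> ?A * ((infnorm (z1 - z1') / t1) powr \<alpha> * kap \<alpha> t1 (y1 - z1)) * kap \<beta> t2 (y2 - z2)"
      by (intro mono mult_nonneg_nonneg kap_nonneg) auto
    finally show ?thesis .
  qed
  note int = trunc_integrable[OF K a1 ab]
  have p1: "0 \<le> real CARD('n) * lam1" and p2: "0 \<le> real CARD('m) * lam2" using lam by auto
  show "(\<integral>\<^sup>+y1. indicator {y. dcor k y = dcor k x} y1 * (\<integral>\<^sup>+t1. indicator {0<..2 powr real_of_int k} t1 *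
          (ennreal (1 / t1) * ennreal ((\<integral>z1. indicator {z. dcor k z = dcor k x} z1 * r (trunc K (t1, t2, (y1, y2), (z1, z2))) \<partial>lborel)\<^sup>2)) \<partial>lborel) \<partial>lborel)
        \<le> ennreal ((?A * kap \<beta> t2 (y2 - z2))\<^sup>2 * (2 powr real_of_int k) ^ CARD('n))"
    if t2: "0 < t2" for k x t2 y2 z2
  proof -
    define L :: "real \<times> (real^'n) \<times> (real^'n) \<Rightarrow> complex" where "L = (\<lambda>(t1, u, z1). trunc K (t1, t2, (u, y2), (z1, z2)))"
    have Le: "L (t, u, z) = trunc K (t, t2, (u, y2), (z, z2))" for t u z by (simp add: L_def)
    have mL: "L \<in> borel_measurable borel" unfolding L_def borel_prod[symmetric] by measurable
    have iL: "integrable lborel (\<lambda>z. L (t, u, z))" if "0 < t" for t u unfolding Le by (rule int(1)[OF that t2])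
    have eL: "L (t, u, z) = K t t2 (u, y2) (z, z2)" if "0 < t" for t u z by (simp add: Le trunc_eq[OF that t2])
    have h: "\<forall>(a::(real^'n)) l (x2::(real^'m)) y2 z2 z2' t2. 0 < l \<longrightarrow> 0 < t2 \<longrightarrow>
          ensqrt (\<integral>\<^sup>+ x1. \<integral>\<^sup>+ t1. \<integral>\<^sup>+ y1. indicator (hcube a l) x1 * indicator {0<..<l} t1 *
          ennreal ((cmod (\<integral>z1\<in>hcube a l. K t1 t2 (x1 - y1, x2 - y2) (z1, z2) \<partial>lborel))\<^sup>2
                   * (t1 / (t1 + infnorm y1)) powr (real CARD('n) * lam1) / t1 ^ (CARD('n) + 1)) \<partial>lborel \<partial>lborel \<partial>lborel)
          \<le> ennreal (A * sqrt (measure lborel (hcube a l)) * kap \<beta> t2 (x2 - y2 - z2))"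
      using a2 unfolding assumption2_def kap_def by blast
    have V: "ensqrt (\<integral>\<^sup>+ xa. \<integral>\<^sup>+ t. \<integral>\<^sup>+ y. indicator (hcube (dcor k x) (2 powr real_of_int k)) xa * indicator {0<..<2 powr real_of_int k} t *
          ennreal ((cmod (\<integral>z\<in>hcube (dcor k x) (2 powr real_of_int k). K t t2 (xa - y, y2) (z, z2) \<partial>lborel))\<^sup>2 * (t / (t + infnorm y)) powr (real CARD('n) * lam1) / t ^ (CARD('n) + 1)) \<partial>lborel \<partial>lborel \<partial>lborel)
          \<le> ennreal (A * sqrt (measure lborel (hcube (dcor k x) (2 powr real_of_int k))) * kap \<beta> t2 (y2 - z2))"
      using h[rule_format, of "2 powr real_of_int k" t2 "dcor k x" y2 0 z2] t2 by simp
    have "(\<integral>\<^sup>+y1. indicator {y. dcor k y = dcor k x} y1 * (\<integral>\<^sup>+t1. indicator {0<..2 powr real_of_int k} t1 *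
          (ennreal (1 / t1) * ennreal ((\<integral>z1. indicator {z. dcor k z = dcor k x} z1 * r (trunc K (t1, t2, (y1, y2), (z1, z2))) \<partial>lborel)\<^sup>2)) \<partial>lborel) \<partial>lborel)
      \<le> ennreal (2 powr (real CARD('n) * lam1) * (A * kap \<beta> t2 (y2 - z2))\<^sup>2 * (2 powr real_of_int k) ^ CARD('n))"
      using carleson_from_testing[OF mL iL eL r _ p1 V] unfolding dcor_cube Le by simp
    also have "\<dots> \<le> ennreal ((?A * kap \<beta> t2 (y2 - z2))\<^sup>2 * (2 powr real_of_int k) ^ CARD('n))"
      by (intro ennreal_leI mult_right_mono AA(3)) simp
    finally show ?thesis .
  qed
  show "(\<integral>\<^sup>+y1. indicator {y. dcor k y = dcor k x} y1 * (\<integral>\<^sup>+t1. indicator {0<..2 powr real_of_int k} t1 *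
          (ennreal (1 / t1) * ennreal ((\<integral>z1. indicator {z. dcor k z = dcor k x} z1 * (r (trunc K (t1, t2, (y1, y2), (z1, z2))) - r (trunc K (t1, t2, (y1, y2), (z1, z2')))) \<partial>lborel)\<^sup>2)) \<partial>lborel) \<partial>lborel)
        \<le> ennreal ((?A * ((infnorm (z2 - z2') / t2) powr \<beta> * kap \<beta> t2 (y2 - z2)))\<^sup>2 * (2 powr real_of_int k) ^ CARD('n))"
    if t2: "0 < t2" and d: "infnorm (z2 - z2') < t2 / 2" for k x t2 y2 z2 z2'
  proof -
    define L :: "real \<times> (real^'n) \<times> (real^'n) \<Rightarrow> complex" where "L = (\<lambda>(t1, u, z1). trunc K (t1, t2, (u, y2), (z1, z2)) - trunc K (t1, t2, (u, y2), (z1, z2')))"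
    have Le: "L (t, u, z) = trunc K (t, t2, (u, y2), (z, z2)) - trunc K (t, t2, (u, y2), (z, z2'))" for t u z by (simp add: L_def)
    have mL: "L \<in> borel_measurable borel" unfolding L_def borel_prod[symmetric] by measurable
    have iL: "integrable lborel (\<lambda>z. L (t, u, z))" if "0 < t" for t u unfolding Le by (intro Bochner_Integration.integrable_diff int(1)[OF that t2])
    have eL: "L (t, u, z) = K t t2 (u, y2) (z, z2) - K t t2 (u, y2) (z, z2')" if "0 < t" for t u z by (simp add: Le trunc_eq[OF that t2])
    have h: "\<forall>(a::(real^'n)) l (x2::(real^'m)) y2 z2 z2' t2. 0 < l \<longrightarrow> 0 < t2 \<longrightarrow> infnorm (z2 - z2') < t2 / 2 \<longrightarrow>
          ensqrt (\<integral>\<^sup>+ x1. \<integral>\<^sup>+ t1. \<integral>\<^sup>+ y1. indicator (hcube a l) x1 * indicator {0<..<l} t1 *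
          ennreal ((cmod (\<integral>z1\<in>hcube a l. (K t1 t2 (x1 - y1, x2 - y2) (z1, z2) - K t1 t2 (x1 - y1, x2 - y2) (z1, z2')) \<partial>lborel))\<^sup>2
                   * (t1 / (t1 + infnorm y1)) powr (real CARD('n) * lam1) / t1 ^ (CARD('n) + 1)) \<partial>lborel \<partial>lborel \<partial>lborel)
          \<le> ennreal (A * sqrt (measure lborel (hcube a l)) * (infnorm (z2 - z2') powr \<beta> / (t2 + infnorm (x2 - y2 - z2)) powr (real CARD('m) + \<beta>)))"
      using a2 unfolding assumption2_def by blast
    have V: "ensqrt (\<integral>\<^sup>+ xa. \<integral>\<^sup>+ t. \<integral>\<^sup>+ y. indicator (hcube (dcor k x) (2 powr real_of_int k)) xa * indicator {0<..<2 powr real_of_int k} t *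
          ennreal ((cmod (\<integral>z\<in>hcube (dcor k x) (2 powr real_of_int k). (K t t2 (xa - y, y2) (z, z2) - K t t2 (xa - y, y2) (z, z2')) \<partial>lborel))\<^sup>2 * (t / (t + infnorm y)) powr (real CARD('n) * lam1) / t ^ (CARD('n) + 1)) \<partial>lborel \<partial>lborel \<partial>lborel)
          \<le> ennreal (A * sqrt (measure lborel (hcube (dcor k x) (2 powr real_of_int k))) * ((infnorm (z2 - z2') / t2) powr \<beta> * kap \<beta> t2 (y2 - z2)))"
      using h[rule_format, of "2 powr real_of_int k" t2 z2 z2' "dcor k x" y2 0] t2 d by (simp add: holder_kap)
    have "(\<integral>\<^sup>+y1. indicator {y. dcor k y = dcor k x} y1 * (\<integral>\<^sup>+t1. indicator {0<..2 powr real_of_int k} t1 *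
          (ennreal (1 / t1) * ennreal ((\<integral>z1. indicator {z. dcor k z = dcor k x} z1 * (r (trunc K (t1, t2, (y1, y2), (z1, z2))) - r (trunc K (t1, t2, (y1, y2), (z1, z2')))) \<partial>lborel)\<^sup>2)) \<partial>lborel) \<partial>lborel)
      \<le> ennreal (2 powr (real CARD('n) * lam1) * (A * ((infnorm (z2 - z2') / t2) powr \<beta> * kap \<beta> t2 (y2 - z2)))\<^sup>2 * (2 powr real_of_int k) ^ CARD('n))"
      using carleson_from_testing[OF mL iL eL r _ p1 V] unfolding dcor_cube rd Le by simp
    also have "\<dots> \<le> ennreal ((?A * ((infnorm (z2 - z2') / t2) powr \<beta> * kap \<beta> t2 (y2 - z2)))\<^sup>2 * (2 powr real_of_int k) ^ CARD('n))"
      by (intro ennreal_leI mult_right_mono AA(3)) simp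
    finally show ?thesis .
  qed
  show "(\<integral>\<^sup>+y2. indicator {y. dcor k y = dcor k x} y2 * (\<integral>\<^sup>+t2. indicator {0<..2 powr real_of_int k} t2 *
          (ennreal (1 / t2) * ennreal ((\<integral>z2. indicator {z. dcor k z = dcor k x} z2 * r (trunc K (t1, t2, (y1, y2), (z1, z2))) \<partial>lborel)\<^sup>2)) \<partial>lborel) \<partial>lborel)
        \<le> ennreal ((?A * kap \<alpha> t1 (y1 - z1))\<^sup>2 * (2 powr real_of_int k) ^ CARD('m))"
    if t1: "0 < t1" for k x t1 y1 z1
  proof -
    define L :: "real \<times> (real^'m) \<times> (real^'m) \<Rightarrow> complex" where "L = (\<lambda>(t2, u, z2). trunc K (t1, t2, (y1, u), (z1, z2)))"
    have Le: "L (t, u, z) = trunc K (t1, t, (y1, u), (z1, z))" for t u z by (simp add: L_def)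
    have mL: "L \<in> borel_measurable borel" unfolding L_def borel_prod[symmetric] by measurable
    have iL: "integrable lborel (\<lambda>z. L (t, u, z))" if "0 < t" for t u unfolding Le by (rule int(2)[OF t1 that])
    have eL: "L (t, u, z) = K t1 t (y1, u) (z1, z)" if "0 < t" for t u z by (simp add: Le trunc_eq[OF t1 that])
    have h: "\<forall>(b::(real^'m)) l (x1::(real^'n)) y1 z1 z1' t1. 0 < l \<longrightarrow> 0 < t1 \<longrightarrow>
          ensqrt (\<integral>\<^sup>+ x2. \<integral>\<^sup>+ t2. \<integral>\<^sup>+ y2. indicator (hcube b l) x2 * indicator {0<..<l} t2 *
          ennreal ((cmod (\<integral>z2\<in>hcube b l. K t1 t2 (x1 - y1, x2 - y2) (z1, z2) \<partial>lborel))\<^sup>2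
                   * (t2 / (t2 + infnorm y2)) powr (real CARD('m) * lam2) / t2 ^ (CARD('m) + 1)) \<partial>lborel \<partial>lborel \<partial>lborel)
          \<le> ennreal (A * sqrt (measure lborel (hcube b l)) * kap \<alpha> t1 (x1 - y1 - z1))"
      using a2 unfolding assumption2_def kap_def by blast
    have V: "ensqrt (\<integral>\<^sup>+ xa. \<integral>\<^sup>+ t. \<integral>\<^sup>+ y. indicator (hcube (dcor k x) (2 powr real_of_int k)) xa * indicator {0<..<2 powr real_of_int k} t *
          ennreal ((cmod (\<integral>z\<in>hcube (dcor k x) (2 powr real_of_int k). K t1 t (y1, xa - y) (z1, z) \<partial>lborel))\<^sup>2 * (t / (t + infnorm y)) powr (real CARD('m) * lam2) / t ^ (CARD('m) + 1)) \<partial>lborel \<partial>lborel \<partial>lborel)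
          \<le> ennreal (A * sqrt (measure lborel (hcube (dcor k x) (2 powr real_of_int k))) * kap \<alpha> t1 (y1 - z1))"
      using h[rule_format, of "2 powr real_of_int k" t1 "dcor k x" y1 0 z1] t1 by simp
    have "(\<integral>\<^sup>+y2. indicator {y. dcor k y = dcor k x} y2 * (\<integral>\<^sup>+t2. indicator {0<..2 powr real_of_int k} t2 *
          (ennreal (1 / t2) * ennreal ((\<integral>z2. indicator {z. dcor k z = dcor k x} z2 * r (trunc K (t1, t2, (y1, y2), (z1, z2))) \<partial>lborel)\<^sup>2)) \<partial>lborel) \<partial>lborel)
      \<le> ennreal (2 powr (real CARD('m) * lam2) * (A * kap \<alpha> t1 (y1 - z1))\<^sup>2 * (2 powr real_of_int k) ^ CARD('m))"
      using carleson_from_testing[OF mL iL eL r _ p2 V] unfolding dcor_cube Le by simp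
    also have "\<dots> \<le> ennreal ((?A * kap \<alpha> t1 (y1 - z1))\<^sup>2 * (2 powr real_of_int k) ^ CARD('m))"
      by (intro ennreal_leI mult_right_mono AA(4)) simp
    finally show ?thesis .
  qed
  show "(\<integral>\<^sup>+y2. indicator {y. dcor k y = dcor k x} y2 * (\<integral>\<^sup>+t2. indicator {0<..2 powr real_of_int k} t2 *
          (ennreal (1 / t2) * ennreal ((\<integral>z2. indicator {z. dcor k z = dcor k x} z2 * (r (trunc K (t1, t2, (y1, y2), (z1, z2))) - r (trunc K (t1, t2, (y1, y2), (z1', z2)))) \<partial>lborel)\<^sup>2)) \<partial>lborel) \<partial>lborel)
        \<le> ennreal ((?A * ((infnorm (z1 - z1') / t1) powr \<alpha> * kap \<alpha> t1 (y1 - z1)))\<^sup>2 * (2 powr real_of_int k) ^ CARD('m))"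
    if t1: "0 < t1" and d: "infnorm (z1 - z1') < t1 / 2" for k x t1 y1 z1 z1'
  proof -
    define L :: "real \<times> (real^'m) \<times> (real^'m) \<Rightarrow> complex" where "L = (\<lambda>(t2, u, z2). trunc K (t1, t2, (y1, u), (z1, z2)) - trunc K (t1, t2, (y1, u), (z1', z2)))"
    have Le: "L (t, u, z) = trunc K (t1, t, (y1, u), (z1, z)) - trunc K (t1, t, (y1, u), (z1', z))" for t u z by (simp add: L_def)
    have mL: "L \<in> borel_measurable borel" unfolding L_def borel_prod[symmetric] by measurable
    have iL: "integrable lborel (\<lambda>z. L (t, u, z))" if "0 < t" for t u unfolding Le by (intro Bochner_Integration.integrable_diff int(2)[OF t1 that])
    have eL: "L (t, u, z) = K t1 t (y1, u) (z1, z) - K t1 t (y1, u) (z1', z)" if "0 < t" for t u z by (simp add: Le trunc_eq[OF t1 that])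
    have h: "\<forall>(b::(real^'m)) l (x1::(real^'n)) y1 z1 z1' t1. 0 < l \<longrightarrow> 0 < t1 \<longrightarrow> infnorm (z1 - z1') < t1 / 2 \<longrightarrow>
          ensqrt (\<integral>\<^sup>+ x2. \<integral>\<^sup>+ t2. \<integral>\<^sup>+ y2. indicator (hcube b l) x2 * indicator {0<..<l} t2 *
          ennreal ((cmod (\<integral>z2\<in>hcube b l. (K t1 t2 (x1 - y1, x2 - y2) (z1, z2) - K t1 t2 (x1 - y1, x2 - y2) (z1', z2)) \<partial>lborel))\<^sup>2
                   * (t2 / (t2 + infnorm y2)) powr (real CARD('m) * lam2) / t2 ^ (CARD('m) + 1)) \<partial>lborel \<partial>lborel \<partial>lborel)
          \<le> ennreal (A * sqrt (measure lborel (hcube b l)) * (infnorm (z1 - z1') powr \<alpha> / (t1 + infnorm (x1 - y1 - z1)) powr (real CARD('n) + \<alpha>)))"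
      using a2 unfolding assumption2_def by blast
    have V: "ensqrt (\<integral>\<^sup>+ xa. \<integral>\<^sup>+ t. \<integral>\<^sup>+ y. indicator (hcube (dcor k x) (2 powr real_of_int k)) xa * indicator {0<..<2 powr real_of_int k} t *
          ennreal ((cmod (\<integral>z\<in>hcube (dcor k x) (2 powr real_of_int k). (K t1 t (y1, xa - y) (z1, z) - K t1 t (y1, xa - y) (z1', z)) \<partial>lborel))\<^sup>2 * (t / (t + infnorm y)) powr (real CARD('m) * lam2) / t ^ (CARD('m) + 1)) \<partial>lborel \<partial>lborel \<partial>lborel)
          \<le> ennreal (A * sqrt (measure lborel (hcube (dcor k x) (2 powr real_of_int k))) * ((infnorm (z1 - z1') / t1) powr \<alpha> * kap \<alpha> t1 (y1 - z1)))"
      using h[rule_format, of "2 powr real_of_int k" t1 z1 z1' "dcor k x" y1 0] t1 d by (simp add: holder_kap)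
    have "(\<integral>\<^sup>+y2. indicator {y. dcor k y = dcor k x} y2 * (\<integral>\<^sup>+t2. indicator {0<..2 powr real_of_int k} t2 *
          (ennreal (1 / t2) * ennreal ((\<integral>z2. indicator {z. dcor k z = dcor k x} z2 * (r (trunc K (t1, t2, (y1, y2), (z1, z2))) - r (trunc K (t1, t2, (y1, y2), (z1', z2)))) \<partial>lborel)\<^sup>2)) \<partial>lborel) \<partial>lborel)
      \<le> ennreal (2 powr (real CARD('m) * lam2) * (A * ((infnorm (z1 - z1') / t1) powr \<alpha> * kap \<alpha> t1 (y1 - z1)))\<^sup>2 * (2 powr real_of_int k) ^ CARD('m))"
      using carleson_from_testing[OF mL iL eL r _ p2 V] unfolding dcor_cube rd Le by simp
    also have "\<dots> \<le> ennreal ((?A * ((infnorm (z1 - z1') / t1) powr \<alpha> * kap \<alpha> t1 (y1 - z1)))\<^sup>2 * (2 powr real_of_int k) ^ CARD('m))"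
      by (intro ennreal_leI mult_right_mono AA(4)) simp
    finally show ?thesis .
  qed
  fix S :: "int \<Rightarrow> int \<Rightarrow> ((real^'n) \<times> (real^'m)) set"
  assume S: "\<And>k1 k2. S k1 k2 \<in> sets borel"
    "\<And>k1 k2 y z. y \<in> S k1 k2 \<Longrightarrow> dcor k1 (fst z) = dcor k1 (fst y) \<Longrightarrow> dcor k2 (snd z) = dcor k2 (snd y) \<Longrightarrow> z \<in> S k1 k2"
    "emeasure lborel (\<Union>k1 k2. S k1 k2) < \<infinity>"
  let ?G = "\<lambda>q. (\<integral>z. r (trunc K (fst q, fst (snd q), snd (snd q), z)) \<partial>lborel)\<^sup>2"
  have Gm: "?G \<in> borel_measurable borel" by measurable
  have Gt: "?G (t1, t2, y) \<le> (cmod (theta K t1 t2 (\<lambda>_. 1) y))\<^sup>2" if t: "0 < t1" "0 < t2" for t1 t2 y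
  proof -
    have "(\<integral>z. r (trunc K (t1, t2, y, z)) \<partial>lborel) = r (\<integral>z. trunc K (t1, t2, y, z) \<partial>lborel)"
      by (rule integral_bounded_linear[OF r(1) int(3)[OF t]])
    also have "(\<integral>z. trunc K (t1, t2, y, z) \<partial>lborel) = theta K t1 t2 (\<lambda>_. 1) y" using t by (simp add: theta_def trunc_eq)
    finally have "\<bar>\<integral>z. r (trunc K (t1, t2, y, z)) \<partial>lborel\<bar> \<le> cmod (theta K t1 t2 (\<lambda>_. 1) y)" using r(2) by simp
    then show ?thesis using power_mono[of "\<bar>\<integral>z. r (trunc K (t1, t2, y, z)) \<partial>lborel\<bar>" _ 2] by fastforce
  qed
  show "(\<integral>\<^sup>+t1. \<integral>\<^sup>+t2. \<integral>\<^sup>+y. indicator {0<..} t1 * indicator {0<..} t2 * ennreal (1 / (t1 * t2) * (\<integral>z. r (trunc K (t1, t2, y, z)) \<partial>lborel)\<^sup>2)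
          * indicator (S (kk t1) (kk t2)) y \<partial>lborel \<partial>lborel \<partial>lborel)
        \<le> ennreal (dconstant CARD('n) CARD('m) A lam1 lam2) * emeasure lborel (\<Union>k1 k2. S k1 k2)"
    using dyadic_rectangles_sum[OF a3 Gm Gt _ lam S] by (simp add: dconstant_def)
qed

section \<open>Removal of the weights and conclusion\<close>

text \<open>\<open>\<Theta>\<close> stands in for the squared modulus of theta f: it is measurable
  on the whole space and agrees with it for positive parameters. The weights are integrated one
  variable at a time, x2 for fixed x1 and then x1, and each costs a \<open>ckap\<close> with
  exponent n (lam - 1) for its own dimension n.\<close>

lemma gstar_L2_bound:
  fixes K :: "('n::finite, 'm::finite) kernel" and \<Theta> :: "real \<times> real \<times> ((real^'n) \<times> (real^'m)) \<Rightarrow> ennreal"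
  assumes \<Theta>[measurable]: "\<Theta> \<in> borel_measurable borel"
    and eq: "\<And>t1 t2 y. 0 < t1 \<Longrightarrow> 0 < t2 \<Longrightarrow> ennreal ((cmod (theta K t1 t2 f y))\<^sup>2) = \<Theta> (t1, t2, y)"
    and lam: "1 < lam1" "1 < lam2"
  shows "(\<integral>\<^sup>+x. gstar_sq K lam1 lam2 f x \<partial>lborel)
    \<le> ennreal (ckap CARD('n) (real CARD('n) * lam1 - real CARD('n)) * ckap CARD('m) (real CARD('m) * lam2 - real CARD('m)))
      * (\<integral>\<^sup>+t1. \<integral>\<^sup>+t2. \<integral>\<^sup>+y. indicator {0<..} t1 * indicator {0<..} t2 * (ennreal (1 / (t1 * t2)) * \<Theta> (t1, t2, y)) \<partial>lborel \<partial>lborel \<partial>lborel)"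
proof -
  let ?p1 = "real CARD('n) * lam1" and ?p2 = "real CARD('m) * lam2"
  let ?c1 = "ckap CARD('n) (?p1 - real CARD('n))" and ?c2 = "ckap CARD('m) (?p2 - real CARD('m))"
  have p1: "real CARD('n) < ?p1" and p2: "real CARD('m) < ?p2" using lam by simp_all
  have c: "0 < ?c1" "0 < ?c2" using p1 p2 by (auto intro!: ckap_pos)
  let ?i = "\<lambda>t. indicator {0<..} (t::real) :: ennreal"
  let ?w1 = "\<lambda>t u. ennreal ((t / (t + infnorm (u::real^'n))) powr ?p1 / t ^ (CARD('n) + 1))"
  let ?w2 = "\<lambda>t u. ennreal ((t / (t + infnorm (u::real^'m))) powr ?p2 / t ^ (CARD('m) + 1))"
  let ?Z = "\<lambda>x1 t2 y2. \<integral>\<^sup>+y1. \<integral>\<^sup>+t1. ?i t1 * ?w1 t1 (x1 - y1) * \<Theta> (t1, t2, (y1, y2)) \<partial>lborel \<partial>lborel"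
  let ?Y = "\<lambda>t2 y2. \<integral>\<^sup>+y1. \<integral>\<^sup>+t1. ?i t1 * ennreal (1 / t1) * \<Theta> (t1, t2, (y1, y2)) \<partial>lborel \<partial>lborel"
  have gs: "gstar_sq K lam1 lam2 f (x1, x2) = (\<integral>\<^sup>+y2. \<integral>\<^sup>+t2. ?i t2 * ?w2 t2 (x2 - y2) * ?Z x1 t2 y2 \<partial>lborel \<partial>lborel)" for x1 x2
    unfolding gstar_sq_def fst_conv snd_conv
  proof (rule nn_integral_cong, rule nn_integral_cong)
    fix y2 :: "real^'m" and t2 :: real
    show "?i t2 * ?w2 t2 (x2 - y2) * (\<integral>\<^sup>+y1. \<integral>\<^sup>+t1. ?i t1 * ennreal ((t1 / (t1 + infnorm (x1 - y1))) powr ?p1 * (cmod (theta K t1 t2 f (y1, y2)))\<^sup>2 / t1 ^ (CARD('n) + 1)) \<partial>lborel \<partial>lborel)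
      = ?i t2 * ?w2 t2 (x2 - y2) * ?Z x1 t2 y2"
    proof (cases "0 < t2")
      case t2: True
      have "?i t1 * ennreal ((t1 / (t1 + infnorm (x1 - y1))) powr ?p1 * (cmod (theta K t1 t2 f (y1, y2)))\<^sup>2 / t1 ^ (CARD('n) + 1)) = ?i t1 * ?w1 t1 (x1 - y1) * \<Theta> (t1, t2, (y1, y2))" for t1 y1
      proof (cases "0 < t1")
        case True
        have "ennreal ((t1 / (t1 + infnorm (x1 - y1))) powr ?p1 * (cmod (theta K t1 t2 f (y1, y2)))\<^sup>2 / t1 ^ (CARD('n) + 1))
          = ennreal ((t1 / (t1 + infnorm (x1 - y1))) powr ?p1 / t1 ^ (CARD('n) + 1) * (cmod (theta K t1 t2 f (y1, y2)))\<^sup>2)" by simp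
        also have "\<dots> = ?w1 t1 (x1 - y1) * ennreal ((cmod (theta K t1 t2 f (y1, y2)))\<^sup>2)"
          using True by (intro ennreal_mult) auto
        finally show ?thesis using eq[OF True t2, of "(y1, y2)"] by (simp add: mult.assoc)
      qed simp
      then show ?thesis by simp
    qed simp
  qed
  have "(\<integral>\<^sup>+x. gstar_sq K lam1 lam2 f x \<partial>lborel) = (\<integral>\<^sup>+x. (\<integral>\<^sup>+y2. \<integral>\<^sup>+t2. ?i t2 * ?w2 t2 (snd x - y2) * ?Z (fst x) t2 y2 \<partial>lborel \<partial>lborel) \<partial>(lborel \<Otimes>\<^sub>M lborel))"
    unfolding lborel_prod by (rule nn_integral_cong) (metis gs prod.collapse)
  also have "\<dots> = (\<integral>\<^sup>+x1. \<integral>\<^sup>+x2. (\<integral>\<^sup>+y2. \<integral>\<^sup>+t2. ?i t2 * ?w2 t2 (x2 - y2) * ?Z x1 t2 y2 \<partial>lborel \<partial>lborel) \<partial>lborel \<partial>lborel)"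
    by (subst lborel.nn_integral_fst[symmetric]) (simp_all, measurable)
  also have "\<dots> \<le> (\<integral>\<^sup>+x1. ennreal ?c2 * (\<integral>\<^sup>+y2. \<integral>\<^sup>+t2. ?i t2 * ennreal (1 / t2) * ?Z x1 t2 y2 \<partial>lborel \<partial>lborel) \<partial>lborel)"
  proof (rule nn_integral_mono)
    fix x1 :: "real^'n"
    have g: "(\<lambda>q. ?Z x1 (fst q) (snd q)) \<in> borel_measurable borel" by measurable
    show "(\<integral>\<^sup>+x2. (\<integral>\<^sup>+y2. \<integral>\<^sup>+t2. ?i t2 * ?w2 t2 (x2 - y2) * ?Z x1 t2 y2 \<partial>lborel \<partial>lborel) \<partial>lborel) \<le> ennreal ?c2 * (\<integral>\<^sup>+y2. \<integral>\<^sup>+t2. ?i t2 * ennreal (1 / t2) * ?Z x1 t2 y2 \<partial>lborel \<partial>lborel)"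
      using nn_integral_weight_upper[OF g p2] by simp
  qed
  also have "\<dots> = ennreal ?c2 * (\<integral>\<^sup>+x1. \<integral>\<^sup>+y2. \<integral>\<^sup>+t2. ?i t2 * ennreal (1 / t2) * ?Z x1 t2 y2 \<partial>lborel \<partial>lborel \<partial>lborel)"
    by (rule nn_integral_cmult) measurable
  also have "(\<integral>\<^sup>+x1. \<integral>\<^sup>+y2. \<integral>\<^sup>+t2. ?i t2 * ennreal (1 / t2) * ?Z x1 t2 y2 \<partial>lborel \<partial>lborel \<partial>lborel) = (\<integral>\<^sup>+y2. \<integral>\<^sup>+x1. \<integral>\<^sup>+t2. ?i t2 * ennreal (1 / t2) * ?Z x1 t2 y2 \<partial>lborel \<partial>lborel \<partial>lborel)"
    by (rule lborel_pair.Fubini') measurable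
  also have "\<dots> = (\<integral>\<^sup>+y2. \<integral>\<^sup>+t2. \<integral>\<^sup>+x1. ?i t2 * ennreal (1 / t2) * ?Z x1 t2 y2 \<partial>lborel \<partial>lborel \<partial>lborel)"
    by (rule nn_integral_cong, rule lborel_pair.Fubini') measurable
  also have "\<dots> = (\<integral>\<^sup>+y2. \<integral>\<^sup>+t2. ?i t2 * ennreal (1 / t2) * (\<integral>\<^sup>+x1. ?Z x1 t2 y2 \<partial>lborel) \<partial>lborel \<partial>lborel)"
    by (rule nn_integral_cong, rule nn_integral_cong, rule nn_integral_cmult) measurable
  also have "\<dots> \<le> (\<integral>\<^sup>+y2. \<integral>\<^sup>+t2. ?i t2 * ennreal (1 / t2) * (ennreal ?c1 * ?Y t2 y2) \<partial>lborel \<partial>lborel)"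
  proof (rule nn_integral_mono, rule nn_integral_mono, rule mult_left_mono)
    fix y2 :: "real^'m" and t2 :: real
    have g: "(\<lambda>q. \<Theta> (fst q, t2, (snd q, y2))) \<in> borel_measurable borel" by measurable
    show "(\<integral>\<^sup>+x1. ?Z x1 t2 y2 \<partial>lborel) \<le> ennreal ?c1 * ?Y t2 y2"
      using nn_integral_weight_upper[OF g p1] by simp
  qed simp
  also have "\<dots> = (\<integral>\<^sup>+y2. \<integral>\<^sup>+t2. ennreal ?c1 * (?i t2 * ennreal (1 / t2) * ?Y t2 y2) \<partial>lborel \<partial>lborel)" by (simp only: mult_ac)
  also have "\<dots> = ennreal ?c1 * (\<integral>\<^sup>+y2. \<integral>\<^sup>+t2. ?i t2 * ennreal (1 / t2) * ?Y t2 y2 \<partial>lborel \<partial>lborel)"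
    by (simp add: nn_integral_cmult)
  also have "(\<integral>\<^sup>+y2. \<integral>\<^sup>+t2. ?i t2 * ennreal (1 / t2) * ?Y t2 y2 \<partial>lborel \<partial>lborel)
    = (\<integral>\<^sup>+t1. \<integral>\<^sup>+t2. \<integral>\<^sup>+y. ?i t1 * ?i t2 * (ennreal (1 / (t1 * t2)) * \<Theta> (t1, t2, y)) \<partial>lborel \<partial>lborel \<partial>lborel)"
  proof -
    let ?g = "\<lambda>t1 t2 y1 y2. ?i t1 * ?i t2 * (ennreal (1 / (t1 * t2)) * \<Theta> (t1, t2, (y1, y2)))"
    have e: "?i t2 * ennreal (1 / t2) * (?i t1 * ennreal (1 / t1) * \<Theta> (t1, t2, (y1, y2))) = ?g t1 t2 y1 y2" for t1 t2 y1 y2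
    proof (cases "0 < t1 \<and> 0 < t2")
      case True
      have "ennreal (1 / (t1 * t2)) = ennreal (1 / t1) * ennreal (1 / t2)" using True by (simp add: ennreal_mult[symmetric])
      then show ?thesis by (simp only: mult_ac)
    qed auto
    have "(\<integral>\<^sup>+y2. \<integral>\<^sup>+t2. ?i t2 * ennreal (1 / t2) * ?Y t2 y2 \<partial>lborel \<partial>lborel) = (\<integral>\<^sup>+y2. \<integral>\<^sup>+t2. \<integral>\<^sup>+y1. \<integral>\<^sup>+t1. ?g t1 t2 y1 y2 \<partial>lborel \<partial>lborel \<partial>lborel \<partial>lborel)"
      unfolding e[symmetric] by (simp add: nn_integral_cmult)
    also have "\<dots> = (\<integral>\<^sup>+y2. \<integral>\<^sup>+t2. \<integral>\<^sup>+t1. \<integral>\<^sup>+y1. ?g t1 t2 y1 y2 \<partial>lborel \<partial>lborel \<partial>lborel \<partial>lborel)"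
      by (rule nn_integral_cong, rule nn_integral_cong, rule lborel_pair.Fubini') measurable
    also have "\<dots> = (\<integral>\<^sup>+y2. \<integral>\<^sup>+t1. \<integral>\<^sup>+t2. \<integral>\<^sup>+y1. ?g t1 t2 y1 y2 \<partial>lborel \<partial>lborel \<partial>lborel \<partial>lborel)"
      by (rule nn_integral_cong, rule lborel_pair.Fubini') measurable
    also have "\<dots> = (\<integral>\<^sup>+t1. \<integral>\<^sup>+y2. \<integral>\<^sup>+t2. \<integral>\<^sup>+y1. ?g t1 t2 y1 y2 \<partial>lborel \<partial>lborel \<partial>lborel \<partial>lborel)"
      by (rule lborel_pair.Fubini') measurable
    also have "\<dots> = (\<integral>\<^sup>+t1. \<integral>\<^sup>+t2. \<integral>\<^sup>+y2. \<integral>\<^sup>+y1. ?g t1 t2 y1 y2 \<partial>lborel \<partial>lborel \<partial>lborel \<partial>lborel)"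
      by (rule nn_integral_cong, rule lborel_pair.Fubini') measurable
    also have "\<dots> = (\<integral>\<^sup>+t1. \<integral>\<^sup>+t2. \<integral>\<^sup>+y. ?i t1 * ?i t2 * (ennreal (1 / (t1 * t2)) * \<Theta> (t1, t2, y)) \<partial>lborel \<partial>lborel \<partial>lborel)"
      unfolding lborel_prod[symmetric, where ?'a="real^'n"]
      by (rule nn_integral_cong, rule nn_integral_cong, rule lborel_pair.nn_integral_snd) (simp add: lborel_prod)
    finally show ?thesis .
  qed
  finally have "(\<integral>\<^sup>+x. gstar_sq K lam1 lam2 f x \<partial>lborel) \<le> ennreal ?c2 * (ennreal ?c1 * (\<integral>\<^sup>+t1. \<integral>\<^sup>+t2. \<integral>\<^sup>+y. ?i t1 * ?i t2 * (ennreal (1 / (t1 * t2)) * \<Theta> (t1, t2, y)) \<partial>lborel \<partial>lborel \<partial>lborel))"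
    by (simp add: mult_left_mono)
  then show ?thesis using c by (simp add: ennreal_mult mult_ac)
qed

text \<open>Splitting kernel and function into real and imaginary parts gives four real operators.
  Squaring the two sums costs a factor 2, and each of \<open>u\<close> and \<open>v\<close> occurs
  twice, whence \<open>4 * C\<close>.\<close>

lemma vertical_square_function_bound:
  fixes K :: "('n::finite, 'm::finite) kernel" and f :: "(real^'n) \<times> (real^'m) \<Rightarrow> complex"
  assumes K: "kernel_measurable K" and a1: "assumption1 A \<alpha> \<beta> K" and a2: "assumption2 A \<alpha> \<beta> lam1 lam2 K" and a3: "assumption3 A lam1 lam2 K"
    and ab: "0 < \<alpha>" "0 < \<beta>" and lam: "0 \<le> lam1" "0 \<le> lam2" and f: "L2 f"
  defines "C \<equiv> cbi CARD('n) CARD('m) (aconst CARD('n) CARD('m) A lam1 lam2) \<alpha> \<beta> (dconstant CARD('n) CARD('m) A lam1 lam2)"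
  shows "(\<integral>\<^sup>+t1. \<integral>\<^sup>+t2. \<integral>\<^sup>+y. indicator {0<..} t1 * indicator {0<..} t2 * (ennreal (1 / (t1 * t2)) * ennreal ((cmod (\<integral>z. trunc K (t1, t2, y, z) * f z \<partial>lborel))\<^sup>2)) \<partial>lborel \<partial>lborel \<partial>lborel)
      \<le> ennreal (4 * C) * (\<integral>\<^sup>+y. ennreal ((cmod (f y))\<^sup>2) \<partial>lborel)"
    and "0 \<le> C"
proof -
  let ?A = "aconst CARD('n) CARD('m) A lam1 lam2" and ?D = "dconstant CARD('n) CARD('m) A lam1 lam2"
  interpret R: bi_parameter "\<lambda>q. Re (trunc K q)" ?A \<alpha> \<beta> ?D
    by (rule bi_parameter_of_assumptions[OF K a1 a2 a3 ab lam bounded_linear_Re abs_Re_le_cmod])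
  interpret I: bi_parameter "\<lambda>q. Im (trunc K q)" ?A \<alpha> \<beta> ?D
    by (rule bi_parameter_of_assumptions[OF K a1 a2 a3 ab lam bounded_linear_Im abs_Im_le_cmod])
  show C0: "0 \<le> C" unfolding C_def by (rule R.cbi_nonneg)
  have m[measurable]: "trunc K \<in> borel_measurable borel" using K by (simp add: kernel_measurable_def trunc_def)
  have fm[measurable]: "f \<in> borel_measurable borel" using f by (simp add: L2_def)
  let ?H = "\<integral>\<^sup>+y. ennreal ((cmod (f y))\<^sup>2) \<partial>lborel"
  have ffin: "?H < \<infinity>" using f unfolding L2_def integrable_iff_bounded by simp
  define u where "u = (\<lambda>z. Re (f z))"
  define v where "v = (\<lambda>z. Im (f z))"
  have um[measurable]: "u \<in> borel_measurable borel" and vm[measurable]: "v \<in> borel_measurable borel" unfolding u_def v_def by measurable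
  have uv: "?H = (\<integral>\<^sup>+y. ennreal ((u y)\<^sup>2) \<partial>lborel) + (\<integral>\<^sup>+y. ennreal ((v y)\<^sup>2) \<partial>lborel)"
    by (subst nn_integral_add[symmetric]) (auto simp: u_def v_def cmod_power2)
  have ufin: "(\<integral>\<^sup>+y. ennreal ((u y)\<^sup>2) \<partial>lborel) < \<infinity>" and vfin: "(\<integral>\<^sup>+y. ennreal ((v y)\<^sup>2) \<partial>lborel) < \<infinity>"
    using ffin uv by auto
  let ?i = "\<lambda>t1 t2. indicator {0<..} (t1::real) * indicator {0<..} (t2::real) :: ennreal"
  let ?T = "\<lambda>(k::complex \<Rightarrow> real) (h::(real^'n) \<times> (real^'m) \<Rightarrow> real) t1 t2 y. \<integral>z. k (trunc K (t1, t2, y, z)) * h z \<partial>lborel"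
  let ?X = "\<lambda>k h t1 t2 y. ?i t1 t2 * ennreal (1 / (t1 * t2) * (?T k h t1 t2 y)\<^sup>2)"
  have point: "?i t1 t2 * (ennreal (1 / (t1 * t2)) * ennreal ((cmod (\<integral>z. trunc K (t1, t2, y, z) * f z \<partial>lborel))\<^sup>2))
     \<le> 2 * (?X Re u t1 t2 y + ?X Im v t1 t2 y + ?X Re v t1 t2 y + ?X Im u t1 t2 y)" for t1 t2 y
  proof (cases "0 < t1 \<and> 0 < t2")
    case True
    then have t: "0 < t1" "0 < t2" by auto
    note i = R.Kf_integrable[OF um ufin t, of y] R.Kf_integrable[OF vm vfin t, of y] I.Kf_integrable[OF um ufin t, of y] I.Kf_integrable[OF vm vfin t, of y]
    let ?k = "\<lambda>z. trunc K (t1, t2, y, z)"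
    have "(\<integral>z. ?k z * f z \<partial>lborel) = (\<integral>z. complex_of_real (Re (?k z) * u z - Im (?k z) * v z) + \<i> * complex_of_real (Re (?k z) * v z + Im (?k z) * u z) \<partial>lborel)"
      by (rule Bochner_Integration.integral_cong) (auto simp: complex_eq_iff u_def v_def)
    also have "\<dots> = complex_of_real (?T Re u t1 t2 y - ?T Im v t1 t2 y) + \<i> * complex_of_real (?T Re v t1 t2 y + ?T Im u t1 t2 y)"
    proof -
      have j1: "integrable lborel (\<lambda>z. Re (?k z) * u z - Im (?k z) * v z)" and j2: "integrable lborel (\<lambda>z. Re (?k z) * v z + Im (?k z) * u z)"
        using i by auto
      have "(\<integral>z. complex_of_real (Re (?k z) * u z - Im (?k z) * v z) + \<i> * complex_of_real (Re (?k z) * v z + Im (?k z) * u z) \<partial>lborel)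
        = complex_of_real (\<integral>z. Re (?k z) * u z - Im (?k z) * v z \<partial>lborel) + \<i> * complex_of_real (\<integral>z. Re (?k z) * v z + Im (?k z) * u z \<partial>lborel)"
        by (subst Bochner_Integration.integral_add) (use j1 j2 in \<open>auto simp del: of_real_diff of_real_add of_real_mult\<close>)
      then show ?thesis using i by simp
    qed
    finally have "(cmod (\<integral>z. ?k z * f z \<partial>lborel))\<^sup>2 = (?T Re u t1 t2 y - ?T Im v t1 t2 y)\<^sup>2 + (?T Re v t1 t2 y + ?T Im u t1 t2 y)\<^sup>2"
      by (simp add: cmod_power2)
    also have "\<dots> \<le> 2 * ((?T Re u t1 t2 y)\<^sup>2 + (?T Im v t1 t2 y)\<^sup>2 + (?T Re v t1 t2 y)\<^sup>2 + (?T Im u t1 t2 y)\<^sup>2)"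
      using square_diff_le[of "?T Re u t1 t2 y" "?T Im v t1 t2 y"] square_add_le[of "?T Re v t1 t2 y" "?T Im u t1 t2 y"]
      by (simp add: distrib_left)
    finally have "1 / (t1 * t2) * (cmod (\<integral>z. ?k z * f z \<partial>lborel))\<^sup>2 \<le> 1 / (t1 * t2) * (2 * ((?T Re u t1 t2 y)\<^sup>2 + (?T Im v t1 t2 y)\<^sup>2 + (?T Re v t1 t2 y)\<^sup>2 + (?T Im u t1 t2 y)\<^sup>2))"
      using t by (intro mult_left_mono) auto
    also have "\<dots> = 2 * (1 / (t1 * t2) * (?T Re u t1 t2 y)\<^sup>2 + 1 / (t1 * t2) * (?T Im v t1 t2 y)\<^sup>2 + 1 / (t1 * t2) * (?T Re v t1 t2 y)\<^sup>2 + 1 / (t1 * t2) * (?T Im u t1 t2 y)\<^sup>2)"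
      by (simp add: distrib_left)
    finally have "ennreal (1 / (t1 * t2) * (cmod (\<integral>z. ?k z * f z \<partial>lborel))\<^sup>2) \<le> ennreal (2 * (1 / (t1 * t2) * (?T Re u t1 t2 y)\<^sup>2 + 1 / (t1 * t2) * (?T Im v t1 t2 y)\<^sup>2 + 1 / (t1 * t2) * (?T Re v t1 t2 y)\<^sup>2 + 1 / (t1 * t2) * (?T Im u t1 t2 y)\<^sup>2))"
      by (rule ennreal_leI)
    also have "\<dots> = 2 * (ennreal (1 / (t1 * t2) * (?T Re u t1 t2 y)\<^sup>2) + ennreal (1 / (t1 * t2) * (?T Im v t1 t2 y)\<^sup>2) + ennreal (1 / (t1 * t2) * (?T Re v t1 t2 y)\<^sup>2) + ennreal (1 / (t1 * t2) * (?T Im u t1 t2 y)\<^sup>2))"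
    proof -
      have four: "ennreal (2 * (p + q + r + s)) = 2 * (ennreal p + ennreal q + ennreal r + ennreal s)" if "0 \<le> p" "0 \<le> q" "0 \<le> r" "0 \<le> s" for p q r s
        using that by (simp add: ennreal_mult)
      show ?thesis by (rule four) (use t in auto)
    qed
    finally show ?thesis using t by (simp add: ennreal_mult[symmetric])
  qed auto
  have Tm[measurable]: "(\<lambda>x. ?T k h (f1 x) (f2 x) (g x)) \<in> borel_measurable M"
    if [measurable]: "f1 \<in> borel_measurable M" "f2 \<in> borel_measurable M" "g \<in> borel_measurable M" "h \<in> borel_measurable borel" and k: "k = Re \<or> k = Im" for k h f1 f2 g and M :: "'z measure"
    using k by (elim disjE) (simp, measurable)+
  have "(\<integral>\<^sup>+t1. \<integral>\<^sup>+t2. \<integral>\<^sup>+y. ?i t1 t2 * (ennreal (1 / (t1 * t2)) * ennreal ((cmod (\<integral>z. trunc K (t1, t2, y, z) * f z \<partial>lborel))\<^sup>2)) \<partial>lborel \<partial>lborel \<partial>lborel)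
    \<le> (\<integral>\<^sup>+t1. \<integral>\<^sup>+t2. \<integral>\<^sup>+y. 2 * (?X Re u t1 t2 y + ?X Im v t1 t2 y + ?X Re v t1 t2 y + ?X Im u t1 t2 y) \<partial>lborel \<partial>lborel \<partial>lborel)"
    by (intro nn_integral_mono point)
  also have "\<dots> = 2 * ((\<integral>\<^sup>+t1. \<integral>\<^sup>+t2. \<integral>\<^sup>+y. ?X Re u t1 t2 y \<partial>lborel \<partial>lborel \<partial>lborel) + (\<integral>\<^sup>+t1. \<integral>\<^sup>+t2. \<integral>\<^sup>+y. ?X Im v t1 t2 y \<partial>lborel \<partial>lborel \<partial>lborel)
      + (\<integral>\<^sup>+t1. \<integral>\<^sup>+t2. \<integral>\<^sup>+y. ?X Re v t1 t2 y \<partial>lborel \<partial>lborel \<partial>lborel) + (\<integral>\<^sup>+t1. \<integral>\<^sup>+t2. \<integral>\<^sup>+y. ?X Im u t1 t2 y \<partial>lborel \<partial>lborel \<partial>lborel))"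
    by (simp add: nn_integral_add nn_integral_cmult)
  also have "\<dots> \<le> 2 * (ennreal C * (\<integral>\<^sup>+y. ennreal ((u y)\<^sup>2) \<partial>lborel) + ennreal C * (\<integral>\<^sup>+y. ennreal ((v y)\<^sup>2) \<partial>lborel)
      + ennreal C * (\<integral>\<^sup>+y. ennreal ((v y)\<^sup>2) \<partial>lborel) + ennreal C * (\<integral>\<^sup>+y. ennreal ((u y)\<^sup>2) \<partial>lborel))"
    unfolding C_def
    by (intro mult_left_mono add_mono R.bi_parameter_bound_L2 I.bi_parameter_bound_L2 um vm ufin vfin) simp
  also have "\<dots> = ennreal (4 * C) * ?H"
  proof -
    have "2 * (c * p + c * q + c * q + c * p) = (4 * c) * (p + q)" for c p q :: ennreal
      by (simp add: distrib_left distrib_right mult_2 add_ac mult.assoc) (simp add: add.assoc[symmetric] flip: mult_2 distrib_right)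
    then show ?thesis unfolding uv using C0 by (simp add: ennreal_mult)
  qed
  finally show "(\<integral>\<^sup>+t1. \<integral>\<^sup>+t2. \<integral>\<^sup>+y. ?i t1 t2 * (ennreal (1 / (t1 * t2)) * ennreal ((cmod (\<integral>z. trunc K (t1, t2, y, z) * f z \<partial>lborel))\<^sup>2)) \<partial>lborel \<partial>lborel \<partial>lborel)
      \<le> ennreal (4 * C) * ?H" .
qed

theorem theorem1p1:
  fixes lam1 lam2 \<alpha> \<beta> :: real
  assumes "lam1 > 2" and "lam2 > 2"
    and "0 < \<alpha>" and "\<alpha> \<le> real CARD('n::finite) * (lam1 - 2) / 2"
    and "0 < \<beta>" and "\<beta> \<le> real CARD('m::finite) * (lam2 - 2) / 2"
  shows "\<forall>A::real. \<exists>C::real. \<forall>K :: ('n, 'm) kernel.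
           kernel_measurable K \<and> assumption1 A \<alpha> \<beta> K \<and> assumption2 A \<alpha> \<beta> lam1 lam2 K
           \<and> assumption3 A lam1 lam2 K \<longrightarrow>
           (\<forall>f :: (real^'n) \<times> (real^'m) \<Rightarrow> complex. L2 f \<longrightarrow>
              L2norm_nn (gstar K lam1 lam2 f) \<le> ennreal (C * L2norm f))"
proof
  fix A :: real
  \<comment> \<open>Both constants are fixed before the kernel and the function: \<open>c\<close>
    pays for the weights, \<open>4 * B\<close> for the vertical square function. Since they bound
    squared norms, the witness below is the square root of their product.\<close>
  define c where "c = ckap CARD('n) (real CARD('n) * lam1 - real CARD('n)) * ckap CARD('m) (real CARD('m) * lam2 - real CARD('m))"
  define B where "B = cbi CARD('n) CARD('m) (aconst CARD('n) CARD('m) A lam1 lam2) \<alpha> \<beta> (dconstant CARD('n) CARD('m) A lam1 lam2)"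
  have c0: "0 \<le> c" unfolding c_def using assms(1,2) by (intro mult_nonneg_nonneg less_imp_le ckap_pos) auto
  show "\<exists>C::real. \<forall>K :: ('n, 'm) kernel. kernel_measurable K \<and> assumption1 A \<alpha> \<beta> K \<and> assumption2 A \<alpha> \<beta> lam1 lam2 K
           \<and> assumption3 A lam1 lam2 K \<longrightarrow> (\<forall>f :: (real^'n) \<times> (real^'m) \<Rightarrow> complex. L2 f \<longrightarrow>
              L2norm_nn (gstar K lam1 lam2 f) \<le> ennreal (C * L2norm f))"
  proof (intro exI[of _ "sqrt (c * (4 * B))"] allI impI, elim conjE)
    fix K :: "('n, 'm) kernel" and f :: "(real^'n) \<times> (real^'m) \<Rightarrow> complex"
    assume K: "kernel_measurable K" "assumption1 A \<alpha> \<beta> K" "assumption2 A \<alpha> \<beta> lam1 lam2 K" "assumption3 A lam1 lam2 K" and f: "L2 f"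
    have m[measurable]: "trunc K \<in> borel_measurable borel" using K(1) by (simp add: kernel_measurable_def trunc_def)
    have fm[measurable]: "f \<in> borel_measurable borel" using f by (simp add: L2_def)
    let ?\<Theta> = "\<lambda>q. ennreal ((cmod (\<integral>z. trunc K (fst q, fst (snd q), snd (snd q), z) * f z \<partial>lborel))\<^sup>2)"
    have \<Theta>: "?\<Theta> \<in> borel_measurable borel" by measurable
    have eq: "ennreal ((cmod (theta K t1 t2 f y))\<^sup>2) = ?\<Theta> (t1, t2, y)" if "0 < t1" "0 < t2" for t1 t2 y
      using that by (simp add: theta_def trunc_eq)
    have lam: "0 \<le> lam1" "0 \<le> lam2" "1 < lam1" "1 < lam2" using assms by auto
    note B = vertical_square_function_bound[OF K assms(3,5) lam(1,2) f, folded B_def]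
    have H: "(\<integral>\<^sup>+y. ennreal ((cmod (f y))\<^sup>2) \<partial>lborel) = ennreal ((L2norm f)\<^sup>2)"
      using f unfolding L2norm_def L2_def by (subst nn_integral_eq_integral) auto
    have "(\<integral>\<^sup>+x. (gstar K lam1 lam2 f x)\<^sup>2 \<partial>lborel) = (\<integral>\<^sup>+x. gstar_sq K lam1 lam2 f x \<partial>lborel)"
      by (simp add: gstar_def ensqrt_power2)
    also have "\<dots> \<le> ennreal c * (ennreal (4 * B) * ennreal ((L2norm f)\<^sup>2))"
      using order_trans[OF gstar_L2_bound[OF \<Theta> eq lam(3,4), folded c_def] mult_left_mono, of "ennreal (4 * B) * ennreal ((L2norm f)\<^sup>2)"] B(1)
      unfolding H by simp
    also have "\<dots> = ennreal ((sqrt (c * (4 * B)) * L2norm f)\<^sup>2)"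
      using c0 B(2) by (simp add: ennreal_mult[symmetric] power_mult_distrib mult.assoc)
    finally show "L2norm_nn (gstar K lam1 lam2 f) \<le> ennreal (sqrt (c * (4 * B)) * L2norm f)"
      unfolding L2norm_nn_def by (rule ensqrt_le_ennrealI) (use c0 B(2) in \<open>auto simp: L2norm_def\<close>)
  qed
qed

end
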